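(* In the $K$-stage two-way rate-distortion problem with a helper described in the context, where $Y-X-Z$ is a Markov chain, $\mathcal R_K^O(D_x,D_z)=\mathcal R_K(D_x,D_z)$.
   Context: Let $\mathcal X,\mathcal Y,\mathcal Z,\hat{\mathcal X},\hat{\mathcal Z}$ be finite alphabets, $(X_i,Y_i,Z_i)$ i.i.d. $\sim p(x,y)p(z|x)$ (Markov chain $Y-X-Z$), and $d_x:\mathcal X\times\hat{\mathcal X}\to[0,\infty)$, $d_z:\mathcal Z\times\hat{\mathcal Z}\to[0,\infty)$. Fix $K\ge1$. An $(n,M_y,(M_{x,k})_{k=1}^K,(M_{z,k})_{k=1}^K,D_x,D_z)$ code consists of a helper encoder $T_y=f_y(Y^n)\in\{1,\dots,M_y\}$; for $k=1,\dots,K$, User Z's encoder $T_{z,k}=f_{z,k}(Z^n,T_y,T_{x,1},\dots,T_{x,k-1})\in\{1,\dots,M_{z,k}\}$ and User X's encoder $T_{x,k}=f_{x,k}(X^n,T_y,T_{z,1},\dots,T_{z,k})\in\{1,\dots,M_{x,k}\}$; and decoders $\hat Z^n=g_x(X^n,T_y,T_{z,1},\dots,T_{z,K})$, $\hat X^n=g_z(Z^n,T_y,T_{x,1},\dots,T_{x,K})$ with $\mathbb E[\frac1n\sum_i d_x(X_i,\hat X_i)]\le D_x$ and $\mathbb E[\frac1n\sum_i d_z(Z_i,\hat Z_i)]\le D_z$. Its rates are $R_y=\frac1n\log M_y$, $R_x=\frac1n\sum_{k=1}^K\log M_{x,k}$, $R_z=\frac1n\sum_{k=1}^K\log M_{z,k}$.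 A triple $(R_x,R_y,R_z)$ is achievable if for every $\epsilon>0$ and all large $n$ there exist such codes with rates at most $(R_x+\epsilon,R_y+\epsilon,R_z+\epsilon)$ and distortions at most $(D_x+\epsilon,D_z+\epsilon)$; $\mathcal R_K^O(D_x,D_z)$ is the closure of the achievable set. $\mathcal R_K(D_x,D_z)$ is the set of triples $(R_x,R_y,R_z)$ with $R_y\ge I(U;Y|Z)$, $R_z\ge\sum_{k=1}^K I(Z;V_k|X,U,V^{k-1},W^{k-1})$, $R_x\ge\sum_{k=1}^K I(X;W_k|Z,U,V^k,W^{k-1})$ for some finite-alphabet random variables $U,V_1,\dots,V_K,W_1,\dots,W_K$ (with $V^k=(V_1,\dots,V_k)$, $W^k=(W_1,\dots,W_k)$) satisfying the Markov chains $U-Y-(X,Z)$, $V_k-(Z,U,V^{k-1},W^{k-1})-(X,Y)$ and $W_k-(X,U,V^k,W^{k-1})-(Z,Y)$ for $k=1,\dots,K$, and deterministic functions with $\mathbb E\, d_x(X,\hat X(U,W^K,Z))\le D_x$ and $\mathbb E\, d_z(Z,\hat Z(U,V^K,X))\le D_z$. *)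

theory Defs
  imports "HOL-Analysis.Analysis" "HOL-Probability.Probability"
begin

definition cmi :: "'o pmf \<Rightarrow> ('o \<Rightarrow> 'a) \<Rightarrow> ('o \<Rightarrow> 'b) \<Rightarrow> ('o \<Rightarrow> 'c) \<Rightarrow> real" where
  "cmi P A B C =
    (let J = map_pmf (\<lambda>\<omega>. (A \<omega>, B \<omega>, C \<omega>)) P in
     \<Sum>t\<in>set_pmf J. (case t of (a, b, c) \<Rightarrow>
        pmf J (a, b, c) *
        log 2 (pmf J (a, b, c) * pmf (map_pmf C P) c /
               (pmf (map_pmf (\<lambda>\<omega>. (A \<omega>, C \<omega>)) P) (a, c) *
                pmf (map_pmf (\<lambda>\<omega>. (B \<omega>, C \<omega>)) P) (b, c)))))"

definition markov :: "'o pmf \<Rightarrow> ('o \<Rightarrow> 'a) \<Rightarrow> ('o \<Rightarrow> 'b) \<Rightarrow> ('o \<Rightarrow> 'c) \<Rightarrow> bool" where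
  "markov P A B C \<longleftrightarrow>
    (\<forall>a b c. pmf (map_pmf (\<lambda>\<omega>. (A \<omega>, B \<omega>, C \<omega>)) P) (a, b, c) * pmf (map_pmf B P) b =
             pmf (map_pmf (\<lambda>\<omega>. (A \<omega>, B \<omega>)) P) (a, b) *
             pmf (map_pmf (\<lambda>\<omega>. (B \<omega>, C \<omega>)) P) (b, c))"

text \<open>Single-letter source p(x,y) p(z|x) (so Y - X - Z is a Markov chain).\<close>
definition source :: "('x \<times> 'y) pmf \<Rightarrow> ('x \<Rightarrow> 'z pmf) \<Rightarrow> ('x \<times> 'y \<times> 'z) pmf" where
  "source pxy pzx = bind_pmf pxy (\<lambda>(x, y). map_pmf (\<lambda>z. (x, y, z)) (pzx x))"

fun msgs :: "(nat \<Rightarrow> 'z list \<Rightarrow> nat \<Rightarrow> nat list \<Rightarrow> nat) \<Rightarrow>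
             (nat \<Rightarrow> 'x list \<Rightarrow> nat \<Rightarrow> nat list \<Rightarrow> nat) \<Rightarrow>
             'x list \<Rightarrow> 'z list \<Rightarrow> nat \<Rightarrow> nat \<Rightarrow> nat list \<times> nat list" where
  "msgs fz fx xs zs ty 0 = ([], [])"
| "msgs fz fx xs zs ty (Suc k) =
     (case msgs fz fx xs zs ty k of (tz, tx) \<Rightarrow>
        (let a = fz (Suc k) zs ty tx; b = fx (Suc k) xs ty (tz @ [a]) in (tz @ [a], tx @ [b])))"

text \<open>Existence of an (n, My, (Mx k), (Mz k), Dx, Dz) code.  Decoders output the
  reconstruction sequence as a function of the time index i < n.\<close>
definition is_code ::
  "('x \<times> 'y) pmf \<Rightarrow> ('x \<Rightarrow> 'z pmf) \<Rightarrow> ('x \<Rightarrow> 'xh \<Rightarrow> real) \<Rightarrow> ('z \<Rightarrow> 'zh \<Rightarrow> real) \<Rightarrow>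
   nat \<Rightarrow> nat \<Rightarrow> nat \<Rightarrow> (nat \<Rightarrow> nat) \<Rightarrow> (nat \<Rightarrow> nat) \<Rightarrow> real \<Rightarrow> real \<Rightarrow> bool" where
  "is_code pxy pzx dx dz K n My Mx Mz Dx Dz \<longleftrightarrow>
    (\<exists>(fy :: 'y list \<Rightarrow> nat) (fz :: nat \<Rightarrow> 'z list \<Rightarrow> nat \<Rightarrow> nat list \<Rightarrow> nat)
      (fx :: nat \<Rightarrow> 'x list \<Rightarrow> nat \<Rightarrow> nat list \<Rightarrow> nat)
      (gx :: 'x list \<Rightarrow> nat \<Rightarrow> nat list \<Rightarrow> nat \<Rightarrow> 'zh)
      (gz :: 'z list \<Rightarrow> nat \<Rightarrow> nat list \<Rightarrow> nat \<Rightarrow> 'xh).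
       (\<forall>ys. fy ys \<in> {1..My}) \<and>
       (\<forall>k\<in>{1..K}. \<forall>zs ty txs. fz k zs ty txs \<in> {1..Mz k}) \<and>
       (\<forall>k\<in>{1..K}. \<forall>xs ty tzs. fx k xs ty tzs \<in> {1..Mx k}) \<and>
       measure_pmf.expectation (replicate_pmf n (source pxy pzx))
         (\<lambda>s. let xs = map fst s; ys = map (fst \<circ> snd) s; zs = map (snd \<circ> snd) s;
                  ty = fy ys; tx = snd (msgs fz fx xs zs ty K)
              in (\<Sum>i<n. dx (xs ! i) (gz zs ty tx i)) / real n) \<le> Dx \<and>
       measure_pmf.expectation (replicate_pmf n (source pxy pzx))
         (\<lambda>s. let xs = map fst s; ys = map (fst \<circ> snd) s; zs = map (snd \<circ> snd) s;
                  ty = fy ys; tz = fst (msgs fz fx xs zs ty K)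
              in (\<Sum>i<n. dz (zs ! i) (gx xs ty tz i)) / real n) \<le> Dz)"

definition achievable ::
  "('x \<times> 'y) pmf \<Rightarrow> ('x \<Rightarrow> 'z pmf) \<Rightarrow> ('x \<Rightarrow> 'xh \<Rightarrow> real) \<Rightarrow> ('z \<Rightarrow> 'zh \<Rightarrow> real) \<Rightarrow>
   nat \<Rightarrow> real \<Rightarrow> real \<Rightarrow> real \<times> real \<times> real \<Rightarrow> bool" where
  "achievable pxy pzx dx dz K Dx Dz R \<longleftrightarrow>
    (case R of (Rx, Ry, Rz) \<Rightarrow>
      (\<forall>\<epsilon>>0. \<exists>N. \<forall>n\<ge>N. \<exists>My Mx Mz.
         is_code pxy pzx dx dz K n My Mx Mz (Dx + \<epsilon>) (Dz + \<epsilon>) \<and>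
         log 2 (real My) / real n \<le> Ry + \<epsilon> \<and>
         (\<Sum>k=1..K. log 2 (real (Mx k))) / real n \<le> Rx + \<epsilon> \<and>
         (\<Sum>k=1..K. log 2 (real (Mz k))) / real n \<le> Rz + \<epsilon>))"

definition region_op ::
  "('x \<times> 'y) pmf \<Rightarrow> ('x \<Rightarrow> 'z pmf) \<Rightarrow> ('x \<Rightarrow> 'xh \<Rightarrow> real) \<Rightarrow> ('z \<Rightarrow> 'zh \<Rightarrow> real) \<Rightarrow>
   nat \<Rightarrow> real \<Rightarrow> real \<Rightarrow> (real \<times> real \<times> real) set" where
  "region_op pxy pzx dx dz K Dx Dz = closure {R. achievable pxy pzx dx dz K Dx Dz R}"

text \<open>Outcomes (x, y, z, u, [v_1..v_K], [w_1..w_K]); auxiliary finite alphabets are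
  encoded into nat (finite support of the joint pmf).\<close>
type_synonym ('x, 'y, 'z) aux_outcome = "'x \<times> 'y \<times> 'z \<times> nat \<times> nat list \<times> nat list"

definition oX :: "('x, 'y, 'z) aux_outcome \<Rightarrow> 'x" where "oX \<omega> = fst \<omega>"
definition oY :: "('x, 'y, 'z) aux_outcome \<Rightarrow> 'y" where "oY \<omega> = fst (snd \<omega>)"
definition oZ :: "('x, 'y, 'z) aux_outcome \<Rightarrow> 'z" where "oZ \<omega> = fst (snd (snd \<omega>))"
definition oU :: "('x, 'y, 'z) aux_outcome \<Rightarrow> nat" where "oU \<omega> = fst (snd (snd (snd \<omega>)))"
definition oV :: "('x, 'y, 'z) aux_outcome \<Rightarrow> nat list" where "oV \<omega> = fst (snd (snd (snd (snd \<omega>))))"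
definition oW :: "('x, 'y, 'z) aux_outcome \<Rightarrow> nat list" where "oW \<omega> = snd (snd (snd (snd (snd \<omega>))))"

definition region_RK ::
  "('x \<times> 'y) pmf \<Rightarrow> ('x \<Rightarrow> 'z pmf) \<Rightarrow> ('x \<Rightarrow> 'xh \<Rightarrow> real) \<Rightarrow> ('z \<Rightarrow> 'zh \<Rightarrow> real) \<Rightarrow>
   nat \<Rightarrow> real \<Rightarrow> real \<Rightarrow> (real \<times> real \<times> real) set" where
  "region_RK pxy pzx dx dz K Dx Dz =
    {(Rx, Ry, Rz). \<exists>(P :: ('x, 'y, 'z) aux_outcome pmf)
        (xhat :: nat \<Rightarrow> nat list \<Rightarrow> 'z \<Rightarrow> 'xh) (zhat :: nat \<Rightarrow> nat list \<Rightarrow> 'x \<Rightarrow> 'zh).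
       finite (set_pmf P) \<and>
       map_pmf (\<lambda>\<omega>. (oX \<omega>, oY \<omega>, oZ \<omega>)) P = source pxy pzx \<and>
       (\<forall>\<omega>\<in>set_pmf P. length (oV \<omega>) = K \<and> length (oW \<omega>) = K) \<and>
       markov P oU oY (\<lambda>\<omega>. (oX \<omega>, oZ \<omega>)) \<and>
       (\<forall>k\<in>{1..K}. markov P (\<lambda>\<omega>. oV \<omega> ! (k - 1))
           (\<lambda>\<omega>. (oZ \<omega>, oU \<omega>, take (k - 1) (oV \<omega>), take (k - 1) (oW \<omega>)))
           (\<lambda>\<omega>. (oX \<omega>, oY \<omega>))) \<and>
       (\<forall>k\<in>{1..K}. markov P (\<lambda>\<omega>. oW \<omega> ! (k - 1))
           (\<lambda>\<omega>. (oX \<omega>, oU \<omega>, take k (oV \<omega>), take (k - 1) (oW \<omega>)))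
           (\<lambda>\<omega>. (oZ \<omega>, oY \<omega>))) \<and>
       measure_pmf.expectation P (\<lambda>\<omega>. dx (oX \<omega>) (xhat (oU \<omega>) (oW \<omega>) (oZ \<omega>))) \<le> Dx \<and>
       measure_pmf.expectation P (\<lambda>\<omega>. dz (oZ \<omega>) (zhat (oU \<omega>) (oV \<omega>) (oX \<omega>))) \<le> Dz \<and>
       Ry \<ge> cmi P oU oY oZ \<and>
       Rz \<ge> (\<Sum>k=1..K. cmi P oZ (\<lambda>\<omega>. oV \<omega> ! (k - 1))
               (\<lambda>\<omega>. (oX \<omega>, oU \<omega>, take (k - 1) (oV \<omega>), take (k - 1) (oW \<omega>)))) \<and>
       Rx \<ge> (\<Sum>k=1..K. cmi P oX (\<lambda>\<omega>. oW \<omega> ! (k - 1))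
               (\<lambda>\<omega>. (oZ \<omega>, oU \<omega>, take k (oV \<omega>), take (k - 1) (oW \<omega>))))}"

end

theory Submission
  imports Defs
begin

text \<open>
  Achievability. Each message block is sent by a one-shot random binning scheme. All players share a
  random selection function that samples every law at once, built from exponential races, so that
  whoever samples from a law close to the true one most likely obtains the same block. The scheme
  reproduces the single-letter test channel exactly unless some block is decoded wrongly, and by the
  weak law of large numbers this is unlikely as soon as the rates exceed the mutual informations.

  Converse. A test channel splits the law of the source like a tree: the helper's message splits the
  law of \<open>Y\<close>, then the messages of the two users alternately multiply the law of \<open>(X, Z)\<close> by functions
  of \<open>z\<close> and of \<open>x\<close>. Rates and distortions are sums over the leaves of functionals that are continuous
  and positively homogeneous in the unnormalised law. Hence, by Caratheodory's theorem, the set of all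
  pairs (law, payoff) reachable by splittings is a closed cone, which makes the region closed without an
  explicit bound on the alphabets. A code of length \<open>n\<close> gives a point of that cone: the coordinate \<open>i\<close>
  and \<open>U\<^sub>i = (T\<^sub>y, X\<^sup>i\<^sup>-\<^sup>1, Z\<^sub>i\<^sub>+\<^sub>1\<^sup>n)\<close> serve as the helper's message and the transcript of the code as
  the users' messages. The last message of User X need not be known to his own decoder: he guesses the
  value that is best given his letter, which does not increase the distortion.
\<close>

section \<open>Entropy and Markov chains\<close>

text \<open>That Y - X - Z is a Markov chain is used in both directions. In the direct part it gives
  H(U|X) \<le> H(U|Z), so the one helper message, binned at rate I(U;Y|Z) for User Z, can also be
  decoded by User X. In the converse it links Z^n to the helper's message T through X^n only, which
  turns H(Z^n|X^n,T) into n H(Z|X) and makes the choice of U_i separate the two users. The obstacle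
  is that the operational region is a closure, whereas the single-letter region quantifies over
  auxiliary alphabets of any size, so a sequence of test channels has no evident limit; a limit has
  to be taken in a space of fixed finite dimension. This works because each rate is a difference of
  conditional entropies: the sum over the rounds telescopes, and only the values just after the
  helper's message and at the end of the exchange survive. These few numbers, with the two
  distortions, are all that is remembered of a test channel.\<close>

abbreviation expec :: "'o pmf \<Rightarrow> ('o \<Rightarrow> real) \<Rightarrow> real" where
  "expec P \<equiv> measure_pmf.expectation P"

abbreviation prob :: "'o pmf \<Rightarrow> 'o set \<Rightarrow> real" where
  "prob P \<equiv> measure_pmf.prob P"

abbreviation mass :: "'o pmf \<Rightarrow> ('o \<Rightarrow> 'a) \<Rightarrow> 'a \<Rightarrow> real" where
  "mass P A \<equiv> pmf (map_pmf A P)"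

definition ent :: "'o pmf \<Rightarrow> ('o \<Rightarrow> 'a) \<Rightarrow> real" where
  "ent P A = expec P (\<lambda>\<omega>. - log 2 (mass P A (A \<omega>)))"

definition cent :: "'o pmf \<Rightarrow> ('o \<Rightarrow> 'a) \<Rightarrow> ('o \<Rightarrow> 'b) \<Rightarrow> real" where
  "cent P A B = ent P (\<lambda>\<omega>. (A \<omega>, B \<omega>)) - ent P B"

lemma integrable_finite_pmf [simp]:
  fixes f :: "'o \<Rightarrow> real"
  shows "finite (set_pmf P) \<Longrightarrow> integrable (measure_pmf P) f"
  by (rule integrable_measure_pmf_finite)

lemma expec_sum:
  fixes f :: "'o \<Rightarrow> real"
  assumes "finite S" "set_pmf P \<subseteq> S"
  shows "expec P f = (\<Sum>\<omega>\<in>S. pmf P \<omega> * f \<omega>)"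
proof -
  have "expec P f = (\<Sum>\<omega>\<in>S. f \<omega> * pmf P \<omega>)"
    by (rule integral_measure_pmf_real) (use assms in auto)
  thus ?thesis by (simp add: mult.commute)
qed

lemma expec_cong:
  "(\<And>\<omega>. \<omega> \<in> set_pmf P \<Longrightarrow> f \<omega> = g \<omega>) \<Longrightarrow> expec P f = expec P g"
  by (rule integral_cong_AE) (auto simp: AE_measure_pmf_iff)

lemma expec_mono:
  "finite (set_pmf P) \<Longrightarrow> (\<And>\<omega>. \<omega> \<in> set_pmf P \<Longrightarrow> f \<omega> \<le> g \<omega>) \<Longrightarrow> expec P f \<le> expec P g"
  by (rule integral_mono_AE) (auto simp: AE_measure_pmf_iff)

lemma mass_eq: "mass P A a = prob P {\<omega>. A \<omega> = a}"
  by (simp add: pmf_map vimage_def)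

lemma prob_cong: "(\<And>\<omega>. \<omega> \<in> set_pmf P \<Longrightarrow> \<omega> \<in> S \<longleftrightarrow> \<omega> \<in> T) \<Longrightarrow> prob P S = prob P T"
  by (rule measure_prob_cong_0) (auto simp: set_pmf_iff)

lemma prob_mono_supp:
  assumes "\<And>\<omega>. \<omega> \<in> set_pmf P \<Longrightarrow> \<omega> \<in> S \<Longrightarrow> \<omega> \<in> T"
  shows "prob P S \<le> prob P T"
proof -
  have "prob P S = prob P (S \<inter> set_pmf P)" by (simp add: measure_Int_set_pmf)
  also have "\<dots> \<le> prob P T"
    by (rule measure_pmf.finite_measure_mono) (use assms in auto)
  finally show ?thesis .
qed

lemma mass_pos: "\<omega> \<in> set_pmf P \<Longrightarrow> mass P A (A \<omega>) > 0"
  by (rule pmf_positive) simp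

text \<open>Entropy sees a variable only through the partition it induces on the support. Stated
  this way, reordering tuples and re-encoding messages become equivalences that automation can
  check.\<close>

lemma ent_cong:
  assumes "\<And>\<omega> \<omega>'. \<omega> \<in> set_pmf P \<Longrightarrow> \<omega>' \<in> set_pmf P \<Longrightarrow> A \<omega> = A \<omega>' \<longleftrightarrow> B \<omega> = B \<omega>'"
  shows "ent P A = ent P B"
  unfolding ent_def mass_eq
proof (rule expec_cong)
  fix \<omega> assume "\<omega> \<in> set_pmf P"
  hence "prob P {\<omega>'. A \<omega>' = A \<omega>} = prob P {\<omega>'. B \<omega>' = B \<omega>}"
    by (intro prob_cong) (use assms in auto)
  thus "- log 2 (prob P {\<omega>'. A \<omega>' = A \<omega>}) = - log 2 (prob P {\<omega>'. B \<omega>' = B \<omega>})" by simp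
qed

lemma cent_cong:
  assumes "\<And>\<omega> \<omega>'. \<omega> \<in> set_pmf P \<Longrightarrow> \<omega>' \<in> set_pmf P \<Longrightarrow> B \<omega> = B \<omega>' \<longleftrightarrow> B' \<omega> = B' \<omega>'"
    and "\<And>\<omega> \<omega>'. \<omega> \<in> set_pmf P \<Longrightarrow> \<omega>' \<in> set_pmf P \<Longrightarrow> B \<omega> = B \<omega>' \<Longrightarrow> A \<omega> = A \<omega>' \<longleftrightarrow> A' \<omega> = A' \<omega>'"
  shows "cent P A B = cent P A' B'"
proof -
  have "ent P B = ent P B'" by (rule ent_cong) (use assms in auto)
  moreover have "ent P (\<lambda>\<omega>. (A \<omega>, B \<omega>)) = ent P (\<lambda>\<omega>. (A' \<omega>, B' \<omega>))"
    by (rule ent_cong) (use assms in auto)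
  ultimately show ?thesis by (simp add: cent_def)
qed

lemma ent_map: "ent (map_pmf f P) A = ent P (\<lambda>\<omega>. A (f \<omega>))"
  by (simp add: ent_def map_pmf_comp)

lemma cent_map: "cent (map_pmf f P) A B = cent P (\<lambda>\<omega>. A (f \<omega>)) (\<lambda>\<omega>. B (f \<omega>))"
  by (simp add: cent_def ent_map)

lemma cent_expec:
  assumes "finite (set_pmf P)"
  shows "cent P A B = expec P (\<lambda>\<omega>. - log 2 (mass P (\<lambda>\<omega>. (A \<omega>, B \<omega>)) (A \<omega>, B \<omega>) / mass P B (B \<omega>)))"
proof -
  have "cent P A B = expec P (\<lambda>\<omega>. - log 2 (mass P (\<lambda>\<omega>. (A \<omega>, B \<omega>)) (A \<omega>, B \<omega>)) - - log 2 (mass P B (B \<omega>)))"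
    unfolding cent_def ent_def using assms by simp
  also have "\<dots> = expec P (\<lambda>\<omega>. - log 2 (mass P (\<lambda>\<omega>. (A \<omega>, B \<omega>)) (A \<omega>, B \<omega>) / mass P B (B \<omega>)))"
  proof (rule expec_cong)
    fix \<omega> assume w: "\<omega> \<in> set_pmf P"
    have "mass P (\<lambda>\<omega>. (A \<omega>, B \<omega>)) (A \<omega>, B \<omega>) > 0" "mass P B (B \<omega>) > 0"
      using mass_pos[OF w, of "\<lambda>\<omega>. (A \<omega>, B \<omega>)"] mass_pos[OF w, of B] by auto
    thus "- log 2 (mass P (\<lambda>\<omega>. (A \<omega>, B \<omega>)) (A \<omega>, B \<omega>)) - - log 2 (mass P B (B \<omega>))
      = - log 2 (mass P (\<lambda>\<omega>. (A \<omega>, B \<omega>)) (A \<omega>, B \<omega>) / mass P B (B \<omega>))"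
      by (simp add: log_divide_pos)
  qed
  finally show ?thesis .
qed

text \<open>On the support all four masses are positive, so the logarithm of the quotient splits
  into four terms.\<close>

lemma cmi_ent:
  assumes fin: "finite (set_pmf P)"
  shows "cmi P A B C = ent P (\<lambda>\<omega>. (A \<omega>, C \<omega>)) + ent P (\<lambda>\<omega>. (B \<omega>, C \<omega>))
    - ent P (\<lambda>\<omega>. (A \<omega>, B \<omega>, C \<omega>)) - ent P C"
proof -
  let ?J = "map_pmf (\<lambda>\<omega>. (A \<omega>, B \<omega>, C \<omega>)) P"
  let ?g = "\<lambda>(a, b, c). log 2 (pmf ?J (a, b, c) * pmf (map_pmf C P) c /
               (pmf (map_pmf (\<lambda>\<omega>. (A \<omega>, C \<omega>)) P) (a, c) *
                pmf (map_pmf (\<lambda>\<omega>. (B \<omega>, C \<omega>)) P) (b, c)))"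
  have "cmi P A B C = expec ?J ?g"
    unfolding cmi_def Let_def
    by (subst expec_sum[of "set_pmf ?J"]) (use fin in \<open>auto intro!: sum.cong\<close>)
  also have "\<dots> = expec P (\<lambda>\<omega>. ?g (A \<omega>, B \<omega>, C \<omega>))"
    by simp
  also have "\<dots> = expec P (\<lambda>\<omega>. - log 2 (mass P (\<lambda>\<omega>. (A \<omega>, C \<omega>)) (A \<omega>, C \<omega>))
     + - log 2 (mass P (\<lambda>\<omega>. (B \<omega>, C \<omega>)) (B \<omega>, C \<omega>))
     - - log 2 (mass P (\<lambda>\<omega>. (A \<omega>, B \<omega>, C \<omega>)) (A \<omega>, B \<omega>, C \<omega>))
     - - log 2 (mass P C (C \<omega>)))"
  proof (rule expec_cong)
    fix \<omega> assume w: "\<omega> \<in> set_pmf P"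
    have "mass P (\<lambda>\<omega>. (A \<omega>, C \<omega>)) (A \<omega>, C \<omega>) > 0" "mass P C (C \<omega>) > 0"
      "mass P (\<lambda>\<omega>. (B \<omega>, C \<omega>)) (B \<omega>, C \<omega>) > 0" "mass P (\<lambda>\<omega>. (A \<omega>, B \<omega>, C \<omega>)) (A \<omega>, B \<omega>, C \<omega>) > 0"
      using mass_pos[OF w, of "\<lambda>\<omega>. (A \<omega>, C \<omega>)"] mass_pos[OF w, of C]
       mass_pos[OF w, of "\<lambda>\<omega>. (B \<omega>, C \<omega>)"] mass_pos[OF w, of "\<lambda>\<omega>. (A \<omega>, B \<omega>, C \<omega>)"] by auto
    thus "?g (A \<omega>, B \<omega>, C \<omega>) = - log 2 (mass P (\<lambda>\<omega>. (A \<omega>, C \<omega>)) (A \<omega>, C \<omega>))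
     + - log 2 (mass P (\<lambda>\<omega>. (B \<omega>, C \<omega>)) (B \<omega>, C \<omega>))
     - - log 2 (mass P (\<lambda>\<omega>. (A \<omega>, B \<omega>, C \<omega>)) (A \<omega>, B \<omega>, C \<omega>))
     - - log 2 (mass P C (C \<omega>))"
      by (simp add: log_divide_pos log_mult_pos)
  qed
  also have "\<dots> = ent P (\<lambda>\<omega>. (A \<omega>, C \<omega>)) + ent P (\<lambda>\<omega>. (B \<omega>, C \<omega>))
    - ent P (\<lambda>\<omega>. (A \<omega>, B \<omega>, C \<omega>)) - ent P C"
    unfolding ent_def using fin by simp
  finally show ?thesis .
qed

lemma cmi_cent:
  assumes fin: "finite (set_pmf P)"
  shows "cmi P A B C = cent P A C - cent P A (\<lambda>\<omega>. (B \<omega>, C \<omega>))"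
  by (simp add: cmi_ent[OF fin] cent_def)

lemma cmi_cent':
  assumes fin: "finite (set_pmf P)"
  shows "cmi P A B C = cent P B C - cent P B (\<lambda>\<omega>. (A \<omega>, C \<omega>))"
proof -
  have "ent P (\<lambda>\<omega>. (A \<omega>, B \<omega>, C \<omega>)) = ent P (\<lambda>\<omega>. (B \<omega>, A \<omega>, C \<omega>))" by (rule ent_cong) auto
  thus ?thesis by (simp add: cmi_ent[OF fin] cent_def)
qed

section \<open>Nonnegativity of conditional mutual information and its consequences\<close>

lemma log2_ge: "x > 0 \<Longrightarrow> log 2 x \<ge> (1 - 1 / x) / ln 2"
proof -
  assume x: "x > 0"
  have "ln (1 / x) \<le> 1 / x - 1" by (rule ln_le_minus_one) (use x in auto)
  hence "1 - 1 / x \<le> ln x" using x by (simp add: ln_div)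
  thus ?thesis by (simp add: log_def divide_right_mono)
qed

lemma mass_sum_snd:
  assumes "finite (set_pmf P)" "finite S" "A ` set_pmf P \<subseteq> S"
  shows "(\<Sum>a\<in>S. mass P (\<lambda>\<omega>. (A \<omega>, C \<omega>)) (a, c)) = mass P C c"
proof -
  have "(\<Sum>a\<in>S. mass P (\<lambda>\<omega>. (A \<omega>, C \<omega>)) (a, c)) = prob P (\<Union>a\<in>S. {\<omega>. (A \<omega>, C \<omega>) = (a, c)})"
    unfolding mass_eq
    by (subst measure_pmf.finite_measure_finite_Union) (use assms in \<open>auto simp: disjoint_family_on_def\<close>)
  also have "\<dots> = mass P C c" unfolding mass_eq
    by (rule prob_cong) (use assms in auto)
  finally show ?thesis .
qed

lemma mass_sum_fst:
  assumes "finite (set_pmf P)" "finite S" "A ` set_pmf P \<subseteq> S"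
  shows "(\<Sum>a\<in>S. mass P (\<lambda>\<omega>. (C \<omega>, A \<omega>)) (c, a)) = mass P C c"
proof -
  have "mass P (\<lambda>\<omega>. (C \<omega>, A \<omega>)) (c, a) = mass P (\<lambda>\<omega>. (A \<omega>, C \<omega>)) (a, c)" for a
    unfolding mass_eq by (rule prob_cong) auto
  thus ?thesis using mass_sum_snd[OF assms] by simp
qed

text \<open>Gibbs' inequality: the tangent bound \<open>log2_ge\<close> replaces each logarithm by
  one minus the inverse ratio, and the weights p(a,c) p(b,c) / p(c) sum to at most one over the
  support of the triple.\<close>

lemma cmi_nonneg:
  assumes fin: "finite (set_pmf P)"
  shows "cmi P A B C \<ge> 0"
proof -
  let ?J = "map_pmf (\<lambda>\<omega>. (A \<omega>, B \<omega>, C \<omega>)) P"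
  let ?AC = "mass P (\<lambda>\<omega>. (A \<omega>, C \<omega>))" and ?BC = "mass P (\<lambda>\<omega>. (B \<omega>, C \<omega>))" and ?C = "mass P C"
  let ?SA = "A ` set_pmf P" and ?SB = "B ` set_pmf P" and ?SC = "C ` set_pmf P"
  have pos: "pmf ?J t > 0 \<and> ?AC (fst t, snd (snd t)) > 0 \<and> ?BC (snd t) > 0 \<and> ?C (snd (snd t)) > 0"
    if t: "t \<in> set_pmf ?J" for t
  proof -
    obtain \<omega> where w: "\<omega> \<in> set_pmf P" "t = (A \<omega>, B \<omega>, C \<omega>)" using t by auto
    show ?thesis using mass_pos[OF w(1), of "\<lambda>\<omega>. (A \<omega>, C \<omega>)"] mass_pos[OF w(1), of C]
       mass_pos[OF w(1), of "\<lambda>\<omega>. (B \<omega>, C \<omega>)"] mass_pos[OF w(1), of "\<lambda>\<omega>. (A \<omega>, B \<omega>, C \<omega>)"] w(2) by auto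
  qed
  have bd: "(\<Sum>t\<in>set_pmf ?J. (pmf ?J t - ?AC (fst t, snd (snd t)) * ?BC (snd t) / ?C (snd (snd t))) / ln 2)
    \<le> cmi P A B C"
    unfolding cmi_def Let_def
  proof (rule sum_mono)
    fix t assume t: "t \<in> set_pmf ?J"
    obtain a b c where tt: "t = (a, b, c)" by (cases t)
    have p: "pmf ?J (a,b,c) > 0" "?AC (a, c) > 0" "?BC (b, c) > 0" "?C c > 0"
      using pos[OF t] tt by auto
    let ?r = "pmf ?J (a,b,c) * ?C c / (?AC (a,c) * ?BC (b,c))"
    have "?r > 0" using p by simp
    hence "pmf ?J (a,b,c) * log 2 ?r \<ge> pmf ?J (a,b,c) * ((1 - 1 / ?r) / ln 2)"
      using p by (intro mult_left_mono log2_ge) auto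
    moreover have "pmf ?J (a,b,c) * ((1 - 1 / ?r) / ln 2) = (pmf ?J (a,b,c) - ?AC (a, c) * ?BC (b,c) / ?C c) / ln 2"
      using p by (simp add: field_simps)
    ultimately show "(pmf ?J t - ?AC (fst t, snd (snd t)) * ?BC (snd t) / ?C (snd (snd t))) / ln 2
      \<le> (case t of (a, b, c) \<Rightarrow> pmf ?J (a, b, c) * log 2 (pmf ?J (a, b, c) * ?C c / (?AC (a, c) * ?BC (b, c))))"
      by (simp add: tt)
  qed
  \<comment> \<open>Enlarging the support of the triple to a product of ranges adds only nonnegative
    terms and lets the sum factor.\<close>
  have le1: "(\<Sum>t\<in>set_pmf ?J. ?AC (fst t, snd (snd t)) * ?BC (snd t) / ?C (snd (snd t))) \<le> 1"
  proof -
    have "(\<Sum>t\<in>set_pmf ?J. ?AC (fst t, snd (snd t)) * ?BC (snd t) / ?C (snd (snd t)))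
      \<le> (\<Sum>t\<in>?SA \<times> ?SB \<times> ?SC. ?AC (fst t, snd (snd t)) * ?BC (snd t) / ?C (snd (snd t)))"
      by (rule sum_mono2) (use fin in auto)
    also have "\<dots> = (\<Sum>a\<in>?SA. \<Sum>b\<in>?SB. \<Sum>c\<in>?SC. ?AC (a, c) * ?BC (b, c) / ?C c)"
      by (simp add: sum.cartesian_product case_prod_unfold)
    also have "\<dots> = (\<Sum>a\<in>?SA. \<Sum>c\<in>?SC. \<Sum>b\<in>?SB. ?AC (a, c) * ?BC (b, c) / ?C c)"
      by (intro sum.cong refl sum.swap)
    also have "\<dots> = (\<Sum>c\<in>?SC. \<Sum>a\<in>?SA. \<Sum>b\<in>?SB. ?AC (a, c) * ?BC (b, c) / ?C c)"
      by (rule sum.swap)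
    also have "\<dots> = (\<Sum>c\<in>?SC. (\<Sum>a\<in>?SA. ?AC (a, c)) * (\<Sum>b\<in>?SB. ?BC (b, c)) / ?C c)"
      by (simp add: sum_product sum_divide_distrib)
    also have "\<dots> = (\<Sum>c\<in>?SC. ?C c)"
      using fin by (subst mass_sum_snd, simp, simp, simp)+ simp
    also have "\<dots> = 1" by (rule sum_pmf_eq_1) (use fin in auto)
    finally show ?thesis .
  qed
  have s1: "(\<Sum>t\<in>set_pmf ?J. pmf ?J t) = 1"
    by (rule sum_pmf_eq_1) (use fin in auto)
  have "(\<Sum>t\<in>set_pmf ?J. (pmf ?J t - ?AC (fst t, snd (snd t)) * ?BC (snd t) / ?C (snd (snd t))) / ln 2)
    = ((\<Sum>t\<in>set_pmf ?J. pmf ?J t) - (\<Sum>t\<in>set_pmf ?J. ?AC (fst t, snd (snd t)) * ?BC (snd t) / ?C (snd (snd t)))) / ln 2"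
    unfolding sum_subtractf[symmetric] sum_divide_distrib ..
  with bd have p1: "((\<Sum>t\<in>set_pmf ?J. pmf ?J t) - (\<Sum>t\<in>set_pmf ?J. ?AC (fst t, snd (snd t)) * ?BC (snd t) / ?C (snd (snd t)))) / ln 2
    \<le> cmi P A B C" by (simp only:)
  have aux: "(x - y) / ln 2 \<ge> 0" if "x = 1" "y \<le> 1" for x y :: real using that by simp
  have p2: "((\<Sum>t\<in>set_pmf ?J. pmf ?J t) - (\<Sum>t\<in>set_pmf ?J. ?AC (fst t, snd (snd t)) * ?BC (snd t) / ?C (snd (snd t)))) / ln 2 \<ge> 0"
    by (rule aux[OF s1 le1])
  show ?thesis by (rule order_trans[OF p2 p1])
qed

text \<open>Adding the determined variable \<open>C\<close> to \<open>B\<close> changes nothing, and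
  the drop from \<open>C\<close> to the pair is a conditional mutual information.\<close>

lemma cent_mono:
  assumes "finite (set_pmf P)"
    and "\<And>\<omega> \<omega>'. \<omega> \<in> set_pmf P \<Longrightarrow> \<omega>' \<in> set_pmf P \<Longrightarrow> B \<omega> = B \<omega>' \<Longrightarrow> C \<omega> = C \<omega>'"
  shows "cent P A B \<le> cent P A C"
proof -
  have "cent P A B = cent P A (\<lambda>\<omega>. (B \<omega>, C \<omega>))" by (rule cent_cong, unfold prod.inject) (use assms(2) in blast)+
  thus ?thesis using cmi_nonneg[OF assms(1), of A B C] cmi_cent[OF assms(1), of A B C] by simp
qed

text \<open>Holds pointwise: the atom of the coarser variable contains that of the finer
  one.\<close>

lemma ent_le:
  assumes "finite (set_pmf P)"
    and "\<And>\<omega> \<omega>'. \<omega> \<in> set_pmf P \<Longrightarrow> \<omega>' \<in> set_pmf P \<Longrightarrow> B \<omega> = B \<omega>' \<Longrightarrow> A \<omega> = A \<omega>'"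
  shows "ent P A \<le> ent P B"
  unfolding ent_def
proof (rule expec_mono[OF assms(1)])
  fix \<omega> assume w: "\<omega> \<in> set_pmf P"
  have "mass P B (B \<omega>) \<le> mass P A (A \<omega>)"
    unfolding mass_eq by (rule prob_mono_supp, unfold mem_Collect_eq) (use assms(2) w in blast)
  thus "- log 2 (mass P A (A \<omega>)) \<le> - log 2 (mass P B (B \<omega>))"
    using mass_pos[OF w, of B] by simp
qed

lemma cent_nonneg: "finite (set_pmf P) \<Longrightarrow> cent P A B \<ge> 0"
  unfolding cent_def diff_ge_0_iff_ge by (rule ent_le) auto

lemma cent_zero:
  assumes "\<And>\<omega> \<omega>'. \<omega> \<in> set_pmf P \<Longrightarrow> \<omega>' \<in> set_pmf P \<Longrightarrow> B \<omega> = B \<omega>' \<Longrightarrow> A \<omega> = A \<omega>'"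
  shows "cent P A B = 0"
proof -
  have "ent P (\<lambda>\<omega>. (A \<omega>, B \<omega>)) = ent P B" by (rule ent_cong, unfold prod.inject) (use assms in blast)
  thus ?thesis by (simp add: cent_def)
qed

text \<open>The tangent bound again, now for the divergence from the uniform law on \<open>N\<close>
  points.\<close>

lemma ent_le_log_card:
  assumes fin: "finite (set_pmf P)" and S: "finite S" "A ` set_pmf P \<subseteq> S" "card S \<le> N"
  shows "ent P A \<le> log 2 (real N)"
proof -
  have N: "real N > 0" using S set_pmf_not_empty[of P]
    by (metis card_gt_0_iff empty_is_image gr0I le_zero_eq of_nat_0_less_iff subset_empty)
  have "- ent P A + log 2 (real N) = expec P (\<lambda>\<omega>. log 2 (mass P A (A \<omega>)) + log 2 (real N))"
    unfolding ent_def using fin by simp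
  also have "\<dots> \<ge> expec P (\<lambda>\<omega>. (1 - 1 / (mass P A (A \<omega>) * real N)) / ln 2)"
  proof (rule expec_mono[OF fin])
    fix \<omega> assume w: "\<omega> \<in> set_pmf P"
    have "mass P A (A \<omega>) * real N > 0" using mass_pos[OF w, of A] N by simp
    from log2_ge[OF this] show "(1 - 1 / (mass P A (A \<omega>) * real N)) / ln 2 \<le> log 2 (mass P A (A \<omega>)) + log 2 (real N)"
      using mass_pos[OF w, of A] N by (simp add: log_mult_pos)
  qed
  moreover have "expec P (\<lambda>\<omega>. (1 - 1 / (mass P A (A \<omega>) * real N)) / ln 2) \<ge> 0"
  proof -
    have "expec P (\<lambda>\<omega>. 1 / (mass P A (A \<omega>) * real N)) = expec (map_pmf A P) (\<lambda>a. 1 / (mass P A a * real N))"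
      by simp
    also have "\<dots> = (\<Sum>a\<in>A ` set_pmf P. mass P A a * (1 / (mass P A a * real N)))"
      by (rule expec_sum) (use fin in auto)
    also have "\<dots> = (\<Sum>a\<in>A ` set_pmf P. 1 / real N)"
    proof (rule sum.cong[OF refl])
      fix a assume "a \<in> A ` set_pmf P"
      then obtain \<omega> where w: "\<omega> \<in> set_pmf P" "a = A \<omega>" by auto
      show "mass P A a * (1 / (mass P A a * real N)) = 1 / real N"
        using mass_pos[OF w(1), of A] w(2) by simp
    qed
    also have "\<dots> = real (card (A ` set_pmf P)) / real N" by simp
    also have "\<dots> \<le> 1" using card_mono[OF S(1,2)] S(3) N by (simp add: divide_le_eq)
    finally have "expec P (\<lambda>\<omega>. 1 / (mass P A (A \<omega>) * real N)) \<le> 1" .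
    moreover have "expec P (\<lambda>\<omega>. (1 - 1 / (mass P A (A \<omega>) * real N)) / ln 2)
      = (1 - expec P (\<lambda>\<omega>. 1 / (mass P A (A \<omega>) * real N))) / ln 2"
      using fin by (subst Bochner_Integration.integral_divide_zero, subst Bochner_Integration.integral_diff) simp_all
    ultimately show ?thesis by simp
  qed
  ultimately show ?thesis by linarith
qed

lemma cent_le_ent: 
  assumes "finite (set_pmf P)"
  shows "cent P A B \<le> ent P A"
proof -
  have "cent P A B \<le> cent P A (\<lambda>_. ())" by (rule cent_mono) (use assms in auto)
  also have "ent P (\<lambda>\<omega>. ()) = 0" by (simp add: ent_def mass_eq)
  hence "cent P A (\<lambda>_. ()) = ent P (\<lambda>\<omega>. (A \<omega>, ()))" by (simp add: cent_def)
  also have "\<dots> = ent P A" by (rule ent_cong) auto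
  finally show ?thesis .
qed

section \<open>Criteria for Markov chains\<close>

lemma markovI_supp:
  assumes "\<And>\<omega> \<omega>'. \<omega> \<in> set_pmf P \<Longrightarrow> \<omega>' \<in> set_pmf P \<Longrightarrow> B \<omega> = B \<omega>' \<Longrightarrow>
    prob P {v. A v = A \<omega> \<and> B v = B \<omega> \<and> C v = C \<omega>'} * prob P {v. B v = B \<omega>}
    = prob P {v. A v = A \<omega> \<and> B v = B \<omega>} * prob P {v. B v = B \<omega> \<and> C v = C \<omega>'}"
  shows "markov P A B C"
  unfolding markov_def mass_eq
proof (intro allI)
  fix a b c
  show "prob P {\<omega>. (A \<omega>, B \<omega>, C \<omega>) = (a, b, c)} * prob P {\<omega>. B \<omega> = b} =
     prob P {\<omega>. (A \<omega>, B \<omega>) = (a, b)} * prob P {\<omega>. (B \<omega>, C \<omega>) = (b, c)}"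
  \<comment> \<open>\<open>\<omega>\<close> supplies the values of \<open>A\<close> and
    \<open>B\<close>, \<open>\<omega>'\<close> that of \<open>C\<close>. If no such pair of outcomes
    exists, one factor on the right vanishes, and so does the triple mass on the left.\<close>
  proof (cases "\<exists>\<omega>\<in>set_pmf P. \<exists>\<omega>'\<in>set_pmf P. A \<omega> = a \<and> B \<omega> = b \<and> B \<omega>' = b \<and> C \<omega>' = c")
    case True
    obtain \<omega> \<omega>' where w: "\<omega> \<in> set_pmf P" "\<omega>' \<in> set_pmf P"
      and eq: "A \<omega> = a" "B \<omega> = b" "B \<omega>' = b" "C \<omega>' = c"
      using True by (elim bexE conjE) (rule that)
    have "B \<omega> = B \<omega>'" using eq by simp
    from assms[OF w this] show ?thesis unfolding eq prod.inject .
  next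
    case False
    hence "set_pmf P \<inter> {\<omega>. (A \<omega>, B \<omega>, C \<omega>) = (a, b, c)} = {}" by blast
    hence "prob P {\<omega>. (A \<omega>, B \<omega>, C \<omega>) = (a, b, c)} = 0"
      by (simp only: measure_pmf_zero_iff)
    moreover have "set_pmf P \<inter> {\<omega>. (A \<omega>, B \<omega>) = (a, b)} = {} \<or> set_pmf P \<inter> {\<omega>. (B \<omega>, C \<omega>) = (b, c)} = {}"
      using False by blast
    hence "prob P {\<omega>. (A \<omega>, B \<omega>) = (a, b)} = 0 \<or> prob P {\<omega>. (B \<omega>, C \<omega>) = (b, c)} = 0"
      by (simp only: measure_pmf_zero_iff)
    ultimately show ?thesis by auto
  qed
qed

text \<open>The counterpart of \<open>ent_cong\<close>. \<open>A\<close> and \<open>C\<close> are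
  compared only within a fibre of \<open>B\<close>, so parts already contained in \<open>B\<close>
  may be added to them or removed.\<close>

lemma markov_cong:
  assumes "markov P A B C"
    and "\<And>\<omega> \<omega>'. \<omega> \<in> set_pmf P \<Longrightarrow> \<omega>' \<in> set_pmf P \<Longrightarrow> B \<omega> = B \<omega>' \<longleftrightarrow> B' \<omega> = B' \<omega>'"
    and "\<And>\<omega> \<omega>'. \<omega> \<in> set_pmf P \<Longrightarrow> \<omega>' \<in> set_pmf P \<Longrightarrow> B \<omega> = B \<omega>' \<Longrightarrow> A \<omega> = A \<omega>' \<longleftrightarrow> A' \<omega> = A' \<omega>'"
    and "\<And>\<omega> \<omega>'. \<omega> \<in> set_pmf P \<Longrightarrow> \<omega>' \<in> set_pmf P \<Longrightarrow> B \<omega> = B \<omega>' \<Longrightarrow> C \<omega> = C \<omega>' \<longleftrightarrow> C' \<omega> = C' \<omega>'"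
  shows "markov P A' B' C'"
proof (rule markovI_supp)
  fix \<omega> \<omega>' assume w: "\<omega> \<in> set_pmf P" "\<omega>' \<in> set_pmf P" "B' \<omega> = B' \<omega>'"
  have Bv: "B' v = B' \<omega> \<longleftrightarrow> B v = B \<omega>" if "v \<in> set_pmf P" for v using assms(2)[OF that w(1)] by simp
  have Bw: "B \<omega> = B \<omega>'" using assms(2)[OF w(1,2)] w(3) by simp
  have Av: "A' v = A' \<omega> \<longleftrightarrow> A v = A \<omega>" if "v \<in> set_pmf P" "B v = B \<omega>" for v
    using assms(3)[OF that(1) w(1)] that(2) by simp
  have Cv: "C' v = C' \<omega>' \<longleftrightarrow> C v = C \<omega>'" if "v \<in> set_pmf P" "B v = B \<omega>" for v
    using assms(4)[OF that(1) w(2)] that(2) Bw by simp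
  have 1: "prob P {v. A' v = A' \<omega> \<and> B' v = B' \<omega> \<and> C' v = C' \<omega>'} = mass P (\<lambda>\<omega>. (A \<omega>, B \<omega>, C \<omega>)) (A \<omega>, B \<omega>, C \<omega>')"
    unfolding mass_eq by (rule prob_cong, unfold mem_Collect_eq prod.inject) (use Av Bv Cv in blast)
  have 2: "prob P {v. B' v = B' \<omega>} = mass P B (B \<omega>)"
    unfolding mass_eq by (rule prob_cong, unfold mem_Collect_eq prod.inject) (use Bv in blast)
  have 3: "prob P {v. A' v = A' \<omega> \<and> B' v = B' \<omega>} = mass P (\<lambda>\<omega>. (A \<omega>, B \<omega>)) (A \<omega>, B \<omega>)"
    unfolding mass_eq by (rule prob_cong, unfold mem_Collect_eq prod.inject) (use Av Bv in blast)
  have 4: "prob P {v. B' v = B' \<omega> \<and> C' v = C' \<omega>'} = mass P (\<lambda>\<omega>. (B \<omega>, C \<omega>)) (B \<omega>, C \<omega>')"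
    unfolding mass_eq by (rule prob_cong, unfold mem_Collect_eq prod.inject) (use Bv Cv in blast)
  show "prob P {v. A' v = A' \<omega> \<and> B' v = B' \<omega> \<and> C' v = C' \<omega>'} * prob P {v. B' v = B' \<omega>}
    = prob P {v. A' v = A' \<omega> \<and> B' v = B' \<omega>} * prob P {v. B' v = B' \<omega> \<and> C' v = C' \<omega>'}"
    unfolding 1 2 3 4 using assms(1)[unfolded markov_def, rule_format] .
qed

lemma cent_markov:
  assumes fin: "finite (set_pmf P)" and m: "markov P A B C"
  shows "cent P A (\<lambda>\<omega>. (B \<omega>, C \<omega>)) = cent P A B"
proof -
  show ?thesis unfolding cent_expec[OF fin]
  proof (rule expec_cong)
    fix \<omega> assume w: "\<omega> \<in> set_pmf P"
    have p: "mass P B (B \<omega>) > 0" "mass P (\<lambda>\<omega>. (B \<omega>, C \<omega>)) (B \<omega>, C \<omega>) > 0"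
      using mass_pos[OF w, of B] mass_pos[OF w, of "\<lambda>\<omega>. (B \<omega>, C \<omega>)"] by auto
    have "mass P (\<lambda>\<omega>. (A \<omega>, B \<omega>, C \<omega>)) (A \<omega>, B \<omega>, C \<omega>) * mass P B (B \<omega>) =
      mass P (\<lambda>\<omega>. (A \<omega>, B \<omega>)) (A \<omega>, B \<omega>) * mass P (\<lambda>\<omega>. (B \<omega>, C \<omega>)) (B \<omega>, C \<omega>)"
      using m[unfolded markov_def, rule_format] .
    hence "mass P (\<lambda>\<omega>. (A \<omega>, B \<omega>, C \<omega>)) (A \<omega>, B \<omega>, C \<omega>) / mass P (\<lambda>\<omega>. (B \<omega>, C \<omega>)) (B \<omega>, C \<omega>) =
      mass P (\<lambda>\<omega>. (A \<omega>, B \<omega>)) (A \<omega>, B \<omega>) / mass P B (B \<omega>)"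
      using p by (simp add: field_simps)
    thus "- log 2 (mass P (\<lambda>\<omega>. (A \<omega>, B \<omega>, C \<omega>)) (A \<omega>, B \<omega>, C \<omega>) / mass P (\<lambda>\<omega>. (B \<omega>, C \<omega>)) (B \<omega>, C \<omega>)) =
      - log 2 (mass P (\<lambda>\<omega>. (A \<omega>, B \<omega>)) (A \<omega>, B \<omega>) / mass P B (B \<omega>))" by simp
  qed
qed

text \<open>Summing the factorisation over \<open>A\<close>, over \<open>C\<close> and over both
  yields the three marginals, and the same products appear on both sides. The factors need not be
  normalised, so any explicit product formula for the joint mass will do.\<close>

lemma markovI_factor:
  assumes fin: "finite (set_pmf P)"
    and f: "\<And>a b c. a \<in> A ` set_pmf P \<Longrightarrow> b \<in> B ` set_pmf P \<Longrightarrow> c \<in> C ` set_pmf P \<Longrightarrow>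
      mass P (\<lambda>\<omega>. (A \<omega>, B \<omega>, C \<omega>)) (a, b, c) = \<phi> a b * \<psi> b c"
  shows "markov P A B C"
proof (rule markovI_supp)
  let ?SA = "A ` set_pmf P" and ?SC = "C ` set_pmf P"
  fix \<omega> \<omega>' assume w: "\<omega> \<in> set_pmf P" "\<omega>' \<in> set_pmf P" "B \<omega> = B \<omega>'"
  define a b c where abc: "a = A \<omega>" "b = B \<omega>" "c = C \<omega>'"
  have mem: "a \<in> ?SA" "b \<in> B ` set_pmf P" "c \<in> ?SC" using w abc by auto
  have AB: "mass P (\<lambda>\<omega>. (A \<omega>, B \<omega>)) (a, b) = \<phi> a b * (\<Sum>c\<in>?SC. \<psi> b c)" if "a \<in> ?SA" for a
  proof -
    have "mass P (\<lambda>\<omega>. (A \<omega>, B \<omega>)) (a, b) = (\<Sum>c\<in>?SC. mass P (\<lambda>\<omega>. ((A \<omega>, B \<omega>), C \<omega>)) ((a, b), c))"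
      by (rule mass_sum_fst[symmetric]) (use fin in auto)
    also have "\<dots> = (\<Sum>c\<in>?SC. mass P (\<lambda>\<omega>. (A \<omega>, B \<omega>, C \<omega>)) (a, b, c))"
      unfolding mass_eq by (intro sum.cong refl prob_cong) auto
    also have "\<dots> = (\<Sum>c\<in>?SC. \<phi> a b * \<psi> b c)" using f that mem by (intro sum.cong) auto
    finally show ?thesis by (simp add: sum_distrib_left)
  qed
  have BC: "mass P (\<lambda>\<omega>. (B \<omega>, C \<omega>)) (b, c) = (\<Sum>a\<in>?SA. \<phi> a b) * \<psi> b c"
  proof -
    have "mass P (\<lambda>\<omega>. (B \<omega>, C \<omega>)) (b, c) = (\<Sum>a\<in>?SA. mass P (\<lambda>\<omega>. (A \<omega>, B \<omega>, C \<omega>)) (a, b, c))"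
      by (rule mass_sum_snd[symmetric]) (use fin in auto)
    also have "\<dots> = (\<Sum>a\<in>?SA. \<phi> a b * \<psi> b c)" using f mem by (intro sum.cong) auto
    finally show ?thesis by (simp add: sum_distrib_right)
  qed
  have "mass P B b = (\<Sum>a\<in>?SA. mass P (\<lambda>\<omega>. (A \<omega>, B \<omega>)) (a, b))"
    by (rule mass_sum_snd[symmetric]) (use fin in auto)
  also have "\<dots> = (\<Sum>a\<in>?SA. \<phi> a b) * (\<Sum>c\<in>?SC. \<psi> b c)"
    by (simp add: AB sum_distrib_right)
  finally have BB: "mass P B b = (\<Sum>a\<in>?SA. \<phi> a b) * (\<Sum>c\<in>?SC. \<psi> b c)" .
  have "mass P (\<lambda>\<omega>. (A \<omega>, B \<omega>, C \<omega>)) (a, b, c) * mass P B b = mass P (\<lambda>\<omega>. (A \<omega>, B \<omega>)) (a, b) * mass P (\<lambda>\<omega>. (B \<omega>, C \<omega>)) (b, c)"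
    unfolding BB AB[OF mem(1)] BC f[OF mem] by (simp add: algebra_simps)
  thus "prob P {v. A v = A \<omega> \<and> B v = B \<omega> \<and> C v = C \<omega>'} * prob P {v. B v = B \<omega>}
    = prob P {v. A v = A \<omega> \<and> B v = B \<omega>} * prob P {v. B v = B \<omega> \<and> C v = C \<omega>'}"
    by (simp add: mass_eq abc)
qed

section \<open>Sampling by exponential races\<close>

lemma ex_pmf_of_weights:
  assumes S: "finite S" and nn: "\<And>x. x \<in> S \<Longrightarrow> f x \<ge> (0::real)" and s1: "sum f S = 1"
  shows "\<exists>P. set_pmf P \<subseteq> S \<and> (\<forall>x\<in>S. pmf P x = f x)"
proof -
  let ?g = "\<lambda>x. if x \<in> S then f x else 0"
  have g: "\<And>x. 0 \<le> ?g x" using nn by auto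
  have "(\<integral>\<^sup>+x. ennreal (?g x) \<partial>count_space UNIV) = (\<Sum>x\<in>S. ennreal (?g x))"
    by (rule nn_integral_count_space') (use S nn in auto)
  also have "\<dots> = ennreal (\<Sum>x\<in>S. ?g x)" using nn by (intro sum_ennreal) auto
  also have "(\<Sum>x\<in>S. ?g x) = 1" using s1 by simp
  finally have 1: "(\<integral>\<^sup>+x. ennreal (?g x) \<partial>count_space UNIV) = 1" by simp
  show ?thesis
    by (rule exI[of _ "embed_pmf ?g"]) (auto simp: pmf_embed_pmf[OF g 1] set_embed_pmf[OF g 1])
qed

text \<open>Lets the continuous clocks be discarded once the finitely valued selection function has
  been built from them.\<close>

lemma (in prob_space) ex_pmf_of_finite_rv:
  assumes R: "finite R" and F: "\<And>x. x \<in> space M \<Longrightarrow> F x \<in> R"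
    and meas: "\<And>f. f \<in> R \<Longrightarrow> {x \<in> space M. F x = f} \<in> sets M"
  shows "\<exists>\<Phi>. set_pmf \<Phi> \<subseteq> R \<and> (\<forall>X. measure_pmf.prob \<Phi> X = measure M {x \<in> space M. F x \<in> X})"
proof -
  have un: "measure M {x \<in> space M. F x \<in> X} = (\<Sum>f\<in>R \<inter> X. measure M {x \<in> space M. F x = f})" for X
  proof -
    have "{x \<in> space M. F x \<in> X} = (\<Union>f\<in>R \<inter> X. {x \<in> space M. F x = f})" using F by auto
    also have "measure M \<dots> = (\<Sum>f\<in>R \<inter> X. measure M {x \<in> space M. F x = f})"
      by (rule finite_measure_finite_Union) (use R meas in \<open>auto simp: disjoint_family_on_def\<close>)
    finally show ?thesis .
  qed
  have "(\<Sum>f\<in>R. measure M {x \<in> space M. F x = f}) = 1"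
    using un[of UNIV] prob_space by simp
  then obtain \<Phi> where P: "set_pmf \<Phi> \<subseteq> R" "\<forall>f\<in>R. pmf \<Phi> f = measure M {x \<in> space M. F x = f}"
    using ex_pmf_of_weights[OF R, of "\<lambda>f. measure M {x \<in> space M. F x = f}"] by auto
  have "measure_pmf.prob \<Phi> X = measure M {x \<in> space M. F x \<in> X}" for X
  proof -
    have "measure_pmf.prob \<Phi> X = measure_pmf.prob \<Phi> (R \<inter> X)"
      by (rule prob_cong) (use P in auto)
    also have "\<dots> = (\<Sum>f\<in>R \<inter> X. pmf \<Phi> f)" using R by (simp add: measure_measure_pmf_finite)
    also have "\<dots> = measure M {x \<in> space M. F x \<in> X}" unfolding un using P by (intro sum.cong) auto
    finally show ?thesis .
  qed
  thus ?thesis using P by blast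
qed

abbreviation exp1 :: "real measure" where
  "exp1 \<equiv> density lborel (exponential_density 1)"

abbreviation races :: "'a set \<Rightarrow> ('a \<Rightarrow> real) measure" where
  "races A \<equiv> Pi\<^sub>M A (\<lambda>_. exp1)"

lemma prob_space_exp1: "prob_space exp1"
  by (rule prob_space_exponential_density) simp

lemma prob_space_races: "prob_space (races A)"
  by (intro prob_space_PiM prob_space_exp1)

lemma emeasure_exp1_gt:
  assumes "a \<ge> 0" shows "emeasure exp1 {a<..} = ennreal (exp (- a))"
proof -
  interpret prob_space exp1 by (rule prob_space_exp1)
  have "distr exp1 lborel (\<lambda>x. x) = density lborel (exponential_density 1)"
    by (subst distr_cong[OF refl, of _ exp1 _ "\<lambda>x. x"]) (auto simp: distr_id)
  hence "distributed exp1 lborel (\<lambda>x. x) (exponential_density 1)"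
    unfolding distributed_def by simp
  from exponential_distributedD_gt[OF this assms]
  have "measure exp1 {x \<in> space exp1. a < x} = exp (- a)" by simp
  moreover have "{x \<in> space exp1. a < x} = {a<..}" by auto
  ultimately show ?thesis by (simp add: emeasure_eq_measure)
qed

lemma measurable_race_component:
  "b \<in> A \<Longrightarrow> (\<lambda>E. E b) \<in> borel_measurable (races A)"
  using measurable_component_singleton[of b A "\<lambda>_. exp1"]
  by (simp cong: measurable_cong_sets)

lemma sets_race:
  assumes "finite A" "a \<in> A"
  shows "{E \<in> space (races A). \<forall>b\<in>A - {a}. E b > c b * E a} \<in> sets (races A)"
proof (rule sets.sets_Collect_finite_All)
  fix b assume "b \<in> A - {a}"
  hence b: "b \<in> A" by simp
  note [measurable] = measurable_race_component[OF b] measurable_race_component[OF assms(2)]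
  show "{E \<in> space (races A). E b > c b * E a} \<in> sets (races A)" by measurable
qed (use assms in auto)

text \<open>If clock \<open>a\<close> rings at time y, the other clocks exceed
  \<open>c b * y\<close> independently, each with probability exp(- c b y); this is then integrated
  against the density of y.\<close>

lemma measure_race:
  fixes c :: "'a \<Rightarrow> real"
  assumes A: "finite A" "a \<in> A" and c: "\<And>b. b \<in> A - {a} \<Longrightarrow> c b \<ge> 0"
  shows "measure (races A) {E \<in> space (races A). \<forall>b\<in>A - {a}. E b > c b * E a} = 1 / (1 + (\<Sum>b\<in>A - {a}. c b))"
proof -
  let ?I = "A - {a}" and ?S = "{E \<in> space (races A). \<forall>b\<in>A - {a}. E b > c b * E a}" and ?C = "\<Sum>b\<in>A - {a}. c b"
  have ins: "A = insert a ?I" using A by auto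
  have C: "?C \<ge> 0" by (rule sum_nonneg) (use c in auto)
  interpret prob_space exp1 by (rule prob_space_exp1)
  interpret product_sigma_finite "\<lambda>_::'a. exp1" by standard
  interpret R: prob_space "races A" by (rule prob_space_races)
  have [measurable]: "?S \<in> sets (races A)" using A by (rule sets_race)
  have ind: "indicator ?S (x(a := y)) = (indicator (PiE ?I (\<lambda>b. {c b * y<..})) x :: ennreal)"
    if "x \<in> space (races ?I)" for x y
    using that A by (auto simp: indicator_def space_PiM PiE_def extensional_def Pi_def)
  have "emeasure (races A) ?S = (\<integral>\<^sup>+E. indicator ?S E \<partial>races A)" by simp
  also have "\<dots> = (\<integral>\<^sup>+E. indicator ?S E \<partial>races (insert a ?I))" using ins by simp
  also have "\<dots> = (\<integral>\<^sup>+y. (\<integral>\<^sup>+x. indicator ?S (x(a := y)) \<partial>races ?I) \<partial>exp1)"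
    by (rule product_nn_integral_insert_rev) (use A ins in auto)
  also have "\<dots> = (\<integral>\<^sup>+y. (\<integral>\<^sup>+x. indicator (PiE ?I (\<lambda>b. {c b * y<..})) x \<partial>races ?I) \<partial>exp1)"
    by (intro nn_integral_cong ind)
  also have "\<dots> = (\<integral>\<^sup>+y. emeasure (races ?I) (PiE ?I (\<lambda>b. {c b * y<..})) \<partial>exp1)"
    by (intro nn_integral_cong nn_integral_indicator sets_PiM_I_finite) (use A in auto)
  also have "\<dots> = (\<integral>\<^sup>+y. (\<Prod>b\<in>?I. emeasure exp1 {c b * y<..}) \<partial>exp1)"
    by (intro nn_integral_cong emeasure_PiM) (use A in auto)
  also have "\<dots> = (\<integral>\<^sup>+y. ennreal (exponential_density 1 y) * (\<Prod>b\<in>?I. emeasure exp1 {c b * y<..}) \<partial>lborel)"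
  proof (rule nn_integral_density)
    have "(\<lambda>y. \<Prod>b\<in>?I. emeasure exp1 {c b * y<..}) \<in> borel_measurable borel"
    proof (rule borel_measurable_prod_ennreal)
      fix b assume "b \<in> ?I"
      have "(\<lambda>t. emeasure exp1 {t<..}) \<in> borel_measurable borel"
      proof -
        \<comment> \<open>Measurability of the tail probability comes from its monotonicity in the
          threshold.\<close>
        have "mono (\<lambda>t. - measure exp1 {t<..})"
          by (auto intro!: monoI finite_measure_mono)
        hence "(\<lambda>t. - measure exp1 {t<..}) \<in> borel_measurable borel"
          by (rule borel_measurable_mono)
        hence "(\<lambda>t. - (- measure exp1 {t<..})) \<in> borel_measurable borel"
          by (rule borel_measurable_uminus)
        thus ?thesis by (simp add: emeasure_eq_measure)
      qed
      from measurable_compose[OF _ this, of "\<lambda>y. c b * y"]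
      show "(\<lambda>y. emeasure exp1 {c b * y<..}) \<in> borel_measurable borel" by simp
    qed
    thus "(\<lambda>y. \<Prod>b\<in>?I. emeasure exp1 {c b * y<..}) \<in> borel_measurable lborel" by simp
  qed simp
  \<comment> \<open>The product of the tails turns the density of rate \<open>1\<close> into that of
    rate \<open>1 + ?C\<close>, up to the factor \<open>1 / (1 + ?C)\<close>; what remains is the
    total mass of a probability density.\<close>
  also have "\<dots> = (\<integral>\<^sup>+y. ennreal (1 / (1 + ?C)) * ennreal (exponential_density (1 + ?C) y) \<partial>lborel)"
  proof (rule nn_integral_cong)
    fix y :: real
    show "ennreal (exponential_density 1 y) * (\<Prod>b\<in>?I. emeasure exp1 {c b * y<..})
      = ennreal (1 / (1 + ?C)) * ennreal (exponential_density (1 + ?C) y)"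
    proof (cases "y < 0")
      case True thus ?thesis by (simp add: exponential_density_def)
    next
      case False
      have "(\<Prod>b\<in>?I. emeasure exp1 {c b * y<..}) = (\<Prod>b\<in>?I. ennreal (exp (- (c b * y))))"
        by (intro prod.cong refl emeasure_exp1_gt) (use c False in auto)
      also have "\<dots> = ennreal (\<Prod>b\<in>?I. exp (- (c b * y)))" by (rule prod_ennreal) simp
      also have "(\<Prod>b\<in>?I. exp (- (c b * y))) = exp (- ?C * y)"
        using A by (simp add: exp_sum[symmetric] sum_negf sum_distrib_right)
      finally have *: "(\<Prod>b\<in>?I. emeasure exp1 {c b * y<..}) = ennreal (exp (- ?C * y))" .
      have "exp (- y) * exp (- ?C * y) = 1 / (1 + ?C) * ((1 + ?C) * exp (- y * (1 + ?C)))"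
      proof -
        have "1 + ?C \<noteq> 0" using C by linarith
        hence "1 / (1 + ?C) * ((1 + ?C) * exp (- y * (1 + ?C))) = exp (- y * (1 + ?C))"
          by (simp del: mult_minus_left)
        thus ?thesis by (simp add: exp_add[symmetric] algebra_simps del: mult_minus_left)
      qed
      thus ?thesis unfolding * using False C
        by (simp add: exponential_density_def ennreal_mult[symmetric])
    qed
  qed
  also have "\<dots> = ennreal (1 / (1 + ?C)) * (\<integral>\<^sup>+y. ennreal (exponential_density (1 + ?C) y) \<partial>lborel)"
    by (rule nn_integral_cmult) simp
  also have "(\<integral>\<^sup>+y. ennreal (exponential_density (1 + ?C) y) \<partial>lborel) = 1"
  proof -
    interpret D: prob_space "density lborel (exponential_density (1 + ?C))"
      by (rule prob_space_exponential_density) (use C in auto)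
    show ?thesis using D.emeasure_space_1 by (simp add: emeasure_density)
  qed
  finally show ?thesis using C by (simp add: R.emeasure_eq_measure)
qed

text \<open>Exponential races (the finite case of the Poisson functional representation): scaling one
  family of independent exponential clocks by the weights of any \<open>p\<close> and taking the first to ring
  samples \<open>p\<close>, and samples of similar distributions mostly agree.\<close>

lemma ex_race_selection:
  fixes A :: "'a set" and PP :: "'a pmf set"
  assumes A: "finite A" and PP: "finite PP" and sub: "\<And>p. p \<in> PP \<Longrightarrow> set_pmf p \<subseteq> A"
  shows "\<exists>\<Phi> :: ('a pmf \<Rightarrow> 'a) pmf. finite (set_pmf \<Phi>) \<and> (\<forall>p\<in>PP. map_pmf (\<lambda>\<sigma>. \<sigma> p) \<Phi> = p) \<and>
    (\<forall>p\<in>PP. \<forall>q\<in>PP. \<forall>a. pmf q a > 0 \<longrightarrow> prob \<Phi> {\<sigma>. \<sigma> p = a \<and> \<sigma> q \<noteq> a} \<le> pmf p a * (pmf p a / pmf q a))"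
proof (cases "A = {}")
  case True
  hence "PP = {}" using sub set_pmf_not_empty by (metis subset_empty ex_in_conv)
  thus ?thesis by (intro exI[of _ "return_pmf undefined"]) auto
next
  case False
  then obtain a0 where a0: "a0 \<in> A" by auto
  let ?M = "races A"
  interpret R: prob_space ?M by (rule prob_space_races)
  \<comment> \<open>The event that E a / pmf p a is the strict minimum, i.e. that \<open>a\<close>
    rings first for \<open>p\<close>. It has this meaning only if \<open>pmf p a > 0\<close>, which
    is assumed wherever it matters.\<close>
  define S where "S p a = {E \<in> space ?M. \<forall>b\<in>A - {a}. E b > pmf p b / pmf p a * E a}" for p :: "'a pmf" and a
  have S_meas: "S p a \<in> sets ?M" if "a \<in> A" for p a unfolding S_def using A that by (rule sets_race)
  have one: "sum (pmf p) A = 1" if "p \<in> PP" for p using sum_pmf_eq_1[OF A sub[OF that]] .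
  have S_disj: "a = b" if "a \<in> A" "b \<in> A" "pmf p a > 0" "pmf p b > 0" "E \<in> S p a" "E \<in> S p b" for p a b E
  proof (rule ccontr)
    assume ne: "a \<noteq> b"
    have "E b > pmf p b / pmf p a * E a" "E a > pmf p a / pmf p b * E b"
      using that ne unfolding S_def by auto
    thus False using that(3,4) by (simp add: field_simps)
  qed
  have mS: "measure ?M (S p a) = pmf p a" if p: "p \<in> PP" "a \<in> A" "pmf p a > 0" for p a
  proof -
    have "measure ?M (S p a) = 1 / (1 + (\<Sum>b\<in>A - {a}. pmf p b / pmf p a))"
      unfolding S_def by (rule measure_race) (use A p in auto)
    also have "1 + (\<Sum>b\<in>A - {a}. pmf p b / pmf p a) = (pmf p a + (\<Sum>b\<in>A - {a}. pmf p b)) / pmf p a"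
      using p(3) by (simp add: sum_divide_distrib[symmetric] add_divide_distrib)
    also have "pmf p a + (\<Sum>b\<in>A - {a}. pmf p b) = 1"
      using one[OF p(1)] sum.remove[OF A p(2), of "pmf p"] by simp
    finally show ?thesis by simp
  qed
  \<comment> \<open>A clock that wins even after the relative weights of \<open>p\<close> and
    \<open>q\<close> are added wins for both laws. The added weights sum to 1 / pmf p a + 1 / pmf q
    a - 2, whence the constant.\<close>
  have mSS: "measure ?M (S p a \<inter> S q a) \<ge> 1 / (1 / pmf p a + 1 / pmf q a)"
    if p: "p \<in> PP" "q \<in> PP" "a \<in> A" "pmf p a > 0" "pmf q a > 0" for p q a
  proof -
    let ?c = "\<lambda>b. pmf p b / pmf p a + pmf q b / pmf q a"
    have "1 / (1 / pmf p a + 1 / pmf q a) \<le> 1 / (1 + (\<Sum>b\<in>A - {a}. ?c b))"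
    proof (rule divide_left_mono)
      have "(\<Sum>b\<in>A - {a}. ?c b) = (sum (pmf p) A - pmf p a) / pmf p a + (sum (pmf q) A - pmf q a) / pmf q a"
        using sum.remove[OF A p(3), of "pmf p"] sum.remove[OF A p(3), of "pmf q"]
        by (simp add: sum.distrib sum_divide_distrib[symmetric])
      also have "\<dots> = 1 / pmf p a + 1 / pmf q a - 2"
        using p one by (simp add: field_simps)
      finally show "1 + (\<Sum>b\<in>A - {a}. ?c b) \<le> 1 / pmf p a + 1 / pmf q a" by simp
      have "(\<Sum>b\<in>A - {a}. ?c b) \<ge> 0" by (rule sum_nonneg) simp
      thus "0 < (1 / pmf p a + 1 / pmf q a) * (1 + (\<Sum>b\<in>A - {a}. ?c b))" using p
        by (intro mult_pos_pos add_pos_pos add_pos_nonneg) auto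
    qed simp
    also have "\<dots> = measure ?M {E \<in> space ?M. \<forall>b\<in>A - {a}. E b > ?c b * E a}"
      by (rule measure_race[symmetric]) (use A p in auto)
    also have "\<dots> \<le> measure ?M (S p a \<inter> S q a)"
    proof -
      \<comment> \<open>The sum of two relative weights times \<open>E a\<close> dominates each
        summand only if \<open>E a\<close> is nonnegative, which holds almost surely.\<close>
      have "AE E in ?M. E a \<ge> 0"
      proof (rule AE_PiM_component)
        show "AE x in exp1. 0 \<le> x" by (auto simp: AE_density exponential_density_def)
      qed (use p prob_space_exp1 in auto)
      then obtain N where N: "{E \<in> space ?M. \<not> E a \<ge> 0} \<subseteq> N" "N \<in> null_sets ?M" by (auto elim!: AE_E)
      have "{E \<in> space ?M. \<forall>b\<in>A - {a}. E b > ?c b * E a} \<subseteq> (S p a \<inter> S q a) \<union> N"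
      proof
        fix E assume E: "E \<in> {E \<in> space ?M. \<forall>b\<in>A - {a}. E b > ?c b * E a}"
        show "E \<in> (S p a \<inter> S q a) \<union> N"
        proof (cases "E a \<ge> 0")
          case True
          have "E b > pmf p b / pmf p a * E a \<and> E b > pmf q b / pmf q a * E a" if "b \<in> A - {a}" for b
          proof -
            have "E b > ?c b * E a" using E that by auto
            moreover have "pmf p b / pmf p a * E a \<ge> 0" "pmf q b / pmf q a * E a \<ge> 0" using True by auto
            ultimately show ?thesis by (simp only: distrib_right) linarith
          qed
          thus ?thesis using E unfolding S_def by auto
        qed (use E N in auto)
      qed
      hence "measure ?M {E \<in> space ?M. \<forall>b\<in>A - {a}. E b > ?c b * E a} \<le> measure ?M ((S p a \<inter> S q a) \<union> N)"
        by (rule R.finite_measure_mono) (intro sets.Un sets.Int S_meas p null_setsD2 N(2))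
      also have "\<dots> = measure ?M (S p a \<inter> S q a)"
        by (rule measure_Un_null_set) (intro sets.Int S_meas p N(2))+
      finally show ?thesis .
    qed
    finally show ?thesis .
  qed
  \<comment> \<open>\<open>a0\<close> is a default for the null event that no clock wins
    strictly.\<close>
  define sel where "sel p E = (if \<exists>a\<in>A. pmf p a > 0 \<and> E \<in> S p a then (SOME a. a \<in> A \<and> pmf p a > 0 \<and> E \<in> S p a) else a0)" for p E
  have sel: "sel p E = a" if "a \<in> A" "pmf p a > 0" "E \<in> S p a" for p E a
  proof -
    have ex: "\<exists>a\<in>A. pmf p a > 0 \<and> E \<in> S p a" using that by blast
    hence "\<exists>a. a \<in> A \<and> pmf p a > 0 \<and> E \<in> S p a" by blast
    from someI_ex[OF this] show ?thesis unfolding sel_def using S_disj[OF _ that(1) _ that(2) _ that(3)] ex by simp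
  qed
  have sel_A: "sel p E \<in> A" for p E
  proof (cases "\<exists>a\<in>A. pmf p a > 0 \<and> E \<in> S p a")
    case True
    then obtain a where "a \<in> A" "pmf p a > 0" "E \<in> S p a" by blast
    thus ?thesis using sel by metis
  next
    case False
    hence "sel p E = a0" unfolding sel_def by (rule if_not_P)
    thus ?thesis using a0 by simp
  qed
  have S_space: "E \<in> space ?M" if "E \<in> S p b" for p b E using that by (simp add: S_def)
  have sel_meas: "{E \<in> space ?M. sel p E = a} \<in> sets ?M" if a: "a \<in> A" for p a
  proof -
    let ?B = "\<Union>b\<in>{b\<in>A. pmf p b > 0}. S p b"
    have "{E \<in> space ?M. sel p E = a} = (if pmf p a > 0 then S p a else {}) \<union> (if a = a0 then space ?M - ?B else {})"
      (is "?L = ?R")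
    proof (intro set_eqI iffI)
      fix E assume E: "E \<in> ?L"
      show "E \<in> ?R"
      proof (cases "\<exists>a\<in>A. pmf p a > 0 \<and> E \<in> S p a")
        case True
        then obtain b where b: "b \<in> A" "pmf p b > 0" "E \<in> S p b" by blast
        have "b = a" using sel[OF b] E by simp
        thus ?thesis using b by simp
      next
        case False
        hence "sel p E = a0" unfolding sel_def by (rule if_not_P)
        thus ?thesis using False E by auto
      qed
    next
      fix E assume "E \<in> ?R"
      then consider "pmf p a > 0" "E \<in> S p a" | "a = a0" "E \<in> space ?M - ?B" by (auto split: if_splits)
      thus "E \<in> ?L"
      proof cases
        case 1 thus ?thesis using sel[OF a 1] S_space by simp
      next
        case 2
        hence "\<not> (\<exists>a\<in>A. pmf p a > 0 \<and> E \<in> S p a)" by blast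
        hence "sel p E = a0" unfolding sel_def by (rule if_not_P)
        thus ?thesis using 2 by simp
      qed
    qed
    also have "\<dots> \<in> sets ?M"
    proof -
      have "?B \<in> sets ?M" by (rule sets.finite_UN) (use A S_meas in auto)
      thus ?thesis using S_meas[OF a] by auto
    qed
    finally show ?thesis .
  qed
  \<comment> \<open>Fixing the value outside \<open>PP\<close> leaves finitely many selection
    functions.\<close>
  define F where "F E = (\<lambda>p. if p \<in> PP then sel p E else a0)" for E
  let ?R = "{f. \<forall>p. (p \<in> PP \<longrightarrow> f p \<in> A) \<and> (p \<notin> PP \<longrightarrow> f p = a0)}"
  have finR: "finite ?R" using PP A by (rule finite_set_of_finite_funs)
  have "\<exists>\<Phi>. set_pmf \<Phi> \<subseteq> ?R \<and>
    (\<forall>X. prob \<Phi> X = measure ?M {x \<in> space ?M. F x \<in> X})"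
  proof (rule R.ex_pmf_of_finite_rv)
    show "finite ?R" by (rule finR)
    show "F E \<in> ?R" for E
      using sel_A by (auto simp: F_def)
    fix f assume f: "f \<in> ?R"
    have "{E \<in> space ?M. F E = f} = {E \<in> space ?M. \<forall>p\<in>PP. sel p E = f p}"
      using f by (auto simp: F_def fun_eq_iff)
    also have "\<dots> \<in> sets ?M"
      by (rule sets.sets_Collect_finite_All[OF _ PP]) (use f sel_meas in auto)
    finally show "{E \<in> space ?M. F E = f} \<in> sets ?M" .
  qed
  then obtain \<Phi> where \<Phi>s: "set_pmf \<Phi> \<subseteq> ?R"
    and \<Phi>: "\<And>X. prob \<Phi> X = measure ?M {x \<in> space ?M. F x \<in> X}" by blast
  have fin\<Phi>: "finite (set_pmf \<Phi>)"
    using \<Phi>s finR by (rule finite_subset)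
  have p1: "mass \<Phi> (\<lambda>\<sigma>. \<sigma> p) a = measure ?M {E \<in> space ?M. sel p E = a}" if "p \<in> PP" for p a
    unfolding mass_eq \<Phi> F_def using that by simp
  have ge: "mass \<Phi> (\<lambda>\<sigma>. \<sigma> p) a \<ge> pmf p a" if p: "p \<in> PP" "a \<in> A" for p a
  proof (cases "pmf p a > 0")
    case True
    have "pmf p a = measure ?M (S p a)" using mS p True by simp
    also have "\<dots> \<le> measure ?M {E \<in> space ?M. sel p E = a}"
      by (rule R.finite_measure_mono) (use sel True p S_def sel_meas in auto)
    finally show ?thesis using p1 p by simp
  qed (simp add: not_less)
  \<comment> \<open>Each atom was only bounded from below; as both laws have total mass one, all
    bounds are equalities. This also disposes of the event on which no clock wins.\<close>
  have law: "map_pmf (\<lambda>\<sigma>. \<sigma> p) \<Phi> = p" if p: "p \<in> PP" for p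
  proof -
    let ?q = "map_pmf (\<lambda>\<sigma>. \<sigma> p) \<Phi>"
    have qA: "set_pmf ?q \<subseteq> A" using \<Phi>s p by auto
    have "(\<Sum>a\<in>A. pmf ?q a - pmf p a) = 0"
      using sum_pmf_eq_1[OF A qA] one[OF p] by (simp add: sum_subtractf)
    hence eqA: "\<forall>a\<in>A. pmf ?q a - pmf p a = 0"
      using ge[OF p] by (subst (asm) sum_nonneg_eq_0_iff[OF A]) auto
    show ?thesis
    proof (rule pmf_eqI)
      fix a show "pmf ?q a = pmf p a"
      proof (cases "a \<in> A")
        case False
        hence "a \<notin> set_pmf ?q" "a \<notin> set_pmf p" using qA sub[OF p] by blast+
        thus ?thesis by (simp only: pmf_eq_0_set_pmf[symmetric])
      qed (use eqA in simp)
    qed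
  qed
  have "prob \<Phi> {\<sigma>. \<sigma> p = a \<and> \<sigma> q \<noteq> a} \<le> pmf p a * (pmf p a / pmf q a)"
    if p: "p \<in> PP" "q \<in> PP" and q: "pmf q a > 0" for p q a
  proof (cases "pmf p a > 0")
    case False
    have "prob \<Phi> {\<sigma>. \<sigma> p = a \<and> \<sigma> q \<noteq> a} \<le> mass \<Phi> (\<lambda>\<sigma>. \<sigma> p) a"
      unfolding mass_eq by (rule prob_mono_supp) auto
    thus ?thesis using law[OF p(1)] False by (simp add: not_less)
  next
    case True
    have a: "a \<in> A" using sub[OF p(1)] True by (auto simp: set_pmf_iff)
    have "prob \<Phi> {\<sigma>. \<sigma> p = a \<and> \<sigma> q \<noteq> a} = measure ?M {E \<in> space ?M. sel p E = a \<and> sel q E \<noteq> a}"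
      unfolding \<Phi> F_def using p by simp
    also have "\<dots> \<le> measure ?M ({E \<in> space ?M. sel p E = a} - (S p a \<inter> S q a))"
    proof (rule R.finite_measure_mono)
      show "{E \<in> space ?M. sel p E = a \<and> sel q E \<noteq> a} \<subseteq> {E \<in> space ?M. sel p E = a} - (S p a \<inter> S q a)"
        using sel[OF a q] by blast
    qed (intro sets.Diff sets.Int sel_meas S_meas a)
    also have "\<dots> = measure ?M {E \<in> space ?M. sel p E = a} - measure ?M (S p a \<inter> S q a)"
    proof (rule R.finite_measure_Diff)
      show "S p a \<inter> S q a \<subseteq> {E \<in> space ?M. sel p E = a}"
        using sel[OF a True] S_space by blast
    qed (intro sets.Int sel_meas S_meas a)+
    also have "measure ?M {E \<in> space ?M. sel p E = a} = pmf p a"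
      using p1[OF p(1), of a] law[OF p(1)] by simp
    also have "pmf p a - measure ?M (S p a \<inter> S q a) \<le> pmf p a - 1 / (1 / pmf p a + 1 / pmf q a)"
      using mSS[OF p a True q] by simp
    also have "\<dots> = pmf p a * (pmf p a / (pmf p a + pmf q a))"
      using True q by (simp add: field_simps)
    also have "\<dots> \<le> pmf p a * (pmf p a / pmf q a)"
      using True q by (intro mult_left_mono divide_left_mono) auto
    finally show ?thesis .
  qed
  thus ?thesis using law fin\<Phi> by blast
qed

section \<open>Splitting trees\<close>

text \<open>A pair \<open>(q, r)\<close> is an unnormalised law together with a payoff vector. A message that depends on
  \<open>s\<close> only through \<open>f s\<close> splits \<open>q\<close> into pieces, one for each value of the message; payoffs add up.\<close>

definition splitting :: "nat \<Rightarrow> ('s::finite \<Rightarrow> 'k) \<Rightarrow> ((real^'s) \<times> 'r::real_vector) set \<Rightarrow> real^'s \<Rightarrow> 'r \<Rightarrow>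
    (nat \<Rightarrow> real^'s) \<Rightarrow> (nat \<Rightarrow> 'r) \<Rightarrow> (nat \<Rightarrow> 's \<Rightarrow> real) \<Rightarrow> bool" where
  "splitting N f G q r qs rs g \<longleftrightarrow>
     (\<forall>m<N. (qs m, rs m) \<in> G \<and> (\<forall>s. g m s \<ge> 0) \<and> (\<forall>s s'. f s = f s' \<longrightarrow> g m s = g m s') \<and>
        (\<forall>s. qs m $ s = q $ s * g m s)) \<and>
     (\<forall>s. (\<Sum>m<N. g m s) = 1) \<and> r = (\<Sum>m<N. rs m)"

definition refineN :: "nat \<Rightarrow> ('s::finite \<Rightarrow> 'k) \<Rightarrow> ((real^'s) \<times> 'r::real_vector) set \<Rightarrow> ((real^'s) \<times> 'r) set" where
  "refineN N f G = {(q, r). \<exists>qs rs g. splitting N f G q r qs rs g}"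

definition refine :: "('s::finite \<Rightarrow> 'k) \<Rightarrow> ((real^'s) \<times> 'r::real_vector) set \<Rightarrow> ((real^'s) \<times> 'r) set" where
  "refine f G = (\<Union>N. refineN N f G)"

text \<open>Closed cones with payoff dominated by the total mass. Refining preserves them because, by
  Caratheodory's theorem, a bounded number of pieces suffices.\<close>

definition admissible :: "real \<Rightarrow> ((real^'s::finite) \<times> 'r::real_normed_vector) set \<Rightarrow> bool" where
  "admissible C G \<longleftrightarrow> closed G \<and> (0, 0) \<in> G \<and>
     (\<forall>q r. (q, r) \<in> G \<longrightarrow> (\<forall>s. q $ s \<ge> 0) \<and> norm r \<le> C * (\<Sum>s\<in>UNIV. q $ s)) \<and>
     (\<forall>q r c. (q, r) \<in> G \<longrightarrow> c \<ge> 0 \<longrightarrow> (c *\<^sub>R q, c *\<^sub>R r) \<in> G)"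

lemma admissibleD:
  assumes "admissible C G"
  shows "closed G" "(0, 0) \<in> G" "(q, r) \<in> G \<Longrightarrow> q $ s \<ge> 0" "(q, r) \<in> G \<Longrightarrow> norm r \<le> C * (\<Sum>s\<in>UNIV. q $ s)"
    "(q, r) \<in> G \<Longrightarrow> c \<ge> 0 \<Longrightarrow> (c *\<^sub>R q, c *\<^sub>R r) \<in> G"
  using assms unfolding admissible_def by blast+

text \<open>The pieces determine the kernel only on fibres of \<open>f\<close> that meet the support
  of \<open>q\<close>, and there its total is forced to be one. On the other fibres everything is
  sent to piece \<open>0\<close>. Zero pieces fill up the number to \<open>N\<close>.\<close>

lemma refineN_I:
  assumes I: "finite I" "card I \<le> N" "N > 0" and z: "(0, 0) \<in> G"
    and G: "\<And>i. i \<in> I \<Longrightarrow> (qs i, rs i) \<in> G"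
    and g0: "\<And>i s. i \<in> I \<Longrightarrow> g i s \<ge> 0"
    and gf: "\<And>i s s'. i \<in> I \<Longrightarrow> f s = f s' \<Longrightarrow> g i s = g i s'"
    and qs: "\<And>i s. i \<in> I \<Longrightarrow> qs i $ s = q $ s * g i s"
    and q: "q = (\<Sum>i\<in>I. qs i)"
  shows "(q, \<Sum>i\<in>I. rs i) \<in> refineN N f G"
proof -
  obtain h where h: "bij_betw h {..<card I} I"
    using ex_bij_betw_nat_finite[OF I(1)] by (auto simp: atLeast0LessThan)
  have hI: "h m \<in> I" if "m < card I" for m using h that by (auto simp: bij_betw_def)
  have reix: "(\<Sum>m<N. if m < card I then F (h m) else 0) = (\<Sum>i\<in>I. F i)" for F :: "_ \<Rightarrow> 'z::comm_monoid_add"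
  proof -
    have "(\<Sum>m<N. if m < card I then F (h m) else 0) = (\<Sum>m<card I. F (h m))"
      by (rule sum.mono_neutral_cong_right) (use I in auto)
    also have "\<dots> = (\<Sum>i\<in>I. F i)" by (rule sum.reindex_bij_betw[OF h])
    finally show ?thesis .
  qed
  define P where "P s \<longleftrightarrow> (\<exists>s'. f s' = f s \<and> q $ s' \<noteq> 0)" for s
  define g' where "g' m s = (if P s then (if m < card I then g (h m) s else 0) else if m = 0 then 1 else 0)" for m s
  define qs' where "qs' m = (if m < card I then qs (h m) else 0)" for m
  define rs' where "rs' m = (if m < card I then rs (h m) else 0)" for m
  have Pq: "q $ s = 0" if "\<not> P s" for s using that unfolding P_def by blast
  show ?thesis unfolding refineN_def splitting_def
  proof (intro CollectI case_prodI exI[of _ qs'] exI[of _ rs'] exI[of _ g'] conjI allI impI)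
    fix m assume m: "m < N"
    show "(qs' m, rs' m) \<in> G" using z G hI by (auto simp: qs'_def rs'_def)
    fix s
    show "g' m s \<ge> 0" using g0 hI by (auto simp: g'_def)
    show "qs' m $ s = q $ s * g' m s" using qs hI Pq by (auto simp: qs'_def g'_def)
    fix s' assume e: "f s = f s'"
    have PP: "P s = P s'" unfolding P_def e by (rule refl)
    have "g (h m) s = g (h m) s'" if "m < card I" by (rule gf[OF hI[OF that] e])
    thus "g' m s = g' m s'" unfolding g'_def PP by (cases "m < card I") auto
  next
    fix s
    show "(\<Sum>m<N. g' m s) = 1"
    proof (cases "P s")
      case True
      then obtain s' where s': "f s' = f s" "q $ s' \<noteq> 0" unfolding P_def by blast
      have "(\<Sum>m<N. g' m s) = (\<Sum>i\<in>I. g i s)" using True reix[of "\<lambda>i. g i s"] by (simp add: g'_def)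
      also have "\<dots> = (\<Sum>i\<in>I. g i s')" using gf[OF _ s'(1)] by (intro sum.cong) simp_all
      finally have 1: "(\<Sum>m<N. g' m s) = (\<Sum>i\<in>I. g i s')" .
      have "q $ s' = (\<Sum>i\<in>I. qs i $ s')" using arg_cong[OF q, of "\<lambda>v. v $ s'"] by simp
      also have "\<dots> = q $ s' * (\<Sum>i\<in>I. g i s')" using qs by (simp add: sum_distrib_left)
      finally show ?thesis using 1 s' by simp
    qed (use I in \<open>simp add: g'_def\<close>)
  next
    show "(\<Sum>i\<in>I. rs i) = (\<Sum>m<N. rs' m)" unfolding rs'_def by (rule reix[symmetric])
  qed
qed

lemma refineE:
  assumes "(q, r) \<in> refine f G"
  obtains N qs rs g where "\<forall>m<(N::nat). (qs m, rs m) \<in> G" "\<forall>m<N. \<forall>s. g m s \<ge> (0::real)"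
    "\<forall>m<N. \<forall>s s'. f s = f s' \<longrightarrow> g m s = g m s'" "\<forall>m<N. \<forall>s. qs m $ s = q $ s * g m s"
    "\<forall>s. (\<Sum>m<N. g m s) = 1" "r = (\<Sum>m<N. rs m)"
proof -
  obtain N qs rs g where A: "\<forall>m<(N::nat). (qs m, rs m) \<in> G \<and> (\<forall>s. g m s \<ge> (0::real)) \<and> (\<forall>s s'. f s = f s' \<longrightarrow> g m s = g m s') \<and>
        (\<forall>s. qs m $ s = q $ s * g m s)"
    and B: "\<forall>s. (\<Sum>m<N. g m s) = 1" and C: "r = (\<Sum>m<N. rs m)"
    using assms unfolding refine_def refineN_def splitting_def UN_iff mem_Collect_eq prod.case by (elim bexE exE conjE) (rule that)
  show ?thesis by (rule that[of N qs rs g]) (use A B C in blast)+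
qed

text \<open>The average of the vectors lies in their convex hull, so few of them suffice to
  represent it; multiplying by \<open>N\<close> returns to the sum.\<close>

lemma conic_caratheodory:
  fixes e :: "nat \<Rightarrow> 'e::euclidean_space"
  assumes N: "N > 0"
  obtains \<mu> :: "nat \<Rightarrow> real" where "\<And>m. \<mu> m \<ge> 0" "card {m. m < N \<and> \<mu> m \<noteq> 0} \<le> DIM('e) + 1"
    "(\<Sum>m<N. \<mu> m *\<^sub>R e m) = (\<Sum>m<N. e m)"
proof -
  have "(\<Sum>m<N. (1 / real N) *\<^sub>R e m) \<in> convex hull (e ` {..<N})"
    by (rule convex_sum) (use N in \<open>auto intro: hull_inc\<close>)
  then obtain S u where S: "finite S" "S \<subseteq> e ` {..<N}" "card S \<le> DIM('e) + 1" "\<And>x. x \<in> S \<Longrightarrow> 0 \<le> u x"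
    and sum: "(\<Sum>v\<in>S. u v *\<^sub>R v) = (\<Sum>m<N. (1 / real N) *\<^sub>R e m)"
    unfolding convex_hull_caratheodory[of "e ` {..<N}"] by blast
  \<comment> \<open>The theorem selects points, not indices: among indices carrying the same vector
    a single one receives the weight.\<close>
  define j where "j x = (SOME m. m < N \<and> e m = x)" for x
  have j: "j x < N \<and> e (j x) = x" if "x \<in> S" for x
  proof -
    have "\<exists>m. m < N \<and> e m = x" using S(2) that by auto
    thus ?thesis unfolding j_def by (rule someI_ex)
  qed
  have inj: "inj_on j S" by (rule inj_onI) (metis j)
  define \<mu> where "\<mu> m = (if m \<in> j ` S then real N * u (e m) else 0)" for m
  show ?thesis
  proof
    show "\<mu> m \<ge> 0" for m using S(4) j by (auto simp: \<mu>_def)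
    have "card {m. m < N \<and> \<mu> m \<noteq> 0} \<le> card (j ` S)"
      by (rule card_mono) (use S in \<open>auto simp: \<mu>_def split: if_splits\<close>)
    also have "\<dots> \<le> card S" using S(1) by (rule card_image_le)
    finally show "card {m. m < N \<and> \<mu> m \<noteq> 0} \<le> DIM('e) + 1" using S(3) by simp
    have "(\<Sum>m<N. \<mu> m *\<^sub>R e m) = (\<Sum>m\<in>j ` S. \<mu> m *\<^sub>R e m)"
      by (rule sum.mono_neutral_right) (use j in \<open>auto simp: \<mu>_def\<close>)
    also have "\<dots> = (\<Sum>x\<in>S. \<mu> (j x) *\<^sub>R e (j x))" using inj by (simp add: sum.reindex)
    also have "\<dots> = (\<Sum>x\<in>S. real N *\<^sub>R (u x *\<^sub>R x))" using j by (intro sum.cong) (auto simp: \<mu>_def)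
    also have "\<dots> = (\<Sum>m<N. e m)" using N
      by (simp only: scaleR_right.sum[symmetric] sum) (simp add: scaleR_right.sum)
    finally show "(\<Sum>m<N. \<mu> m *\<^sub>R e m) = (\<Sum>m<N. e m)" .
  qed
qed

lemma refineN_sum:
  assumes "\<forall>m<N. \<forall>s. qs m $ s = (q::real^'s::finite) $ s * g m s" "\<forall>s. (\<Sum>m<N. g m s) = 1"
  shows "(\<Sum>m<N. qs m) = q"
proof (rule vec_eq_iff[THEN iffD2], intro allI)
  fix s
  have "(\<Sum>m<N. qs m) $ s = (\<Sum>m<N. q $ s * g m s)" using assms by simp
  also have "\<dots> = q $ s" using assms by (simp add: sum_distrib_left[symmetric])
  finally show "(\<Sum>m<N. qs m) $ s = q $ s" .
qed

text \<open>Applied to the pairs (piece, payoff), so that both totals are kept. Rescaled pieces stay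
  in the cone \<open>G\<close>, and since the weights do not depend on the state, the rescaled
  kernels still factor through \<open>f\<close>.\<close>

lemma refine_bounded:
  fixes G :: "((real^'s::finite) \<times> 'r::euclidean_space) set"
  assumes adm: "admissible C G" and mem: "(q, r) \<in> refine f G"
  shows "(q, r) \<in> refineN (DIM((real^'s) \<times> 'r) + 1) f G"
proof -
  obtain N qs rs g where NN: "\<forall>m<(N::nat). (qs m, rs m) \<in> G" "\<forall>m<N. \<forall>s. g m s \<ge> (0::real)"
    "\<forall>m<N. \<forall>s s'. f s = f s' \<longrightarrow> g m s = g m s'" "\<forall>m<N. \<forall>s. qs m $ s = q $ s * g m s"
    and gg1: "\<forall>s. (\<Sum>m<N. g m s) = 1" and r: "r = (\<Sum>m<N. rs m)"
    using mem by (rule refineE) (rule that)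
  note N = NN[rule_format] and g1 = gg1[rule_format]
  have q: "(\<Sum>m<N. qs m) = q" by (rule refineN_sum) (use N(4) g1 in auto)
  have "N > 0" using g1[of undefined] by (cases N) auto
  then obtain \<mu> where \<mu>: "\<And>m. \<mu> m \<ge> 0" "card {m. m < N \<and> \<mu> m \<noteq> 0} \<le> DIM((real^'s) \<times> 'r) + 1"
    "(\<Sum>m<N. \<mu> m *\<^sub>R (qs m, rs m)) = (\<Sum>m<N. (qs m, rs m))"
    using conic_caratheodory[of N "\<lambda>m. (qs m, rs m)"] by blast
  let ?I = "{m. m < N \<and> \<mu> m \<noteq> 0}"
  have *: "(\<Sum>m\<in>?I. \<mu> m *\<^sub>R F m) = (\<Sum>m<N. \<mu> m *\<^sub>R F m)" for F :: "nat \<Rightarrow> 'z::real_vector"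
    by (rule sum.mono_neutral_left) auto
  have qr: "(\<Sum>m\<in>?I. \<mu> m *\<^sub>R qs m) = q" "(\<Sum>m\<in>?I. \<mu> m *\<^sub>R rs m) = r"
    using arg_cong[OF \<mu>(3), of fst] arg_cong[OF \<mu>(3), of snd] unfolding * by (simp_all add: fst_sum snd_sum q r)
  have "(q, \<Sum>m\<in>?I. \<mu> m *\<^sub>R rs m) \<in> refineN (DIM((real^'s) \<times> 'r) + 1) f G"
  proof (rule refineN_I[where qs = "\<lambda>m. \<mu> m *\<^sub>R qs m" and g = "\<lambda>m s. \<mu> m * g m s"])
    show "(0, 0) \<in> G" using adm by (simp add: admissible_def)
    show "(\<mu> i *\<^sub>R qs i, \<mu> i *\<^sub>R rs i) \<in> G" if "i \<in> ?I" for i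
      using admissibleD(5)[OF adm N(1) \<mu>(1)] that by simp
    show "\<mu> i * g i s = \<mu> i * g i s'" if "i \<in> ?I" "f s = f s'" for i s s' using N(3)[of i s s'] that by simp
    show "q = (\<Sum>m\<in>?I. \<mu> m *\<^sub>R qs m)" using qr by simp
  qed (use \<mu>(1,2) N(2,4) in auto)
  thus ?thesis by (simp only: qr)
qed

lemma common_convergent_subsequence:
  fixes e :: "nat \<Rightarrow> nat \<Rightarrow> 'e::heine_borel"
  assumes "\<And>m. m < N \<Longrightarrow> bounded (range (\<lambda>k. e k m))"
  shows "\<exists>\<phi> l. strict_mono \<phi> \<and> (\<forall>m<N. (\<lambda>k. e (\<phi> k) m) \<longlonglongrightarrow> l m)"
  using assms
proof (induction N)
  case 0
  show ?case by (intro exI[of _ id] exI) (auto simp: strict_mono_def)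
next
  case (Suc N)
  then obtain \<phi> l where p: "strict_mono \<phi>" "\<forall>m<N. (\<lambda>k. e (\<phi> k) m) \<longlonglongrightarrow> l m" by fastforce
  have "bounded (range (\<lambda>k. e (\<phi> k) N))"
    by (rule bounded_subset[OF Suc.prems[of N]]) auto
  from bounded_imp_convergent_subsequence[OF this] obtain l' \<psi> where
    s: "strict_mono (\<psi> :: nat \<Rightarrow> nat)" "((\<lambda>k. e (\<phi> k) N) \<circ> \<psi>) \<longlonglongrightarrow> l'" by blast
  show ?case
  proof (intro exI[of _ "\<phi> \<circ> \<psi>"] exI[of _ "l(N := l')"] conjI allI impI)
    show "strict_mono (\<phi> \<circ> \<psi>)" using p(1) s(1) by (rule strict_mono_o)
    fix m assume "m < Suc N"
    then consider "m < N" | "m = N" by linarith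
    thus "(\<lambda>k. e ((\<phi> \<circ> \<psi>) k) m) \<longlonglongrightarrow> (l(N := l')) m"
    proof cases
      case 1
      have "((\<lambda>k. e (\<phi> k) m) \<circ> \<psi>) \<longlonglongrightarrow> l m" using p(2) 1 s(1) by (intro LIMSEQ_subseq_LIMSEQ) auto
      thus ?thesis using 1 by (simp add: o_def)
    qed (use s in \<open>simp add: o_def\<close>)
  qed
qed

text \<open>With a fixed number of pieces, payoffs bounded by mass and kernels with values in the
  unit interval, the data of a sequence of splittings stay bounded. The kernels are made to converge
  along with the payoffs, because where the law vanishes in the limit the pieces alone no longer
  determine them.\<close>

lemma closed_refine:
  fixes G :: "((real^'s::finite) \<times> 'r::euclidean_space) set"
  assumes adm: "admissible C G"
  shows "closed (refine f G)"
proof (unfold closed_sequential_limits, intro allI impI, elim conjE)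
  fix X L assume X: "\<forall>n::nat. X n \<in> refine f G" and lim: "X \<longlonglongrightarrow> L"
  define N where "N = DIM((real^'s) \<times> 'r) + 1"
  have "\<forall>k. \<exists>qs rs g. splitting N f G (fst (X k)) (snd (X k)) qs rs g"
  proof
    fix k
    have "(fst (X k), snd (X k)) \<in> refineN N f G" unfolding N_def
      by (rule refine_bounded[OF adm]) (use X in simp)
    thus "\<exists>qs rs g. splitting N f G (fst (X k)) (snd (X k)) qs rs g"
      unfolding refineN_def by (simp add: case_prod_unfold)
  qed
  then obtain qs rs g where sp: "\<And>k. splitting N f G (fst (X k)) (snd (X k)) (qs k) (rs k) (g k)"
    by metis
  have G: "\<And>k m. m < N \<Longrightarrow> (qs k m, rs k m) \<in> G" and g0: "\<And>k m s. m < N \<Longrightarrow> g k m s \<ge> (0::real)"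
    and gf: "\<And>k m s s'. m < N \<Longrightarrow> f s = f s' \<Longrightarrow> g k m s = g k m s'"
    and qs: "\<And>k m s. m < N \<Longrightarrow> qs k m $ s = fst (X k) $ s * g k m s"
    and g1: "\<And>k s. (\<Sum>m<N. g k m s) = 1" and r: "\<And>k. snd (X k) = (\<Sum>m<N. rs k m)"
    using sp unfolding splitting_def by blast+
  have q: "(\<Sum>m<N. qs k m) = fst (X k)" for k
    by (rule refineN_sum) (use qs g1 in auto)
  have g_le: "g k m s \<le> 1" if "m < N" for k m s
    using member_le_sum[of m "{..<N}" "\<lambda>m. g k m s"] g0 g1 that by auto
  have Xb: "bounded (range X)" using lim convergent_imp_bounded by blast
  then obtain B where B: "\<And>k. norm (X k) \<le> B" unfolding bounded_iff by auto
  have qn: "qs k m $ s \<ge> 0" if "m < N" for k m s by (rule admissibleD(3)[OF adm G[OF that]])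
  have C: "norm (rs k m) \<le> \<bar>C\<bar> * (real CARD('s) * B)" if m: "m < N" for k m
  proof -
    have "norm (rs k m) \<le> C * (\<Sum>s\<in>UNIV. qs k m $ s)" by (rule admissibleD(4)[OF adm G[OF m]])
    also have "\<dots> \<le> \<bar>C\<bar> * (\<Sum>s\<in>UNIV. qs k m $ s)"
      by (intro mult_right_mono sum_nonneg) (use qn m in auto)
    also have "\<dots> \<le> \<bar>C\<bar> * (\<Sum>s\<in>(UNIV::'s set). B)"
    proof (intro mult_left_mono sum_mono)
      fix s
      have "qs k m $ s \<le> (\<Sum>m<N. qs k m $ s)" using member_le_sum[of m "{..<N}" "\<lambda>m. qs k m $ s"] qn m by auto
      also have "\<dots> = fst (X k) $ s" using arg_cong[OF q[of k], of "\<lambda>v. v $ s"] by simp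
      also have "\<dots> \<le> norm (fst (X k))" using component_le_norm_cart[of "fst (X k)" s] by simp
      also have "\<dots> \<le> norm (X k)" by (metis norm_fst_le prod.collapse)
      also have "\<dots> \<le> B" by (rule B)
      finally show "qs k m $ s \<le> B" .
    qed simp
    finally show ?thesis by simp
  qed
  have "bounded (range (\<lambda>k. (rs k m, \<chi> s. g k m s)))" if m: "m < N" for m
  proof -
    have "bounded (range (\<lambda>k. rs k m))" unfolding bounded_iff using C[OF m] by blast
    moreover have "bounded (range (\<lambda>k. \<chi> s. g k m s))"
      unfolding bounded_iff
    proof (intro exI[of _ "\<Sum>s\<in>(UNIV::'s set). 1"] ballI, clarify)
      fix k
      have "norm (\<chi> s. g k m s) \<le> (\<Sum>s\<in>UNIV. \<bar>(\<chi> s. g k m s) $ s\<bar>)" by (rule norm_le_l1_cart)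
      also have "\<dots> \<le> (\<Sum>s\<in>(UNIV::'s set). 1)" using g_le[OF m] g0[OF m] by (intro sum_mono) auto
      finally show "norm (\<chi> s. g k m s) \<le> (\<Sum>s\<in>(UNIV::'s set). 1)" .
    qed
    ultimately have "bounded (range (\<lambda>k. rs k m) \<times> range (\<lambda>k. \<chi> s. g k m s))" by (rule bounded_Times)
    thus ?thesis by (rule bounded_subset) auto
  qed
  from common_convergent_subsequence[of N "\<lambda>k m. (rs k m, \<chi> s. g k m s)", OF this]
  obtain \<phi> l where mono: "strict_mono \<phi>" and l: "\<forall>m<N. (\<lambda>k. (rs (\<phi> k) m, \<chi> s. g (\<phi> k) m s)) \<longlonglongrightarrow> l m" by blast
  define rs' where "rs' m = fst (l m)" for m
  define g' where "g' m s = snd (l m) $ s" for m s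
  have lim_r: "(\<lambda>k. rs (\<phi> k) m) \<longlonglongrightarrow> rs' m" if "m < N" for m
    using tendsto_fst[OF l[rule_format, OF that]] by (simp add: rs'_def)
  have lim_g: "(\<lambda>k. g (\<phi> k) m s) \<longlonglongrightarrow> g' m s" if "m < N" for m s
    using tendsto_vec_nth[OF tendsto_snd[OF l[rule_format, OF that]], of s] by (simp add: g'_def)
  have limX: "(\<lambda>k. X (\<phi> k)) \<longlonglongrightarrow> L" using LIMSEQ_subseq_LIMSEQ[OF lim mono] by (simp add: o_def)
  define qs' where "qs' m = (\<chi> s. fst L $ s * g' m s)" for m
  have lim_q: "(\<lambda>k. qs (\<phi> k) m) \<longlonglongrightarrow> qs' m" if m: "m < N" for m
  proof (rule vec_tendstoI)
    fix s
    have "(\<lambda>k. fst (X (\<phi> k)) $ s * g (\<phi> k) m s) \<longlonglongrightarrow> fst L $ s * g' m s"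
      by (intro tendsto_mult tendsto_vec_nth tendsto_fst limX lim_g m)
    thus "(\<lambda>k. qs (\<phi> k) m $ s) \<longlonglongrightarrow> qs' m $ s" using qs[OF m] by (simp add: qs'_def)
  qed
  have "(fst L, snd L) \<in> refineN N f G"
    unfolding refineN_def splitting_def
  proof (intro CollectI case_prodI exI[of _ qs'] exI[of _ rs'] exI[of _ g'] conjI allI impI)
    fix m assume m: "m < N"
    have "(\<lambda>k. (qs (\<phi> k) m, rs (\<phi> k) m)) \<longlonglongrightarrow> (qs' m, rs' m)"
      by (intro tendsto_Pair lim_q lim_r m)
    thus "(qs' m, rs' m) \<in> G"
      by (rule closed_sequentially[OF admissibleD(1)[OF adm] G[OF m]])
    fix s
    show "g' m s \<ge> 0" by (rule LIMSEQ_le_const[OF lim_g[OF m]]) (use g0 m in auto)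
    show "qs' m $ s = fst L $ s * g' m s" by (simp add: qs'_def)
    fix s' assume "f s = f s'"
    hence "(\<lambda>k. g (\<phi> k) m s) = (\<lambda>k. g (\<phi> k) m s')" by (intro ext gf[OF m])
    hence "(\<lambda>k. g (\<phi> k) m s) \<longlonglongrightarrow> g' m s'" using lim_g[OF m, of s'] by simp
    thus "g' m s = g' m s'" by (rule LIMSEQ_unique[OF lim_g[OF m]])
  next
    fix s
    have "(\<lambda>k. \<Sum>m<N. g (\<phi> k) m s) \<longlonglongrightarrow> (\<Sum>m<N. g' m s)"
      by (intro tendsto_sum lim_g) auto
    hence "(\<lambda>k::nat. 1) \<longlonglongrightarrow> (\<Sum>m<N. g' m s)" by (simp add: g1)
    thus "(\<Sum>m<N. g' m s) = 1" by (rule LIMSEQ_unique[OF _ tendsto_const])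
  next
    have "(\<lambda>k. \<Sum>m<N. rs (\<phi> k) m) \<longlonglongrightarrow> (\<Sum>m<N. rs' m)"
      by (intro tendsto_sum lim_r) auto
    moreover have "(\<lambda>k. \<Sum>m<N. rs (\<phi> k) m) \<longlonglongrightarrow> snd L"
      using tendsto_snd[OF limX] r by simp
    ultimately show "snd L = (\<Sum>m<N. rs' m)" by (rule LIMSEQ_unique[rotated])
  qed
  thus "L \<in> refine f G" unfolding refine_def by auto
qed

lemma admissible_refine:
  fixes G :: "((real^'s::finite) \<times> 'r::euclidean_space) set"
  assumes adm: "admissible C G"
  shows "admissible C (refine f G)"
proof -
  have z: "(0, 0) \<in> refine f G"
    using refineN_I[of "{}" 1 G "\<lambda>_. 0" "\<lambda>_. 0" "\<lambda>_ _. 0" f 0, OF _ _ _ admissibleD(2)[OF adm]] unfolding refine_def by auto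
  have "(\<forall>s. q $ s \<ge> 0) \<and> norm r \<le> C * (\<Sum>s\<in>UNIV. q $ s) \<and> (\<forall>c\<ge>0. (c *\<^sub>R q, c *\<^sub>R r) \<in> refine f G)"
    if mem: "(q, r) \<in> refine f G" for q r
  proof -
    obtain N qs rs g where NN: "\<forall>m<(N::nat). (qs m, rs m) \<in> G" "\<forall>m<N. \<forall>s. g m s \<ge> (0::real)"
      "\<forall>m<N. \<forall>s s'. f s = f s' \<longrightarrow> g m s = g m s'" "\<forall>m<N. \<forall>s. qs m $ s = q $ s * g m s"
      and gg1: "\<forall>s. (\<Sum>m<N. g m s) = 1" and r: "r = (\<Sum>m<N. rs m)"
      using mem by (rule refineE) (rule that)
  note N = NN[rule_format] and g1 = gg1[rule_format]
    have q: "q $ s = (\<Sum>m<N. qs m $ s)" for s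
      using arg_cong[OF refineN_sum[of N qs q g], of "\<lambda>v. v $ s"] N(4) g1 by simp
    have qn: "qs m $ s \<ge> 0" if "m < N" for m s by (rule admissibleD(3)[OF adm N(1)[OF that]])
    have "norm r \<le> (\<Sum>m<N. norm (rs m))" unfolding r by (rule norm_sum)
    also have "\<dots> \<le> (\<Sum>m<N. C * (\<Sum>s\<in>UNIV. qs m $ s))"
      by (intro sum_mono admissibleD(4)[OF adm] N(1)) simp
    also have "\<dots> = C * (\<Sum>s\<in>UNIV. q $ s)" unfolding q sum_distrib_left by (rule sum.swap)
    finally have nr: "norm r \<le> C * (\<Sum>s\<in>UNIV. q $ s)" .
    have "(c *\<^sub>R q, c *\<^sub>R r) \<in> refineN N f G" if "c \<ge> 0" for c
      unfolding refineN_def splitting_def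
    proof (intro CollectI case_prodI exI[of _ "\<lambda>m. c *\<^sub>R qs m"] exI[of _ "\<lambda>m. c *\<^sub>R rs m"] exI[of _ g] conjI allI impI)
      show "(c *\<^sub>R qs m, c *\<^sub>R rs m) \<in> G" if "m < N" for m
        by (rule admissibleD(5)[OF adm N(1)[OF that] \<open>c \<ge> 0\<close>])
      show "g m s = g m s'" if "m < N" "f s = f s'" for m s s' by (rule N(3)[OF that])
    qed (use N(2,4) g1 r in \<open>auto simp: scaleR_right.sum\<close>)
    hence sc: "\<forall>c\<ge>0. (c *\<^sub>R q, c *\<^sub>R r) \<in> refine f G" unfolding refine_def by blast
    have "q $ s \<ge> 0" for s unfolding q by (rule sum_nonneg) (use qn in auto)
    thus ?thesis using nr sc by blast
  qed
  thus ?thesis using z closed_refine[OF adm] unfolding admissible_def by blast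
qed

section \<open>Trees of splittings and their kernels\<close>

primrec tree :: "(nat \<Rightarrow> 's::finite \<Rightarrow> 'k) \<Rightarrow> ((real^'s) \<times> 'r::real_vector) set \<Rightarrow> nat \<Rightarrow> ((real^'s) \<times> 'r) set" where
  "tree f G 0 = G"
| "tree f G (Suc j) = refine (f 0) (tree (\<lambda>p. f (Suc p)) G j)"

lemma admissible_tree:
  fixes G :: "((real^'s::finite) \<times> 'r::euclidean_space) set"
  shows "admissible C G \<Longrightarrow> admissible C (tree f G j)"
  by (induction j arbitrary: f) (simp_all add: admissible_refine)

definition words :: "nat \<Rightarrow> nat \<Rightarrow> nat list set" where
  "words N j = {h. length h = j \<and> set h \<subseteq> {..<N}}"

lemma finite_words [simp]: "finite (words N j)"
  unfolding words_def using finite_lists_length_eq[of "{..<N}" j] by (simp add: conj_commute)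

lemma words_0 [simp]: "words N 0 = {[]}" by (auto simp: words_def)

lemma words_Suc: "words N (Suc j) = (\<Union>m<N. (#) m ` words N j)"
  by (auto simp: words_def length_Suc_conv)

lemma words_mono: "N \<le> N' \<Longrightarrow> words N j \<subseteq> words N' j"
  by (auto simp: words_def)

lemma sum_words_Suc:
  "(\<Sum>h\<in>words N (Suc j). F h) = (\<Sum>m<N. \<Sum>h\<in>words N j. F (m # h))"
proof -
  have "(\<Sum>h\<in>words N (Suc j). F h) = (\<Sum>m<N. \<Sum>h\<in>(#) m ` words N j. F h)"
    unfolding words_Suc by (rule sum.UNION_disjoint) auto
  also have "\<dots> = (\<Sum>m<N. \<Sum>h\<in>words N j. F (m # h))"
    by (intro sum.cong refl sum.reindex_cong[where l = "(#) _"]) (auto simp: inj_on_def)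
  finally show ?thesis .
qed

text \<open>Assembles a tree from laws attached to the message histories. Each edge needs some
  nonnegative factor of the right dependence only; \<open>refineN_I\<close> repairs the
  normalisation where there is no mass.\<close>

lemma treeI:
  fixes G :: "((real^'s::finite) \<times> 'r::euclidean_space) set"
  assumes adm: "admissible C G" and N: "N > 0"
  shows "(\<And>h. length h < J \<Longrightarrow> q h = (\<Sum>m<N. q (h @ [m]))) \<Longrightarrow>
    (\<And>h m. length h < J \<Longrightarrow> \<exists>g. (\<forall>s. g s \<ge> 0) \<and> (\<forall>s s'. f (length h) s = f (length h) s' \<longrightarrow> g s = g s') \<and>
      (\<forall>s. q (h @ [m]) $ s = q h $ s * g s)) \<Longrightarrow>
    (\<And>h. length h = J \<Longrightarrow> (q h, lf h) \<in> G) \<Longrightarrow>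
    (q [], \<Sum>h\<in>words N J. lf h) \<in> tree f G J"
proof (induction J arbitrary: q lf f)
  case 0
  thus ?case by simp
next
  case (Suc J)
  have sub: "(q [m], \<Sum>h\<in>words N J. lf (m # h)) \<in> tree (\<lambda>p. f (Suc p)) G J" for m
  proof (rule Suc.IH[of "\<lambda>h. q (m # h)"])
    show "q (m # h) = (\<Sum>k<N. q (m # h @ [k]))" if "length h < J" for h
      using Suc.prems(1)[of "m # h"] that by simp
    show "\<exists>g. (\<forall>s. g s \<ge> 0) \<and> (\<forall>s s'. f (Suc (length h)) s = f (Suc (length h)) s' \<longrightarrow> g s = g s') \<and>
      (\<forall>s. q (m # h @ [k]) $ s = q (m # h) $ s * g s)" if "length h < J" for h k
      using Suc.prems(2)[of "m # h" k] that by simp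
    show "(q (m # h), lf (m # h)) \<in> G" if "length h = J" for h
      using Suc.prems(3)[of "m # h"] that by simp
  qed
  have "\<forall>m. \<exists>g. (\<forall>s. g s \<ge> 0) \<and> (\<forall>s s'. f 0 s = f 0 s' \<longrightarrow> g s = g s') \<and> (\<forall>s. q [m] $ s = q [] $ s * g s)"
    using Suc.prems(2)[of "[]"] by simp
  then obtain g where g: "\<And>m s. g m s \<ge> 0" "\<And>m s s'. f 0 s = f 0 s' \<Longrightarrow> g m s = g m s'"
    "\<And>m s. q [m] $ s = q [] $ s * g m s" by metis
  have "(q [], \<Sum>m<N. \<Sum>h\<in>words N J. lf (m # h)) \<in> refineN N (f 0) (tree (\<lambda>p. f (Suc p)) G J)"
  proof (rule refineN_I[where qs = "\<lambda>m. q [m]" and g = g])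
    show "(0, 0) \<in> tree (\<lambda>p. f (Suc p)) G J"
      by (rule admissibleD(2)[OF admissible_tree[OF adm]])
    show "q [] = (\<Sum>m<N. q [m])" using Suc.prems(1)[of "[]"] by simp
    show "g m s = g m s'" if "f 0 s = f 0 s'" for m s s' by (rule g(2)[OF that])
  qed (use N g(1,3) sub in auto)
  thus ?case by (auto simp: sum_words_Suc refine_def)
qed

text \<open>The law of a message history of given length when the state is \<open>s\<close> and each
  message is drawn from the kernel of the history so far.\<close>

primrec run :: "(nat list \<Rightarrow> 's \<Rightarrow> nat pmf) \<Rightarrow> nat \<Rightarrow> 's \<Rightarrow> nat list pmf" where
  "run \<kappa> 0 s = return_pmf []"
| "run \<kappa> (Suc j) s = bind_pmf (\<kappa> [] s) (\<lambda>m. map_pmf ((#) m) (run (\<lambda>h. \<kappa> (m # h)) j s))"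

lemma pmf_bind_Cons:
  "pmf (bind_pmf p (\<lambda>k. map_pmf ((#) k) (Q k))) (m # h) = pmf p m * pmf (Q m) h"
proof -
  have "pmf (bind_pmf p (\<lambda>k. map_pmf ((#) k) (Q k))) (m # h) = expec p (\<lambda>k. pmf (map_pmf ((#) k) (Q k)) (m # h))"
    by (simp add: pmf_bind)
  also have "\<dots> = expec p (\<lambda>k. indicator {m} k * pmf (Q m) h)"
  proof (rule expec_cong)
    fix k
    show "pmf (map_pmf ((#) k) (Q k)) (m # h) = indicator {m} k * pmf (Q m) h"
    proof (cases "k = m")
      case True
      have "inj ((#) m)" by (auto simp: inj_def)
      from pmf_map_inj'[OF this] True show ?thesis by simp
    next
      case False
      thus ?thesis by (auto intro!: pmf_map_outside)
    qed
  qed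
  also have "\<dots> = pmf p m * pmf (Q m) h" by (simp add: measure_pmf_single)
  finally show ?thesis .
qed

lemma pmf_run_Cons: "pmf (run \<kappa> (Suc j) s) (m # h) = pmf (\<kappa> [] s) m * pmf (run (\<lambda>h. \<kappa> (m # h)) j s) h"
  by (simp only: run.simps(2) pmf_bind_Cons)

lemma set_run: "(\<And>h. set_pmf (\<kappa> h s) \<subseteq> {..<N}) \<Longrightarrow> set_pmf (run \<kappa> j s) \<subseteq> words N j"
proof (induction j arbitrary: \<kappa>)
  case (Suc j)
  have "set_pmf (run (\<lambda>h. \<kappa> (m # h)) j s) \<subseteq> words N j" for m by (rule Suc.IH) (rule Suc.prems)
  thus ?case using Suc.prems[of "[]"] by (fastforce simp: words_Suc)
qed simp

text \<open>The splittings along the tree are glued into one kernel on all histories. Subtrees may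
  use alphabets of different sizes; words beyond the alphabet of their subtree get mass and payoff
  zero, and this pair lies in \<open>G\<close>.\<close>

lemma treeE:
  fixes G :: "((real^'s::finite) \<times> 'r::euclidean_space) set"
  assumes adm: "admissible C G"
  shows "(q, r) \<in> tree f G J \<Longrightarrow> \<exists>N \<kappa> lf. N > 0 \<and> (\<forall>h s. set_pmf (\<kappa> h s) \<subseteq> {..<N}) \<and>
    (\<forall>h s s'. f (length h) s = f (length h) s' \<longrightarrow> \<kappa> h s = \<kappa> h s') \<and>
    (\<forall>h\<in>words N J. ((\<chi> s. q $ s * pmf (run \<kappa> J s) h), lf h) \<in> G) \<and> r = (\<Sum>h\<in>words N J. lf h)"
proof (induction J arbitrary: q r f)
  case 0
  have "(\<chi> s. q $ s * pmf (run (\<lambda>_ _. return_pmf 0) 0 s) []) = q" by (simp add: vec_eq_iff)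
  thus ?case using 0 by (intro exI[of _ 1] exI[of _ "\<lambda>_ _. return_pmf 0"] exI[of _ "\<lambda>_. r"]) auto
next
  case (Suc J)
  from Suc.prems have "(q, r) \<in> refine (f 0) (tree (\<lambda>p. f (Suc p)) G J)" by simp
  then obtain N qs rs g where NN: "\<forall>m<(N::nat). (qs m, rs m) \<in> tree (\<lambda>p. f (Suc p)) G J" "\<forall>m<N. \<forall>s. g m s \<ge> (0::real)"
      "\<forall>m<N. \<forall>s s'. f 0 s = f 0 s' \<longrightarrow> g m s = g m s'" "\<forall>m<N. \<forall>s. qs m $ s = q $ s * g m s"
      and gg1: "\<forall>s. (\<Sum>m<N. g m s) = 1" and r: "r = (\<Sum>m<N. rs m)"
    by (rule refineE) (rule that)
  note N = NN[rule_format] and g1 = gg1[rule_format]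
  have Npos: "N > 0" using g1[of undefined] by (cases N) auto
  define Q where "Q m M \<kappa> lf \<longleftrightarrow> M > 0 \<and> (\<forall>h s. set_pmf (\<kappa> h s) \<subseteq> {..<M}) \<and>
    (\<forall>h s s'. f (Suc (length h)) s = f (Suc (length h)) s' \<longrightarrow> \<kappa> h s = \<kappa> h s') \<and>
    (\<forall>h\<in>words M J. ((\<chi> s. qs m $ s * pmf (run \<kappa> J s) h), lf h) \<in> G) \<and> rs m = (\<Sum>h\<in>words M J. lf h)" for m M \<kappa> lf
  have "\<exists>M \<kappa> lf. Q m M \<kappa> lf" if "m < N" for m
    using Suc.IH[OF N(1)[OF that]] unfolding Q_def .
  then obtain M \<kappa> lf where Q: "\<And>m. m < N \<Longrightarrow> Q m (M m) (\<kappa> m) (lf m)" by metis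
  have M: "\<And>m h s. m < N \<Longrightarrow> set_pmf (\<kappa> m h s) \<subseteq> {..<M m}"
    "\<And>m h s s'. m < N \<Longrightarrow> f (Suc (length h)) s = f (Suc (length h)) s' \<Longrightarrow> \<kappa> m h s = \<kappa> m h s'"
    "\<And>m h. m < N \<Longrightarrow> h \<in> words (M m) J \<Longrightarrow> ((\<chi> s. qs m $ s * pmf (run (\<kappa> m) J s) h), lf m h) \<in> G"
    "\<And>m. m < N \<Longrightarrow> rs m = (\<Sum>h\<in>words (M m) J. lf m h)"
    using Q unfolding Q_def by blast+
  define K where "K = Max (insert N (M ` {..<N}))"
  have K: "N \<le> K" "\<And>m. m < N \<Longrightarrow> M m \<le> K" unfolding K_def by auto
  have "\<forall>s. \<exists>p. set_pmf p \<subseteq> {..<N} \<and> (\<forall>m<N. pmf p m = g m s)"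
  proof
    fix s
    show "\<exists>p. set_pmf p \<subseteq> {..<N} \<and> (\<forall>m<N. pmf p m = g m s)"
      using ex_pmf_of_weights[of "{..<N}" "\<lambda>m. g m s", OF _ N(2) g1] by auto
  qed
  then obtain p0 where p0: "\<And>s. set_pmf (p0 s) \<subseteq> {..<N}" "\<And>s m. m < N \<Longrightarrow> pmf (p0 s) m = g m s"
    by metis
  \<comment> \<open>Going through a representative of the class makes the law depend on
    \<open>f 0 s\<close> by construction.\<close>
  define p where "p c = p0 (SOME s. f 0 s = c)" for c
  have p: "set_pmf (p (f 0 s)) \<subseteq> {..<N}" "m < N \<Longrightarrow> pmf (p (f 0 s)) m = g m s" for s m
  proof -
    have "f 0 (SOME s'. f 0 s' = f 0 s) = f 0 s" by (rule someI[of "\<lambda>s'. f 0 s' = f 0 s"]) (rule refl)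
    thus "m < N \<Longrightarrow> pmf (p (f 0 s)) m = g m s" using p0(2) N(3) unfolding p_def by metis
  qed (simp add: p_def p0)
  define \<kappa>' where "\<kappa>' h s = (case h of [] \<Rightarrow> p (f 0 s) | m # h' \<Rightarrow> if m < N then \<kappa> m h' s else return_pmf 0)" for h s
  define lf' where "lf' h = (case h of [] \<Rightarrow> 0 | m # h' \<Rightarrow> if m < N \<and> h' \<in> words (M m) J then lf m h' else 0)" for h
  have run': "pmf (run \<kappa>' (Suc J) s) (m # h) = (if m < N then g m s * pmf (run (\<kappa> m) J s) h else 0)" for m h s
  proof -
    have "pmf (run \<kappa>' (Suc J) s) (m # h) = pmf (p (f 0 s)) m * pmf (run (\<lambda>h. \<kappa>' (m # h)) J s) h"
      by (subst pmf_run_Cons) (use p(1) in \<open>auto simp: \<kappa>'_def intro: finite_subset\<close>)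
    moreover have "m \<notin> set_pmf (p (f 0 s))" if "\<not> m < N" using p(1)[of s] that by auto
    moreover have "(\<lambda>h. \<kappa>' (m # h)) = \<kappa> m" if "m < N" using that by (simp add: \<kappa>'_def fun_eq_iff)
    ultimately show ?thesis using p(2) by (auto simp: pmf_eq_0_set_pmf)
  qed
  show ?case
  proof (intro exI[of _ K] exI[of _ \<kappa>'] exI[of _ lf'] conjI allI impI ballI)
    show "0 < K" using Npos K by simp
    show "set_pmf (\<kappa>' h s) \<subseteq> {..<K}" for h s
    proof (cases h)
      case Nil
      thus ?thesis using p(1)[of s] K(1) by (auto simp: \<kappa>'_def)
    next
      case (Cons m h')
      show ?thesis using M(1)[of m h' s] K(1) K(2)[of m] Npos unfolding Cons \<kappa>'_def by (cases "m < N") auto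
    qed
    show "\<kappa>' h s = \<kappa>' h s'" if "f (length h) s = f (length h) s'" for h s s'
    proof (cases h)
      case (Cons m h')
      show ?thesis using M(2)[of m h' s s'] that unfolding Cons \<kappa>'_def by simp
    qed (use that in \<open>simp add: \<kappa>'_def\<close>)
  next
    fix h assume h: "h \<in> words K (Suc J)"
    then obtain m h' where hm: "h = m # h'" "h' \<in> words K J" by (auto simp: words_Suc)
    show "((\<chi> s. q $ s * pmf (run \<kappa>' (Suc J) s) h), lf' h) \<in> G"
    proof (cases "m < N \<and> h' \<in> words (M m) J")
      case True
      hence "(\<chi> s. q $ s * pmf (run \<kappa>' (Suc J) s) h) = (\<chi> s. qs m $ s * pmf (run (\<kappa> m) J s) h')"
        using N(4) by (simp add: hm run' mult.assoc del: run.simps)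
      thus ?thesis using True M(3) by (simp add: lf'_def hm)
    next
      case False
      have "pmf (run (\<kappa> m) J s) h' = 0" if "m < N" for s
        using set_run[of "\<kappa> m" s "M m" J] M(1) False that by (force simp: pmf_eq_0_set_pmf)
      hence "(\<chi> s. q $ s * pmf (run \<kappa>' (Suc J) s) h) = 0"
        by (auto simp: vec_eq_iff hm run' simp del: run.simps)
      moreover have "lf' h = 0" using False by (auto simp: lf'_def hm)
      ultimately show ?thesis using adm by (simp add: admissible_def)
    qed
  next
    have "(\<Sum>h\<in>words K (Suc J). lf' h) = (\<Sum>m<K. \<Sum>h\<in>words K J. lf' (m # h))" by (rule sum_words_Suc)
    also have "\<dots> = (\<Sum>m<N. \<Sum>h\<in>words K J. lf' (m # h))"
      by (rule sum.mono_neutral_right) (use K in \<open>auto simp: lf'_def\<close>)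
    also have "\<dots> = (\<Sum>m<N. \<Sum>h\<in>words (M m) J. lf' (m # h))"
      by (intro sum.cong refl sum.mono_neutral_right)
        (use K words_mono in \<open>auto simp: lf'_def\<close>)
    also have "\<dots> = (\<Sum>m<N. \<Sum>h\<in>words (M m) J. lf m h)"
      by (intro sum.cong) (auto simp: lf'_def)
    also have "\<dots> = r" using M(4) by (simp add: r)
    finally show "r = (\<Sum>h\<in>words K (Suc J). lf' h)" ..
  qed
qed

section \<open>Expectations under repeated sampling and the weak law of large numbers\<close>

lemma expec_bind:
  assumes "finite (set_pmf P)" "\<And>x. x \<in> set_pmf P \<Longrightarrow> finite (set_pmf (Q x))"
  shows "expec (bind_pmf P Q) f = expec P (\<lambda>x. expec (Q x) f)"
proof -
  have "expec (bind_pmf P Q) f = (\<Sum>a\<in>set_pmf P. pmf P a *\<^sub>R expec (Q a) f)"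
    by (rule pmf_expectation_bind) (use assms in auto)
  also have "\<dots> = expec P (\<lambda>x. expec (Q x) f)"
    by (subst expec_sum[of "set_pmf P"]) (use assms in auto)
  finally show ?thesis .
qed

lemma prob_expec: "prob P A = expec P (indicator A)"
  by simp

lemma prob_bind:
  assumes "finite (set_pmf P)" "\<And>x. x \<in> set_pmf P \<Longrightarrow> finite (set_pmf (Q x))"
  shows "prob (bind_pmf P Q) A = expec P (\<lambda>x. prob (Q x) A)"
  unfolding prob_expec by (rule expec_bind) (use assms in auto)

lemma finite_replicate_pmf [simp]: "finite (set_pmf P) \<Longrightarrow> finite (set_pmf (replicate_pmf n P))"
  using finite_lists_length_eq[of "set_pmf P" n] by (simp add: set_replicate_pmf lists_eq_set conj_commute)

lemma expec_replicate_Suc: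
  assumes "finite (set_pmf P)"
  shows "expec (replicate_pmf (Suc n) P) f = expec P (\<lambda>x. expec (replicate_pmf n P) (\<lambda>xs. f (x # xs)))"
  using assms by (simp add: expec_bind)

lemma expec_sum_list:
  assumes "finite (set_pmf P)"
  shows "expec (replicate_pmf n P) (\<lambda>xs. \<Sum>x\<leftarrow>xs. g x) = real n * expec P g"
proof (induction n)
  case (Suc n)
  show ?case unfolding expec_replicate_Suc[OF assms]
    using assms Suc by (simp add: algebra_simps)
qed simp

text \<open>The cross terms vanish because the mean is zero.\<close>

lemma expec_sum_list_square:
  assumes fin: "finite (set_pmf P)" and z: "expec P g = 0"
  shows "expec (replicate_pmf n P) (\<lambda>xs. (\<Sum>x\<leftarrow>xs. g x)\<^sup>2) = real n * expec P (\<lambda>x. (g x)\<^sup>2)"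
proof (induction n)
  case (Suc n)
  have "expec (replicate_pmf n P) (\<lambda>xs. (\<Sum>x'\<leftarrow>x # xs. g x')\<^sup>2)
    = (g x)\<^sup>2 + real n * expec P (\<lambda>x. (g x)\<^sup>2)" for x
  proof -
    have "expec (replicate_pmf n P) (\<lambda>xs. (\<Sum>x'\<leftarrow>x # xs. g x')\<^sup>2)
      = expec (replicate_pmf n P) (\<lambda>xs. (g x)\<^sup>2 + 2 * g x * (\<Sum>x'\<leftarrow>xs. g x') + (\<Sum>x'\<leftarrow>xs. g x')\<^sup>2)"
      by (simp add: power2_sum algebra_simps)
    also have "\<dots> = (g x)\<^sup>2 + 2 * g x * expec (replicate_pmf n P) (\<lambda>xs. \<Sum>x'\<leftarrow>xs. g x')
      + expec (replicate_pmf n P) (\<lambda>xs. (\<Sum>x'\<leftarrow>xs. g x')\<^sup>2)"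
      using fin by simp
    finally show ?thesis using Suc by (simp add: expec_sum_list[OF fin] z)
  qed
  thus ?case unfolding expec_replicate_Suc[OF fin] using fin by (simp add: algebra_simps)
qed simp

text \<open>Chebyshev's inequality for the upper deviation. An upper bound \<open>\<mu>\<close> of
  the mean suffices, so rates and distortions that are not attained exactly can be inserted.\<close>

lemma weak_law:
  assumes fin: "finite (set_pmf P)" and \<mu>: "expec P g \<le> \<mu>" and \<epsilon>: "\<epsilon> > 0"
  shows "(\<lambda>n. prob (replicate_pmf n P) {xs. (\<Sum>x\<leftarrow>xs. g x) > real n * (\<mu> + \<epsilon>)}) \<longlonglongrightarrow> 0"
proof (rule tendsto_sandwich[OF _ _ tendsto_const])
  define V where "V = expec P (\<lambda>x. (g x - expec P g)\<^sup>2)"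
  have z: "expec P (\<lambda>x. g x - expec P g) = 0" using fin by simp
  have "prob (replicate_pmf n P) {xs. (\<Sum>x\<leftarrow>xs. g x) > real n * (\<mu> + \<epsilon>)} \<le> V / \<epsilon>\<^sup>2 * (1 / real n)" if n: "n > 0" for n
  proof -
    have "prob (replicate_pmf n P) {xs. (\<Sum>x\<leftarrow>xs. g x) > real n * (\<mu> + \<epsilon>)}
      \<le> expec (replicate_pmf n P) (\<lambda>xs. (\<Sum>x\<leftarrow>xs. g x - expec P g)\<^sup>2 / (real n * \<epsilon>)\<^sup>2)"
      unfolding prob_expec
    proof (rule expec_mono)
      fix xs assume "xs \<in> set_pmf (replicate_pmf n P)"
      hence len: "length xs = n" by (simp add: set_replicate_pmf)
      show "indicator {xs. (\<Sum>x\<leftarrow>xs. g x) > real n * (\<mu> + \<epsilon>)} xs \<le> (\<Sum>x\<leftarrow>xs. g x - expec P g)\<^sup>2 / (real n * \<epsilon>)\<^sup>2"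
      proof (cases "(\<Sum>x\<leftarrow>xs. g x) > real n * (\<mu> + \<epsilon>)")
        case True
        have "(\<Sum>x\<leftarrow>xs. g x - expec P g) = (\<Sum>x\<leftarrow>xs. g x) - real n * expec P g"
          using len by (simp add: sum_list_subtractf sum_list_triv)
        also have "\<dots> \<ge> real n * (\<mu> + \<epsilon>) - real n * \<mu>"
          using True \<mu> by (intro diff_mono mult_left_mono) auto
        finally have "(\<Sum>x\<leftarrow>xs. g x - expec P g) \<ge> real n * \<epsilon>" by (simp add: algebra_simps)
        hence "(\<Sum>x\<leftarrow>xs. g x - expec P g)\<^sup>2 \<ge> (real n * \<epsilon>)\<^sup>2" using \<epsilon> by (intro power_mono) auto
        thus ?thesis using n \<epsilon> True by (simp add: divide_le_eq le_divide_eq)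
      qed simp
    qed (use fin in simp)
    also have "\<dots> = expec (replicate_pmf n P) (\<lambda>xs. (\<Sum>x\<leftarrow>xs. g x - expec P g)\<^sup>2) / (real n * \<epsilon>)\<^sup>2" by simp
    also have "\<dots> = real n * V / (real n * \<epsilon>)\<^sup>2"
      unfolding V_def expec_sum_list_square[OF fin z] ..
    also have "\<dots> = V / \<epsilon>\<^sup>2 * (1 / real n)" using n by (simp add: power2_eq_square)
    finally show ?thesis .
  qed
  thus "\<forall>\<^sub>F n in sequentially. prob (replicate_pmf n P) {xs. (\<Sum>x\<leftarrow>xs. g x) > real n * (\<mu> + \<epsilon>)} \<le> V / \<epsilon>\<^sup>2 * (1 / real n)"
    by (intro eventually_sequentiallyI[of 1]) auto
  show "(\<lambda>n. V / \<epsilon>\<^sup>2 * (1 / real n)) \<longlonglongrightarrow> 0"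
    using tendsto_mult[OF tendsto_const[of "V / \<epsilon>\<^sup>2"] lim_1_over_n] by (simp only: mult_zero_right)
qed simp

section \<open>One-shot binning and letterwise kernels\<close>

definition bin_pmf :: "nat \<Rightarrow> 'v pmf \<Rightarrow> ('v \<times> nat) pmf" where
  "bin_pmf L p = pair_pmf p (pmf_of_set {1..L})"

text \<open>The decoder's belief moved to pairs with a fixed bin, so that encoder and decoder sample
  from laws on the same space and the race comparison applies.\<close>

definition tag_pmf :: "'v pmf \<Rightarrow> nat \<Rightarrow> ('v \<times> nat) pmf" where
  "tag_pmf q m = map_pmf (\<lambda>v. (v, m)) q"

lemma pmf_tag: "pmf (tag_pmf q m) (v, m) = pmf q v"
  unfolding tag_pmf_def by (rule pmf_map_inj') (auto simp: inj_def)

text \<open>One-shot Wyner-Ziv coding: the encoder selects (codeword, bin) from \<open>p \<times> uniform\<close> and sends the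
  bin, the decoder selects from its belief \<open>q\<close> restricted to that bin.\<close>

lemma ex_coding_round:
  fixes V :: "'v set"
  assumes V: "finite V" and L: "L > 0"
    and PP: "finite PP" "\<And>p. p \<in> PP \<Longrightarrow> set_pmf p \<subseteq> V" and QQ: "finite QQ" "\<And>q. q \<in> QQ \<Longrightarrow> set_pmf q \<subseteq> V"
  shows "\<exists>\<Phi> :: (('v \<times> nat) pmf \<Rightarrow> 'v \<times> nat) pmf. finite (set_pmf \<Phi>) \<and>
    (\<forall>p\<in>PP. map_pmf (\<lambda>\<sigma>. fst (\<sigma> (bin_pmf L p))) \<Phi> = p \<and> (\<forall>\<sigma>\<in>set_pmf \<Phi>. snd (\<sigma> (bin_pmf L p)) \<in> {1..L})) \<and>
    (\<forall>p\<in>PP. \<forall>q\<in>QQ. \<forall>T\<ge>0. (\<forall>v. pmf p v > 0 \<longrightarrow> pmf q v > 0) \<longrightarrow>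
      prob \<Phi> {\<sigma>. fst (\<sigma> (tag_pmf q (snd (\<sigma> (bin_pmf L p))))) \<noteq> fst (\<sigma> (bin_pmf L p))}
        \<le> prob p {v. pmf p v > T * pmf q v} + T / real L)"
proof -
  let ?A = "V \<times> {1..L}"
  let ?PP = "bin_pmf L ` PP \<union> (\<lambda>(q, m). tag_pmf q m) ` (QQ \<times> {1..L})"
  have ne: "{1..L} \<noteq> {}" using L by auto
  have "\<exists>\<Phi> :: (('v \<times> nat) pmf \<Rightarrow> 'v \<times> nat) pmf. finite (set_pmf \<Phi>) \<and> (\<forall>p\<in>?PP. map_pmf (\<lambda>\<sigma>. \<sigma> p) \<Phi> = p) \<and>
    (\<forall>p\<in>?PP. \<forall>q\<in>?PP. \<forall>a. pmf q a > 0 \<longrightarrow> prob \<Phi> {\<sigma>. \<sigma> p = a \<and> \<sigma> q \<noteq> a} \<le> pmf p a * (pmf p a / pmf q a))"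
  proof (rule ex_race_selection)
    show "finite ?A" using V by simp
    show "finite ?PP" using PP QQ by simp
    show "set_pmf p \<subseteq> ?A" if "p \<in> ?PP" for p
      using that PP(2) QQ(2) ne by (fastforce simp: bin_pmf_def tag_pmf_def)
  qed
  then obtain \<Phi> :: "(('v \<times> nat) pmf \<Rightarrow> 'v \<times> nat) pmf" where fin: "finite (set_pmf \<Phi>)"
    and law: "\<forall>p\<in>?PP. map_pmf (\<lambda>\<sigma>. \<sigma> p) \<Phi> = p"
    and err: "\<forall>p\<in>?PP. \<forall>q\<in>?PP. \<forall>a. pmf q a > 0 \<longrightarrow> prob \<Phi> {\<sigma>. \<sigma> p = a \<and> \<sigma> q \<noteq> a} \<le> pmf p a * (pmf p a / pmf q a)"
    by blast
  have law_bin: "map_pmf (\<lambda>\<sigma>. \<sigma> (bin_pmf L p)) \<Phi> = bin_pmf L p" if "p \<in> PP" for p using law that by blast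
  have inA: "\<sigma> (bin_pmf L p) \<in> ?A" if "p \<in> PP" "\<sigma> \<in> set_pmf \<Phi>" for p \<sigma>
  proof -
    have "\<sigma> (bin_pmf L p) \<in> set_pmf (map_pmf (\<lambda>\<sigma>. \<sigma> (bin_pmf L p)) \<Phi>)" using that by auto
    hence "\<sigma> (bin_pmf L p) \<in> set_pmf (bin_pmf L p)" unfolding law_bin[OF that(1)] .
    thus ?thesis using PP(2)[OF that(1)] ne by (auto simp: bin_pmf_def)
  qed
  have 1: "map_pmf (\<lambda>\<sigma>. fst (\<sigma> (bin_pmf L p))) \<Phi> = p" if "p \<in> PP" for p
  proof -
    have "map_pmf (\<lambda>\<sigma>. fst (\<sigma> (bin_pmf L p))) \<Phi> = map_pmf fst (map_pmf (\<lambda>\<sigma>. \<sigma> (bin_pmf L p)) \<Phi>)"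
      by (simp add: map_pmf_comp)
    also have "\<dots> = p" unfolding law_bin[OF that] by (simp add: bin_pmf_def map_fst_pair_pmf)
    finally show ?thesis .
  qed
  have 2: "prob \<Phi> {\<sigma>. fst (\<sigma> (tag_pmf q (snd (\<sigma> (bin_pmf L p))))) \<noteq> fst (\<sigma> (bin_pmf L p))}
        \<le> prob p {v. pmf p v > T * pmf q v} + T / real L"
    if p: "p \<in> PP" and q: "q \<in> QQ" and T: "T \<ge> 0" and pos: "\<forall>v. pmf p v > 0 \<longrightarrow> pmf q v > 0" for p q T
  proof -
    let ?bad = "{v. pmf p v > T * pmf q v}"
    let ?x = "\<lambda>(v, m). prob \<Phi> {\<sigma>. \<sigma> (bin_pmf L p) = (v, m) \<and> \<sigma> (tag_pmf q m) \<noteq> (v, m)}"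
    have "prob \<Phi> {\<sigma>. fst (\<sigma> (tag_pmf q (snd (\<sigma> (bin_pmf L p))))) \<noteq> fst (\<sigma> (bin_pmf L p))}
      \<le> prob \<Phi> (\<Union>a\<in>?A. {\<sigma>. \<sigma> (bin_pmf L p) = a \<and> \<sigma> (tag_pmf q (snd a)) \<noteq> a})"
      by (rule prob_mono_supp) (use inA[OF p] in fastforce)
    also have "\<dots> \<le> (\<Sum>a\<in>?A. prob \<Phi> {\<sigma>. \<sigma> (bin_pmf L p) = a \<and> \<sigma> (tag_pmf q (snd a)) \<noteq> a})"
      by (rule measure_pmf.finite_measure_subadditive_finite) (use V in auto)
    \<comment> \<open>A codeword whose likelihood ratio exceeds \<open>T\<close> is charged in full.
      For any other the race bound is (p / L) * (p / (q L)) \<le> (p / L) * (T / L), which sums to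
      \<open>T / L\<close> over bins and codewords.\<close>
    also have "\<dots> \<le> (\<Sum>a\<in>?A. pmf p (fst a) * indicator ?bad (fst a) / real L + pmf p (fst a) * (T / real L) / real L)"
    proof (rule sum_mono)
      fix a assume a: "a \<in> ?A"
      obtain v m where vm: "a = (v, m)" by (cases a)
      have pa: "pmf (bin_pmf L p) a = pmf p v / real L"
        using a ne by (simp add: bin_pmf_def vm pmf_pair)
      have le: "prob \<Phi> {\<sigma>. \<sigma> (bin_pmf L p) = a \<and> \<sigma> (tag_pmf q (snd a)) \<noteq> a} \<le> pmf p v / real L"
      proof -
        have "prob \<Phi> {\<sigma>. \<sigma> (bin_pmf L p) = a \<and> \<sigma> (tag_pmf q (snd a)) \<noteq> a} \<le> mass \<Phi> (\<lambda>\<sigma>. \<sigma> (bin_pmf L p)) a"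
          unfolding mass_eq by (rule prob_mono_supp) auto
        thus ?thesis unfolding law_bin[OF p] pa .
      qed
      have nn: "pmf p v * (T / real L) / real L \<ge> 0" using T by simp
      show "prob \<Phi> {\<sigma>. \<sigma> (bin_pmf L p) = a \<and> \<sigma> (tag_pmf q (snd a)) \<noteq> a}
        \<le> pmf p (fst a) * indicator ?bad (fst a) / real L + pmf p (fst a) * (T / real L) / real L"
      proof (cases "v \<in> ?bad")
        case True
        thus ?thesis using le nn by (simp add: vm)
      next
        case False
        show ?thesis
        proof (cases "pmf p v > 0")
          case True
          hence qv: "pmf q v > 0" using pos by blast
          have ta: "pmf (tag_pmf q (snd a)) a = pmf q v" by (simp add: vm pmf_tag)
          have "prob \<Phi> {\<sigma>. \<sigma> (bin_pmf L p) = a \<and> \<sigma> (tag_pmf q (snd a)) \<noteq> a} \<le>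
            pmf (bin_pmf L p) a * (pmf (bin_pmf L p) a / pmf (tag_pmf q (snd a)) a)"
          proof (rule err[rule_format])
            show "bin_pmf L p \<in> ?PP" using p by blast
            show "tag_pmf q (snd a) \<in> ?PP" using q a by force
          qed (use ta qv in simp)
          also have "\<dots> = pmf p v / real L * (pmf p v / pmf q v / real L)" unfolding pa ta by simp
          also have "\<dots> \<le> pmf p v / real L * (T / real L)"
            using False qv T by (intro mult_left_mono divide_right_mono) (auto simp: divide_le_eq)
          finally show ?thesis using False by (simp add: vm)
        next
          case False
          hence "pmf p v = 0" by (simp add: not_less)
          thus ?thesis using le by (simp add: vm)
        qed
      qed
    qed
    also have "\<dots> = (\<Sum>v\<in>V. \<Sum>m\<in>{1..L}. pmf p v * indicator ?bad v / real L + pmf p v * (T / real L) / real L)"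
      unfolding sum.cartesian_product case_prod_unfold ..
    also have "\<dots> = (\<Sum>v\<in>V. pmf p v * indicator ?bad v + pmf p v * (T / real L))"
      using L by (intro sum.cong refl) (simp add: distrib_left)
    also have "\<dots> = (\<Sum>v\<in>V. pmf p v * indicator ?bad v) + (\<Sum>v\<in>V. pmf p v) * (T / real L)"
      unfolding sum.distrib sum_distrib_right ..
    also have "(\<Sum>v\<in>V. pmf p v) = 1" by (rule sum_pmf_eq_1[OF V PP(2)[OF p]])
    also have "(\<Sum>v\<in>V. pmf p v * indicator ?bad v) = prob p ?bad"
      unfolding prob_expec by (rule expec_sum[OF V PP(2)[OF p], symmetric])
    finally show ?thesis by simp
  qed
  have 3: "snd (\<sigma> (bin_pmf L p)) \<in> {1..L}" if "p \<in> PP" "\<sigma> \<in> set_pmf \<Phi>" for p \<sigma>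
    using inA[OF that] by auto
  show ?thesis
    by (rule exI[of _ \<Phi>], intro conjI ballI allI impI fin 1 2 3) auto
qed

primrec seq_pmf :: "'a pmf list \<Rightarrow> 'a list pmf" where
  "seq_pmf [] = return_pmf []"
| "seq_pmf (p # ps) = bind_pmf p (\<lambda>x. map_pmf ((#) x) (seq_pmf ps))"

lemma set_seq_pmf: "set_pmf (seq_pmf ps) = {xs. list_all2 (\<lambda>x p. x \<in> set_pmf p) xs ps}"
  by (induction ps) (auto simp: list_all2_Cons2)

text \<open>Drawing pairs letter by letter is the same as drawing the whole block of first parts and
  then all second parts. This lets a memoryless kernel act as one message for a block.\<close>

lemma replicate_pmf_bind:
  "replicate_pmf n (bind_pmf P (\<lambda>a. map_pmf (e a) (\<kappa> a))) =
   bind_pmf (replicate_pmf n P) (\<lambda>as. map_pmf (\<lambda>ms. map2 e as ms) (seq_pmf (map \<kappa> as)))"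
proof (induction n)
  case (Suc n)
  let ?R = "replicate_pmf n P"
  have "replicate_pmf (Suc n) (bind_pmf P (\<lambda>a. map_pmf (e a) (\<kappa> a))) =
    bind_pmf P (\<lambda>a. bind_pmf (\<kappa> a) (\<lambda>m. bind_pmf ?R (\<lambda>as. map_pmf (\<lambda>ms. e a m # map2 e as ms) (seq_pmf (map \<kappa> as)))))"
    by (simp add: Suc bind_assoc_pmf bind_map_pmf map_bind_pmf map_pmf_comp flip: map_pmf_def)
  also have "\<dots> = bind_pmf P (\<lambda>a. bind_pmf ?R (\<lambda>as. bind_pmf (\<kappa> a) (\<lambda>m. map_pmf (\<lambda>ms. e a m # map2 e as ms) (seq_pmf (map \<kappa> as)))))"
    by (subst bind_commute_pmf) (rule refl)
  also have "\<dots> = bind_pmf (replicate_pmf (Suc n) P) (\<lambda>as. map_pmf (\<lambda>ms. map2 e as ms) (seq_pmf (map \<kappa> as)))"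
    by (simp add: bind_assoc_pmf bind_return_pmf map_bind_pmf map_pmf_comp)
  finally show ?case .
qed (simp add: bind_return_pmf)

section \<open>Random codes for interactive protocols\<close>

definition extend :: "('s \<times> nat list) list \<Rightarrow> nat list \<Rightarrow> ('s \<times> nat list) list" where
  "extend rws v = map2 (\<lambda>(s, h) m. (s, h @ [m])) rws v"

lemma map_replicate_pmf: "map_pmf (map f) (replicate_pmf n P) = replicate_pmf n (map_pmf f P)"
proof (induction n)
  case (Suc n)
  show ?case by (simp add: Suc[symmetric] map_bind_pmf bind_map_pmf map_pmf_comp flip: map_pmf_def)
qed simp

text \<open>In round \<open>j\<close> player \<open>spk j\<close> draws a message from \<open>\<kappa> j\<close>, given his part \<open>bl (spk j) s\<close> of the source and
  the previous messages. The players \<open>p \<in> Pl j\<close> have to recover it, and \<open>\<tau> j p\<close> is what they believe its law to be.\<close>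

locale protocol =
  fixes P0 :: "'s::finite pmf" and spk :: "nat \<Rightarrow> nat" and bl :: "nat \<Rightarrow> 's \<Rightarrow> 's"
    and \<kappa> :: "nat \<Rightarrow> 's \<Rightarrow> nat list \<Rightarrow> nat pmf" and \<tau> :: "nat \<Rightarrow> nat \<Rightarrow> 's \<Rightarrow> nat list \<Rightarrow> nat pmf"
    and B :: nat and Pl :: "nat \<Rightarrow> nat set"
  assumes \<kappa>_sub: "set_pmf (\<kappa> j s h) \<subseteq> {..<B}" and \<tau>_sub: "set_pmf (\<tau> j p s h) \<subseteq> {..<B}"
    and Pl: "finite (Pl j)"
begin

definition view :: "nat \<Rightarrow> ('s \<times> nat list) list \<Rightarrow> ('s \<times> nat list) list" where
  "view p rws = map (\<lambda>(s, h). (bl p s, h)) rws"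

definition spoken :: "nat \<Rightarrow> ('s \<times> nat list) list \<Rightarrow> nat list pmf" where
  "spoken j rws = seq_pmf (map (\<lambda>(s, h). \<kappa> j s h) rws)"

definition belief :: "nat \<Rightarrow> nat \<Rightarrow> ('s \<times> nat list) list \<Rightarrow> nat list pmf" where
  "belief j p rws = seq_pmf (map (\<lambda>(s, h). \<tau> j p s h) rws)"

primrec law :: "nat \<Rightarrow> ('s \<times> nat list) pmf" where
  "law 0 = map_pmf (\<lambda>s. (s, [])) P0"
| "law (Suc j) = bind_pmf (law j) (\<lambda>(s, h). map_pmf (\<lambda>m. (s, h @ [m])) (\<kappa> j (bl (spk j) s) h))"

text \<open>The log-likelihood ratio of the message just sent, between the speaker's kernel and the
  listener's belief. Its mean is the rate that binning has to exceed for this listener.\<close>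

definition lr :: "nat \<Rightarrow> nat \<Rightarrow> 's \<times> nat list \<Rightarrow> real" where
  "lr j p = (\<lambda>(s, h). log 2 (pmf (\<kappa> j (bl (spk j) s) (butlast h)) (last h) / pmf (\<tau> j p (bl p s) (butlast h)) (last h)))"

text \<open>Absolute continuity of the true law with respect to each listener's belief, as required
  by the race bound.\<close>

definition consistent :: "nat \<Rightarrow> bool" where
  "consistent j \<longleftrightarrow> (\<forall>p\<in>Pl j. \<forall>(s, h)\<in>set_pmf (law j). \<forall>m. pmf (\<kappa> j (bl (spk j) s) h) m > 0 \<longrightarrow> pmf (\<tau> j p (bl p s) h) m > 0)"

end

type_synonym selector = "(nat list \<times> nat) pmf \<Rightarrow> nat list \<times> nat"

context protocol
begin

text \<open>A selector is the shared randomness of one round: it samples simultaneously from all laws of pairs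
  (block of messages, bin). \<open>ideal\<close> is the message history when nobody ever errs.\<close>

definition encode :: "nat \<Rightarrow> selector \<Rightarrow> nat \<Rightarrow> ('s \<times> nat list) list \<Rightarrow> nat list \<times> nat" where
  "encode L \<sigma> j rws = \<sigma> (bin_pmf L (spoken j rws))"

definition decode :: "selector \<Rightarrow> nat \<Rightarrow> nat \<Rightarrow> ('s \<times> nat list) list \<Rightarrow> nat \<Rightarrow> nat list" where
  "decode \<sigma> j p rws m = fst (\<sigma> (tag_pmf (belief j p rws) m))"

primrec ideal :: "(nat \<Rightarrow> nat) \<Rightarrow> selector list \<Rightarrow> 's list \<Rightarrow> nat \<Rightarrow> ('s \<times> nat list) list" where
  "ideal L \<theta> ss 0 = map (\<lambda>s. (s, [])) ss"
| "ideal L \<theta> ss (Suc j) = extend (ideal L \<theta> ss j) (fst (encode (L j) (\<theta> ! j) j (view (spk j) (ideal L \<theta> ss j))))"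

definition message :: "(nat \<Rightarrow> nat) \<Rightarrow> selector list \<Rightarrow> 's list \<Rightarrow> nat \<Rightarrow> nat" where
  "message L \<theta> ss j = snd (encode (L j) (\<theta> ! j) j (view (spk j) (ideal L \<theta> ss j)))"

text \<open>Errors are counted along the ideal history. While none occurs, every player's
  reconstruction agrees with that history (\<open>est_ideal\<close>), so excluding these events
  excludes every error of the actual exchange.\<close>

definition miss :: "(nat \<Rightarrow> nat) \<Rightarrow> selector list \<Rightarrow> 's list \<Rightarrow> nat \<Rightarrow> nat \<Rightarrow> bool" where
  "miss L \<theta> ss j p \<longleftrightarrow> decode (\<theta> ! j) j p (view p (ideal L \<theta> ss j)) (message L \<theta> ss j)
     \<noteq> fst (encode (L j) (\<theta> ! j) j (view (spk j) (ideal L \<theta> ss j)))"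

text \<open>A finite range of block histories, so that the selector of a round has to handle only
  finitely many laws.\<close>

definition rowset :: "nat \<Rightarrow> nat \<Rightarrow> ('s \<times> nat list) list set" where
  "rowset n j = {rws. length rws = n \<and> set rws \<subseteq> UNIV \<times> words B j}"

lemma finite_rowset: "finite (rowset n j)"
proof -
  have "finite ((UNIV :: 's set) \<times> words B j)" by (rule finite_cartesian_product) auto
  from finite_lists_length_eq[OF this, of n] show ?thesis by (simp add: rowset_def conj_commute)
qed

lemma view_rowset: "rws \<in> rowset n j \<Longrightarrow> view p rws \<in> rowset n j"
  by (force simp: rowset_def view_def)

lemma extend_rowset:
  assumes "rws \<in> rowset n j" "v \<in> words B n"
  shows "extend rws v \<in> rowset n (Suc j)"
proof -
  have "(s, h) \<in> UNIV \<times> words B (Suc j)" if mem: "(s, h) \<in> set (extend rws v)" for s h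
  proof -
    obtain h' m where "((s, h'), m) \<in> set (zip rws v)" "h = h' @ [m]"
      using mem unfolding extend_def by auto
    hence "(s, h') \<in> set rws" "m \<in> set v" by (auto dest: set_zip_leftD set_zip_rightD)
    thus ?thesis using assms \<open>h = h' @ [m]\<close> by (fastforce simp: rowset_def words_def)
  qed
  hence "set (extend rws v) \<subseteq> UNIV \<times> words B (Suc j)" by (rule subrelI)
  moreover have "length (extend rws v) = n" using assms by (simp add: rowset_def words_def extend_def)
  ultimately show ?thesis by (simp add: rowset_def)
qed

lemma set_spoken: "rws \<in> rowset n j \<Longrightarrow> set_pmf (spoken j rws) \<subseteq> words B n"
  unfolding spoken_def set_seq_pmf
proof (clarify)
  fix xs assume "rws \<in> rowset n j" "list_all2 (\<lambda>x p. x \<in> set_pmf p) xs (map (\<lambda>(s, h). \<kappa> j s h) rws)"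
  thus "xs \<in> words B n" using \<kappa>_sub
    by (fastforce simp: words_def rowset_def list_all2_conv_all_nth in_set_conv_nth case_prod_unfold)
qed

lemma set_belief: "rws \<in> rowset n j \<Longrightarrow> set_pmf (belief j' p rws) \<subseteq> words B n"
  unfolding belief_def set_seq_pmf
proof (clarify)
  fix xs assume "rws \<in> rowset n j" "list_all2 (\<lambda>x q. x \<in> set_pmf q) xs (map (\<lambda>(s, h). \<tau> j' p s h) rws)"
  thus "xs \<in> words B n" using \<tau>_sub
    by (fastforce simp: words_def rowset_def list_all2_conv_all_nth in_set_conv_nth case_prod_unfold)
qed

lemma finite_law: "finite (set_pmf (law j))"
proof (induction j)
  case (Suc j)
  have "finite (set_pmf (\<kappa> i s h))" for i s h by (rule finite_subset[OF \<kappa>_sub]) simp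
  thus ?case using Suc by auto
qed simp

lemma law_words: "(s, h) \<in> set_pmf (law j) \<Longrightarrow> h \<in> words B j"
proof (induction j arbitrary: h)
  case (Suc j)
  thus ?case using \<kappa>_sub by (fastforce simp: words_def)
qed auto

lemma replicate_law_rowset: "rws \<in> set_pmf (replicate_pmf n (law j)) \<Longrightarrow> rws \<in> rowset n j"
  using law_words by (fastforce simp: set_replicate_pmf rowset_def lists_eq_set)

lemma replicate_law_Suc:
  "replicate_pmf n (law (Suc j)) =
   bind_pmf (replicate_pmf n (law j)) (\<lambda>rws. map_pmf (extend rws) (spoken j (view (spk j) rws)))"
proof -
  have *: "law (Suc j) = bind_pmf (law j) (\<lambda>a. map_pmf ((\<lambda>(s, h) m. (s, h @ [m])) a) ((\<lambda>(s, h). \<kappa> j (bl (spk j) s) h) a))"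
    by (simp add: case_prod_unfold)
  have "map (\<lambda>(s, h). \<kappa> j s h) (view (spk j) rws) = map (\<lambda>(s, h). \<kappa> j (bl (spk j) s) h) rws" for rws
    by (simp add: view_def case_prod_unfold)
  thus ?thesis unfolding * replicate_pmf_bind spoken_def extend_def by simp
qed

text \<open>Both block laws are products over the letters, so their ratio is two to the sum of the
  letterwise \<open>lr\<close>.\<close>

lemma spoken_belief:
  assumes c: "consistent j" and p: "p \<in> Pl j"
  shows "set rws \<subseteq> set_pmf (law j) \<Longrightarrow> pmf (spoken j (view (spk j) rws)) v > 0 \<Longrightarrow>
    pmf (belief j p (view p rws)) v > 0 \<and>
    pmf (spoken j (view (spk j) rws)) v = pmf (belief j p (view p rws)) v * 2 powr (\<Sum>r\<leftarrow>extend rws v. lr j p r)"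
proof (induction rws arbitrary: v)
  case Nil
  thus ?case by (cases v) (auto simp: spoken_def belief_def view_def extend_def)
next
  case (Cons r rws)
  obtain s h where r: "r = (s, h)" by (cases r)
  obtain m w where v: "v = m # w"
  proof (cases v)
    case Nil
    hence "v \<notin> set_pmf (spoken j (view (spk j) (r # rws)))" by (auto simp: spoken_def view_def r)
    thus ?thesis using Cons.prems(2) by (simp only: pmf_positive_iff)
  qed
  have sp: "pmf (spoken j (view (spk j) (r # rws))) v = pmf (\<kappa> j (bl (spk j) s) h) m * pmf (spoken j (view (spk j) rws)) w"
    unfolding spoken_def view_def v r by (simp add: pmf_bind_Cons)
  have be: "pmf (belief j p (view p (r # rws))) v = pmf (\<tau> j p (bl p s) h) m * pmf (belief j p (view p rws)) w"
    unfolding belief_def view_def v r by (simp add: pmf_bind_Cons)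
  have k: "pmf (\<kappa> j (bl (spk j) s) h) m > 0" and w: "pmf (spoken j (view (spk j) rws)) w > 0"
    using Cons.prems(2) unfolding sp by (auto simp: zero_less_mult_iff)
  have t: "pmf (\<tau> j p (bl p s) h) m > 0"
    using c p k Cons.prems(1) unfolding consistent_def r by fastforce
  have IH: "pmf (belief j p (view p rws)) w > 0"
    "pmf (spoken j (view (spk j) rws)) w = pmf (belief j p (view p rws)) w * 2 powr (\<Sum>r\<leftarrow>extend rws w. lr j p r)"
    using Cons.IH[OF _ w] Cons.prems(1) by auto
  have "2 powr (lr j p (s, h @ [m])) = pmf (\<kappa> j (bl (spk j) s) h) m / pmf (\<tau> j p (bl p s) h) m"
    using k t by (simp add: lr_def)
  hence "pmf (\<kappa> j (bl (spk j) s) h) m = pmf (\<tau> j p (bl p s) h) m * 2 powr (lr j p (s, h @ [m]))"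
    using t by simp
  thus ?case using IH t unfolding sp be by (simp add: extend_def v r powr_add)
qed

text \<open>The coding round for blocks, with \<open>T = 2 powr t\<close>. The overflow of the
  likelihood ratio is written as an event about the extended block, so that averaging over the
  previous block yields a statement about i.i.d. rows.\<close>

lemma ex_round_selector:
  assumes c: "consistent j" and L: "L > 0"
  shows "\<exists>\<Phi>::selector pmf. finite (set_pmf \<Phi>) \<and>
    (\<forall>rws\<in>rowset n j. map_pmf (\<lambda>\<sigma>. fst (encode L \<sigma> j rws)) \<Phi> = spoken j rws \<and>
       (\<forall>\<sigma>\<in>set_pmf \<Phi>. snd (encode L \<sigma> j rws) \<in> {1..L})) \<and>
    (\<forall>p\<in>Pl j. \<forall>rws\<in>set_pmf (replicate_pmf n (law j)). \<forall>t.
      prob \<Phi> {\<sigma>. decode \<sigma> j p (view p rws) (snd (encode L \<sigma> j (view (spk j) rws))) \<noteq> fst (encode L \<sigma> j (view (spk j) rws))}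
        \<le> prob (map_pmf (extend rws) (spoken j (view (spk j) rws))) {rws'. (\<Sum>r\<leftarrow>rws'. lr j p r) > t} + 2 powr t / real L)"
proof -
  let ?PP = "spoken j ` rowset n j" and ?QQ = "(\<lambda>(p, rws). belief j p rws) ` (Pl j \<times> rowset n j)"
  have "\<exists>\<Phi>::selector pmf. finite (set_pmf \<Phi>) \<and>
    (\<forall>p\<in>?PP. map_pmf (\<lambda>\<sigma>. fst (\<sigma> (bin_pmf L p))) \<Phi> = p \<and> (\<forall>\<sigma>\<in>set_pmf \<Phi>. snd (\<sigma> (bin_pmf L p)) \<in> {1..L})) \<and>
    (\<forall>p\<in>?PP. \<forall>q\<in>?QQ. \<forall>T\<ge>0. (\<forall>v. pmf p v > 0 \<longrightarrow> pmf q v > 0) \<longrightarrow>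
      prob \<Phi> {\<sigma>. fst (\<sigma> (tag_pmf q (snd (\<sigma> (bin_pmf L p))))) \<noteq> fst (\<sigma> (bin_pmf L p))}
        \<le> prob p {v. pmf p v > T * pmf q v} + T / real L)"
  proof (rule ex_coding_round[where V = "words B n"])
    show "set_pmf p \<subseteq> words B n" if "p \<in> ?PP" for p using that set_spoken by blast
    show "set_pmf q \<subseteq> words B n" if "q \<in> ?QQ" for q using that set_belief by fast
  qed (use L finite_rowset Pl in auto)
  then obtain \<Phi> :: "selector pmf" where fin: "finite (set_pmf \<Phi>)"
    and 1: "\<forall>p\<in>?PP. map_pmf (\<lambda>\<sigma>. fst (\<sigma> (bin_pmf L p))) \<Phi> = p \<and> (\<forall>\<sigma>\<in>set_pmf \<Phi>. snd (\<sigma> (bin_pmf L p)) \<in> {1..L})"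
    and 2: "\<forall>p\<in>?PP. \<forall>q\<in>?QQ. \<forall>T\<ge>0. (\<forall>v. pmf p v > 0 \<longrightarrow> pmf q v > 0) \<longrightarrow>
      prob \<Phi> {\<sigma>. fst (\<sigma> (tag_pmf q (snd (\<sigma> (bin_pmf L p))))) \<noteq> fst (\<sigma> (bin_pmf L p))}
        \<le> prob p {v. pmf p v > T * pmf q v} + T / real L" by blast
  have "prob \<Phi> {\<sigma>. decode \<sigma> j p (view p rws) (snd (encode L \<sigma> j (view (spk j) rws))) \<noteq> fst (encode L \<sigma> j (view (spk j) rws))}
        \<le> prob (map_pmf (extend rws) (spoken j (view (spk j) rws))) {rws'. (\<Sum>r\<leftarrow>rws'. lr j p r) > t} + 2 powr t / real L"
    if p: "p \<in> Pl j" and rws: "rws \<in> set_pmf (replicate_pmf n (law j))" for p rws t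
  proof -
    let ?p = "spoken j (view (spk j) rws)" and ?q = "belief j p (view p rws)"
    have rs: "rws \<in> rowset n j" using replicate_law_rowset[OF rws] .
    have sub: "set rws \<subseteq> set_pmf (law j)" using rws by (auto simp: set_replicate_pmf)
    have "prob \<Phi> {\<sigma>. fst (\<sigma> (tag_pmf ?q (snd (\<sigma> (bin_pmf L ?p))))) \<noteq> fst (\<sigma> (bin_pmf L ?p))}
        \<le> prob ?p {v. pmf ?p v > 2 powr t * pmf ?q v} + 2 powr t / real L"
    proof (rule 2[rule_format])
      show "?p \<in> ?PP" using view_rowset[OF rs] by blast
      show "?q \<in> ?QQ" using view_rowset[OF rs] p by force
    qed (use spoken_belief[OF c p sub] in auto)
    also have "prob ?p {v. pmf ?p v > 2 powr t * pmf ?q v} \<le> prob (map_pmf (extend rws) ?p) {rws'. (\<Sum>r\<leftarrow>rws'. lr j p r) > t}"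
      unfolding measure_map_pmf
    proof (rule prob_mono_supp)
      fix v assume v: "v \<in> set_pmf ?p" "v \<in> {v. pmf ?p v > 2 powr t * pmf ?q v}"
      have "pmf ?q v > 0" "pmf ?p v = pmf ?q v * 2 powr (\<Sum>r\<leftarrow>extend rws v. lr j p r)"
        using spoken_belief[OF c p sub, of v] pmf_positive[OF v(1)] by auto
      hence "2 powr (\<Sum>r\<leftarrow>extend rws v. lr j p r) > 2 powr t" using v(2) by (simp add: mult.commute)
      thus "v \<in> extend rws -` {rws'. (\<Sum>r\<leftarrow>rws'. lr j p r) > t}" by simp
    qed
    finally show ?thesis unfolding decode_def encode_def by simp
  qed
  thus ?thesis using fin 1 unfolding encode_def by blast
qed

lemma ideal_append: "j \<le> length \<theta> \<Longrightarrow> ideal L (\<theta> @ \<theta>') ss j = ideal L \<theta> ss j"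
  by (induction j) (simp_all add: nth_append)

lemma message_append: "j < length \<theta> \<Longrightarrow> message L (\<theta> @ \<theta>') ss j = message L \<theta> ss j"
  by (simp add: message_def ideal_append nth_append)

lemma miss_append: "j < length \<theta> \<Longrightarrow> miss L (\<theta> @ \<theta>') ss j p = miss L \<theta> ss j p"
  by (simp add: miss_def ideal_append message_append nth_append)

text \<open>The selector of a round is independent of the source and of earlier selectors, so given
  the ideal history the next ideal block has exactly the law \<open>spoken\<close>. Hence the ideal
  history is i.i.d. whatever the decoders do, and errors only enter through a union bound.\<close>

theorem ex_random_code:
  assumes L: "\<And>j. L j > 0" and c: "\<forall>j<J. consistent j"
  shows "\<exists>\<Theta> :: selector list pmf. finite (set_pmf \<Theta>) \<and> (\<forall>\<theta>\<in>set_pmf \<Theta>. length \<theta> = J \<and>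
      (\<forall>ss. length ss = n \<longrightarrow> ideal L \<theta> ss J \<in> rowset n J \<and> (\<forall>j<J. message L \<theta> ss j \<in> {1..L j}))) \<and>
    map_pmf (\<lambda>(\<theta>, ss). ideal L \<theta> ss J) (pair_pmf \<Theta> (replicate_pmf n P0)) = replicate_pmf n (law J) \<and>
    prob (pair_pmf \<Theta> (replicate_pmf n P0)) {(\<theta>, ss). \<exists>j<J. \<exists>p\<in>Pl j. miss L \<theta> ss j p}
      \<le> (\<Sum>j<J. \<Sum>p\<in>Pl j. prob (replicate_pmf n (law (Suc j))) {rws. (\<Sum>r\<leftarrow>rws. lr j p r) > t j p} + 2 powr (t j p) / real (L j))"
  using c
proof (induction J)
  case 0
  have "map_pmf (\<lambda>(\<theta>, ss). map (\<lambda>s. (s, []::nat list)) ss) (pair_pmf (return_pmf []) (replicate_pmf n P0))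
    = map_pmf (map (\<lambda>s. (s, []))) (replicate_pmf n P0)"
    by (simp add: pair_return_pmf1 map_pmf_comp)
  also have "\<dots> = replicate_pmf n (law 0)" by (simp add: map_replicate_pmf)
  finally have lw0: "map_pmf (\<lambda>(\<theta>, ss). ideal L \<theta> ss 0) (pair_pmf (return_pmf []) (replicate_pmf n P0)) = replicate_pmf n (law 0)"
    by (simp only: ideal.simps)
  show ?case
  proof (intro exI[of _ "return_pmf []"] conjI ballI allI impI lw0)
    show "ideal L \<theta> ss 0 \<in> rowset n 0" if "length ss = n" for \<theta> ss
      using that by (auto simp: rowset_def)
  qed simp_all
next
  case (Suc J)
  let ?R = "replicate_pmf n P0"
  let ?b = "\<lambda>j p. prob (replicate_pmf n (law (Suc j))) {rws. (\<Sum>r\<leftarrow>rws. lr j p r) > t j p} + 2 powr (t j p) / real (L j)"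
  have c': "\<forall>j<J. consistent j" "consistent J" using Suc.prems by simp_all
  obtain \<Theta> :: "selector list pmf" where fin: "finite (set_pmf \<Theta>)"
    and len: "\<forall>\<theta>\<in>set_pmf \<Theta>. length \<theta> = J \<and>
      (\<forall>ss. length ss = n \<longrightarrow> ideal L \<theta> ss J \<in> rowset n J \<and> (\<forall>j<J. message L \<theta> ss j \<in> {1..L j}))"
    and lw: "map_pmf (\<lambda>(\<theta>, ss). ideal L \<theta> ss J) (pair_pmf \<Theta> ?R) = replicate_pmf n (law J)"
    and er: "prob (pair_pmf \<Theta> ?R) {(\<theta>, ss). \<exists>j<J. \<exists>p\<in>Pl j. miss L \<theta> ss j p} \<le> (\<Sum>j<J. \<Sum>p\<in>Pl j. ?b j p)"
    using Suc.IH[OF c'(1)] by (elim exE conjE) (rule that)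
  obtain \<Phi> :: "selector pmf" where fin\<Phi>: "finite (set_pmf \<Phi>)"
    and \<Phi>1: "\<forall>rws\<in>rowset n J. map_pmf (\<lambda>\<sigma>. fst (encode (L J) \<sigma> J rws)) \<Phi> = spoken J rws \<and>
       (\<forall>\<sigma>\<in>set_pmf \<Phi>. snd (encode (L J) \<sigma> J rws) \<in> {1..L J})"
    and \<Phi>2: "\<forall>p\<in>Pl J. \<forall>rws\<in>set_pmf (replicate_pmf n (law J)). \<forall>t.
      prob \<Phi> {\<sigma>. decode \<sigma> J p (view p rws) (snd (encode (L J) \<sigma> J (view (spk J) rws))) \<noteq> fst (encode (L J) \<sigma> J (view (spk J) rws))}
        \<le> prob (map_pmf (extend rws) (spoken J (view (spk J) rws))) {rws'. (\<Sum>r\<leftarrow>rws'. lr J p r) > t} + 2 powr t / real (L J)"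
    using ex_round_selector[OF c'(2) L[of J], of n] by (elim exE conjE) (rule that)
  define \<Theta>' where "\<Theta>' = bind_pmf \<Theta> (\<lambda>\<theta>. map_pmf (\<lambda>\<sigma>. \<theta> @ [\<sigma>]) \<Phi>)"
  have fin': "finite (set_pmf \<Theta>')" using fin fin\<Phi> by (simp add: \<Theta>'_def)
  have finR: "finite (set_pmf ?R)" by simp
  \<comment> \<open>The fresh selector may be drawn last, after the source block and the old
    selectors, hence given the ideal history.\<close>
  have pair': "pair_pmf \<Theta>' ?R = bind_pmf (pair_pmf \<Theta> ?R) (\<lambda>(\<theta>, ss). map_pmf (\<lambda>\<sigma>. (\<theta> @ [\<sigma>], ss)) \<Phi>)"
    unfolding \<Theta>'_def pair_pmf_def map_pmf_def
    by (simp add: bind_assoc_pmf bind_return_pmf) (subst bind_commute_pmf, rule refl)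
  have len': "length \<theta>' = Suc J \<and>
      (\<forall>ss. length ss = n \<longrightarrow> ideal L \<theta>' ss (Suc J) \<in> rowset n (Suc J) \<and> (\<forall>j<Suc J. message L \<theta>' ss j \<in> {1..L j}))"
    if th: "\<theta>' \<in> set_pmf \<Theta>'" for \<theta>'
  proof -
    obtain \<theta> \<sigma> where \<theta>: "\<theta> \<in> set_pmf \<Theta>" "\<sigma> \<in> set_pmf \<Phi>" "\<theta>' = \<theta> @ [\<sigma>]" using th by (auto simp: \<Theta>'_def)
    have lJ: "length \<theta> = J" using len \<theta> by blast
    have "ideal L \<theta>' ss (Suc J) \<in> rowset n (Suc J) \<and> (\<forall>j<Suc J. message L \<theta>' ss j \<in> {1..L j})" if ss: "length ss = n" for ss
    proof -
      have rs: "ideal L \<theta> ss J \<in> rowset n J" using len \<theta> ss by blast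
      note vw = view_rowset[OF rs, of "spk J"]
      have "fst (encode (L J) \<sigma> J (view (spk J) (ideal L \<theta> ss J))) \<in> set_pmf (spoken J (view (spk J) (ideal L \<theta> ss J)))"
        using \<Phi>1[rule_format, OF vw, THEN conjunct1] \<theta>(2) by (metis (no_types, lifting) image_eqI set_map_pmf)
      hence "fst (encode (L J) \<sigma> J (view (spk J) (ideal L \<theta> ss J))) \<in> words B n" using set_spoken[OF vw] by blast
      hence "ideal L \<theta>' ss (Suc J) \<in> rowset n (Suc J)"
        using extend_rowset[OF rs] lJ by (simp add: \<theta>(3) ideal_append nth_append)
      moreover have "message L \<theta>' ss J \<in> {1..L J}"
        using \<Phi>1 vw \<theta>(2) lJ by (simp add: \<theta>(3) message_def ideal_append nth_append)
      moreover have "message L \<theta>' ss j \<in> {1..L j}" if "j < J" for j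
        using len \<theta>(1) ss that lJ by (simp add: \<theta>(3) message_append)
      ultimately show ?thesis by (auto simp: less_Suc_eq)
    qed
    thus ?thesis using lJ \<theta>(3) by simp
  qed
  have supp: "\<theta> \<in> set_pmf \<Theta> \<and> length ss = n \<and> ideal L \<theta> ss J \<in> rowset n J \<and> length \<theta> = J"
    if "(\<theta>, ss) \<in> set_pmf (pair_pmf \<Theta> ?R)" for \<theta> ss
    using that len by (auto simp: set_replicate_pmf)
  have lw': "map_pmf (\<lambda>(\<theta>, ss). ideal L \<theta> ss (Suc J)) (pair_pmf \<Theta>' ?R) = replicate_pmf n (law (Suc J))"
  proof -
    have "map_pmf (\<lambda>(\<theta>, ss). ideal L \<theta> ss (Suc J)) (pair_pmf \<Theta>' ?R) =
      bind_pmf (pair_pmf \<Theta> ?R) (\<lambda>(\<theta>, ss). map_pmf (\<lambda>\<sigma>. ideal L (\<theta> @ [\<sigma>]) ss (Suc J)) \<Phi>)"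
      unfolding pair' by (simp add: map_bind_pmf case_prod_unfold map_pmf_comp del: ideal.simps)
    also have "\<dots> = bind_pmf (pair_pmf \<Theta> ?R) (\<lambda>(\<theta>, ss). map_pmf (extend (ideal L \<theta> ss J)) (spoken J (view (spk J) (ideal L \<theta> ss J))))"
    proof (intro bind_pmf_cong refl, clarify)
      fix \<theta> ss assume "(\<theta>, ss) \<in> set_pmf (pair_pmf \<Theta> ?R)"
      from supp[OF this] have rs: "ideal L \<theta> ss J \<in> rowset n J" and l: "length \<theta> = J" by auto
      have "map_pmf (\<lambda>\<sigma>. ideal L (\<theta> @ [\<sigma>]) ss (Suc J)) \<Phi> =
        map_pmf (extend (ideal L \<theta> ss J)) (map_pmf (\<lambda>\<sigma>. fst (encode (L J) \<sigma> J (view (spk J) (ideal L \<theta> ss J)))) \<Phi>)"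
        using l by (simp add: map_pmf_comp ideal_append nth_append)
      thus "map_pmf (\<lambda>\<sigma>. ideal L (\<theta> @ [\<sigma>]) ss (Suc J)) \<Phi> =
         map_pmf (extend (ideal L \<theta> ss J)) (spoken J (view (spk J) (ideal L \<theta> ss J)))"
        using \<Phi>1 view_rowset[OF rs] by simp
    qed
    also have "\<dots> = bind_pmf (map_pmf (\<lambda>(\<theta>, ss). ideal L \<theta> ss J) (pair_pmf \<Theta> ?R)) (\<lambda>rws. map_pmf (extend rws) (spoken J (view (spk J) rws)))"
      by (simp add: bind_map_pmf case_prod_unfold)
    also have "\<dots> = replicate_pmf n (law (Suc J))" unfolding lw replicate_law_Suc ..
    finally show ?thesis .
  qed
  have old: "prob (pair_pmf \<Theta>' ?R) {(\<theta>, ss). \<exists>j<J. \<exists>p\<in>Pl j. miss L \<theta> ss j p} \<le> (\<Sum>j<J. \<Sum>p\<in>Pl j. ?b j p)"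
  proof -
    have "prob (pair_pmf \<Theta>' ?R) {(\<theta>, ss). \<exists>j<J. \<exists>p\<in>Pl j. miss L \<theta> ss j p} =
      expec (pair_pmf \<Theta> ?R) (\<lambda>(\<theta>, ss). prob (map_pmf (\<lambda>\<sigma>. (\<theta> @ [\<sigma>], ss)) \<Phi>) {(\<theta>, ss). \<exists>j<J. \<exists>p\<in>Pl j. miss L \<theta> ss j p})"
      unfolding pair' by (subst prob_bind) (use fin fin\<Phi> finR in \<open>auto simp: case_prod_unfold\<close>)
    also have "\<dots> = expec (pair_pmf \<Theta> ?R) (indicator {(\<theta>, ss). \<exists>j<J. \<exists>p\<in>Pl j. miss L \<theta> ss j p})"
    proof (rule expec_cong, clarify)
      fix \<theta> ss assume "(\<theta>, ss) \<in> set_pmf (pair_pmf \<Theta> ?R)"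
      from supp[OF this] have l: "length \<theta> = J" by auto
      show "prob (map_pmf (\<lambda>\<sigma>. (\<theta> @ [\<sigma>], ss)) \<Phi>) {(\<theta>, ss). \<exists>j<J. \<exists>p\<in>Pl j. miss L \<theta> ss j p} =
        indicator {(\<theta>, ss). \<exists>j<J. \<exists>p\<in>Pl j. miss L \<theta> ss j p} (\<theta>, ss)"
      proof -
        have "miss L (\<theta> @ [\<sigma>]) ss j p = miss L \<theta> ss j p" if "j < J" for \<sigma> j p using miss_append l that by simp
        hence "(\<lambda>\<sigma>. (\<theta> @ [\<sigma>], ss)) -` {(\<theta>, ss). \<exists>j<J. \<exists>p\<in>Pl j. miss L \<theta> ss j p} =
          (if \<exists>j<J. \<exists>p\<in>Pl j. miss L \<theta> ss j p then UNIV else {})" by (auto, blast+)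
        thus ?thesis by simp
      qed
    qed
    finally show ?thesis using er by simp
  qed
  \<comment> \<open>The failure probability is bounded given the ideal history, whose law is known
    by induction; averaging turns the conditional overflow into one for
    \<open>law (Suc J)\<close>.\<close>
  have new: "prob (pair_pmf \<Theta>' ?R) {(\<theta>, ss). miss L \<theta> ss J p} \<le> ?b J p" if p: "p \<in> Pl J" for p
  proof -
    let ?E = "{rws. (\<Sum>r\<leftarrow>rws. lr J p r) > t J p}" and ?k = "2 powr (t J p) / real (L J)"
    have "prob (pair_pmf \<Theta>' ?R) {(\<theta>, ss). miss L \<theta> ss J p} =
      expec (pair_pmf \<Theta> ?R) (\<lambda>(\<theta>, ss). prob (map_pmf (\<lambda>\<sigma>. (\<theta> @ [\<sigma>], ss)) \<Phi>) {(\<theta>, ss). miss L \<theta> ss J p})"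
      unfolding pair' by (subst prob_bind) (use fin fin\<Phi> finR in \<open>auto simp: case_prod_unfold\<close>)
    also have "\<dots> \<le> expec (pair_pmf \<Theta> ?R) (\<lambda>(\<theta>, ss). prob (map_pmf (extend (ideal L \<theta> ss J)) (spoken J (view (spk J) (ideal L \<theta> ss J)))) ?E + ?k)"
    proof (rule expec_mono, use fin finR in simp, clarify)
      fix \<theta> ss assume m: "(\<theta>, ss) \<in> set_pmf (pair_pmf \<Theta> ?R)"
      from supp[OF m] have l: "length \<theta> = J" by auto
      have "ideal L \<theta> ss J \<in> set_pmf (map_pmf (\<lambda>(\<theta>, ss). ideal L \<theta> ss J) (pair_pmf \<Theta> ?R))"
        using m by force
      hence rws: "ideal L \<theta> ss J \<in> set_pmf (replicate_pmf n (law J))" unfolding lw .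
      have "prob (map_pmf (\<lambda>\<sigma>. (\<theta> @ [\<sigma>], ss)) \<Phi>) {(\<theta>, ss). miss L \<theta> ss J p} =
        prob \<Phi> {\<sigma>. decode \<sigma> J p (view p (ideal L \<theta> ss J)) (snd (encode (L J) \<sigma> J (view (spk J) (ideal L \<theta> ss J))))
          \<noteq> fst (encode (L J) \<sigma> J (view (spk J) (ideal L \<theta> ss J)))}"
        using l by (simp add: vimage_def miss_def message_def ideal_append nth_append)
      also have "\<dots> \<le> prob (map_pmf (extend (ideal L \<theta> ss J)) (spoken J (view (spk J) (ideal L \<theta> ss J)))) ?E + ?k"
        by (rule \<Phi>2[rule_format, OF p rws])
      finally show "prob (map_pmf (\<lambda>\<sigma>. (\<theta> @ [\<sigma>], ss)) \<Phi>) {(\<theta>, ss). miss L \<theta> ss J p}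
        \<le> prob (map_pmf (extend (ideal L \<theta> ss J)) (spoken J (view (spk J) (ideal L \<theta> ss J)))) ?E + ?k" .
    qed
    also have "\<dots> = expec (map_pmf (\<lambda>(\<theta>, ss). ideal L \<theta> ss J) (pair_pmf \<Theta> ?R))
      (\<lambda>rws. prob (map_pmf (extend rws) (spoken J (view (spk J) rws))) ?E) + ?k"
      using fin finR by (simp add: case_prod_unfold)
    also have "expec (map_pmf (\<lambda>(\<theta>, ss). ideal L \<theta> ss J) (pair_pmf \<Theta> ?R))
      (\<lambda>rws. prob (map_pmf (extend rws) (spoken J (view (spk J) rws))) ?E) = prob (replicate_pmf n (law (Suc J))) ?E"
      unfolding lw replicate_law_Suc
    proof (subst prob_bind)
      show "finite (set_pmf (map_pmf (extend rws) (spoken J (view (spk J) rws))))"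
        if "rws \<in> set_pmf (replicate_pmf n (law J))" for rws
        using finite_subset[OF set_spoken[OF view_rowset[OF replicate_law_rowset[OF that]]]] by simp
    qed (use finite_law in simp_all)
    finally show ?thesis .
  qed
  have "prob (pair_pmf \<Theta>' ?R) {(\<theta>, ss). \<exists>j<Suc J. \<exists>p\<in>Pl j. miss L \<theta> ss j p} \<le>
    prob (pair_pmf \<Theta>' ?R) ({(\<theta>, ss). \<exists>j<J. \<exists>p\<in>Pl j. miss L \<theta> ss j p} \<union> (\<Union>p\<in>Pl J. {(\<theta>, ss). miss L \<theta> ss J p}))"
    by (rule measure_pmf.finite_measure_mono) (auto simp: less_Suc_eq)
  also have "\<dots> \<le> prob (pair_pmf \<Theta>' ?R) {(\<theta>, ss). \<exists>j<J. \<exists>p\<in>Pl j. miss L \<theta> ss j p} +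
    prob (pair_pmf \<Theta>' ?R) (\<Union>p\<in>Pl J. {(\<theta>, ss). miss L \<theta> ss J p})"
    by (rule measure_Un_le) auto
  also have "prob (pair_pmf \<Theta>' ?R) (\<Union>p\<in>Pl J. {(\<theta>, ss). miss L \<theta> ss J p}) \<le>
    (\<Sum>p\<in>Pl J. prob (pair_pmf \<Theta>' ?R) {(\<theta>, ss). miss L \<theta> ss J p})"
    by (rule measure_pmf.finite_measure_subadditive_finite) (use Pl in auto)
  also have "\<dots> \<le> (\<Sum>p\<in>Pl J. ?b J p)" by (rule sum_mono) (rule new)
  finally have "prob (pair_pmf \<Theta>' ?R) {(\<theta>, ss). \<exists>j<Suc J. \<exists>p\<in>Pl j. miss L \<theta> ss j p} \<le> (\<Sum>j<Suc J. \<Sum>p\<in>Pl j. ?b j p)"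
    using old by simp
  thus ?case using fin' len' lw' by blast
qed

end

section \<open>Histories as reconstructed by the players, and derandomisation\<close>

context protocol
begin

text \<open>A player has no memory beyond his block and the received bins, so he recomputes even his
  own earlier blocks with the shared selectors.\<close>

primrec est :: "(nat \<Rightarrow> nat) \<Rightarrow> selector list \<Rightarrow> nat \<Rightarrow> 's list \<Rightarrow> (nat \<Rightarrow> nat) \<Rightarrow> nat \<Rightarrow> ('s \<times> nat list) list" where
  "est L \<theta> p vs ms 0 = map (\<lambda>s. (s, [])) vs"
| "est L \<theta> p vs ms (Suc j) = extend (est L \<theta> p vs ms j)
     (if spk j = p then fst (encode (L j) (\<theta> ! j) j (est L \<theta> p vs ms j))
      else decode (\<theta> ! j) j p (est L \<theta> p vs ms j) (ms j))"

lemma view_extend: "view p (extend rws v) = extend (view p rws) v"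
proof (induction rws arbitrary: v)
  case (Cons r rws)
  thus ?case by (cases v) (auto simp: view_def extend_def split: prod.split)
qed (simp add: view_def extend_def)

lemma est_ideal:
  assumes "\<forall>i<j. spk i \<noteq> p \<longrightarrow> \<not> miss L \<theta> ss i p \<and> ms i = message L \<theta> ss i"
  shows "est L \<theta> p (map (bl p) ss) ms j = view p (ideal L \<theta> ss j)"
  using assms
proof (induction j)
  case 0
  show ?case by (simp add: view_def)
next
  case (Suc j)
  have IH: "est L \<theta> p (map (bl p) ss) ms j = view p (ideal L \<theta> ss j)"
    by (rule Suc.IH) (use Suc.prems in simp)
  show ?case
  proof (cases "spk j = p")
    case True
    thus ?thesis by (simp add: IH view_extend)
  next
    case False
    hence "\<not> miss L \<theta> ss j p" "ms j = message L \<theta> ss j" using Suc.prems by simp_all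
    thus ?thesis using False by (simp add: IH view_extend miss_def)
  qed
qed

lemma fst_extend: "map fst (extend rws v) = take (length v) (map fst rws)"
proof (induction rws arbitrary: v)
  case (Cons r rws)
  thus ?case by (cases v) (auto simp: extend_def split: prod.split)
qed (simp add: extend_def)

lemma fst_ideal:
  assumes "length ss = n" "ideal L \<theta> ss J \<in> rowset n J"
  shows "map fst (ideal L \<theta> ss J) = ss" "length (ideal L \<theta> ss J) = n"
proof -
  have "\<exists>l. map fst (ideal L \<theta> ss J) = take l ss" for J
  proof (induction J)
    case 0
    show ?case by (intro exI[of _ "length ss"]) (simp add: comp_def)
  next
    case (Suc J)
    then obtain l where "map fst (ideal L \<theta> ss J) = take l ss" by blast
    thus ?case by (auto simp: fst_extend)
  qed
  then obtain l where l: "map fst (ideal L \<theta> ss J) = take l ss" by blast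
  show len: "length (ideal L \<theta> ss J) = n" using assms(2) by (simp add: rowset_def)
  have "length (take l ss) = length ss" unfolding l[symmetric] using len assms(1) by simp
  hence "take l ss = ss" by simp
  thus "map fst (ideal L \<theta> ss J) = ss" using l by simp
qed

text \<open>The margin \<open>\<epsilon> / 2\<close> lies above the slack
  \<open>\<epsilon> / 4\<close> of the likelihood threshold, which makes failures rare, and below
  the permitted excess \<open>\<epsilon>\<close>, which leaves room for rounding up.\<close>

definition codebook :: "(nat \<Rightarrow> real) \<Rightarrow> real \<Rightarrow> nat \<Rightarrow> nat \<Rightarrow> nat" where
  "codebook I \<epsilon> n j = nat \<lceil>2 powr (real n * (I j + \<epsilon> / 2))\<rceil>"

lemma codebook_ge: "real (codebook I \<epsilon> n j) \<ge> 2 powr (real n * (I j + \<epsilon> / 2))"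
  unfolding codebook_def by (metis of_nat_ceiling)

lemma codebook_pos: "codebook I \<epsilon> n j > 0"
  using codebook_ge[where n = n and j = j and I = I and \<epsilon> = \<epsilon>]
  by (smt (verit) gr0I of_nat_0 powr_gt_zero)

lemma codebook_log:
  assumes "I j \<ge> 0" "\<epsilon> > 0" "real n * \<epsilon> \<ge> 2"
  shows "log 2 (real (codebook I \<epsilon> n j)) / real n \<le> I j + \<epsilon>"
proof -
  let ?y = "real n * (I j + \<epsilon> / 2)"
  have n: "real n > 0" using assms by (cases n) auto
  have "?y \<ge> 0" using assms by simp
  hence y1: "2 powr ?y \<ge> 1" by (simp add: ge_one_powr_ge_zero)
  have "real (codebook I \<epsilon> n j) \<le> 2 powr ?y + 1"
    unfolding codebook_def using y1 by linarith
  also have "\<dots> \<le> 2 powr (?y + 1)" using y1 by (simp add: powr_add)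
  finally have "log 2 (real (codebook I \<epsilon> n j)) \<le> log 2 (2 powr (?y + 1))"
    using codebook_pos[of I \<epsilon> n j] by (intro log_mono) auto
  also have "\<dots> = ?y + 1" by simp
  also have "\<dots> \<le> real n * (I j + \<epsilon>)" using assms by (simp add: algebra_simps)
  finally show ?thesis using n by (simp add: divide_le_eq mult.commute)
qed

text \<open>Decoding errors and the two distortion excesses form one bad event of small average
  probability, so a single list of selectors is good in all respects. Treating distortion as a tail
  event is what allows this union.\<close>

theorem ex_good_code:
  assumes c: "\<forall>j<J. consistent j"
    and I: "\<And>j p. j < J \<Longrightarrow> p \<in> Pl j \<Longrightarrow> expec (law (Suc j)) (lr j p) \<le> I j" and I0: "\<And>j. I j \<ge> 0"
    and g1: "expec (law J) g1 \<le> D1" and g2: "expec (law J) g2 \<le> D2"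
    and \<epsilon>: "\<epsilon> > 0" and \<delta>: "\<delta> > 0"
  shows "\<exists>N0. \<forall>n\<ge>N0. n > 0 \<and> (\<exists>L \<theta>. (\<forall>j. L j > 0) \<and> (\<forall>j. log 2 (real (L j)) / real n \<le> I j + \<epsilon>) \<and>
    (\<forall>ss. length ss = n \<longrightarrow> ideal L \<theta> ss J \<in> rowset n J \<and> (\<forall>j<J. message L \<theta> ss j \<in> {1..L j})) \<and>
    prob (replicate_pmf n P0) {ss. (\<exists>j<J. \<exists>p\<in>Pl j. miss L \<theta> ss j p) \<or>
       (\<Sum>r\<leftarrow>ideal L \<theta> ss J. g1 r) > real n * (D1 + \<epsilon>) \<or> (\<Sum>r\<leftarrow>ideal L \<theta> ss J. g2 r) > real n * (D2 + \<epsilon>)} \<le> \<delta>)"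
proof -
  \<comment> \<open>The threshold exponent n (I j + \<epsilon>/4) against the codebook exponent n (I
    j + \<epsilon>/2) leaves the geometric term.\<close>
  define b where "b n = (\<Sum>j<J. \<Sum>p\<in>Pl j. prob (replicate_pmf n (law (Suc j))) {rws. (\<Sum>r\<leftarrow>rws. lr j p r) > real n * (I j + \<epsilon> / 4)}
      + (2 powr (- \<epsilon> / 4)) ^ n)" for n
  define d where "d g D n = prob (replicate_pmf n (law J)) {rws. (\<Sum>r\<leftarrow>rws. g r) > real n * (D + \<epsilon>)}" for g D n
  have "b \<longlonglongrightarrow> (\<Sum>j<J. \<Sum>p\<in>Pl j. 0 + 0)"
    unfolding b_def
  proof (intro tendsto_sum tendsto_add)
    fix j p assume "j \<in> {..<J}" "p \<in> Pl j"
    thus "(\<lambda>n. prob (replicate_pmf n (law (Suc j))) {rws. (\<Sum>r\<leftarrow>rws. lr j p r) > real n * (I j + \<epsilon> / 4)}) \<longlonglongrightarrow> 0"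
      using I \<epsilon> by (intro weak_law finite_law) auto
    have "2 powr (- \<epsilon> / 4) < (1::real)" using \<epsilon> by (simp add: powr_less_one)
    thus "(\<lambda>n. (2 powr (- \<epsilon> / 4)) ^ n) \<longlonglongrightarrow> 0" by (intro LIMSEQ_realpow_zero) auto
  qed
  moreover have "d g1 D1 \<longlonglongrightarrow> 0" "d g2 D2 \<longlonglongrightarrow> 0"
    unfolding d_def using g1 g2 \<epsilon> by (auto intro!: weak_law finite_law)
  ultimately have "(\<lambda>n. b n + d g1 D1 n + d g2 D2 n) \<longlonglongrightarrow> 0 + 0 + 0"
    by (intro tendsto_add) simp_all
  hence "\<forall>\<^sub>F n in sequentially. b n + d g1 D1 n + d g2 D2 n < \<delta>"
    using \<delta> by (intro order_tendstoD(2)) auto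
  then obtain N1 where N1: "\<And>n. n \<ge> N1 \<Longrightarrow> b n + d g1 D1 n + d g2 D2 n < \<delta>"
    unfolding eventually_sequentially by blast
  define N0 where "N0 = max (max N1 1) (nat \<lceil>2 / \<epsilon>\<rceil>)"
  show ?thesis
  proof (intro exI[of _ N0] allI impI conjI)
    fix n assume n: "n \<ge> N0"
    show n0: "n > 0" using n by (simp add: N0_def)
    have "real n \<ge> 2 / \<epsilon>" using n unfolding N0_def by linarith
    hence n\<epsilon>: "real n * \<epsilon> \<ge> 2" using \<epsilon> by (simp add: divide_le_eq)
    let ?R = "replicate_pmf n P0"
    define L where "L = codebook I \<epsilon> n"
    have Lpos: "L j > 0" for j by (simp add: L_def codebook_pos)
    obtain \<Theta> :: "selector list pmf" where fin: "finite (set_pmf \<Theta>)"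
      and len: "\<forall>\<theta>\<in>set_pmf \<Theta>. length \<theta> = J \<and>
        (\<forall>ss. length ss = n \<longrightarrow> ideal L \<theta> ss J \<in> rowset n J \<and> (\<forall>j<J. message L \<theta> ss j \<in> {1..L j}))"
      and lw: "map_pmf (\<lambda>(\<theta>, ss). ideal L \<theta> ss J) (pair_pmf \<Theta> ?R) = replicate_pmf n (law J)"
      and er: "prob (pair_pmf \<Theta> ?R) {(\<theta>, ss). \<exists>j<J. \<exists>p\<in>Pl j. miss L \<theta> ss j p}
        \<le> (\<Sum>j<J. \<Sum>p\<in>Pl j. prob (replicate_pmf n (law (Suc j))) {rws. (\<Sum>r\<leftarrow>rws. lr j p r) > real n * (I j + \<epsilon> / 4)}
          + 2 powr (real n * (I j + \<epsilon> / 4)) / real (L j))"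
      using ex_random_code[where L = L and n = n and t = "\<lambda>j p. real n * (I j + \<epsilon> / 4)", OF Lpos c]
      by (elim exE conjE) (rule that)
    have "2 powr (real n * (I j + \<epsilon> / 4)) / real (L j) \<le> (2 powr (- \<epsilon> / 4)) ^ n" for j
    proof -
      have "2 powr (real n * (I j + \<epsilon> / 4)) / real (L j) \<le> 2 powr (real n * (I j + \<epsilon> / 4)) / 2 powr (real n * (I j + \<epsilon> / 2))"
        unfolding L_def using codebook_ge[where n = n and j = j and I = I and \<epsilon> = \<epsilon>] by (intro divide_left_mono) (auto simp: codebook_pos)
      also have "\<dots> = 2 powr (real n * (- \<epsilon> / 4))"
        by (simp add: powr_diff[symmetric] algebra_simps)
      also have "\<dots> = (2 powr (- \<epsilon> / 4)) ^ n" by (subst powr_realpow[symmetric], simp, subst powr_powr) (simp add: mult.commute)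
      finally show ?thesis .
    qed
    hence e1: "prob (pair_pmf \<Theta> ?R) {(\<theta>, ss). \<exists>j<J. \<exists>p\<in>Pl j. miss L \<theta> ss j p} \<le> b n"
      unfolding b_def by (intro order_trans[OF er] sum_mono add_mono) auto
    have e2: "prob (pair_pmf \<Theta> ?R) {(\<theta>, ss). (\<Sum>r\<leftarrow>ideal L \<theta> ss J. g r) > real n * (D + \<epsilon>)} = d g D n" for g D
      unfolding d_def lw[symmetric] by (simp add: vimage_def case_prod_unfold)
    define bad where "bad \<theta> = {ss. (\<exists>j<J. \<exists>p\<in>Pl j. miss L \<theta> ss j p) \<or>
       (\<Sum>r\<leftarrow>ideal L \<theta> ss J. g1 r) > real n * (D1 + \<epsilon>) \<or> (\<Sum>r\<leftarrow>ideal L \<theta> ss J. g2 r) > real n * (D2 + \<epsilon>)}" for \<theta>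
    have "prob (pair_pmf \<Theta> ?R) {(\<theta>, ss). ss \<in> bad \<theta>} \<le>
      prob (pair_pmf \<Theta> ?R) ({(\<theta>, ss). \<exists>j<J. \<exists>p\<in>Pl j. miss L \<theta> ss j p} \<union>
        {(\<theta>, ss). (\<Sum>r\<leftarrow>ideal L \<theta> ss J. g1 r) > real n * (D1 + \<epsilon>)} \<union> {(\<theta>, ss). (\<Sum>r\<leftarrow>ideal L \<theta> ss J. g2 r) > real n * (D2 + \<epsilon>)})"
      by (rule measure_pmf.finite_measure_mono) (auto simp: bad_def)
    also have "\<dots> \<le> (prob (pair_pmf \<Theta> ?R) {(\<theta>, ss). \<exists>j<J. \<exists>p\<in>Pl j. miss L \<theta> ss j p} +
        prob (pair_pmf \<Theta> ?R) {(\<theta>, ss). (\<Sum>r\<leftarrow>ideal L \<theta> ss J. g1 r) > real n * (D1 + \<epsilon>)}) +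
        prob (pair_pmf \<Theta> ?R) {(\<theta>, ss). (\<Sum>r\<leftarrow>ideal L \<theta> ss J. g2 r) > real n * (D2 + \<epsilon>)}"
      by (intro order_trans[OF measure_Un_le] add_mono measure_Un_le order_refl) auto
    also have "\<dots> \<le> b n + d g1 D1 n + d g2 D2 n" unfolding e2 using e1 by simp
    also have "\<dots> < \<delta>" by (rule N1) (use n in \<open>simp add: N0_def\<close>)
    finally have small: "prob (pair_pmf \<Theta> ?R) {(\<theta>, ss). ss \<in> bad \<theta>} < \<delta>" .
    have "prob (pair_pmf \<Theta> ?R) {(\<theta>, ss). ss \<in> bad \<theta>} = expec \<Theta> (\<lambda>\<theta>. prob ?R (bad \<theta>))"
    proof -
      have "pair_pmf \<Theta> ?R = bind_pmf \<Theta> (\<lambda>\<theta>. map_pmf (Pair \<theta>) ?R)" by (simp add: pair_pmf_def map_pmf_def)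
      thus ?thesis using fin by (simp add: prob_bind vimage_def)
    qed
    have "\<exists>\<theta>\<in>set_pmf \<Theta>. prob ?R (bad \<theta>) \<le> \<delta>"
    proof (rule ccontr)
      assume "\<not> ?thesis"
      hence "expec \<Theta> (\<lambda>_. \<delta>) \<le> expec \<Theta> (\<lambda>\<theta>. prob ?R (bad \<theta>))"
        by (intro expec_mono fin) auto
      thus False using small \<open>prob (pair_pmf \<Theta> ?R) {(\<theta>, ss). ss \<in> bad \<theta>} = _\<close> by simp
    qed
    then obtain \<theta> where \<theta>: "\<theta> \<in> set_pmf \<Theta>" "prob ?R (bad \<theta>) \<le> \<delta>" by blast
    show "\<exists>L \<theta>. (\<forall>j. L j > 0) \<and> (\<forall>j. log 2 (real (L j)) / real n \<le> I j + \<epsilon>) \<and>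
      (\<forall>ss. length ss = n \<longrightarrow> ideal L \<theta> ss J \<in> rowset n J \<and> (\<forall>j<J. message L \<theta> ss j \<in> {1..L j})) \<and>
      prob (replicate_pmf n P0) {ss. (\<exists>j<J. \<exists>p\<in>Pl j. miss L \<theta> ss j p) \<or>
       (\<Sum>r\<leftarrow>ideal L \<theta> ss J. g1 r) > real n * (D1 + \<epsilon>) \<or> (\<Sum>r\<leftarrow>ideal L \<theta> ss J. g2 r) > real n * (D2 + \<epsilon>)} \<le> \<delta>"
    proof (intro exI[of _ L] exI[of _ \<theta>] conjI)
      show "\<forall>j. L j > 0" by (simp add: L_def codebook_pos)
      show "\<forall>j. log 2 (real (L j)) / real n \<le> I j + \<epsilon>"
        unfolding L_def using codebook_log[of I, OF I0 \<epsilon> n\<epsilon>] by (intro allI)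
      show "\<forall>ss. length ss = n \<longrightarrow> ideal L \<theta> ss J \<in> rowset n J \<and> (\<forall>j<J. message L \<theta> ss j \<in> {1..L j})"
        using len \<theta>(1) by blast
    qed (use \<theta>(2) in \<open>simp add: bad_def\<close>)
  qed
qed

end

text \<open>Message \<open>0\<close> is sent by the helper (player \<open>0\<close>), message \<open>2 * k - 1\<close> by User Z (player \<open>1\<close>) and message
  \<open>2 * k\<close> by User X (player \<open>2\<close>). Letters a player does not see are replaced by \<open>undefined\<close>.\<close>

definition spk3 :: "nat \<Rightarrow> nat" where
  "spk3 j = (if j = 0 then 0 else if odd j then 1 else 2)"

definition bl3 :: "nat \<Rightarrow> 'x \<times> 'y \<times> 'z \<Rightarrow> 'x \<times> 'y \<times> 'z" where
  "bl3 p = (\<lambda>(x, y, z). if p = 0 then (undefined, y, undefined) else if p = 1 then (undefined, undefined, z) else (x, undefined, undefined))"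

definition Pl3 :: "nat \<Rightarrow> nat set" where
  "Pl3 j = {1, 2} - {spk3 j}"

definition vs_of :: "nat \<Rightarrow> nat list \<Rightarrow> nat list" where
  "vs_of K h = map (\<lambda>k. h ! (2 * k + 1)) [0..<K]"

definition ws_of :: "nat \<Rightarrow> nat list \<Rightarrow> nat list" where
  "ws_of K h = map (\<lambda>k. h ! (2 * k + 2)) [0..<K]"

section \<open>The protocol turned into a code with a helper\<close>

locale source_protocol = protocol "source pxy pzx" spk3 bl3 \<kappa> \<tau> B Pl3
  for pxy :: "('x::finite \<times> 'y::finite) pmf" and pzx :: "'x \<Rightarrow> 'z::finite pmf" and \<kappa> \<tau> B
begin

text \<open>Sorts what User Z has received by round: \<open>0\<close> is the helper's message and
  round \<open>2 * k + 2\<close> is entry \<open>k\<close> of User X's list. Odd rounds are his own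
  and are recomputed by \<open>est\<close>.\<close>

definition msZ :: "nat \<Rightarrow> nat list \<Rightarrow> nat \<Rightarrow> nat" where
  "msZ ty txs i = (if i = 0 then ty else txs ! (i div 2 - 1))"

definition msX :: "nat \<Rightarrow> nat list \<Rightarrow> nat \<Rightarrow> nat" where
  "msX ty tzs i = (if i = 0 then ty else tzs ! ((i - 1) div 2))"

text \<open>\<open>is_code\<close> demands the message ranges for all arguments, also for those that
  no source block produces; clamping enforces this and leaves messages in range alone.\<close>

definition clamp :: "nat \<Rightarrow> nat \<Rightarrow> nat" where
  "clamp M m = (if m \<in> {1..M} then m else 1)"

definition estZ where
  "estZ L \<theta> zs ty txs j = est L \<theta> 1 (map (\<lambda>z. (undefined, undefined, z)) zs) (msZ ty txs) j"

definition estX where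
  "estX L \<theta> xs ty tzs j = est L \<theta> 2 (map (\<lambda>x. (x, undefined, undefined)) xs) (msX ty tzs) j"

definition fyC :: "(nat \<Rightarrow> nat) \<Rightarrow> selector list \<Rightarrow> 'y list \<Rightarrow> nat" where
  "fyC L \<theta> ys = clamp (L 0) (snd (encode (L 0) (\<theta> ! 0) 0 (map (\<lambda>y. ((undefined, y, undefined), [])) ys)))"

definition fzC :: "(nat \<Rightarrow> nat) \<Rightarrow> selector list \<Rightarrow> nat \<Rightarrow> 'z list \<Rightarrow> nat \<Rightarrow> nat list \<Rightarrow> nat" where
  "fzC L \<theta> k zs ty txs = (let j = 2 * k - 1 in clamp (L j) (snd (encode (L j) (\<theta> ! j) j (estZ L \<theta> zs ty txs j))))"

definition fxC :: "(nat \<Rightarrow> nat) \<Rightarrow> selector list \<Rightarrow> nat \<Rightarrow> 'x list \<Rightarrow> nat \<Rightarrow> nat list \<Rightarrow> nat" where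
  "fxC L \<theta> k xs ty tzs = (let j = 2 * k in clamp (L j) (snd (encode (L j) (\<theta> ! j) j (estX L \<theta> xs ty tzs j))))"

lemma bl3_simps: "bl3 0 = (\<lambda>s. (undefined, fst (snd s), undefined))" "bl3 1 = (\<lambda>s. (undefined, undefined, snd (snd s)))"
  "bl3 (Suc 0) = (\<lambda>s. (undefined, undefined, snd (snd s)))" "bl3 2 = (\<lambda>s. (fst s, undefined, undefined))"
  by (auto simp: bl3_def fun_eq_iff)

context
  fixes L :: "nat \<Rightarrow> nat" and \<theta> :: "selector list" and ss :: "('x \<times> 'y \<times> 'z) list" and K :: nat
  assumes good: "\<And>j p. j < 2 * K + 1 \<Longrightarrow> p \<in> Pl3 j \<Longrightarrow> \<not> miss L \<theta> ss j p"
    and range: "\<And>j. j < 2 * K + 1 \<Longrightarrow> message L \<theta> ss j \<in> {1..L j}"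
begin

lemma ty_message: "fyC L \<theta> (map (fst \<circ> snd) ss) = message L \<theta> ss 0"
proof -
  have "map (\<lambda>y. ((undefined, y, undefined), [])) (map (fst \<circ> snd) ss) = view (spk3 0) (ideal L \<theta> ss 0)"
    by (simp add: spk3_def view_def bl3_simps)
  thus ?thesis using range[of 0] unfolding fyC_def message_def clamp_def by (simp del: ideal.simps)
qed

lemma estZ_ideal:
  assumes j: "j \<le> 2 * K + 1" and m: "\<And>k. 2 * k + 2 < j \<Longrightarrow> txs ! k = message L \<theta> ss (2 * k + 2)"
  shows "estZ L \<theta> (map (snd \<circ> snd) ss) (message L \<theta> ss 0) txs j = view 1 (ideal L \<theta> ss j)"
proof -
  have "map (\<lambda>z. (undefined, undefined, z)) (map (snd \<circ> snd) ss) = map (bl3 1) ss" by (simp add: bl3_simps)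
  moreover have "est L \<theta> 1 (map (bl3 1) ss) (msZ (message L \<theta> ss 0) txs) j = view 1 (ideal L \<theta> ss j)"
  proof (rule est_ideal, intro allI impI conjI)
    fix i assume i: "i < j" "spk3 i \<noteq> 1"
    show "\<not> miss L \<theta> ss i 1" using good[of i 1] i j by (simp add: Pl3_def)
    show "msZ (message L \<theta> ss 0) txs i = message L \<theta> ss i"
    proof (cases "i = 0")
      case False
      hence "even i" using i by (auto simp: spk3_def split: if_splits)
      then obtain k where "i = 2 * k" by blast
      then obtain k' where k': "i = 2 * k' + 2" using False by (cases k) auto
      thus ?thesis using m[of k'] i by (simp add: msZ_def)
    qed (simp add: msZ_def)
  qed
  ultimately show ?thesis unfolding estZ_def by (simp only:)
qed

lemma estX_ideal:
  assumes j: "j \<le> 2 * K + 1" and m: "\<And>k. 2 * k + 1 < j \<Longrightarrow> tzs ! k = message L \<theta> ss (2 * k + 1)"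
  shows "estX L \<theta> (map fst ss) (message L \<theta> ss 0) tzs j = view 2 (ideal L \<theta> ss j)"
proof -
  have "map (\<lambda>x. (x, undefined, undefined)) (map fst ss) = map (bl3 2) ss" by (simp add: bl3_simps)
  moreover have "est L \<theta> 2 (map (bl3 2) ss) (msX (message L \<theta> ss 0) tzs) j = view 2 (ideal L \<theta> ss j)"
  proof (rule est_ideal, intro allI impI conjI)
    fix i assume i: "i < j" "spk3 i \<noteq> 2"
    show "\<not> miss L \<theta> ss i 2" using good[of i 2] i j by (simp add: Pl3_def)
    show "msX (message L \<theta> ss 0) tzs i = message L \<theta> ss i"
    proof (cases "i = 0")
      case False
      hence "odd i" using i by (auto simp: spk3_def split: if_splits)
      then obtain k' where k': "i = 2 * k' + 1" by (rule oddE)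
      thus ?thesis using m[of k'] i by (simp add: msX_def)
    qed (simp add: msX_def)
  qed
  ultimately show ?thesis unfolding estX_def by (simp only:)
qed

text \<open>Induction over the rounds: without earlier misses both reconstructions are views of the
  ideal history, so the next message actually sent is the ideal one.\<close>

lemma msgs_message:
  "k \<le> K \<Longrightarrow> msgs (fzC L \<theta>) (fxC L \<theta>) (map fst ss) (map (snd \<circ> snd) ss) (message L \<theta> ss 0) k =
    (map (\<lambda>i. message L \<theta> ss (2 * i + 1)) [0..<k], map (\<lambda>i. message L \<theta> ss (2 * i + 2)) [0..<k])"
proof (induction k)
  case (Suc k)
  let ?tz = "map (\<lambda>i. message L \<theta> ss (2 * i + 1)) [0..<k]" and ?tx = "map (\<lambda>i. message L \<theta> ss (2 * i + 2)) [0..<k]"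
  have 1: "fzC L \<theta> (Suc k) (map (snd \<circ> snd) ss) (message L \<theta> ss 0) ?tx = message L \<theta> ss (2 * k + 1)"
  proof -
    have "estZ L \<theta> (map (snd \<circ> snd) ss) (message L \<theta> ss 0) ?tx (2 * k + 1) = view 1 (ideal L \<theta> ss (2 * k + 1))"
      by (rule estZ_ideal) (use Suc.prems in auto)
    hence "snd (encode (L (2 * k + 1)) (\<theta> ! (2 * k + 1)) (2 * k + 1) (estZ L \<theta> (map (snd \<circ> snd) ss) (message L \<theta> ss 0) ?tx (2 * k + 1)))
      = message L \<theta> ss (2 * k + 1)" by (simp only: message_def) (simp add: spk3_def)
    thus ?thesis unfolding fzC_def Let_def using range[of "2 * k + 1"] Suc.prems by (simp add: clamp_def)
  qed
  have 2: "fxC L \<theta> (Suc k) (map fst ss) (message L \<theta> ss 0) (?tz @ [message L \<theta> ss (2 * k + 1)]) = message L \<theta> ss (2 * k + 2)"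
  proof -
    have "?tz @ [message L \<theta> ss (2 * k + 1)] = map (\<lambda>i. message L \<theta> ss (2 * i + 1)) [0..<Suc k]" by simp
    hence "estX L \<theta> (map fst ss) (message L \<theta> ss 0) (?tz @ [message L \<theta> ss (2 * k + 1)]) (2 * k + 2) = view 2 (ideal L \<theta> ss (2 * k + 2))"
      by (intro estX_ideal) (use Suc.prems in \<open>auto simp del: upt_Suc\<close>)
    hence "snd (encode (L (2 * k + 2)) (\<theta> ! (2 * k + 2)) (2 * k + 2) (estX L \<theta> (map fst ss) (message L \<theta> ss 0) (?tz @ [message L \<theta> ss (2 * k + 1)]) (2 * k + 2)))
      = message L \<theta> ss (2 * k + 2)" by (simp only: message_def) (simp add: spk3_def)
    thus ?thesis unfolding fxC_def Let_def using range[of "2 * k + 2"] Suc.prems by (simp add: clamp_def)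
  qed
  have IH: "msgs (fzC L \<theta>) (fxC L \<theta>) (map fst ss) (map (snd \<circ> snd) ss) (message L \<theta> ss 0) k = (?tz, ?tx)"
    by (rule Suc.IH) (use Suc.prems in simp)
  show ?case unfolding msgs.simps(2) IH Let_def prod.case 1 2 by simp
qed simp

end

definition gzC where
  "gzC L \<theta> K xhat zs ty txs i = (case estZ L \<theta> zs ty txs (2 * K + 1) ! i of (s, h) \<Rightarrow> xhat (h ! 0) (ws_of K h) (zs ! i))"

definition gxC where
  "gxC L \<theta> K zhat xs ty tzs i = (case estX L \<theta> xs ty tzs (2 * K + 1) ! i of (s, h) \<Rightarrow> zhat (h ! 0) (vs_of K h) (xs ! i))"

lemma expec_le_good:
  assumes fin: "finite (set_pmf P)" and bad: "prob P bad \<le> \<delta>" and M: "M \<ge> 0" and D: "D \<ge> 0"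
    and good: "\<And>\<omega>. \<omega> \<in> set_pmf P \<Longrightarrow> \<omega> \<notin> bad \<Longrightarrow> f \<omega> \<le> D" and all: "\<And>\<omega>. \<omega> \<in> set_pmf P \<Longrightarrow> f \<omega> \<le> M"
  shows "expec P f \<le> D + M * \<delta>"
proof -
  have "expec P f \<le> expec P (\<lambda>\<omega>. D + M * indicator bad \<omega>)"
  proof (rule expec_mono[OF fin])
    fix \<omega> assume w: "\<omega> \<in> set_pmf P"
    show "f \<omega> \<le> D + M * indicator bad \<omega>"
      using good[OF w] all[OF w] D by (cases "\<omega> \<in> bad") auto
  qed
  also have "\<dots> = D + M * prob P bad" using fin by simp
  also have "\<dots> \<le> D + M * \<delta>" using bad M by (intro add_left_mono mult_left_mono)
  finally show ?thesis .
qed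

lemma sum_list_nth: "length xs = n \<Longrightarrow> (\<Sum>r\<leftarrow>xs. g r) = (\<Sum>i<n. g (xs ! i))"
  by (auto simp: sum_list_sum_nth atLeast0LessThan)

text \<open>Off the bad event both users end with their view of the ideal history, so the actual
  distortions are those of its rows; on the bad event they are bounded by \<open>M\<close>.\<close>

lemma is_code_protocol:
  fixes dx :: "'x \<Rightarrow> 'xh \<Rightarrow> real" and dz :: "'z \<Rightarrow> 'zh \<Rightarrow> real"
  assumes n: "n > 0" and L: "\<And>j. L j > 0"
    and range: "\<forall>ss. length ss = n \<longrightarrow> ideal L \<theta> ss (2 * K + 1) \<in> rowset n (2 * K + 1) \<and> (\<forall>j<2 * K + 1. message L \<theta> ss j \<in> {1..L j})"
    and g1: "g1 = (\<lambda>((x, y, z), h). dx x (xhat (h ! 0) (ws_of K h) z))"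
    and g2: "g2 = (\<lambda>((x, y, z), h). dz z (zhat (h ! 0) (vs_of K h) x))"
    and prob: "prob (replicate_pmf n (source pxy pzx)) {ss. (\<exists>j<2 * K + 1. \<exists>p\<in>Pl3 j. miss L \<theta> ss j p) \<or>
       (\<Sum>r\<leftarrow>ideal L \<theta> ss (2 * K + 1). g1 r) > real n * D1 \<or> (\<Sum>r\<leftarrow>ideal L \<theta> ss (2 * K + 1). g2 r) > real n * D2} \<le> \<delta>"
    and M: "M \<ge> 0" "\<And>x xh. dx x xh \<le> M" "\<And>z zh. dz z zh \<le> M" and D: "D1 \<ge> 0" "D2 \<ge> 0"
    and Dx: "D1 + M * \<delta> \<le> Dx" and Dz: "D2 + M * \<delta> \<le> Dz"
  shows "is_code pxy pzx dx dz K n (L 0) (\<lambda>k. L (2 * k)) (\<lambda>k. L (2 * k - 1)) Dx Dz"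
proof -
  let ?R = "replicate_pmf n (source pxy pzx)"
  let ?J = "2 * K + 1"
  let ?bad = "{ss. (\<exists>j<?J. \<exists>p\<in>Pl3 j. miss L \<theta> ss j p) \<or>
       (\<Sum>r\<leftarrow>ideal L \<theta> ss ?J. g1 r) > real n * D1 \<or> (\<Sum>r\<leftarrow>ideal L \<theta> ss ?J. g2 r) > real n * D2}"
  have finR: "finite (set_pmf ?R)" by simp
  have len: "length ss = n" if "ss \<in> set_pmf ?R" for ss using that by (simp add: set_replicate_pmf)
  have avg: "(\<Sum>i<n. c i) / real n \<le> M" if "\<And>i. c i \<le> M" for c :: "nat \<Rightarrow> real"
  proof -
    have "(\<Sum>i<n. c i) \<le> (\<Sum>i<n. M)" by (intro sum_mono that)
    thus ?thesis using n by (simp add: divide_le_eq mult.commute)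
  qed
  have clamp: "clamp (L j) m \<in> {1..L j}" for j m using L[of j] by (auto simp: clamp_def)
  have main: "(\<Sum>i<n. dx (map fst ss ! i) (gzC L \<theta> K xhat (map (snd \<circ> snd) ss) (fyC L \<theta> (map (fst \<circ> snd) ss))
        (snd (msgs (fzC L \<theta>) (fxC L \<theta>) (map fst ss) (map (snd \<circ> snd) ss) (fyC L \<theta> (map (fst \<circ> snd) ss)) K)) i)) / real n \<le> D1 \<and>
    (\<Sum>i<n. dz (map (snd \<circ> snd) ss ! i) (gxC L \<theta> K zhat (map fst ss) (fyC L \<theta> (map (fst \<circ> snd) ss))
        (fst (msgs (fzC L \<theta>) (fxC L \<theta>) (map fst ss) (map (snd \<circ> snd) ss) (fyC L \<theta> (map (fst \<circ> snd) ss)) K)) i)) / real n \<le> D2"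
    if ss: "ss \<in> set_pmf ?R" "ss \<notin> ?bad" for ss
  proof -
    have l: "length ss = n" by (rule len[OF ss(1)])
    have good: "\<And>j p. j < ?J \<Longrightarrow> p \<in> Pl3 j \<Longrightarrow> \<not> miss L \<theta> ss j p" using ss(2) by blast
    have rg: "\<And>j. j < ?J \<Longrightarrow> message L \<theta> ss j \<in> {1..L j}" using range l by blast
    have rs: "ideal L \<theta> ss ?J \<in> rowset n ?J" using range l by blast
    have ms: "msgs (fzC L \<theta>) (fxC L \<theta>) (map fst ss) (map (snd \<circ> snd) ss) (message L \<theta> ss 0) K =
      (map (\<lambda>i. message L \<theta> ss (2 * i + 1)) [0..<K], map (\<lambda>i. message L \<theta> ss (2 * i + 2)) [0..<K])"
      by (rule msgs_message[where K = K, OF good rg order_refl])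
    have ty: "fyC L \<theta> (map (fst \<circ> snd) ss) = message L \<theta> ss 0"
      by (rule ty_message[OF good rg])
    have fi: "map fst (ideal L \<theta> ss ?J) = ss" and li: "length (ideal L \<theta> ss ?J) = n"
      using fst_ideal[OF l rs] by auto
    have row: "fst (ideal L \<theta> ss ?J ! i) = ss ! i" if "i < n" for i
      using that fi li by (metis nth_map)
    have eZ: "estZ L \<theta> (map (snd \<circ> snd) ss) (message L \<theta> ss 0) (map (\<lambda>i. message L \<theta> ss (2 * i + 2)) [0..<K]) ?J
      = view 1 (ideal L \<theta> ss ?J)"
      by (rule estZ_ideal[OF good rg]) auto
    have eX: "estX L \<theta> (map fst ss) (message L \<theta> ss 0) (map (\<lambda>i. message L \<theta> ss (2 * i + 1)) [0..<K]) ?J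
      = view 2 (ideal L \<theta> ss ?J)"
      by (rule estX_ideal[OF good rg]) auto
    have 1: "(\<Sum>i<n. dx (map fst ss ! i) (gzC L \<theta> K xhat (map (snd \<circ> snd) ss) (message L \<theta> ss 0)
        (map (\<lambda>i. message L \<theta> ss (2 * i + 2)) [0..<K]) i)) = (\<Sum>r\<leftarrow>ideal L \<theta> ss ?J. g1 r)"
    proof -
      have "(\<Sum>r\<leftarrow>ideal L \<theta> ss ?J. g1 r) = (\<Sum>i<n. g1 (ideal L \<theta> ss ?J ! i))"
        by (rule sum_list_nth[OF li])
      also have "\<dots> = (\<Sum>i<n. dx (map fst ss ! i) (gzC L \<theta> K xhat (map (snd \<circ> snd) ss) (message L \<theta> ss 0)
        (map (\<lambda>i. message L \<theta> ss (2 * i + 2)) [0..<K]) i))"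
      proof (rule sum.cong[OF refl])
        fix i assume "i \<in> {..<n}"
        hence i: "i < n" by simp
        obtain x y z h where r: "ideal L \<theta> ss ?J ! i = ((x, y, z), h)" by (metis prod.collapse)
        hence s: "ss ! i = (x, y, z)" using row[OF i] by simp
        have "view 1 (ideal L \<theta> ss ?J) ! i = (bl3 1 (x, y, z), h)" using i li r by (simp add: view_def del: ideal.simps)
        thus "g1 (ideal L \<theta> ss ?J ! i) = dx (map fst ss ! i) (gzC L \<theta> K xhat (map (snd \<circ> snd) ss) (message L \<theta> ss 0)
          (map (\<lambda>i. message L \<theta> ss (2 * i + 2)) [0..<K]) i)"
          unfolding gzC_def eZ r g1 using i l s by simp
      qed
      finally show ?thesis ..
    qed
    have 2: "(\<Sum>i<n. dz (map (snd \<circ> snd) ss ! i) (gxC L \<theta> K zhat (map fst ss) (message L \<theta> ss 0)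
        (map (\<lambda>i. message L \<theta> ss (2 * i + 1)) [0..<K]) i)) = (\<Sum>r\<leftarrow>ideal L \<theta> ss ?J. g2 r)"
    proof -
      have "(\<Sum>r\<leftarrow>ideal L \<theta> ss ?J. g2 r) = (\<Sum>i<n. g2 (ideal L \<theta> ss ?J ! i))"
        by (rule sum_list_nth[OF li])
      also have "\<dots> = (\<Sum>i<n. dz (map (snd \<circ> snd) ss ! i) (gxC L \<theta> K zhat (map fst ss) (message L \<theta> ss 0)
        (map (\<lambda>i. message L \<theta> ss (2 * i + 1)) [0..<K]) i))"
      proof (rule sum.cong[OF refl])
        fix i assume "i \<in> {..<n}"
        hence i: "i < n" by simp
        obtain x y z h where r: "ideal L \<theta> ss ?J ! i = ((x, y, z), h)" by (metis prod.collapse)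
        hence s: "ss ! i = (x, y, z)" using row[OF i] by simp
        have "view 2 (ideal L \<theta> ss ?J) ! i = (bl3 2 (x, y, z), h)" using i li r by (simp add: view_def del: ideal.simps)
        thus "g2 (ideal L \<theta> ss ?J ! i) = dz (map (snd \<circ> snd) ss ! i) (gxC L \<theta> K zhat (map fst ss) (message L \<theta> ss 0)
          (map (\<lambda>i. message L \<theta> ss (2 * i + 1)) [0..<K]) i)"
          unfolding gxC_def eX r g2 using i l s by simp
      qed
      finally show ?thesis ..
    qed
    have "(\<Sum>r\<leftarrow>ideal L \<theta> ss ?J. g1 r) \<le> real n * D1" "(\<Sum>r\<leftarrow>ideal L \<theta> ss ?J. g2 r) \<le> real n * D2"
      using ss(2) by (auto simp: not_less simp del: ideal.simps)
    thus ?thesis unfolding ty ms fst_conv snd_conv 1 2 using n by (simp add: divide_le_eq mult.commute del: ideal.simps)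
  qed
  show ?thesis
    unfolding is_code_def
  proof (intro exI[of _ "fyC L \<theta>"] exI[of _ "fzC L \<theta>"] exI[of _ "fxC L \<theta>"] exI[of _ "gxC L \<theta> K zhat"]
      exI[of _ "gzC L \<theta> K xhat"] conjI allI ballI)
    show "fyC L \<theta> ys \<in> {1..L 0}" for ys unfolding fyC_def by (rule clamp)
    show "fzC L \<theta> k zs ty txs \<in> {1..L (2 * k - 1)}" for k zs ty txs unfolding fzC_def Let_def by (rule clamp)
    show "fxC L \<theta> k xs ty tzs \<in> {1..L (2 * k)}" for k xs ty tzs unfolding fxC_def Let_def by (rule clamp)
    show "expec ?R (\<lambda>s. let xs = map fst s; ys = map (fst \<circ> snd) s; zs = map (snd \<circ> snd) s;
                  ty = fyC L \<theta> ys; tx = snd (msgs (fzC L \<theta>) (fxC L \<theta>) xs zs ty K)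
              in (\<Sum>i<n. dx (xs ! i) (gzC L \<theta> K xhat zs ty tx i)) / real n) \<le> Dx"
      unfolding Let_def
    proof (rule order_trans[OF expec_le_good[OF finR prob M(1) D(1)] Dx], goal_cases)
      case (1 ss)
      show ?case by (rule main[OF 1, THEN conjunct1])
    next
      case (2 ss)
      show ?case by (rule avg) (rule M(2))
    qed
    show "expec ?R (\<lambda>s. let xs = map fst s; ys = map (fst \<circ> snd) s; zs = map (snd \<circ> snd) s;
                  ty = fyC L \<theta> ys; tz = fst (msgs (fzC L \<theta>) (fxC L \<theta>) xs zs ty K)
              in (\<Sum>i<n. dz (zs ! i) (gxC L \<theta> K zhat xs ty tz i)) / real n) \<le> Dz"
      unfolding Let_def
    proof (rule order_trans[OF expec_le_good[OF finR prob M(1) D(2)] Dz], goal_cases)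
      case (1 ss)
      show ?case by (rule main[OF 1, THEN conjunct2])
    next
      case (2 ss)
      show ?case by (rule avg) (rule M(3))
    qed
  qed
qed

theorem achievable_protocol:
  fixes dx :: "'x \<Rightarrow> 'xh::finite \<Rightarrow> real" and dz :: "'z \<Rightarrow> 'zh::finite \<Rightarrow> real"
  assumes c: "\<forall>j<2 * K + 1. consistent j"
    and I: "\<And>j p. j < 2 * K + 1 \<Longrightarrow> p \<in> Pl3 j \<Longrightarrow> expec (law (Suc j)) (lr j p) \<le> I j" and I0: "\<And>j. I j \<ge> 0"
    and dx: "\<And>x xh. dx x xh \<ge> 0" and dz: "\<And>z zh. dz z zh \<ge> 0"
    and Dx: "expec (law (2 * K + 1)) (\<lambda>((x, y, z), h). dx x (xhat (h ! 0) (ws_of K h) z)) \<le> Dx"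
    and Dz: "expec (law (2 * K + 1)) (\<lambda>((x, y, z), h). dz z (zhat (h ! 0) (vs_of K h) x)) \<le> Dz"
    and R: "I 0 \<le> Ry" "(\<Sum>k=1..K. I (2 * k)) \<le> Rx" "(\<Sum>k=1..K. I (2 * k - 1)) \<le> Rz"
  shows "achievable pxy pzx dx dz K Dx Dz (Rx, Ry, Rz)"
  unfolding achievable_def prod.case
proof (intro allI impI)
  fix \<epsilon> :: real assume \<epsilon>: "\<epsilon> > 0"
  define M where "M = (\<Sum>x\<in>UNIV. \<Sum>xh\<in>UNIV. dx x xh) + (\<Sum>z\<in>UNIV. \<Sum>zh\<in>UNIV. dz z zh)"
  have Mx: "dx x xh \<le> M" for x xh
  proof -
    have "dx x xh \<le> (\<Sum>xh\<in>UNIV. dx x xh)" by (rule member_le_sum) (use dx in auto)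
    also have "\<dots> \<le> (\<Sum>x\<in>UNIV. \<Sum>xh\<in>UNIV. dx x xh)"
      by (rule member_le_sum[of x UNIV "\<lambda>x. \<Sum>xh\<in>UNIV. dx x xh"]) (use dx in \<open>auto intro: sum_nonneg\<close>)
    also have "\<dots> \<le> M" using dz by (simp add: M_def sum_nonneg)
    finally show ?thesis .
  qed
  have Mz: "dz z zh \<le> M" for z zh
  proof -
    have "dz z zh \<le> (\<Sum>zh\<in>UNIV. dz z zh)" by (rule member_le_sum) (use dz in auto)
    also have "\<dots> \<le> (\<Sum>z\<in>UNIV. \<Sum>zh\<in>UNIV. dz z zh)"
      by (rule member_le_sum[of z UNIV "\<lambda>z. \<Sum>zh\<in>UNIV. dz z zh"]) (use dz in \<open>auto intro: sum_nonneg\<close>)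
    also have "\<dots> \<le> M" using dx by (simp add: M_def sum_nonneg)
    finally show ?thesis .
  qed
  have M0: "M \<ge> 0" by (rule order_trans[OF dx Mx])
  \<comment> \<open>\<open>\<epsilon>'\<close> keeps the rate excess of \<open>K\<close> rounds
    within \<open>\<epsilon> / 2\<close>, and \<open>\<delta>\<close> does the same for the loss
    \<open>M * \<delta>\<close> on the bad event; \<open>M + 1\<close> covers the case
    \<open>M = 0\<close>.\<close>
  define \<epsilon>' where "\<epsilon>' = \<epsilon> / (2 * (real K + 1))"
  define \<delta> where "\<delta> = \<epsilon> / (2 * (M + 1))"
  have \<epsilon>': "\<epsilon>' > 0" and \<delta>: "\<delta> > 0" using \<epsilon> M0 by (auto simp: \<epsilon>'_def \<delta>_def)
  have half: "a * (\<epsilon> / (2 * a)) = \<epsilon> / 2" if "a \<noteq> 0" for a using that by simp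
  have K\<epsilon>: "(real K + 1) * \<epsilon>' = \<epsilon> / 2" unfolding \<epsilon>'_def by (rule half) linarith
  have \<epsilon>2: "\<epsilon>' \<le> \<epsilon> / 2"
  proof -
    have "1 * \<epsilon>' \<le> (real K + 1) * \<epsilon>'" using \<epsilon>' by (intro mult_right_mono) auto
    thus ?thesis by (simp add: K\<epsilon>)
  qed
  have \<epsilon>3: "real K * \<epsilon>' \<le> \<epsilon> / 2" using K\<epsilon> \<epsilon>' by (simp add: distrib_right)
  have M\<delta>: "M * \<delta> \<le> \<epsilon> / 2"
  proof -
    have "M * \<delta> \<le> (M + 1) * \<delta>" using \<delta> by (intro mult_right_mono) auto
    also have "\<dots> = \<epsilon> / 2" unfolding \<delta>_def by (rule half) (use M0 in linarith)
    finally show ?thesis .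
  qed
  define g1 :: "('x \<times> 'y \<times> 'z) \<times> nat list \<Rightarrow> real" where "g1 = (\<lambda>((x, y, z), h). dx x (xhat (h ! 0) (ws_of K h) z))"
  define g2 :: "('x \<times> 'y \<times> 'z) \<times> nat list \<Rightarrow> real" where "g2 = (\<lambda>((x, y, z), h). dz z (zhat (h ! 0) (vs_of K h) x))"
  have D0: "Dx \<ge> 0" "Dz \<ge> 0"
  proof -
    have "0 \<le> expec (law (2 * K + 1)) (\<lambda>((x, y, z), h). dx x (xhat (h ! 0) (ws_of K h) z))"
      by (rule Bochner_Integration.integral_nonneg) (auto simp: dx split: prod.split)
    thus "Dx \<ge> 0" using Dx by simp
    have "0 \<le> expec (law (2 * K + 1)) (\<lambda>((x, y, z), h). dz z (zhat (h ! 0) (vs_of K h) x))"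
      by (rule Bochner_Integration.integral_nonneg) (auto simp: dz split: prod.split)
    thus "Dz \<ge> 0" using Dz by simp
  qed
  have D': "expec (law (2 * K + 1)) g1 \<le> Dx" "expec (law (2 * K + 1)) g2 \<le> Dz"
    using Dx Dz unfolding g1_def g2_def .
  define G where "G n \<longleftrightarrow> n > 0 \<and> (\<exists>L \<theta>. (\<forall>j. L j > 0) \<and> (\<forall>j. log 2 (real (L j)) / real n \<le> I j + \<epsilon>') \<and>
    (\<forall>ss. length ss = n \<longrightarrow> ideal L \<theta> ss (2 * K + 1) \<in> rowset n (2 * K + 1) \<and> (\<forall>j<2 * K + 1. message L \<theta> ss j \<in> {1..L j})) \<and>
    prob (replicate_pmf n (source pxy pzx)) {ss. (\<exists>j<2 * K + 1. \<exists>p\<in>Pl3 j. miss L \<theta> ss j p) \<or>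
       (\<Sum>r\<leftarrow>ideal L \<theta> ss (2 * K + 1). g1 r) > real n * (Dx + \<epsilon>') \<or> (\<Sum>r\<leftarrow>ideal L \<theta> ss (2 * K + 1). g2 r) > real n * (Dz + \<epsilon>')} \<le> \<delta>)" for n
  have "\<exists>N0. \<forall>n\<ge>N0. G n" unfolding G_def
    by (rule ex_good_code[where I = I, OF c _ I0 D' \<epsilon>' \<delta>]) (rule I)
  then obtain N0 where N0: "\<forall>n\<ge>N0. G n" by blast
  show "\<exists>N. \<forall>n\<ge>N. \<exists>My Mx Mz. is_code pxy pzx dx dz K n My Mx Mz (Dx + \<epsilon>) (Dz + \<epsilon>) \<and>
         log 2 (real My) / real n \<le> Ry + \<epsilon> \<and>
         (\<Sum>k=1..K. log 2 (real (Mx k))) / real n \<le> Rx + \<epsilon> \<and>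
         (\<Sum>k=1..K. log 2 (real (Mz k))) / real n \<le> Rz + \<epsilon>"
  proof (rule exI[of _ N0], intro allI impI)
    fix n assume "n \<ge> N0"
    hence "G n" using N0 by blast
    then obtain L \<theta> where n: "n > 0" and L: "\<forall>j. L j > 0" and rate: "\<forall>j. log 2 (real (L j)) / real n \<le> I j + \<epsilon>'"
      and rg: "\<forall>ss. length ss = n \<longrightarrow> ideal L \<theta> ss (2 * K + 1) \<in> rowset n (2 * K + 1) \<and> (\<forall>j<2 * K + 1. message L \<theta> ss j \<in> {1..L j})"
      and pr: "prob (replicate_pmf n (source pxy pzx)) {ss. (\<exists>j<2 * K + 1. \<exists>p\<in>Pl3 j. miss L \<theta> ss j p) \<or>
       (\<Sum>r\<leftarrow>ideal L \<theta> ss (2 * K + 1). g1 r) > real n * (Dx + \<epsilon>') \<or> (\<Sum>r\<leftarrow>ideal L \<theta> ss (2 * K + 1). g2 r) > real n * (Dz + \<epsilon>')} \<le> \<delta>"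
      unfolding G_def by (elim conjE exE) (rule that)
    have code: "is_code pxy pzx dx dz K n (L 0) (\<lambda>k. L (2 * k)) (\<lambda>k. L (2 * k - 1)) (Dx + \<epsilon>) (Dz + \<epsilon>)"
      by (rule is_code_protocol[OF n L[rule_format] rg g1_def g2_def pr M0 Mx Mz])
        (use D0 \<epsilon>' \<epsilon>2 M\<delta> in linarith)+
    have sums: "(\<Sum>k=1..K. log 2 (real (L (c k)))) / real n \<le> R + \<epsilon>" if "(\<Sum>k=1..K. I (c k)) \<le> R" for c R
    proof -
      have "(\<Sum>k=1..K. log 2 (real (L (c k)))) / real n = (\<Sum>k=1..K. log 2 (real (L (c k))) / real n)"
        by (simp add: sum_divide_distrib)
      also have "\<dots> \<le> (\<Sum>k=1..K. I (c k) + \<epsilon>')" using rate by (intro sum_mono) auto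
      also have "\<dots> = (\<Sum>k=1..K. I (c k)) + real K * \<epsilon>'" by (simp add: sum.distrib)
      also have "\<dots> \<le> R + \<epsilon>" using that \<epsilon>3 \<epsilon> by linarith
      finally show ?thesis .
    qed
    have y: "log 2 (real (L 0)) / real n \<le> Ry + \<epsilon>"
      using rate[rule_format, of 0] R(1) \<epsilon>2 \<epsilon> by linarith
    show "\<exists>My Mx Mz. is_code pxy pzx dx dz K n My Mx Mz (Dx + \<epsilon>) (Dz + \<epsilon>) \<and>
         log 2 (real My) / real n \<le> Ry + \<epsilon> \<and>
         (\<Sum>k=1..K. log 2 (real (Mx k))) / real n \<le> Rx + \<epsilon> \<and>
         (\<Sum>k=1..K. log 2 (real (Mz k))) / real n \<le> Rz + \<epsilon>"
      by (intro exI[of _ "L 0"] exI[of _ "\<lambda>k. L (2 * k)"] exI[of _ "\<lambda>k. L (2 * k - 1)"] conjI code y sums R(2,3))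
  qed
qed

end

section \<open>Achievability\<close>

lemma pmf_bind_Pair:
  "pmf (bind_pmf p (\<lambda>k. map_pmf (Pair k) (Q k))) (m, h) = pmf p m * pmf (Q m) h"
proof -
  have "pmf (bind_pmf p (\<lambda>k. map_pmf (Pair k) (Q k))) (m, h) = expec p (\<lambda>k. pmf (map_pmf (Pair k) (Q k)) (m, h))"
    by (simp add: pmf_bind)
  also have "\<dots> = expec p (\<lambda>k. indicator {m} k * pmf (Q m) h)"
  proof (rule expec_cong)
    fix k
    show "pmf (map_pmf (Pair k) (Q k)) (m, h) = indicator {m} k * pmf (Q m) h"
    proof (cases "k = m")
      case True
      have "inj (Pair m)" by (auto simp: inj_def)
      from pmf_map_inj'[OF this] True show ?thesis by simp
    next
      case False
      thus ?thesis by (auto intro!: pmf_map_outside)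
    qed
  qed
  also have "\<dots> = pmf p m * pmf (Q m) h" by (simp add: measure_pmf_single)
  finally show ?thesis .
qed

lemma source_bind: "source pxy pzx = map_pmf (\<lambda>((x, y), z). (x, y, z)) (bind_pmf pxy (\<lambda>p. map_pmf (Pair p) (pzx (fst p))))"
  by (simp add: source_def map_bind_pmf map_pmf_comp case_prod_unfold)

lemma pmf_source: "pmf (source pxy pzx) (x, y, z) = pmf pxy (x, y) * pmf (pzx x) z"
proof -
  have inj: "inj (\<lambda>((x, y), z). (x, y, z))" by (auto simp: inj_def)
  show ?thesis unfolding source_bind
    using pmf_map_inj'[OF inj, of _ "((x, y), z)"] by (simp add: pmf_bind_Pair)
qed

text \<open>The conditional law of \<open>A\<close> given \<open>S\<close>. Outside the support the
  default is a point mass, which keeps all values in a finite alphabet.\<close>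

definition ker :: "'o pmf \<Rightarrow> ('o \<Rightarrow> nat) \<Rightarrow> ('o \<Rightarrow> 'b) \<Rightarrow> 'b \<Rightarrow> nat pmf" where
  "ker P A S c = (if \<exists>\<omega>\<in>set_pmf P. S \<omega> = c then map_pmf A (cond_pmf P {\<omega>. S \<omega> = c}) else return_pmf 0)"

lemma pmf_ker:
  assumes w: "\<omega> \<in> set_pmf P"
  shows "pmf (ker P A S (S \<omega>)) a = mass P (\<lambda>\<omega>. (A \<omega>, S \<omega>)) (a, S \<omega>) / mass P S (S \<omega>)"
proof -
  have ne: "set_pmf P \<inter> {v. S v = S \<omega>} \<noteq> {}" using w by auto
  have "pmf (ker P A S (S \<omega>)) a = prob (cond_pmf P {v. S v = S \<omega>}) {v. A v = a}"
    using w by (auto simp: ker_def mass_eq)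
  also have "\<dots> = prob P ({v. A v = a} \<inter> {v. S v = S \<omega>}) / prob P {v. S v = S \<omega>}"
  proof -
    interpret pmf_as_measure .
    have "measure_pmf.prob (cond_pmf P {v. S v = S \<omega>}) {v. A v = a} =
      measure (uniform_measure P {v. S v = S \<omega>}) {v. A v = a}"
      using cond_pmf.rep_eq[OF ne] by simp
    thus ?thesis using ne
      by (subst (asm) measure_uniform_measure)
        (auto simp: measure_pmf.emeasure_eq_measure measure_pmf_zero_iff Int_commute emeasure_measure_pmf_not_zero)
  qed
  also have "\<dots> = mass P (\<lambda>\<omega>. (A \<omega>, S \<omega>)) (a, S \<omega>) / mass P S (S \<omega>)"
    by (simp add: mass_eq Int_def)
  finally show ?thesis .
qed

lemma set_ker: "set_pmf (ker P A S c) \<subseteq> insert 0 (A ` set_pmf P)"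
proof (cases "\<exists>\<omega>\<in>set_pmf P. S \<omega> = c")
  case True
  hence "set_pmf P \<inter> {\<omega>. S \<omega> = c} \<noteq> {}" by auto
  thus ?thesis using True by (auto simp: ker_def set_cond_pmf)
qed (simp add: ker_def)

text \<open>Turns a Markov condition into a kernel that a player can run: \<open>A\<close> is
  regenerated from \<open>f B\<close> alone, with the joint law of \<open>A\<close> and
  \<open>B\<close> intact.\<close>

lemma markov_bind_ker:
  assumes m: "markov P A (\<lambda>\<omega>. f (B \<omega>)) B"
  shows "map_pmf (\<lambda>\<omega>. (B \<omega>, A \<omega>)) P = bind_pmf (map_pmf B P) (\<lambda>b. map_pmf (Pair b) (ker P A (\<lambda>\<omega>. f (B \<omega>)) (f b)))"
proof (rule pmf_eqI, clarify)
  fix b a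
  show "mass P (\<lambda>\<omega>. (B \<omega>, A \<omega>)) (b, a) = pmf (bind_pmf (map_pmf B P) (\<lambda>b. map_pmf (Pair b) (ker P A (\<lambda>\<omega>. f (B \<omega>)) (f b)))) (b, a)"
    unfolding pmf_bind_Pair
  proof (cases "b \<in> B ` set_pmf P")
    case False
    hence "mass P B b = 0" "mass P (\<lambda>\<omega>. (B \<omega>, A \<omega>)) (b, a) = 0"
      by (auto intro!: pmf_map_outside)
    thus "mass P (\<lambda>\<omega>. (B \<omega>, A \<omega>)) (b, a) = mass P B b * pmf (ker P A (\<lambda>\<omega>. f (B \<omega>)) (f b)) a" by simp
  next
    case True
    then obtain \<omega> where w: "\<omega> \<in> set_pmf P" "b = B \<omega>" by auto
    have pos: "mass P (\<lambda>\<omega>. f (B \<omega>)) (f b) > 0" using mass_pos[OF w(1), of "\<lambda>\<omega>. f (B \<omega>)"] w(2) by simp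
    have m1: "mass P (\<lambda>\<omega>. (A \<omega>, f (B \<omega>), B \<omega>)) (a, f b, b) * mass P (\<lambda>\<omega>. f (B \<omega>)) (f b) =
      mass P (\<lambda>\<omega>. (A \<omega>, f (B \<omega>))) (a, f b) * mass P (\<lambda>\<omega>. (f (B \<omega>), B \<omega>)) (f b, b)"
      by (rule m[unfolded markov_def, rule_format])
    have m2: "mass P (\<lambda>\<omega>. (A \<omega>, f (B \<omega>), B \<omega>)) (a, f b, b) = mass P (\<lambda>\<omega>. (B \<omega>, A \<omega>)) (b, a)"
      unfolding mass_eq by (rule prob_cong) auto
    have m3: "mass P (\<lambda>\<omega>. (f (B \<omega>), B \<omega>)) (f b, b) = mass P B b"
      unfolding mass_eq by (rule prob_cong) auto
    have m4: "pmf (ker P A (\<lambda>\<omega>. f (B \<omega>)) (f b)) a = mass P (\<lambda>\<omega>. (A \<omega>, f (B \<omega>))) (a, f b) / mass P (\<lambda>\<omega>. f (B \<omega>)) (f b)"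
      using pmf_ker[OF w(1), of A "\<lambda>\<omega>. f (B \<omega>)" a] w(2) by simp
    show "mass P (\<lambda>\<omega>. (B \<omega>, A \<omega>)) (b, a) = mass P B b * pmf (ker P A (\<lambda>\<omega>. f (B \<omega>)) (f b)) a"
      unfolding m4 using m1[unfolded m2 m3] pos by (simp add: eq_divide_eq mult.commute)
  qed
qed

section \<open>Test channels as protocols, with messages in the order U, V_1, W_1, V_2, W_2 and so
  on\<close>

definition hist :: "nat \<Rightarrow> ('x, 'y, 'z) aux_outcome \<Rightarrow> nat list" where
  "hist K \<omega> = oU \<omega> # map (\<lambda>i. if even i then oV \<omega> ! (i div 2) else oW \<omega> ! (i div 2)) [0..<2 * K]"

definition src :: "('x, 'y, 'z) aux_outcome \<Rightarrow> 'x \<times> 'y \<times> 'z" where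
  "src \<omega> = (oX \<omega>, oY \<omega>, oZ \<omega>)"

lemma length_hist [simp]: "length (hist K \<omega>) = 2 * K + 1"
  by (simp add: hist_def)

lemma hist_nth: "hist K \<omega> ! 0 = oU \<omega>" "k < K \<Longrightarrow> hist K \<omega> ! (2 * k + 1) = oV \<omega> ! k" "k < K \<Longrightarrow> hist K \<omega> ! (2 * k + 2) = oW \<omega> ! k"
  by (simp_all add: hist_def)

lemma take_eq_iff: "k \<le> length xs \<Longrightarrow> k \<le> length ys \<Longrightarrow> take k xs = take k ys \<longleftrightarrow> (\<forall>i<k. xs ! i = ys ! i)"
  by (auto simp: list_eq_iff_nth_eq)

lemma less_odd_cases:
  assumes "i < 2 * k + (1::nat)"
  obtains "i = 0" | l where "l < k" "i = 2 * l + 1" | l where "l < k" "i = 2 * l + 2"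
proof (cases "i = 0")
  case False
  show ?thesis
  proof (cases "even i")
    case True
    then obtain m where "i = 2 * m" by blast
    thus ?thesis using False assms that(3)[of "m - 1"] by (cases m) auto
  next
    case odd: False
    then obtain m where "i = 2 * m + 1" by (rule oddE)
    thus ?thesis using assms that(2)[of m] by auto
  qed
qed (use that in blast)

text \<open>The congruence lemmas compare variables by equality on two outcomes, so this equivalence
  is what exchanges prefixes of \<open>hist\<close> for the tuples (U, V^k, W^k).\<close>

lemma take_hist_odd:
  fixes \<omega> \<omega>' :: "('x, 'y, 'z) aux_outcome"
  assumes "length (oV \<omega>) = K" "length (oW \<omega>) = K" "length (oV \<omega>') = K" "length (oW \<omega>') = K" "k \<le> K"
  shows "take (2 * k + 1) (hist K \<omega>) = take (2 * k + 1) (hist K \<omega>') \<longleftrightarrow>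
    oU \<omega> = oU \<omega>' \<and> take k (oV \<omega>) = take k (oV \<omega>') \<and> take k (oW \<omega>) = take k (oW \<omega>')"
proof -
  have "take (2 * k + 1) (hist K \<omega>) = take (2 * k + 1) (hist K \<omega>') \<longleftrightarrow> (\<forall>i<2 * k + 1. hist K \<omega> ! i = hist K \<omega>' ! i)"
    by (rule take_eq_iff) (use assms in auto)
  also have "\<dots> \<longleftrightarrow> oU \<omega> = oU \<omega>' \<and> (\<forall>i<k. oV \<omega> ! i = oV \<omega>' ! i) \<and> (\<forall>i<k. oW \<omega> ! i = oW \<omega>' ! i)"
  proof (intro iffI conjI allI impI; (elim conjE)?)
    assume a: "\<forall>i<2 * k + 1. hist K \<omega> ! i = hist K \<omega>' ! i"
    show "oU \<omega> = oU \<omega>'" using a[rule_format, of 0] by (simp add: hist_nth)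
    fix i assume i: "i < k"
    hence iK: "i < K" using assms by simp
    show "oV \<omega> ! i = oV \<omega>' ! i" using a[rule_format, of "2 * i + 1"] i hist_nth(2)[OF iK, of \<omega>] hist_nth(2)[OF iK, of \<omega>'] by simp
    show "oW \<omega> ! i = oW \<omega>' ! i" using a[rule_format, of "2 * i + 2"] i hist_nth(3)[OF iK, of \<omega>] hist_nth(3)[OF iK, of \<omega>'] by simp
  next
    fix i assume u: "oU \<omega> = oU \<omega>'" and v: "\<forall>i<k. oV \<omega> ! i = oV \<omega>' ! i" and w: "\<forall>i<k. oW \<omega> ! i = oW \<omega>' ! i" and i: "i < 2 * k + 1"
    from i show "hist K \<omega> ! i = hist K \<omega>' ! i"
    proof (cases rule: less_odd_cases)
      case 1 thus ?thesis using u by (simp add: hist_nth)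
    next
      case (2 l) 
      hence "l < K" using assms by simp
      thus ?thesis using v 2 hist_nth(2)[of l K \<omega>] hist_nth(2)[of l K \<omega>'] by simp
    next
      case (3 l)
      hence "l < K" using assms by simp
      thus ?thesis using w 3 hist_nth(3)[of l K \<omega>] hist_nth(3)[of l K \<omega>'] by simp
    qed
  qed
  also have "\<dots> \<longleftrightarrow> oU \<omega> = oU \<omega>' \<and> take k (oV \<omega>) = take k (oV \<omega>') \<and> take k (oW \<omega>) = take k (oW \<omega>')"
    using assms by (simp add: take_eq_iff)
  finally show ?thesis .
qed

lemma take_hist_even:
  fixes \<omega> \<omega>' :: "('x, 'y, 'z) aux_outcome"
  assumes "length (oV \<omega>) = K" "length (oW \<omega>) = K" "length (oV \<omega>') = K" "length (oW \<omega>') = K" "k < K"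
  shows "take (2 * k + 2) (hist K \<omega>) = take (2 * k + 2) (hist K \<omega>') \<longleftrightarrow>
    oU \<omega> = oU \<omega>' \<and> take (Suc k) (oV \<omega>) = take (Suc k) (oV \<omega>') \<and> take k (oW \<omega>) = take k (oW \<omega>')"
proof -
  have t: "take (2 * k + 2) (hist K \<omega>) = take (2 * k + 1) (hist K \<omega>) @ [oV \<omega> ! k]" for \<omega> :: "('x, 'y, 'z) aux_outcome"
    using take_Suc_conv_app_nth[of "2 * k + 1" "hist K \<omega>"] hist_nth(2)[OF assms(5), of \<omega>] assms(5) by simp
  have "take (Suc k) (oV \<omega>) = take k (oV \<omega>) @ [oV \<omega> ! k]" "take (Suc k) (oV \<omega>') = take k (oV \<omega>') @ [oV \<omega>' ! k]"
    using assms by (auto intro: take_Suc_conv_app_nth)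
  thus ?thesis unfolding t using take_hist_odd[of \<omega> K \<omega>' k] assms by auto
qed

locale test_channel =
  fixes P :: "('x::finite, 'y::finite, 'z::finite) aux_outcome pmf"
    and pxy :: "('x \<times> 'y) pmf" and pzx :: "'x \<Rightarrow> 'z pmf" and K :: nat
  assumes fin: "finite (set_pmf P)"
    and marg: "map_pmf (\<lambda>\<omega>. (oX \<omega>, oY \<omega>, oZ \<omega>)) P = source pxy pzx"
    and len: "\<And>\<omega>. \<omega> \<in> set_pmf P \<Longrightarrow> length (oV \<omega>) = K \<and> length (oW \<omega>) = K"
    and mU: "markov P oU oY (\<lambda>\<omega>. (oX \<omega>, oZ \<omega>))"
    and mV: "\<And>k. k < K \<Longrightarrow> markov P (\<lambda>\<omega>. oV \<omega> ! k)
           (\<lambda>\<omega>. (oZ \<omega>, oU \<omega>, take k (oV \<omega>), take k (oW \<omega>))) (\<lambda>\<omega>. (oX \<omega>, oY \<omega>))"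
    and mW: "\<And>k. k < K \<Longrightarrow> markov P (\<lambda>\<omega>. oW \<omega> ! k)
           (\<lambda>\<omega>. (oX \<omega>, oU \<omega>, take (Suc k) (oV \<omega>), take k (oW \<omega>))) (\<lambda>\<omega>. (oZ \<omega>, oY \<omega>))"
begin

text \<open>What player \<open>p\<close> knows just before round \<open>j\<close>.\<close>

definition S :: "nat \<Rightarrow> nat \<Rightarrow> ('x, 'y, 'z) aux_outcome \<Rightarrow> ('x \<times> 'y \<times> 'z) \<times> nat list" where
  "S p j \<omega> = (bl3 p (src \<omega>), take j (hist K \<omega>))"

text \<open>Speaker's kernel and listener's belief \<open>\<tau>\<close> are both conditional laws
  of the test channel. So consistency is automatic, and the mean of \<open>lr\<close> is
  H(message|listener) - H(message|speaker).\<close>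

definition \<kappa> :: "nat \<Rightarrow> 'x \<times> 'y \<times> 'z \<Rightarrow> nat list \<Rightarrow> nat pmf" where
  "\<kappa> j c h = (if j \<le> 2 * K then ker P (\<lambda>\<omega>. hist K \<omega> ! j) (S (spk3 j) j) (c, h) else return_pmf 0)"

definition \<tau> :: "nat \<Rightarrow> nat \<Rightarrow> 'x \<times> 'y \<times> 'z \<Rightarrow> nat list \<Rightarrow> nat pmf" where
  "\<tau> j p c h = (if j \<le> 2 * K then ker P (\<lambda>\<omega>. hist K \<omega> ! j) (S p j) (c, h) else return_pmf 0)"

definition B :: nat where
  "B = Suc (Max (insert 0 (\<Union>j\<in>{..2 * K}. (\<lambda>\<omega>. hist K \<omega> ! j) ` set_pmf P)))"

lemma ker_B: "j \<le> 2 * K \<Longrightarrow> set_pmf (ker P (\<lambda>\<omega>. hist K \<omega> ! j) T c) \<subseteq> {..<B}"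
proof
  fix m assume j: "j \<le> 2 * K" and m: "m \<in> set_pmf (ker P (\<lambda>\<omega>. hist K \<omega> ! j) T c)"
  have "m \<in> insert 0 (\<Union>j\<in>{..2 * K}. (\<lambda>\<omega>. hist K \<omega> ! j) ` set_pmf P)"
    using m set_ker[of P "\<lambda>\<omega>. hist K \<omega> ! j" T c] j by blast
  hence "m \<le> Max (insert 0 (\<Union>j\<in>{..2 * K}. (\<lambda>\<omega>. hist K \<omega> ! j) ` set_pmf P))"
    by (rule Max_ge[rotated]) (use fin in simp)
  thus "m \<in> {..<B}" by (simp add: B_def)
qed

sublocale source_protocol pxy pzx \<kappa> \<tau> B
proof
  have "B > 0" by (simp add: B_def)
  thus "set_pmf (\<kappa> j s h) \<subseteq> {..<B}" "set_pmf (\<tau> j p s h) \<subseteq> {..<B}" for j p s h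
    using ker_B[of j "S (spk3 j) j" "(s, h)"] ker_B[of j "S p j" "(s, h)"] by (simp_all add: \<kappa>_def \<tau>_def)
  show "finite (Pl3 j)" for j by (simp add: Pl3_def)
qed

lemma src_source: "map_pmf src P = source pxy pzx"
  using marg by (simp add: src_def[abs_def])

lemma S_eq_odd:
  assumes "\<omega> \<in> set_pmf P" "\<omega>' \<in> set_pmf P" "k \<le> K"
  shows "S p (2 * k + 1) \<omega> = S p (2 * k + 1) \<omega>' \<longleftrightarrow> bl3 p (src \<omega>) = bl3 p (src \<omega>') \<and>
    oU \<omega> = oU \<omega>' \<and> take k (oV \<omega>) = take k (oV \<omega>') \<and> take k (oW \<omega>) = take k (oW \<omega>')"
  unfolding S_def prod.inject using take_hist_odd[of \<omega> K \<omega>' k] len[OF assms(1)] len[OF assms(2)] assms(3) by simp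

lemma S_eq_even:
  assumes "\<omega> \<in> set_pmf P" "\<omega>' \<in> set_pmf P" "k < K"
  shows "S p (2 * k + 2) \<omega> = S p (2 * k + 2) \<omega>' \<longleftrightarrow> bl3 p (src \<omega>) = bl3 p (src \<omega>') \<and>
    oU \<omega> = oU \<omega>' \<and> take (Suc k) (oV \<omega>) = take (Suc k) (oV \<omega>') \<and> take k (oW \<omega>) = take k (oW \<omega>')"
  unfolding S_def prod.inject using take_hist_even[of \<omega> K \<omega>' k] len[OF assms(1)] len[OF assms(2)] assms(3) by simp

lemma bl3_src: "bl3 0 (src \<omega>) = (undefined, oY \<omega>, undefined)" "bl3 1 (src \<omega>) = (undefined, undefined, oZ \<omega>)"
  "bl3 2 (src \<omega>) = (oX \<omega>, undefined, undefined)"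
  by (simp_all add: bl3_def src_def)

lemma round_cases:
  assumes "j \<le> 2 * K"
  obtains "j = 0" | k where "k < K" "j = 2 * k + 1" | k where "k < K" "j = 2 * k + 2"
  using less_odd_cases[of j K] assms by (metis Suc_eq_plus1 less_Suc_eq_le)

text \<open>Brings the three families of Markov conditions into one form, so that the induction over
  rounds needs no case distinction.\<close>

lemma markov_round:
  assumes "j \<le> 2 * K"
  shows "markov P (\<lambda>\<omega>. hist K \<omega> ! j) (\<lambda>\<omega>. S (spk3 j) j \<omega>) (\<lambda>\<omega>. (src \<omega>, take j (hist K \<omega>)))"
  using assms
proof (cases rule: round_cases)
  case 1
  show ?thesis unfolding 1
    by (rule markov_cong[OF mU]) (auto simp: S_def spk3_def bl3_def hist_nth src_def)
next
  case (2 k)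
  have spk: "spk3 (2 * k + 1) = 1" by (simp add: spk3_def)
  show ?thesis unfolding 2 spk
  proof (rule markov_cong[OF mV[OF 2(1)]])
    fix \<omega> \<omega>' assume w: "\<omega> \<in> set_pmf P" "\<omega>' \<in> set_pmf P"
    have kK: "k \<le> K" using 2 by simp
    note e = S_eq_odd[OF w kK]
    show B: "((oZ \<omega>, oU \<omega>, take k (oV \<omega>), take k (oW \<omega>)) = (oZ \<omega>', oU \<omega>', take k (oV \<omega>'), take k (oW \<omega>'))) =
      (S 1 (2 * k + 1) \<omega> = S 1 (2 * k + 1) \<omega>')"
      unfolding e bl3_src by simp
    assume h: "(oZ \<omega>, oU \<omega>, take k (oV \<omega>), take k (oW \<omega>)) = (oZ \<omega>', oU \<omega>', take k (oV \<omega>'), take k (oW \<omega>'))"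
    hence t: "take (2 * k + 1) (hist K \<omega>) = take (2 * k + 1) (hist K \<omega>')" using B by (simp add: S_def)
    show "(oV \<omega> ! k = oV \<omega>' ! k) = (hist K \<omega> ! (2 * k + 1) = hist K \<omega>' ! (2 * k + 1))"
      unfolding hist_nth(2)[OF 2(1)] ..
    show "((oX \<omega>, oY \<omega>) = (oX \<omega>', oY \<omega>')) =
      ((src \<omega>, take (2 * k + 1) (hist K \<omega>)) = (src \<omega>', take (2 * k + 1) (hist K \<omega>')))"
      unfolding t src_def using h by auto
  qed
next
  case (3 k)
  have spk: "spk3 (2 * k + 2) = 2" by (simp add: spk3_def)
  show ?thesis unfolding 3 spk
  proof (rule markov_cong[OF mW[OF 3(1)]])
    fix \<omega> \<omega>' assume w: "\<omega> \<in> set_pmf P" "\<omega>' \<in> set_pmf P"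
    note e = S_eq_even[OF w 3(1)]
    show B: "((oX \<omega>, oU \<omega>, take (Suc k) (oV \<omega>), take k (oW \<omega>)) = (oX \<omega>', oU \<omega>', take (Suc k) (oV \<omega>'), take k (oW \<omega>'))) =
      (S 2 (2 * k + 2) \<omega> = S 2 (2 * k + 2) \<omega>')"
      unfolding e bl3_src by simp
    assume h: "(oX \<omega>, oU \<omega>, take (Suc k) (oV \<omega>), take k (oW \<omega>)) = (oX \<omega>', oU \<omega>', take (Suc k) (oV \<omega>'), take k (oW \<omega>'))"
    hence t: "take (2 * k + 2) (hist K \<omega>) = take (2 * k + 2) (hist K \<omega>')" using B by (simp add: S_def)
    show "(oW \<omega> ! k = oW \<omega>' ! k) = (hist K \<omega> ! (2 * k + 2) = hist K \<omega>' ! (2 * k + 2))"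
      unfolding hist_nth(3)[OF 3(1)] ..
    show "((oZ \<omega>, oY \<omega>) = (oZ \<omega>', oY \<omega>')) =
      ((src \<omega>, take (2 * k + 2) (hist K \<omega>)) = (src \<omega>', take (2 * k + 2) (hist K \<omega>')))"
      unfolding t src_def using h by auto
  qed
qed

text \<open>Each round appends exactly the conditional law of the test channel, because by
  \<open>markov_round\<close> the speaker's knowledge suffices to generate the message.\<close>

lemma law_eq: "j \<le> 2 * K + 1 \<Longrightarrow> law j = map_pmf (\<lambda>\<omega>. (src \<omega>, take j (hist K \<omega>))) P"
proof (induction j)
  case 0
  have "law 0 = map_pmf (\<lambda>s. (s, [])) (map_pmf src P)" by (simp add: src_source)
  thus ?case by (simp only: map_pmf_comp take_0)
next
  case (Suc j)
  let ?B = "\<lambda>\<omega>. (src \<omega>, take j (hist K \<omega>))" and ?f = "\<lambda>(s, h). (bl3 (spk3 j) s, h)"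
  have j: "j \<le> 2 * K" using Suc.prems by simp
  have fB: "S (spk3 j) j = (\<lambda>\<omega>. ?f (?B \<omega>))" by (auto simp: S_def)
  have m: "markov P (\<lambda>\<omega>. hist K \<omega> ! j) (\<lambda>\<omega>. ?f (?B \<omega>)) ?B"
    using markov_round[OF j] unfolding S_def by simp
  have IH: "law j = map_pmf ?B P" by (rule Suc.IH) (use j in simp)
  have k: "\<kappa> j (bl3 (spk3 j) s) h = ker P (\<lambda>\<omega>. hist K \<omega> ! j) (\<lambda>\<omega>. ?f (?B \<omega>)) (?f (s, h))" for s h
    using j by (simp add: \<kappa>_def fB)
  have "law (Suc j) = bind_pmf (map_pmf ?B P) (\<lambda>b. map_pmf (\<lambda>m. (fst b, snd b @ [m])) (ker P (\<lambda>\<omega>. hist K \<omega> ! j) (\<lambda>\<omega>. ?f (?B \<omega>)) (?f b)))"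
    unfolding law.simps IH k by (simp add: case_prod_unfold)
  also have "\<dots> = map_pmf (\<lambda>(b, m). (fst b, snd b @ [m])) (bind_pmf (map_pmf ?B P) (\<lambda>b. map_pmf (Pair b) (ker P (\<lambda>\<omega>. hist K \<omega> ! j) (\<lambda>\<omega>. ?f (?B \<omega>)) (?f b))))"
    by (simp add: map_bind_pmf map_pmf_comp case_prod_unfold)
  also have "\<dots> = map_pmf (\<lambda>(b, m). (fst b, snd b @ [m])) (map_pmf (\<lambda>\<omega>. (?B \<omega>, hist K \<omega> ! j)) P)"
    by (simp only: markov_bind_ker[OF m])
  also have "\<dots> = map_pmf (\<lambda>\<omega>. (src \<omega>, take (Suc j) (hist K \<omega>))) P"
    unfolding map_pmf_comp using Suc.prems by (intro map_pmf_cong refl) (simp add: take_Suc_conv_app_nth)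
  finally show ?case .
qed

lemma pmf_\<kappa>: "\<omega> \<in> set_pmf P \<Longrightarrow> j \<le> 2 * K \<Longrightarrow> pmf (\<kappa> j (bl3 (spk3 j) (src \<omega>)) (take j (hist K \<omega>))) m =
    mass P (\<lambda>\<omega>. (hist K \<omega> ! j, S (spk3 j) j \<omega>)) (m, S (spk3 j) j \<omega>) / mass P (S (spk3 j) j) (S (spk3 j) j \<omega>)"
  using pmf_ker[of \<omega> P "\<lambda>\<omega>. hist K \<omega> ! j" "S (spk3 j) j" m] by (simp add: \<kappa>_def S_def[symmetric])

lemma pmf_\<tau>: "\<omega> \<in> set_pmf P \<Longrightarrow> j \<le> 2 * K \<Longrightarrow> pmf (\<tau> j p (bl3 p (src \<omega>)) (take j (hist K \<omega>))) m =
    mass P (\<lambda>\<omega>. (hist K \<omega> ! j, S p j \<omega>)) (m, S p j \<omega>) / mass P (S p j) (S p j \<omega>)"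
  using pmf_ker[of \<omega> P "\<lambda>\<omega>. hist K \<omega> ! j" "S p j" m] by (simp add: \<tau>_def S_def[symmetric])

lemma all_consistent: "j \<le> 2 * K \<Longrightarrow> consistent j"
  unfolding consistent_def
proof (intro ballI, clarify)
  fix p s h m assume j: "j \<le> 2 * K" and mem: "(s, h) \<in> set_pmf (law j)" and pos: "pmf (\<kappa> j (bl3 (spk3 j) s) h) m > 0"
  have "(s, h @ [m]) \<in> set_pmf (law (Suc j))" using mem pos by (force simp: pmf_positive_iff)
  moreover have "law (Suc j) = map_pmf (\<lambda>\<omega>. (src \<omega>, take (Suc j) (hist K \<omega>))) P" by (rule law_eq) (use j in simp)
  ultimately have "(s, h @ [m]) \<in> (\<lambda>\<omega>. (src \<omega>, take (Suc j) (hist K \<omega>))) ` set_pmf P" by (simp only: set_map_pmf)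
  then obtain \<omega> where w: "\<omega> \<in> set_pmf P" "s = src \<omega>" "h @ [m] = take (Suc j) (hist K \<omega>)" by blast
  have "take (Suc j) (hist K \<omega>) = take j (hist K \<omega>) @ [hist K \<omega> ! j]" using j by (intro take_Suc_conv_app_nth) simp
  hence hm: "h = take j (hist K \<omega>)" "m = hist K \<omega> ! j" using w(3) by auto
  have "mass P (\<lambda>\<omega>. (hist K \<omega> ! j, S p j \<omega>)) (m, S p j \<omega>) > 0" "mass P (S p j) (S p j \<omega>) > 0"
    using mass_pos[OF w(1), of "\<lambda>\<omega>. (hist K \<omega> ! j, S p j \<omega>)"] mass_pos[OF w(1), of "S p j"] hm by auto
  thus "pmf (\<tau> j p (bl3 p s) h) m > 0" unfolding w(2) hm(1) pmf_\<tau>[OF w(1) j] by simp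
qed

lemma expec_lr:
  assumes j: "j \<le> 2 * K"
  shows "expec (law (Suc j)) (lr j p) = cent P (\<lambda>\<omega>. hist K \<omega> ! j) (S p j) - cent P (\<lambda>\<omega>. hist K \<omega> ! j) (S (spk3 j) j)"
proof -
  let ?A = "\<lambda>\<omega>. hist K \<omega> ! j"
  let ?r = "\<lambda>p \<omega>. mass P (\<lambda>\<omega>. (?A \<omega>, S p j \<omega>)) (?A \<omega>, S p j \<omega>) / mass P (S p j) (S p j \<omega>)"
  have "law (Suc j) = map_pmf (\<lambda>\<omega>. (src \<omega>, take (Suc j) (hist K \<omega>))) P" by (rule law_eq) (use j in simp)
  hence "expec (law (Suc j)) (lr j p) = expec P (\<lambda>\<omega>. lr j p (src \<omega>, take (Suc j) (hist K \<omega>)))"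
    by (simp only: integral_map_pmf)
  also have "\<dots> = expec P (\<lambda>\<omega>. - log 2 (?r p \<omega>) - - log 2 (?r (spk3 j) \<omega>))"
  proof (rule expec_cong)
    fix \<omega> assume w: "\<omega> \<in> set_pmf P"
    have t: "take (Suc j) (hist K \<omega>) = take j (hist K \<omega>) @ [hist K \<omega> ! j]" using j by (intro take_Suc_conv_app_nth) simp
    have pos: "?r p \<omega> > 0" for p
      using mass_pos[OF w, of "\<lambda>\<omega>. (?A \<omega>, S p j \<omega>)"] mass_pos[OF w, of "S p j"] by simp
    have "lr j p (src \<omega>, take (Suc j) (hist K \<omega>)) = log 2 (?r (spk3 j) \<omega> / ?r p \<omega>)"
      unfolding lr_def t by (simp add: pmf_\<kappa>[OF w j] pmf_\<tau>[OF w j])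
    also have "\<dots> = - log 2 (?r p \<omega>) - - log 2 (?r (spk3 j) \<omega>)"
      using log_divide_pos[OF pos[of "spk3 j"] pos[of p]] by simp
    finally show "lr j p (src \<omega>, take (Suc j) (hist K \<omega>)) = - log 2 (?r p \<omega>) - - log 2 (?r (spk3 j) \<omega>)" .
  qed
  also have "\<dots> = cent P ?A (S p j) - cent P ?A (S (spk3 j) j)"
    unfolding cent_expec[OF fin] using fin by simp
  finally show ?thesis .
qed

definition cV where "cV k = cmi P oZ (\<lambda>\<omega>. oV \<omega> ! k) (\<lambda>\<omega>. (oX \<omega>, oU \<omega>, take k (oV \<omega>), take k (oW \<omega>)))"
definition cW where "cW k = cmi P oX (\<lambda>\<omega>. oW \<omega> ! k) (\<lambda>\<omega>. (oZ \<omega>, oU \<omega>, take (Suc k) (oV \<omega>), take k (oW \<omega>)))"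

definition I where "I j = (if j = 0 then cmi P oU oY oZ else if odd j then cV (j div 2) else cW (j div 2 - 1))"

text \<open>Here the form p(x,y) p(z|x) of the source is used: U is generated from Y, so summing
  over y leaves a function of (u, x) times p(z|x).\<close>

lemma markov_UXZ: "markov P oU oX oZ"
proof (rule markovI_factor[OF fin])
  let ?B = "\<lambda>\<omega>. (src \<omega>, take 0 (hist K \<omega>))" and ?f = "\<lambda>(s, h). (bl3 (spk3 0) s, h)"
  have m: "markov P (\<lambda>\<omega>. hist K \<omega> ! 0) (\<lambda>\<omega>. ?f (?B \<omega>)) ?B"
    using markov_round[of 0] unfolding S_def by simp
  fix u x z
  let ?k = "\<lambda>y. pmf (ker P (\<lambda>\<omega>. hist K \<omega> ! 0) (\<lambda>\<omega>. ?f (?B \<omega>)) ((undefined, y, undefined), [])) u"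
  have "mass P (\<lambda>\<omega>. (oU \<omega>, oX \<omega>, oZ \<omega>)) (u, x, z) = (\<Sum>y\<in>UNIV. mass P (\<lambda>\<omega>. (oY \<omega>, oU \<omega>, oX \<omega>, oZ \<omega>)) (y, u, x, z))"
    by (rule mass_sum_snd[symmetric]) (use fin in auto)
  also have "\<dots> = (\<Sum>y\<in>UNIV. pmf pxy (x, y) * ?k y * pmf (pzx x) z)"
  proof (rule sum.cong[OF refl])
    fix y
    have "mass P (\<lambda>\<omega>. (oY \<omega>, oU \<omega>, oX \<omega>, oZ \<omega>)) (y, u, x, z) = mass P (\<lambda>\<omega>. (?B \<omega>, hist K \<omega> ! 0)) (((x, y, z), []), u)"
      unfolding mass_eq by (rule prob_cong) (auto simp: src_def hist_nth)
    also have "\<dots> = mass P ?B ((x, y, z), []) * ?k y"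
      unfolding markov_bind_ker[OF m] pmf_bind_Pair by (simp add: bl3_def spk3_def)
    also have "mass P ?B ((x, y, z), []) = pmf (source pxy pzx) (x, y, z)"
      unfolding src_source[symmetric] mass_eq by (rule prob_cong) auto
    finally show "mass P (\<lambda>\<omega>. (oY \<omega>, oU \<omega>, oX \<omega>, oZ \<omega>)) (y, u, x, z) = pmf pxy (x, y) * ?k y * pmf (pzx x) z"
      by (simp add: pmf_source)
  qed
  also have "\<dots> = (\<Sum>y\<in>UNIV. pmf pxy (x, y) * ?k y) * pmf (pzx x) z" by (simp add: sum_distrib_right)
  finally show "mass P (\<lambda>\<omega>. (oU \<omega>, oX \<omega>, oZ \<omega>)) (u, x, z) = (\<Sum>y\<in>UNIV. pmf pxy (x, y) * ?k y) * pmf (pzx x) z" .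
qed

text \<open>Binning for a listener costs H(M|listener) - H(M|speaker). Giving the speaker the
  listener's side information as well turns this into the mutual information of the region and can
  only increase it. For the helper's message User X is covered by User Z's rate, since U - X - Z
  gives H(U|X) \<le> H(U|Z).\<close>

lemma I_bound:
  assumes j: "j < 2 * K + 1" and p: "p \<in> Pl3 j"
  shows "expec (law (Suc j)) (lr j p) \<le> I j"
proof -
  have j': "j \<le> 2 * K" using j by simp
  have "cent P (\<lambda>\<omega>. hist K \<omega> ! j) (S p j) - cent P (\<lambda>\<omega>. hist K \<omega> ! j) (S (spk3 j) j) \<le> I j" using j'
  proof (cases rule: round_cases)
    case 1
    have 0: "cent P (\<lambda>\<omega>. hist K \<omega> ! 0) (S 0 0) = cent P oU oY"
      by (rule cent_cong) (auto simp: S_def bl3_def src_def hist_nth)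
    have Z: "cent P (\<lambda>\<omega>. hist K \<omega> ! 0) (S 1 0) = cent P oU oZ"
      by (rule cent_cong) (auto simp: S_def bl3_def src_def hist_nth)
    have X: "cent P (\<lambda>\<omega>. hist K \<omega> ! 0) (S 2 0) = cent P oU oX"
      by (rule cent_cong) (auto simp: S_def bl3_def src_def hist_nth)
    have "cent P oU oX = cent P oU (\<lambda>\<omega>. (oX \<omega>, oZ \<omega>))" using cent_markov[OF fin markov_UXZ] by simp
    also have "\<dots> \<le> cent P oU oZ" by (rule cent_mono[OF fin]) simp
    finally have XZ: "cent P oU oX \<le> cent P oU oZ" .
    have "cent P oU (\<lambda>\<omega>. (oY \<omega>, oZ \<omega>)) \<le> cent P oU oY" by (rule cent_mono[OF fin]) simp
    hence I: "cent P oU oZ - cent P oU oY \<le> I 0" by (simp add: I_def cmi_cent[OF fin])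
    have "p = 1 \<or> p = 2" using p by (auto simp: Pl3_def)
    moreover have "spk3 0 = 0" by (simp add: spk3_def)
    ultimately show ?thesis unfolding 1 using 0 Z X XZ I by auto
  next
    case (2 k)
    have kK: "k \<le> K" using 2 by simp
    have p2: "p = 2" "spk3 (2 * k + 1) = 1" using p by (auto simp: Pl3_def spk3_def 2)
    let ?V = "\<lambda>\<omega>. oV \<omega> ! k" and ?C = "\<lambda>\<omega>. (oX \<omega>, oU \<omega>, take k (oV \<omega>), take k (oW \<omega>))"
    have a: "cent P (\<lambda>\<omega>. hist K \<omega> ! (2 * k + 1)) (S 2 (2 * k + 1)) = cent P ?V ?C"
      by (rule cent_cong) (simp_all only: S_eq_odd[OF _ _ kK] hist_nth(2)[OF 2(1)] bl3_src prod.inject simp_thms)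
    have b: "cent P (\<lambda>\<omega>. hist K \<omega> ! (2 * k + 1)) (S 1 (2 * k + 1)) = cent P ?V (\<lambda>\<omega>. (oZ \<omega>, oU \<omega>, take k (oV \<omega>), take k (oW \<omega>)))"
      by (rule cent_cong) (simp_all only: S_eq_odd[OF _ _ kK] hist_nth(2)[OF 2(1)] bl3_src prod.inject simp_thms)
    have c: "cent P ?V (\<lambda>\<omega>. (oZ \<omega>, ?C \<omega>)) \<le> cent P ?V (\<lambda>\<omega>. (oZ \<omega>, oU \<omega>, take k (oV \<omega>), take k (oW \<omega>)))"
      by (rule cent_mono[OF fin]) simp
    have "I (2 * k + 1) = cent P ?V ?C - cent P ?V (\<lambda>\<omega>. (oZ \<omega>, ?C \<omega>))"
      by (simp add: I_def cV_def cmi_cent'[OF fin])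
    thus ?thesis unfolding 2(2) p2 a b using c by linarith
  next
    case (3 k)
    have p2: "p = 1" "spk3 (2 * k + 2) = 2" using p by (auto simp: Pl3_def spk3_def 3)
    let ?V = "\<lambda>\<omega>. oW \<omega> ! k" and ?C = "\<lambda>\<omega>. (oZ \<omega>, oU \<omega>, take (Suc k) (oV \<omega>), take k (oW \<omega>))"
    have a: "cent P (\<lambda>\<omega>. hist K \<omega> ! (2 * k + 2)) (S 1 (2 * k + 2)) = cent P ?V ?C"
      by (rule cent_cong) (simp_all only: S_eq_even[OF _ _ 3(1)] hist_nth(3)[OF 3(1)] bl3_src prod.inject simp_thms)
    have b: "cent P (\<lambda>\<omega>. hist K \<omega> ! (2 * k + 2)) (S 2 (2 * k + 2)) = cent P ?V (\<lambda>\<omega>. (oX \<omega>, oU \<omega>, take (Suc k) (oV \<omega>), take k (oW \<omega>)))"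
      by (rule cent_cong) (simp_all only: S_eq_even[OF _ _ 3(1)] hist_nth(3)[OF 3(1)] bl3_src prod.inject simp_thms)
    have c: "cent P ?V (\<lambda>\<omega>. (oX \<omega>, ?C \<omega>)) \<le> cent P ?V (\<lambda>\<omega>. (oX \<omega>, oU \<omega>, take (Suc k) (oV \<omega>), take k (oW \<omega>)))"
      by (rule cent_mono[OF fin]) simp
    have "I (2 * k + 2) = cent P ?V ?C - cent P ?V (\<lambda>\<omega>. (oX \<omega>, ?C \<omega>))"
      by (simp add: I_def cW_def cmi_cent'[OF fin])
    thus ?thesis unfolding 3(2) p2 a b using c by linarith
  qed
  thus ?thesis unfolding expec_lr[OF j'] .
qed

lemma vs_ws_hist:
  assumes "\<omega> \<in> set_pmf P"
  shows "vs_of K (hist K \<omega>) = oV \<omega>" "ws_of K (hist K \<omega>) = oW \<omega>"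
  using len[OF assms] hist_nth(2,3)[of _ K \<omega>] by (auto simp: vs_of_def ws_of_def list_eq_iff_nth_eq)

theorem achievable_test_channel:
  fixes dx :: "'x \<Rightarrow> 'xh::finite \<Rightarrow> real" and dz :: "'z \<Rightarrow> 'zh::finite \<Rightarrow> real"
  assumes dx: "\<And>x xh. dx x xh \<ge> 0" and dz: "\<And>z zh. dz z zh \<ge> 0"
    and Dx: "expec P (\<lambda>\<omega>. dx (oX \<omega>) (xhat (oU \<omega>) (oW \<omega>) (oZ \<omega>))) \<le> Dx"
    and Dz: "expec P (\<lambda>\<omega>. dz (oZ \<omega>) (zhat (oU \<omega>) (oV \<omega>) (oX \<omega>))) \<le> Dz"
    and R: "Ry \<ge> cmi P oU oY oZ"
      "Rz \<ge> (\<Sum>k=1..K. cmi P oZ (\<lambda>\<omega>. oV \<omega> ! (k - 1))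
               (\<lambda>\<omega>. (oX \<omega>, oU \<omega>, take (k - 1) (oV \<omega>), take (k - 1) (oW \<omega>))))"
      "Rx \<ge> (\<Sum>k=1..K. cmi P oX (\<lambda>\<omega>. oW \<omega> ! (k - 1))
               (\<lambda>\<omega>. (oZ \<omega>, oU \<omega>, take k (oV \<omega>), take (k - 1) (oW \<omega>))))"
  shows "achievable pxy pzx dx dz K Dx Dz (Rx, Ry, Rz)"
proof (rule achievable_protocol[where I = I and xhat = xhat and zhat = zhat])
  have law: "law (2 * K + 1) = map_pmf (\<lambda>\<omega>. (src \<omega>, hist K \<omega>)) P"
    using law_eq[OF order_refl] by simp
  show "\<forall>j<2 * K + 1. consistent j" using all_consistent by simp
  show "expec (law (Suc j)) (lr j p) \<le> I j" if "j < 2 * K + 1" "p \<in> Pl3 j" for j p by (rule I_bound[OF that])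
  show "I j \<ge> 0" for j by (simp add: I_def cV_def cW_def cmi_nonneg[OF fin])
  have "expec (law (2 * K + 1)) (\<lambda>((x, y, z), h). dx x (xhat (h ! 0) (ws_of K h) z)) =
    expec P (\<lambda>\<omega>. dx (oX \<omega>) (xhat (oU \<omega>) (oW \<omega>) (oZ \<omega>)))"
    unfolding law integral_map_pmf by (rule expec_cong) (simp add: src_def vs_ws_hist hist_nth)
  thus "expec (law (2 * K + 1)) (\<lambda>((x, y, z), h). dx x (xhat (h ! 0) (ws_of K h) z)) \<le> Dx" using Dx by simp
  have "expec (law (2 * K + 1)) (\<lambda>((x, y, z), h). dz z (zhat (h ! 0) (vs_of K h) x)) =
    expec P (\<lambda>\<omega>. dz (oZ \<omega>) (zhat (oU \<omega>) (oV \<omega>) (oX \<omega>)))"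
    unfolding law integral_map_pmf by (rule expec_cong) (simp add: src_def vs_ws_hist hist_nth)
  thus "expec (law (2 * K + 1)) (\<lambda>((x, y, z), h). dz z (zhat (h ! 0) (vs_of K h) x)) \<le> Dz" using Dz by simp
  show "I 0 \<le> Ry" using R(1) by (simp add: I_def)
  have "(\<Sum>k=1..K. I (2 * k)) = (\<Sum>k=1..K. cmi P oX (\<lambda>\<omega>. oW \<omega> ! (k - 1))
               (\<lambda>\<omega>. (oZ \<omega>, oU \<omega>, take k (oV \<omega>), take (k - 1) (oW \<omega>))))"
    by (intro sum.cong refl) (simp add: I_def cW_def)
  thus "(\<Sum>k=1..K. I (2 * k)) \<le> Rx" using R(3) by simp
  have "(\<Sum>k=1..K. I (2 * k - 1)) = (\<Sum>k=1..K. cmi P oZ (\<lambda>\<omega>. oV \<omega> ! (k - 1))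
               (\<lambda>\<omega>. (oX \<omega>, oU \<omega>, take (k - 1) (oV \<omega>), take (k - 1) (oW \<omega>))))"
  proof (intro sum.cong refl)
    fix k assume "k \<in> {1..K}"
    then obtain k' where k: "k = Suc k'" by (cases k) auto
    have "2 * k - 1 = 2 * k' + 1" by (simp add: k)
    thus "I (2 * k - 1) = cmi P oZ (\<lambda>\<omega>. oV \<omega> ! (k - 1)) (\<lambda>\<omega>. (oX \<omega>, oU \<omega>, take (k - 1) (oV \<omega>), take (k - 1) (oW \<omega>)))"
      by (simp add: I_def cV_def k)
  qed
  thus "(\<Sum>k=1..K. I (2 * k - 1)) \<le> Rz" using R(2) by simp
qed (rule dx dz)+

end

theorem RK_achievable:
  fixes pxy :: "('x::finite \<times> 'y::finite) pmf" and pzx :: "'x \<Rightarrow> ('z::finite) pmf"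
    and dx :: "'x \<Rightarrow> ('xh::finite) \<Rightarrow> real" and dz :: "'z \<Rightarrow> ('zh::finite) \<Rightarrow> real"
  assumes dx: "\<forall>x xh. dx x xh \<ge> 0" and dz: "\<forall>z zh. dz z zh \<ge> 0"
    and R: "R \<in> region_RK pxy pzx dx dz K Dx Dz"
  shows "achievable pxy pzx dx dz K Dx Dz R"
proof -
  obtain Rx Ry Rz where RR: "R = (Rx, Ry, Rz)" by (cases R)
  obtain P xhat zhat where fin: "finite (set_pmf (P :: ('x, 'y, 'z) aux_outcome pmf))"
    and marg: "map_pmf (\<lambda>\<omega>. (oX \<omega>, oY \<omega>, oZ \<omega>)) P = source pxy pzx"
    and len: "\<forall>\<omega>\<in>set_pmf P. length (oV \<omega>) = K \<and> length (oW \<omega>) = K"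
    and mU: "markov P oU oY (\<lambda>\<omega>. (oX \<omega>, oZ \<omega>))"
    and mV: "\<forall>k\<in>{1..K}. markov P (\<lambda>\<omega>. oV \<omega> ! (k - 1))
           (\<lambda>\<omega>. (oZ \<omega>, oU \<omega>, take (k - 1) (oV \<omega>), take (k - 1) (oW \<omega>))) (\<lambda>\<omega>. (oX \<omega>, oY \<omega>))"
    and mW: "\<forall>k\<in>{1..K}. markov P (\<lambda>\<omega>. oW \<omega> ! (k - 1))
           (\<lambda>\<omega>. (oX \<omega>, oU \<omega>, take k (oV \<omega>), take (k - 1) (oW \<omega>))) (\<lambda>\<omega>. (oZ \<omega>, oY \<omega>))"
    and Dx: "expec P (\<lambda>\<omega>. dx (oX \<omega>) (xhat (oU \<omega>) (oW \<omega>) (oZ \<omega>))) \<le> Dx"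
    and Dz: "expec P (\<lambda>\<omega>. dz (oZ \<omega>) (zhat (oU \<omega>) (oV \<omega>) (oX \<omega>))) \<le> Dz"
    and rates: "Ry \<ge> cmi P oU oY oZ"
      "Rz \<ge> (\<Sum>k=1..K. cmi P oZ (\<lambda>\<omega>. oV \<omega> ! (k - 1))
               (\<lambda>\<omega>. (oX \<omega>, oU \<omega>, take (k - 1) (oV \<omega>), take (k - 1) (oW \<omega>))))"
      "Rx \<ge> (\<Sum>k=1..K. cmi P oX (\<lambda>\<omega>. oW \<omega> ! (k - 1))
               (\<lambda>\<omega>. (oZ \<omega>, oU \<omega>, take k (oV \<omega>), take (k - 1) (oW \<omega>))))"
    using R unfolding region_RK_def RR mem_Collect_eq prod.case by (elim exE conjE) (rule that)
  interpret test_channel P pxy pzx K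
  proof
    fix k assume k: "k < K"
    hence "Suc k \<in> {1..K}" by simp
    from mV[rule_format, OF this] mW[rule_format, OF this]
    show "markov P (\<lambda>\<omega>. oV \<omega> ! k) (\<lambda>\<omega>. (oZ \<omega>, oU \<omega>, take k (oV \<omega>), take k (oW \<omega>))) (\<lambda>\<omega>. (oX \<omega>, oY \<omega>))"
      "markov P (\<lambda>\<omega>. oW \<omega> ! k) (\<lambda>\<omega>. (oX \<omega>, oU \<omega>, take (Suc k) (oV \<omega>), take k (oW \<omega>))) (\<lambda>\<omega>. (oZ \<omega>, oY \<omega>))"
      by simp_all
  qed (use fin marg len mU in auto)
  show ?thesis unfolding RR
    by (rule achievable_test_channel[OF _ _ Dx Dz rates]) (use dx dz in auto)
qed

section \<open>The rate-distortion region in terms of splitting trees\<close>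

definition xlogx :: "real \<Rightarrow> real" where "xlogx t = t * log 2 t"

lemma continuous_on_xlogx: "continuous_on {0..} xlogx"
proof (clarsimp simp: continuous_on_eq_continuous_within)
  fix t :: real assume t: "t \<ge> 0"
  show "continuous (at t within {0..}) xlogx"
  proof (cases "t = 0")
    case False
    hence "isCont xlogx t" unfolding xlogx_def[abs_def] using t by (intro continuous_intros) auto
    thus ?thesis by (rule continuous_at_imp_continuous_at_within)
  next
    case True
    have "((\<lambda>t::real. t * log 2 t) \<longlongrightarrow> 0) (at_right 0)"
    proof (rule Lim_null_comparison)
      show "\<forall>\<^sub>F t in at_right 0. norm (t * log 2 t) \<le> 2 * sqrt t / ln 2"
        unfolding eventually_at_right_field
      proof (intro exI[of _ 1] conjI allI impI)
        fix t :: real assume t: "0 < t" "t < 1"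
        \<comment> \<open>The bound ln s \<le> s is taken at s = 1 / sqrt t: after multiplication by
          t a factor sqrt t remains, while s = 1 / t would leave a mere constant.\<close>
        have "ln (1 / sqrt t) \<le> 1 / sqrt t" using ln_le_minus_one[of "1 / sqrt t"] t by simp
        hence "- ln t \<le> 2 / sqrt t" using t by (simp add: ln_div ln_sqrt)
        hence "t * - ln t \<le> t * (2 / sqrt t)" using t by (intro mult_left_mono) auto
        also have "t * (2 / sqrt t) = 2 * (t / sqrt t)" by simp
        also have "t / sqrt t = sqrt t" using t by (intro real_div_sqrt) simp
        finally have "t * - ln t / ln 2 \<le> 2 * sqrt t / ln 2" by (intro divide_right_mono) auto
        moreover have "norm (t * log 2 t) = t * - ln t / ln 2"
          using t by (simp add: log_def abs_mult)
        ultimately show "norm (t * log 2 t) \<le> 2 * sqrt t / ln 2" by simp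
      qed simp
      have "((\<lambda>t. 2 * sqrt t / ln 2) \<longlongrightarrow> 2 * sqrt 0 / ln 2) (at_right 0)"
        by (intro tendsto_intros) auto
      thus "((\<lambda>t. 2 * sqrt t / ln 2) \<longlongrightarrow> 0) (at_right 0)" by simp
    qed
    moreover have "at 0 within {0..} = at_right (0::real)"
      by (rule at_within_nhd[of _ "UNIV"]) auto
    ultimately show ?thesis using True by (simp add: continuous_within xlogx_def[abs_def])
  qed
qed

text \<open>H(B|A) for an unnormalised joint mass. Since it is homogeneous of degree one,
  conditioning on a further variable amounts to summing over its values
  (\<open>cent_condH\<close>).\<close>

definition condH :: "('a::finite \<Rightarrow> 'b::finite \<Rightarrow> real) \<Rightarrow> real" where
  "condH q = (\<Sum>a\<in>UNIV. xlogx (\<Sum>b\<in>UNIV. q a b)) - (\<Sum>a\<in>UNIV. \<Sum>b\<in>UNIV. xlogx (q a b))"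

lemma continuous_on_condH:
  assumes "\<And>a b. continuous_on S (\<lambda>t. q t a b)" "\<And>t a b. t \<in> S \<Longrightarrow> q t a b \<ge> 0"
  shows "continuous_on S (\<lambda>t. condH (q t))"
  unfolding condH_def
proof (intro continuous_on_diff continuous_on_sum)
  show "continuous_on S (\<lambda>t. xlogx (\<Sum>b\<in>UNIV. q t a b))" for a
    by (rule continuous_on_compose2[OF continuous_on_xlogx continuous_on_sum[OF assms(1)]])
      (use assms(2) in \<open>auto intro!: sum_nonneg\<close>)
  show "continuous_on S (\<lambda>t. xlogx (q t a b))" for a b
    by (rule continuous_on_compose2[OF continuous_on_xlogx assms(1)]) (use assms(2) in auto)
qed

text \<open>Scaling inside \<open>xlogx\<close> produces an extra term linear in the argument, and
  these terms cancel between the two sums.\<close>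

lemma condH_scale:
  assumes "c \<ge> 0" "\<And>a b. q a b \<ge> 0"
  shows "condH (\<lambda>a b. c * q a b) = c * condH q"
proof (cases "c = 0")
  case False
  hence c: "c > 0" using assms by simp
  have x: "xlogx (c * t) = c * xlogx t + t * xlogx c" if "t \<ge> 0" for t
    using that c by (cases "t = 0") (auto simp: xlogx_def log_mult_pos algebra_simps)
  have "condH (\<lambda>a b. c * q a b) =
    (\<Sum>a\<in>UNIV. c * xlogx (\<Sum>b\<in>UNIV. q a b) + (\<Sum>b\<in>UNIV. q a b) * xlogx c) - (\<Sum>a\<in>UNIV. \<Sum>b\<in>UNIV. c * xlogx (q a b) + q a b * xlogx c)"
    unfolding condH_def sum_distrib_left[symmetric] using assms(2) by (simp add: x sum_nonneg)
  also have "\<dots> = c * condH q"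
    unfolding condH_def by (simp add: sum.distrib sum_distrib_left sum_distrib_right algebra_simps)
  finally show ?thesis .
qed (simp add: condH_def xlogx_def)

lemma ent_sum:
  assumes "finite S" "A ` set_pmf P \<subseteq> S"
  shows "ent P A = - (\<Sum>a\<in>S. xlogx (mass P A a))"
proof -
  have "ent P A = expec (map_pmf A P) (\<lambda>a. - log 2 (mass P A a))" by (simp add: ent_def)
  also have "\<dots> = (\<Sum>a\<in>S. mass P A a * - log 2 (mass P A a))" by (rule expec_sum) (use assms in auto)
  finally show ?thesis by (simp add: xlogx_def sum_negf)
qed

lemma cent_condH:
  fixes A :: "'o \<Rightarrow> 'a::finite" and B :: "'o \<Rightarrow> 'b::finite"
  assumes fin: "finite (set_pmf P)" and S: "finite S" "C ` set_pmf P \<subseteq> S"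
  shows "cent P B (\<lambda>\<omega>. (A \<omega>, C \<omega>)) = (\<Sum>c\<in>S. condH (\<lambda>a b. mass P (\<lambda>\<omega>. (A \<omega>, B \<omega>, C \<omega>)) (a, b, c)))"
proof -
  have m: "mass P (\<lambda>\<omega>. (B \<omega>, A \<omega>, C \<omega>)) (b, a, c) = mass P (\<lambda>\<omega>. (A \<omega>, B \<omega>, C \<omega>)) (a, b, c)" for a b c
    unfolding mass_eq by (rule prob_cong) auto
  have "ent P (\<lambda>\<omega>. (B \<omega>, A \<omega>, C \<omega>)) = - (\<Sum>t\<in>UNIV \<times> UNIV \<times> S. xlogx (mass P (\<lambda>\<omega>. (B \<omega>, A \<omega>, C \<omega>)) t))"
    by (rule ent_sum) (use S in auto)
  also have "(\<Sum>t\<in>UNIV \<times> UNIV \<times> S. xlogx (mass P (\<lambda>\<omega>. (B \<omega>, A \<omega>, C \<omega>)) t)) =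
    (\<Sum>b\<in>UNIV. \<Sum>a\<in>UNIV. \<Sum>c\<in>S. xlogx (mass P (\<lambda>\<omega>. (A \<omega>, B \<omega>, C \<omega>)) (a, b, c)))"
    unfolding m[symmetric] sum.cartesian_product by (rule sum.cong) auto
  also have "\<dots> = (\<Sum>a\<in>UNIV. \<Sum>b\<in>UNIV. \<Sum>c\<in>S. xlogx (mass P (\<lambda>\<omega>. (A \<omega>, B \<omega>, C \<omega>)) (a, b, c)))" by (rule sum.swap)
  also have "\<dots> = (\<Sum>a\<in>UNIV. \<Sum>c\<in>S. \<Sum>b\<in>UNIV. xlogx (mass P (\<lambda>\<omega>. (A \<omega>, B \<omega>, C \<omega>)) (a, b, c)))"
    by (intro sum.cong refl sum.swap)
  also have "\<dots> = (\<Sum>c\<in>S. \<Sum>a\<in>UNIV. \<Sum>b\<in>UNIV. xlogx (mass P (\<lambda>\<omega>. (A \<omega>, B \<omega>, C \<omega>)) (a, b, c)))" by (rule sum.swap)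
  finally have 1: "ent P (\<lambda>\<omega>. (B \<omega>, A \<omega>, C \<omega>)) = - (\<Sum>c\<in>S. \<Sum>a\<in>UNIV. \<Sum>b\<in>UNIV. xlogx (mass P (\<lambda>\<omega>. (A \<omega>, B \<omega>, C \<omega>)) (a, b, c)))" .
  have n: "mass P (\<lambda>\<omega>. (A \<omega>, C \<omega>)) (a, c) = (\<Sum>b\<in>UNIV. mass P (\<lambda>\<omega>. (A \<omega>, B \<omega>, C \<omega>)) (a, b, c))" for a c
  proof -
    have "mass P (\<lambda>\<omega>. (A \<omega>, C \<omega>)) (a, c) = (\<Sum>b\<in>UNIV. mass P (\<lambda>\<omega>. (B \<omega>, A \<omega>, C \<omega>)) (b, a, c))"
      by (rule mass_sum_snd[symmetric]) (use fin in auto)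
    thus ?thesis by (simp add: m)
  qed
  have "ent P (\<lambda>\<omega>. (A \<omega>, C \<omega>)) = - (\<Sum>t\<in>UNIV \<times> S. xlogx (mass P (\<lambda>\<omega>. (A \<omega>, C \<omega>)) t))"
    by (rule ent_sum) (use S in auto)
  also have "(\<Sum>t\<in>UNIV \<times> S. xlogx (mass P (\<lambda>\<omega>. (A \<omega>, C \<omega>)) t)) = (\<Sum>a\<in>UNIV. \<Sum>c\<in>S. xlogx (mass P (\<lambda>\<omega>. (A \<omega>, C \<omega>)) (a, c)))"
    unfolding sum.cartesian_product by (rule sum.cong) auto
  also have "\<dots> = (\<Sum>c\<in>S. \<Sum>a\<in>UNIV. xlogx (\<Sum>b\<in>UNIV. mass P (\<lambda>\<omega>. (A \<omega>, B \<omega>, C \<omega>)) (a, b, c)))"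
    unfolding n by (rule sum.swap)
  finally have 2: "ent P (\<lambda>\<omega>. (A \<omega>, C \<omega>)) = - (\<Sum>c\<in>S. \<Sum>a\<in>UNIV. xlogx (\<Sum>b\<in>UNIV. mass P (\<lambda>\<omega>. (A \<omega>, B \<omega>, C \<omega>)) (a, b, c)))" .
  show ?thesis unfolding cent_def 1 2 condH_def by (simp add: sum_subtractf)
qed

section \<open>Graphs of homogeneous functionals as closed cones\<close>

lemma closed_nonneg_vec: "closed {q :: real^'s::finite. \<forall>s. q $ s \<ge> 0}"
proof -
  have "{q :: real^'s. \<forall>s. q $ s \<ge> 0} = (\<Inter>s. {q. q $ s \<ge> 0})" by auto
  also have "closed \<dots>" by (intro closed_INT ballI closed_Collect_le continuous_intros)
  finally show ?thesis .
qed

lemma closed_graph_on: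
  fixes F :: "'a::metric_space \<Rightarrow> 'b::metric_space"
  assumes "closed S" "continuous_on S F"
  shows "closed {(q, r). q \<in> S \<and> r = F q}"
  unfolding closed_sequential_limits
proof (intro allI impI, elim conjE)
  fix X L assume X: "\<forall>n::nat. X n \<in> {(q, r). q \<in> S \<and> r = F q}" and lim: "X \<longlonglongrightarrow> L"
  have XS: "fst (X n) \<in> S" "snd (X n) = F (fst (X n))" for n using X[rule_format, of n] by (auto simp: case_prod_unfold)
  have f: "(\<lambda>n. fst (X n)) \<longlonglongrightarrow> fst L" and s: "(\<lambda>n. snd (X n)) \<longlonglongrightarrow> snd L"
    using lim by (auto intro: tendsto_fst tendsto_snd)
  have LS: "fst L \<in> S" by (rule closed_sequentially[OF assms(1) XS(1) f])
  have "(\<lambda>n. F (fst (X n))) \<longlonglongrightarrow> F (fst L)"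
    by (rule continuous_on_tendsto_compose[OF assms(2) f LS]) (use XS in auto)
  hence "snd L = F (fst L)" using s XS(2) LIMSEQ_unique by simp
  thus "L \<in> {(q, r). q \<in> S \<and> r = F q}" using LS by (auto simp: case_prod_unfold)
qed

text \<open>Continuity bounds \<open>F\<close> on the compact unit simplex, and homogeneity extends
  the bound.\<close>

lemma homogeneous_bound:
  fixes F :: "real^'s::finite \<Rightarrow> 'r::real_normed_vector"
  assumes cont: "continuous_on {q. \<forall>s. q $ s \<ge> 0} F"
    and hom: "\<And>c q. c \<ge> 0 \<Longrightarrow> \<forall>s. q $ s \<ge> 0 \<Longrightarrow> F (c *\<^sub>R q) = c *\<^sub>R F q"
  shows "\<exists>C\<ge>0. \<forall>q. (\<forall>s. q $ s \<ge> 0) \<longrightarrow> norm (F q) \<le> C * (\<Sum>s\<in>UNIV. q $ s)"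
proof -
  let ?S = "{q :: real^'s. (\<forall>s. q $ s \<ge> 0) \<and> (\<Sum>s\<in>UNIV. q $ s) = 1}"
  have "closed ?S"
    unfolding Collect_conj_eq by (intro closed_Int closed_nonneg_vec closed_Collect_eq continuous_intros)
  moreover have "bounded ?S"
    unfolding bounded_iff
  proof (intro exI[of _ 1] ballI)
    fix q assume q: "q \<in> ?S"
    have "norm q \<le> (\<Sum>s\<in>UNIV. \<bar>q $ s\<bar>)" by (rule norm_le_l1_cart)
    thus "norm q \<le> 1" using q by simp
  qed
  ultimately have "compact ?S" by (simp add: compact_eq_bounded_closed)
  hence "compact (F ` ?S)"
    by (rule compact_continuous_image[rotated]) (rule continuous_on_subset[OF cont], auto)
  hence "bounded (F ` ?S)" by (rule compact_imp_bounded)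
  then obtain C where C: "C > 0" "\<And>q. q \<in> ?S \<Longrightarrow> norm (F q) \<le> C" unfolding bounded_pos by auto
  have "norm (F q) \<le> C * (\<Sum>s\<in>UNIV. q $ s)" if q: "\<forall>s. q $ s \<ge> 0" for q
  proof (cases "(\<Sum>s\<in>UNIV. q $ s) = 0")
    case True
    hence "\<forall>s\<in>UNIV. q $ s = 0" using q by (subst (asm) sum_nonneg_eq_0_iff) auto
    hence "q = 0 *\<^sub>R q" by (simp add: vec_eq_iff)
    hence "F q = 0" using hom[of 0 q] q by (metis order_refl scale_zero_left)
    thus ?thesis using True by simp
  next
    case False
    let ?t = "\<Sum>s\<in>UNIV. q $ s"
    have t: "?t > 0" using False q sum_nonneg[of UNIV "\<lambda>s. q $ s"] by fastforce
    have "(1 / ?t) *\<^sub>R q \<in> ?S" using q t by (simp add: sum_divide_distrib[symmetric])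
    hence "norm (F ((1 / ?t) *\<^sub>R q)) \<le> C" by (rule C(2))
    moreover have "F ((1 / ?t) *\<^sub>R q) = (1 / ?t) *\<^sub>R F q" using hom[of "1 / ?t" q] q t by simp
    ultimately have "norm (F q) / ?t \<le> C" using t by simp
    thus ?thesis using t by (simp add: divide_le_eq)
  qed
  thus ?thesis using C(1) by (intro exI[of _ C]) auto
qed

lemma graph_admissible:
  fixes F :: "real^'s::finite \<Rightarrow> 'r::real_normed_vector"
  assumes cont: "continuous_on {q. \<forall>s. q $ s \<ge> 0} F"
    and hom: "\<And>c q. c \<ge> 0 \<Longrightarrow> \<forall>s. q $ s \<ge> 0 \<Longrightarrow> F (c *\<^sub>R q) = c *\<^sub>R F q"
  shows "\<exists>C. admissible C {(q, r). q \<in> {q. \<forall>s. q $ s \<ge> 0} \<and> r = F q}"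
proof -
  obtain C where C: "C \<ge> 0" "\<forall>q. (\<forall>s. q $ s \<ge> 0) \<longrightarrow> norm (F q) \<le> C * (\<Sum>s\<in>UNIV. q $ s)"
    using homogeneous_bound[OF cont hom] by blast
  have "F 0 = 0" using hom[of 0 0] by simp
  hence "admissible C {(q, r). q \<in> {q. \<forall>s. q $ s \<ge> 0} \<and> r = F q}"
    unfolding admissible_def using C closed_graph_on[OF closed_nonneg_vec cont] hom by auto
  thus ?thesis ..
qed

lemma admissible_mono: "admissible C G \<Longrightarrow> C \<le> C' \<Longrightarrow> admissible C' G"
  unfolding admissible_def
  by (auto intro!: order_trans[OF _ mult_right_mono[of C C']] sum_nonneg)

text \<open>There are finitely many pairs of single-letter decoders, so a free choice of decoders at
  a leaf is a finite union of graphs.\<close>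

lemma admissible_Un:
  assumes "finite J" "J \<noteq> {}" "\<And>j. j \<in> J \<Longrightarrow> \<exists>C. admissible C (G j)"
  shows "\<exists>C. admissible C (\<Union>j\<in>J. G j)"
proof -
  obtain C where C: "\<And>j. j \<in> J \<Longrightarrow> admissible (C j) (G j)" using assms(3) by metis
  have "admissible (Max (C ` J)) (G j)" if "j \<in> J" for j
    by (rule admissible_mono[OF C[OF that]]) (use assms that in auto)
  hence *: "\<And>j. j \<in> J \<Longrightarrow> admissible (Max (C ` J)) (G j)" .
  have "admissible (Max (C ` J)) (\<Union>j\<in>J. G j)"
    unfolding admissible_def
  proof (intro conjI allI impI)
    show "closed (\<Union>j\<in>J. G j)" using assms(1) admissibleD(1)[OF *] by (intro closed_UN) auto
    show "(0, 0) \<in> (\<Union>j\<in>J. G j)" using assms(2) admissibleD(2)[OF *] by blast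
    fix q r assume "(q, r) \<in> (\<Union>j\<in>J. G j)"
    then obtain j where j: "j \<in> J" "(q, r) \<in> G j" by blast
    show "q $ s \<ge> 0" for s by (rule admissibleD(3)[OF *[OF j(1)] j(2)])
    show "norm r \<le> Max (C ` J) * (\<Sum>s\<in>UNIV. q $ s)" by (rule admissibleD(4)[OF *[OF j(1)] j(2)])
    fix c :: real assume "c \<ge> 0"
    from admissibleD(5)[OF *[OF j(1)] j(2) this] show "(c *\<^sub>R q, c *\<^sub>R r) \<in> (\<Union>j\<in>J. G j)" using j(1) by blast
  qed
  thus ?thesis ..
qed

section \<open>The cones of leaves, of message exchanges and of helper messages\<close>

locale rd_problem =
  fixes pxy :: "('x::finite \<times> 'y::finite) pmf" and pzx :: "'x \<Rightarrow> 'z::finite pmf"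
    and dx :: "'x \<Rightarrow> 'xh::finite \<Rightarrow> real" and dz :: "'z \<Rightarrow> 'zh::finite \<Rightarrow> real" and K :: nat
begin

definition pY :: "'y \<Rightarrow> real" where "pY y = pmf (map_pmf snd pxy) y"

text \<open>The conditional law of (X, Z) given \<open>y\<close>. Where \<open>pY y = 0\<close> it
  is zero by the convention for division, hence only the bound in \<open>sum_Wy\<close>.\<close>

definition Wy :: "'y \<Rightarrow> 'x \<times> 'z \<Rightarrow> real" where
  "Wy y = (\<lambda>(x, z). pmf (source pxy pzx) (x, y, z) / pY y)"

text \<open>The helper splits laws of Y, the users split laws of (X, Z); this linear map passes from
  one to the other.\<close>

definition Lm :: "real^'y \<Rightarrow> real^('x \<times> 'z)" where
  "Lm \<pi> = (\<chi> s. \<Sum>y\<in>UNIV. \<pi> $ y * Wy y s)"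

definition HZX :: "real^('x \<times> 'z) \<Rightarrow> real" where "HZX q = condH (\<lambda>x z. q $ (x, z))"
definition HXZ :: "real^('x \<times> 'z) \<Rightarrow> real" where "HXZ q = condH (\<lambda>z x. q $ (x, z))"
definition HY :: "real^'y \<Rightarrow> real" where "HY \<pi> = condH (\<lambda>z (x, y). \<pi> $ y * Wy y (x, z))"

text \<open>The payoffs at a leaf are \<open>H(Z|X)\<close>, \<open>H(X|Z)\<close> and the two distortions; \<open>Top\<close> prepends \<open>H(X,Y|Z)\<close>
  and \<open>H(X|Z)\<close> as they stand after the helper's message.\<close>

definition leafF :: "('z \<Rightarrow> 'xh) \<Rightarrow> ('x \<Rightarrow> 'zh) \<Rightarrow> real^('x \<times> 'z) \<Rightarrow> real \<times> real \<times> real \<times> real" where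
  "leafF xh zh q = (HZX q, HXZ q, \<Sum>s\<in>UNIV. q $ s * dx (fst s) (xh (snd s)), \<Sum>s\<in>UNIV. q $ s * dz (snd s) (zh (fst s)))"

definition Leaf :: "((real^('x \<times> 'z)) \<times> (real \<times> real \<times> real \<times> real)) set" where
  "Leaf = (\<Union>(xh, zh)\<in>UNIV. {(q, r). q \<in> {q. \<forall>s. q $ s \<ge> 0} \<and> r = leafF xh zh q})"

text \<open>Positions count the users' messages without the helper's: position \<open>0\<close>
  belongs to User Z, so the parity is opposite to that in \<open>spk3\<close>.\<close>

definition side :: "nat \<Rightarrow> 'x \<times> 'z \<Rightarrow> 'x + 'z" where
  "side i = (\<lambda>(x, z). if even i then Inr z else Inl x)"

definition Tr :: "((real^('x \<times> 'z)) \<times> (real \<times> real \<times> real \<times> real)) set" where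
  "Tr = tree side Leaf (2 * K)"

definition Top :: "((real^'y) \<times> (real \<times> real \<times> real \<times> real \<times> real \<times> real)) set" where
  "Top = {(\<pi>, (a, b, r)). (\<forall>y. \<pi> $ y \<ge> 0) \<and> a = HY \<pi> \<and> b = HXZ (Lm \<pi>) \<and> (Lm \<pi>, r) \<in> Tr}"

definition Rtop :: "((real^'y) \<times> (real \<times> real \<times> real \<times> real \<times> real \<times> real)) set" where
  "Rtop = refine (id :: 'y \<Rightarrow> 'y) Top"

lemma Wy_nonneg [simp]: "Wy y s \<ge> 0"
  by (simp add: Wy_def pY_def case_prod_unfold)

lemma pY_eq: "pY y = (\<Sum>s\<in>UNIV. pmf (source pxy pzx) (fst s, y, snd s))"
proof -
  have "pY y = (\<Sum>x\<in>UNIV. pmf pxy (x, y))"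
    unfolding pY_def using mass_sum_snd[of pxy UNIV fst snd y] by simp
  also have "\<dots> = (\<Sum>x\<in>UNIV. \<Sum>z\<in>UNIV. pmf pxy (x, y) * pmf (pzx x) z)"
    by (simp add: sum_distrib_left[symmetric] sum_pmf_eq_1)
  also have "\<dots> = (\<Sum>s\<in>UNIV. pmf (source pxy pzx) (fst s, y, snd s))"
    by (simp add: sum.cartesian_product pmf_source case_prod_unfold)
  finally show ?thesis .
qed

lemma pY_Wy: "pY y * Wy y (x, z) = pmf (source pxy pzx) (x, y, z)"
proof (cases "pY y = 0")
  case True
  hence "\<forall>s\<in>UNIV. pmf (source pxy pzx) (fst s, y, snd s) = 0"
    unfolding pY_eq by (subst (asm) sum_nonneg_eq_0_iff) auto
  from this[rule_format, of "(x, z)"] show ?thesis using True by simp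
qed (simp add: Wy_def)

lemma sum_Wy: "(\<Sum>s\<in>UNIV. Wy y s) \<le> 1"
proof (cases "pY y = 0")
  case True
  thus ?thesis by (simp add: Wy_def case_prod_unfold)
next
  case False
  have "(\<Sum>s\<in>UNIV. Wy y s) = (\<Sum>s\<in>UNIV. pmf (source pxy pzx) (fst s, y, snd s)) / pY y"
    by (simp add: Wy_def case_prod_unfold sum_divide_distrib)
  thus ?thesis using False unfolding pY_eq[symmetric] by simp
qed

lemma Lm_nonneg: "\<forall>y. \<pi> $ y \<ge> 0 \<Longrightarrow> Lm \<pi> $ s \<ge> 0"
  by (simp add: Lm_def sum_nonneg)

lemma Lm_scale: "Lm (c *\<^sub>R \<pi>) = c *\<^sub>R Lm \<pi>"
  by (simp add: Lm_def vec_eq_iff sum_distrib_left mult.assoc)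

lemma continuous_Lm: "continuous_on S Lm"
  unfolding Lm_def by (intro continuous_intros)

lemma sum_Lm:
  assumes "\<forall>y. \<pi> $ y \<ge> 0"
  shows "(\<Sum>s\<in>UNIV. Lm \<pi> $ s) \<le> (\<Sum>y\<in>UNIV. \<pi> $ y)"
proof -
  have "(\<Sum>s\<in>UNIV. Lm \<pi> $ s) = (\<Sum>y\<in>UNIV. \<Sum>s\<in>UNIV. \<pi> $ y * Wy y s)"
    unfolding Lm_def vec_lambda_beta by (rule sum.swap)
  also have "\<dots> = (\<Sum>y\<in>UNIV. \<pi> $ y * (\<Sum>s\<in>UNIV. Wy y s))" by (simp add: sum_distrib_left)
  also have "\<dots> \<le> (\<Sum>y\<in>UNIV. \<pi> $ y * 1)" using assms sum_Wy by (intro sum_mono mult_left_mono) auto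
  finally show ?thesis by simp
qed

lemma continuous_HZX: "continuous_on {q. \<forall>s. q $ s \<ge> 0} HZX"
  unfolding HZX_def by (rule continuous_on_condH) (auto intro!: continuous_intros)

lemma continuous_HXZ: "continuous_on {q. \<forall>s. q $ s \<ge> 0} HXZ"
  unfolding HXZ_def by (rule continuous_on_condH) (auto intro!: continuous_intros)

lemma continuous_HY: "continuous_on {q. \<forall>s. q $ s \<ge> 0} HY"
  unfolding HY_def by (rule continuous_on_condH) (auto simp: case_prod_unfold intro!: continuous_intros)

lemma scale_HZX: "c \<ge> 0 \<Longrightarrow> \<forall>s. q $ s \<ge> 0 \<Longrightarrow> HZX (c *\<^sub>R q) = c * HZX q"
  using condH_scale[of c "\<lambda>x z. q $ (x, z)"] by (simp add: HZX_def)

lemma scale_HXZ: "c \<ge> 0 \<Longrightarrow> \<forall>s. q $ s \<ge> 0 \<Longrightarrow> HXZ (c *\<^sub>R q) = c * HXZ q"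
  using condH_scale[of c "\<lambda>z x. q $ (x, z)"] by (simp add: HXZ_def)

lemma scale_HY: "c \<ge> 0 \<Longrightarrow> \<forall>s. q $ s \<ge> 0 \<Longrightarrow> HY (c *\<^sub>R q) = c * HY q"
  using condH_scale[of c "\<lambda>z xy. q $ snd xy * Wy (snd xy) (fst xy, z)"] by (simp add: HY_def case_prod_unfold mult.assoc)

lemma admissible_Leaf: "\<exists>C. admissible C Leaf"
  unfolding Leaf_def
proof (rule admissible_Un)
  fix j :: "('z \<Rightarrow> 'xh) \<times> ('x \<Rightarrow> 'zh)"
  obtain xh zh where j: "j = (xh, zh)" by (cases j)
  show "\<exists>C. admissible C (case j of (xh, zh) \<Rightarrow> {(q, r). q \<in> {q. \<forall>s. q $ s \<ge> 0} \<and> r = leafF xh zh q})"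
    unfolding j prod.case
  proof (rule graph_admissible)
    show "continuous_on {q. \<forall>s. q $ s \<ge> 0} (leafF xh zh)"
      unfolding leafF_def by (intro continuous_on_Pair continuous_HZX continuous_HXZ continuous_intros)
    show "leafF xh zh (c *\<^sub>R q) = c *\<^sub>R leafF xh zh q" if "c \<ge> 0" "\<forall>s. q $ s \<ge> 0" for c q
      using that by (simp add: leafF_def scale_HZX scale_HXZ sum_distrib_left mult.assoc)
  qed
qed auto

lemma admissible_Tr: "\<exists>C. admissible C Tr"
  using admissible_Leaf admissible_tree unfolding Tr_def by blast

text \<open>\<open>Lm\<close> is continuous and homogeneous and does not increase total mass, so the
  properties of \<open>Tr\<close> carry over to laws of Y; the two additional payoffs are continuous
  and homogeneous functions of the law.\<close>

lemma admissible_Top: "\<exists>C. admissible C Top"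
proof -
  obtain C where C: "admissible C Tr" using admissible_Tr by blast
  obtain C1 where C1: "C1 \<ge> 0" "\<forall>q. (\<forall>s. q $ s \<ge> 0) \<longrightarrow> norm (HY q) \<le> C1 * (\<Sum>s\<in>UNIV. q $ s)"
    using homogeneous_bound[OF continuous_HY] scale_HY by auto
  obtain C2 where C2: "C2 \<ge> 0" "\<forall>q. (\<forall>s. q $ s \<ge> 0) \<longrightarrow> norm (HXZ q) \<le> C2 * (\<Sum>s\<in>UNIV. q $ s)"
    using homogeneous_bound[OF continuous_HXZ] scale_HXZ by auto
  let ?N = "{q :: real^'y. \<forall>s. q $ s \<ge> 0}"
  let ?C = "C1 + C2 + \<bar>C\<bar>"
  have HL: "continuous_on ?N (\<lambda>\<pi>. HXZ (Lm \<pi>))"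
    by (rule continuous_on_compose2[OF continuous_HXZ continuous_Lm]) (auto intro: Lm_nonneg)
  have "closed Top"
    unfolding closed_sequential_limits
  proof (intro allI impI, elim conjE)
    fix X L assume X: "\<forall>n::nat. X n \<in> Top" and lim: "X \<longlonglongrightarrow> L"
    have X': "fst (X n) \<in> ?N" "fst (snd (X n)) = HY (fst (X n))" "fst (snd (snd (X n))) = HXZ (Lm (fst (X n)))"
      "(Lm (fst (X n)), snd (snd (snd (X n)))) \<in> Tr" for n
      using X[rule_format, of n] by (auto simp: Top_def case_prod_unfold)
    have f: "(\<lambda>n. fst (X n)) \<longlonglongrightarrow> fst L" using lim by (rule tendsto_fst)
    have LN: "fst L \<in> ?N" by (rule closed_sequentially[OF closed_nonneg_vec X'(1) f])
    have "(\<lambda>n. HY (fst (X n))) \<longlonglongrightarrow> HY (fst L)"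
      by (rule continuous_on_tendsto_compose[OF continuous_HY f LN]) (use X'(1) in auto)
    moreover have "(\<lambda>n. fst (snd (X n))) \<longlonglongrightarrow> fst (snd L)" by (intro tendsto_intros lim)
    ultimately have 1: "fst (snd L) = HY (fst L)" unfolding X'(2) by (rule LIMSEQ_unique[rotated])
    have "(\<lambda>n. HXZ (Lm (fst (X n)))) \<longlonglongrightarrow> HXZ (Lm (fst L))"
      by (rule continuous_on_tendsto_compose[OF HL f LN]) (use X'(1) in auto)
    moreover have "(\<lambda>n. fst (snd (snd (X n)))) \<longlonglongrightarrow> fst (snd (snd L))" by (intro tendsto_intros lim)
    ultimately have 2: "fst (snd (snd L)) = HXZ (Lm (fst L))" unfolding X'(3) by (rule LIMSEQ_unique[rotated])
    have "(\<lambda>n. (Lm (fst (X n)), snd (snd (snd (X n))))) \<longlonglongrightarrow> (Lm (fst L), snd (snd (snd L)))"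
    proof (intro tendsto_Pair)
      show "(\<lambda>n. Lm (fst (X n))) \<longlonglongrightarrow> Lm (fst L)"
        by (rule continuous_on_tendsto_compose[OF continuous_Lm[of UNIV] f]) auto
      show "(\<lambda>n. snd (snd (snd (X n)))) \<longlonglongrightarrow> snd (snd (snd L))" by (intro tendsto_intros lim)
    qed
    hence 3: "(Lm (fst L), snd (snd (snd L))) \<in> Tr"
      by (rule closed_sequentially[OF admissibleD(1)[OF C] X'(4)])
    show "L \<in> Top" using LN 1 2 3 by (auto simp: Top_def case_prod_unfold)
  qed
  moreover have "(0, 0) \<in> Top"
  proof -
    have "HY 0 = 0" using scale_HY[of 0 0] by simp
    moreover have "Lm 0 = 0" using Lm_scale[of 0 0] by simp
    moreover have "HXZ 0 = 0" using scale_HXZ[of 0 0] by simp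
    moreover have "(0, 0) \<in> Tr" by (rule admissibleD(2)[OF C])
    ultimately show ?thesis by (simp add: Top_def zero_prod_def)
  qed
  moreover have "norm r \<le> ?C * (\<Sum>s\<in>UNIV. \<pi> $ s)" if mem: "(\<pi>, r) \<in> Top" for \<pi> r
  proof -
    obtain a b t where r: "r = (a, b, t)" by (cases r)
    have m: "\<forall>y. \<pi> $ y \<ge> 0" "a = HY \<pi>" "b = HXZ (Lm \<pi>)" "(Lm \<pi>, t) \<in> Tr" using mem by (auto simp: Top_def r)
    let ?s = "\<Sum>s\<in>UNIV. \<pi> $ s"
    have L0: "\<forall>s. Lm \<pi> $ s \<ge> 0" using Lm_nonneg[OF m(1)] by blast
    have "norm r \<le> norm a + norm (b, t)" unfolding r by (rule norm_Pair_le)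
    also have "norm (b, t) \<le> norm b + norm t" by (rule norm_Pair_le)
    finally have "norm r \<le> norm a + (norm b + norm t)" by simp
    moreover have "norm a \<le> C1 * ?s" using C1(2) m by simp
    moreover have "norm b \<le> C2 * ?s"
    proof -
      have "norm b \<le> C2 * (\<Sum>s\<in>UNIV. Lm \<pi> $ s)" using C2(2) L0 m(3) by simp
      also have "\<dots> \<le> C2 * ?s" using sum_Lm[OF m(1)] C2(1) by (rule mult_left_mono)
      finally show ?thesis .
    qed
    moreover have "norm t \<le> \<bar>C\<bar> * ?s"
    proof -
      have "norm t \<le> C * (\<Sum>s\<in>UNIV. Lm \<pi> $ s)" by (rule admissibleD(4)[OF C m(4)])
      also have "\<dots> \<le> \<bar>C\<bar> * (\<Sum>s\<in>UNIV. Lm \<pi> $ s)" using L0 by (intro mult_right_mono sum_nonneg) auto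
      also have "\<dots> \<le> \<bar>C\<bar> * ?s" using sum_Lm[OF m(1)] by (rule mult_left_mono) simp
      finally show ?thesis .
    qed
    ultimately show ?thesis by (simp add: distrib_right)
  qed
  moreover have "\<forall>s. \<pi> $ s \<ge> 0" if "(\<pi>, r) \<in> Top" for \<pi> r using that by (auto simp: Top_def)
  moreover have "(c *\<^sub>R \<pi>, c *\<^sub>R r) \<in> Top" if mem: "(\<pi>, r) \<in> Top" and c: "c \<ge> 0" for \<pi> r c
  proof -
    obtain a b t where r: "r = (a, b, t)" by (cases r)
    have m: "\<forall>y. \<pi> $ y \<ge> 0" "a = HY \<pi>" "b = HXZ (Lm \<pi>)" "(Lm \<pi>, t) \<in> Tr" using mem by (auto simp: Top_def r)
    have L0: "\<forall>s. Lm \<pi> $ s \<ge> 0" using Lm_nonneg[OF m(1)] by blast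
    have "(c *\<^sub>R Lm \<pi>, c *\<^sub>R t) \<in> Tr" by (rule admissibleD(5)[OF C m(4) c])
    thus ?thesis using m c L0 by (simp add: Top_def r Lm_scale scale_HY scale_HXZ)
  qed
  ultimately have "admissible ?C Top" unfolding admissible_def by blast
  thus ?thesis ..
qed

end

section \<open>Test channels generated by trees\<close>

lemma run_snoc: "run \<kappa> (Suc j) s = bind_pmf (run \<kappa> j s) (\<lambda>h. map_pmf (\<lambda>m. h @ [m]) (\<kappa> h s))"
proof (induction j arbitrary: \<kappa>)
  case 0
  show ?case by (simp add: bind_return_pmf map_pmf_def)
next
  case (Suc j)
  have "run \<kappa> (Suc (Suc j)) s = bind_pmf (\<kappa> [] s) (\<lambda>m. map_pmf ((#) m) (run (\<lambda>h. \<kappa> (m # h)) (Suc j) s))" by simp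
  also have "\<dots> = bind_pmf (\<kappa> [] s) (\<lambda>m. map_pmf ((#) m) (bind_pmf (run (\<lambda>h. \<kappa> (m # h)) j s) (\<lambda>h. map_pmf (\<lambda>k. h @ [k]) (\<kappa> (m # h) s))))"
    by (subst Suc) (rule refl)
  also have "\<dots> = bind_pmf (run \<kappa> (Suc j) s) (\<lambda>h. map_pmf (\<lambda>m. h @ [m]) (\<kappa> h s))"
    by (simp add: bind_assoc_pmf bind_map_pmf map_bind_pmf map_pmf_comp)
  finally show ?case .
qed

lemma length_run: "h \<in> set_pmf (run \<kappa> j s) \<Longrightarrow> length h = j"
  by (induction j arbitrary: \<kappa> h) auto

lemma take_run: "j \<le> n \<Longrightarrow> map_pmf (take j) (run \<kappa> n s) = run \<kappa> j s"
proof (induction n)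
  case (Suc n)
  show ?case
  proof (cases "j = Suc n")
    case True
    have "map_pmf (take j) (run \<kappa> j s) = map_pmf id (run \<kappa> j s)"
      by (rule map_pmf_cong) (auto dest: length_run)
    thus ?thesis using True by simp
  next
    case False
    hence j: "j \<le> n" using Suc.prems by simp
    have "map_pmf (take j) (run \<kappa> (Suc n) s) = bind_pmf (run \<kappa> n s) (\<lambda>h. map_pmf (\<lambda>m. take j (h @ [m])) (\<kappa> h s))"
      unfolding run_snoc by (simp add: map_bind_pmf map_pmf_comp)
    also have "\<dots> = bind_pmf (run \<kappa> n s) (\<lambda>h. return_pmf (take j h))"
      by (intro bind_pmf_cong refl) (use j in \<open>simp add: length_run\<close>)
    also have "\<dots> = map_pmf (take j) (run \<kappa> n s)" by (simp add: map_pmf_def)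
    finally show ?thesis using Suc.IH[OF j] by simp
  qed
qed simp

lemma pmf_run_snoc: "length g = j \<Longrightarrow> pmf (run \<kappa> (Suc j) s) (g @ [m]) = pmf (run \<kappa> j s) g * pmf (\<kappa> g s) m"
proof (induction g arbitrary: j \<kappa>)
  case Nil
  have "pmf (run \<kappa> (Suc 0) s) [m] = pmf (\<kappa> [] s) m * pmf (run (\<lambda>h. \<kappa> (m # h)) 0 s) []"
    by (simp only: run.simps(2) pmf_bind_Cons)
  thus ?case using Nil by simp
next
  case (Cons a g)
  then obtain j' where j: "j = Suc j'" "length g = j'" by auto
  have "pmf (run \<kappa> (Suc j) s) ((a # g) @ [m]) = pmf (\<kappa> [] s) a * pmf (run (\<lambda>h. \<kappa> (a # h)) (Suc j') s) (g @ [m])"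
    unfolding j by (simp only: run.simps(2) append_Cons pmf_bind_Cons)
  also have "\<dots> = pmf (\<kappa> [] s) a * (pmf (run (\<lambda>h. \<kappa> (a # h)) j' s) g * pmf (\<kappa> (a # g) s) m)"
    by (simp only: Cons.IH[OF j(2)])
  also have "\<dots> = pmf (run \<kappa> j s) (a # g) * pmf (\<kappa> (a # g) s) m"
    unfolding j by (simp only: run.simps(2) pmf_bind_Cons mult.assoc)
  finally show ?case .
qed

lemma words_snoc: "words N (Suc j) = (\<lambda>(g, m). g @ [m]) ` (words N j \<times> {..<N})"
proof
  show "words N (Suc j) \<subseteq> (\<lambda>(g, m). g @ [m]) ` (words N j \<times> {..<N})"
  proof
    fix h assume h: "h \<in> words N (Suc j)"
    hence "h \<noteq> []" by (auto simp: words_def)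
    hence e: "h = butlast h @ [last h]" by simp
    moreover have "butlast h \<in> words N j" using h by (auto simp: words_def dest: in_set_butlastD)
    moreover have "last h < N" using h last_in_set[OF \<open>h \<noteq> []\<close>] by (auto simp: words_def)
    ultimately show "h \<in> (\<lambda>(g, m). g @ [m]) ` (words N j \<times> {..<N})" by force
  qed
qed (auto simp: words_def)

lemma sum_words_snoc: "(\<Sum>h\<in>words N (Suc j). F h) = (\<Sum>g\<in>words N j. \<Sum>m<N. F (g @ [m]))"
proof -
  have "inj_on (\<lambda>(g, m). g @ [m]) (words N j \<times> {..<N})" by (auto simp: inj_on_def)
  thus ?thesis unfolding words_snoc by (simp add: sum.reindex sum.cartesian_product case_prod_unfold)
qed

text \<open>The data behind a point of \<open>Rtop\<close>: \<open>ku\<close> is the helper's kernel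
  and \<open>ks u\<close> the users' kernels after helper message \<open>u\<close>.
  \<open>K > 0\<close> ensures that V_K and W_K exist, from which the decoders read the
  history.\<close>

locale strategy = rd_problem pxy pzx dx dz K
  for pxy :: "('x::finite \<times> 'y::finite) pmf" and pzx :: "'x \<Rightarrow> 'z::finite pmf"
    and dx :: "'x \<Rightarrow> 'xh::finite \<Rightarrow> real" and dz :: "'z \<Rightarrow> 'zh::finite \<Rightarrow> real" and K +
  fixes ku :: "'y \<Rightarrow> nat pmf" and ks :: "nat \<Rightarrow> nat list \<Rightarrow> 'x \<times> 'z \<Rightarrow> nat pmf" and N M :: nat
  assumes ku_sub: "set_pmf (ku y) \<subseteq> {..<N}" and ks_sub: "set_pmf (ks u h s) \<subseteq> {..<M}" and M: "M > 0"
    and ks_side: "side (length h) s = side (length h) s' \<Longrightarrow> ks u h s = ks u h s'"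
    and K: "K > 0"
begin

definition chan :: "nat \<Rightarrow> (('x \<times> 'y \<times> 'z) \<times> nat \<times> nat list) pmf" where
  "chan j = bind_pmf (source pxy pzx) (\<lambda>s. map_pmf (Pair s)
     (bind_pmf (ku (fst (snd s))) (\<lambda>u. map_pmf (Pair u) (run (ks u) j (fst s, snd (snd s))))))"

abbreviation "P1 \<equiv> chan (2 * K)"

definition vX :: "('x \<times> 'y \<times> 'z) \<times> nat \<times> nat list \<Rightarrow> 'x" where "vX t = fst (fst t)"
definition vY :: "('x \<times> 'y \<times> 'z) \<times> nat \<times> nat list \<Rightarrow> 'y" where "vY t = fst (snd (fst t))"
definition vZ :: "('x \<times> 'y \<times> 'z) \<times> nat \<times> nat list \<Rightarrow> 'z" where "vZ t = snd (snd (fst t))"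
definition vU :: "('x \<times> 'y \<times> 'z) \<times> nat \<times> nat list \<Rightarrow> nat" where "vU t = fst (snd t)"
definition vH :: "('x \<times> 'y \<times> 'z) \<times> nat \<times> nat list \<Rightarrow> nat list" where "vH t = snd (snd t)"

lemmas v_defs = vX_def vY_def vZ_def vU_def vH_def

lemma pmf_chan: "pmf (chan j) ((x, y, z), u, h) = pmf (source pxy pzx) (x, y, z) * pmf (ku y) u * pmf (run (ks u) j (x, z)) h"
  unfolding chan_def pmf_bind_Pair by simp

lemma finite_ks [simp]: "finite (set_pmf (ks u h s))" by (rule finite_subset[OF ks_sub]) simp
lemma finite_ku [simp]: "finite (set_pmf (ku y))" by (rule finite_subset[OF ku_sub]) simp

lemma set_run_words: "set_pmf (run (ks u) j s) \<subseteq> words M j"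
  by (rule set_run) (rule ks_sub)

lemma finite_run [simp]: "finite (set_pmf (run (ks u) j s))"
  by (rule finite_subset[OF set_run_words]) simp

lemma finite_chan [simp]: "finite (set_pmf (chan j))"
  unfolding chan_def by auto

lemma set_chan: "t \<in> set_pmf (chan j) \<Longrightarrow> vU t < N \<and> vH t \<in> words M j"
  using ku_sub set_run_words unfolding chan_def v_defs by fastforce

lemma chan_take:
  assumes "j \<le> n"
  shows "map_pmf (\<lambda>(s, u, h). (s, u, take j h)) (chan n) = chan j"
proof -
  have r: "run (ks u) j s = map_pmf (take j) (run (ks u) n s)" for u s
    by (rule take_run[OF assms, symmetric])
  show ?thesis unfolding chan_def r by (simp add: map_bind_pmf map_pmf_comp case_prod_unfold)
qed

definition \<pi> :: "nat \<Rightarrow> real^'y" where "\<pi> u = (\<chi> y. pY y * pmf (ku y) u)"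
definition qv :: "nat \<Rightarrow> nat \<Rightarrow> nat list \<Rightarrow> real^('x \<times> 'z)" where
  "qv j u h = (\<chi> s. Lm (\<pi> u) $ s * pmf (run (ks u) j s) h)"

lemma Lm_\<pi>: "Lm (\<pi> u) $ (x, z) = (\<Sum>y\<in>UNIV. pmf (source pxy pzx) (x, y, z) * pmf (ku y) u)"
  unfolding Lm_def \<pi>_def vec_lambda_beta pY_Wy[symmetric] by (intro sum.cong) (simp_all add: mult.assoc mult.left_commute)

lemma mass_XZUH:
  assumes "j \<le> 2 * K"
  shows "mass P1 (\<lambda>t. (vX t, vZ t, vU t, take j (vH t))) (x, z, u, h) = qv j u h $ (x, z)"
proof -
  have e: "mass P1 (\<lambda>t. (vY t, vX t, vZ t, vU t, take j (vH t))) (y, x, z, u, h) = pmf (chan j) ((x, y, z), u, h)" for y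
    unfolding chan_take[OF assms, symmetric] mass_eq
    by (rule prob_cong) (auto simp: v_defs)
  have "mass P1 (\<lambda>t. (vX t, vZ t, vU t, take j (vH t))) (x, z, u, h) = (\<Sum>y\<in>UNIV. mass P1 (\<lambda>t. (vY t, vX t, vZ t, vU t, take j (vH t))) (y, x, z, u, h))"
    by (rule mass_sum_snd[symmetric]) auto
  thus ?thesis unfolding e pmf_chan by (simp add: qv_def Lm_\<pi> sum_distrib_right)
qed

lemma qv_0: "qv 0 u [] = Lm (\<pi> u)"
  by (simp add: qv_def vec_eq_iff)

lemma mass_ZXYU: "mass P1 (\<lambda>t. (vZ t, (vX t, vY t), vU t)) (z, (x, y), u) = \<pi> u $ y * Wy y (x, z)"
proof -
  have "mass P1 (\<lambda>t. (vZ t, (vX t, vY t), vU t)) (z, (x, y), u) = pmf (chan 0) ((x, y, z), u, [])"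
    unfolding chan_take[of 0 "2 * K", symmetric, simplified] mass_eq
    by (rule prob_cong) (auto simp: v_defs)
  thus ?thesis by (simp add: pmf_chan \<pi>_def pY_Wy[symmetric])
qed

lemma expec_XZUH:
  assumes "j \<le> 2 * K"
  shows "expec P1 (\<lambda>t. F (vX t, vZ t) (vU t) (take j (vH t))) = (\<Sum>u<N. \<Sum>h\<in>words M j. \<Sum>s\<in>UNIV. qv j u h $ s * F s u h)"
proof -
  let ?V = "\<lambda>t. (vX t, vZ t, vU t, take j (vH t))"
  let ?S = "UNIV \<times> UNIV \<times> {..<N} \<times> words M j"
  have UNIV_prod: "(\<Sum>s\<in>UNIV. G s) = (\<Sum>x\<in>UNIV. \<Sum>z\<in>UNIV. G (x, z))" for G :: "'x \<times> 'z \<Rightarrow> real"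
    by (simp add: sum.cartesian_product)
  have "expec P1 (\<lambda>t. F (vX t, vZ t) (vU t) (take j (vH t))) = expec (map_pmf ?V P1) (\<lambda>(x, z, u, h). F (x, z) u h)" by simp
  also have "\<dots> = (\<Sum>t\<in>?S. mass P1 ?V t * (case t of (x, z, u, h) \<Rightarrow> F (x, z) u h))"
  proof (rule expec_sum)
    have "take j (vH t) \<in> words M j" if "t \<in> set_pmf P1" for t
      using set_chan[OF that] assms by (auto simp: words_def dest: in_set_takeD)
    thus "set_pmf (map_pmf ?V P1) \<subseteq> ?S" using set_chan by auto
  qed simp
  also have "\<dots> = (\<Sum>x\<in>UNIV. \<Sum>z\<in>UNIV. \<Sum>u<N. \<Sum>h\<in>words M j. qv j u h $ (x, z) * F (x, z) u h)"
    unfolding sum.cartesian_product by (rule sum.cong) (auto simp: mass_XZUH[OF assms])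
  also have "\<dots> = (\<Sum>s\<in>UNIV. \<Sum>u<N. \<Sum>h\<in>words M j. qv j u h $ s * F s u h)"
    unfolding UNIV_prod by (rule refl)
  also have "\<dots> = (\<Sum>u<N. \<Sum>s\<in>UNIV. \<Sum>h\<in>words M j. qv j u h $ s * F s u h)" by (rule sum.swap)
  also have "\<dots> = (\<Sum>u<N. \<Sum>h\<in>words M j. \<Sum>s\<in>UNIV. qv j u h $ s * F s u h)" by (intro sum.cong refl sum.swap)
  finally show ?thesis .
qed

lemma take_vH_full: "t \<in> set_pmf P1 \<Longrightarrow> take (2 * K) (vH t) = vH t"
  using set_chan[of t] by (simp add: words_def)

lemma cent_Z_leaf: "cent P1 vZ (\<lambda>t. (vX t, vU t, take (2 * K) (vH t))) = (\<Sum>u<N. \<Sum>h\<in>words M (2 * K). HZX (qv (2 * K) u h))"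
proof -
  have "cent P1 vZ (\<lambda>t. (vX t, vU t, take (2 * K) (vH t))) = (\<Sum>c\<in>{..<N} \<times> words M (2 * K).
     condH (\<lambda>x z. mass P1 (\<lambda>t. (vX t, vZ t, vU t, take (2 * K) (vH t))) (x, z, c)))"
    by (rule cent_condH) (use set_chan in \<open>auto simp: take_vH_full\<close>)
  also have "\<dots> = (\<Sum>u<N. \<Sum>h\<in>words M (2 * K). HZX (qv (2 * K) u h))"
    unfolding sum.cartesian_product by (rule sum.cong) (auto simp: mass_XZUH HZX_def)
  finally show ?thesis .
qed

lemma cent_X_leaf: "cent P1 vX (\<lambda>t. (vZ t, vU t, take (2 * K) (vH t))) = (\<Sum>u<N. \<Sum>h\<in>words M (2 * K). HXZ (qv (2 * K) u h))"
proof -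
  have m: "mass P1 (\<lambda>t. (vZ t, vX t, vU t, take (2 * K) (vH t))) (z, x, u, h) = qv (2 * K) u h $ (x, z)" for x z u h
    unfolding mass_XZUH[OF order_refl, symmetric] mass_eq by (rule prob_cong) auto
  have "cent P1 vX (\<lambda>t. (vZ t, vU t, take (2 * K) (vH t))) = (\<Sum>c\<in>{..<N} \<times> words M (2 * K).
     condH (\<lambda>z x. mass P1 (\<lambda>t. (vZ t, vX t, vU t, take (2 * K) (vH t))) (z, x, c)))"
    by (rule cent_condH) (use set_chan in \<open>auto simp: take_vH_full\<close>)
  also have "\<dots> = (\<Sum>u<N. \<Sum>h\<in>words M (2 * K). HXZ (qv (2 * K) u h))"
    unfolding sum.cartesian_product by (rule sum.cong) (auto simp: m HXZ_def)
  finally show ?thesis .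
qed

lemma cent_X_root: "cent P1 vX (\<lambda>t. (vZ t, vU t, take 0 (vH t))) = (\<Sum>u<N. HXZ (Lm (\<pi> u)))"
proof -
  have m: "mass P1 (\<lambda>t. (vZ t, vX t, vU t, take 0 (vH t))) (z, x, u, []) = Lm (\<pi> u) $ (x, z)" for x z u
    unfolding qv_0[symmetric] mass_XZUH[OF le0, symmetric] mass_eq by (rule prob_cong) auto
  have "cent P1 vX (\<lambda>t. (vZ t, vU t, take 0 (vH t))) = (\<Sum>c\<in>{..<N} \<times> {[]}.
     condH (\<lambda>z x. mass P1 (\<lambda>t. (vZ t, vX t, vU t, take 0 (vH t))) (z, x, c)))"
    by (rule cent_condH) (use set_chan in auto)
  also have "\<dots> = (\<Sum>u<N. HXZ (Lm (\<pi> u)))"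
    by (rule sum.reindex_bij_witness[of _ "\<lambda>u. (u, [])" fst]) (auto simp only: m HXZ_def fst_conv)
  finally show ?thesis .
qed

lemma cent_XY_U: "cent P1 (\<lambda>t. (vX t, vY t)) (\<lambda>t. (vZ t, vU t)) = (\<Sum>u<N. HY (\<pi> u))"
proof -
  have m: "mass P1 (\<lambda>t. (vZ t, (vX t, vY t), vU t)) (z, xy, u) = \<pi> u $ snd xy * Wy (snd xy) (fst xy, z)" for z xy u
    using mass_ZXYU[of z "fst xy" "snd xy" u] by simp
  have "cent P1 (\<lambda>t. (vX t, vY t)) (\<lambda>t. (vZ t, vU t)) = (\<Sum>u<N.
     condH (\<lambda>z xy. mass P1 (\<lambda>t. (vZ t, (vX t, vY t), vU t)) (z, xy, u)))"
    by (rule cent_condH) (use set_chan in auto)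
  also have "\<dots> = (\<Sum>u<N. HY (\<pi> u))"
    unfolding HY_def by (intro sum.cong refl arg_cong[of _ _ condH] ext) (simp add: m case_prod_unfold)
  finally show ?thesis .
qed

lemma source_P1: "map_pmf fst P1 = source pxy pzx"
  unfolding chan_def by (simp add: map_bind_pmf map_pmf_comp bind_return_pmf')

text \<open>The kernel is constant on each class of \<open>side j\<close> and may be evaluated at a
  representative; the joint mass is this kernel times the mass of the channel cut off after
  \<open>j\<close> messages.\<close>

lemma markov_step:
  assumes j: "j < 2 * K"
  shows "markov P1 (\<lambda>t. vH t ! j) (\<lambda>t. (side j (vX t, vZ t), vU t, take j (vH t))) fst"
proof (rule markovI_factor[where
    \<phi> = "\<lambda>m (c, u, g). pmf (ks u g (SOME s. side j s = c)) m" and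
    \<psi> = "\<lambda>(c, u, g) s. if side j (fst s, snd (snd s)) = c then pmf (chan j) (s, u, g) else 0"])
  fix m and b :: "('x + 'z) \<times> nat \<times> nat list" and s :: "'x \<times> 'y \<times> 'z"
  assume b: "b \<in> (\<lambda>t. (side j (vX t, vZ t), vU t, take j (vH t))) ` set_pmf P1"
  obtain x y z where s: "s = (x, y, z)" by (cases s)
  obtain c u g where bb: "b = (c, u, g)" by (cases b)
  have g: "length g = j" using b bb set_chan j by (fastforce simp: words_def)
  show "mass P1 (\<lambda>t. (vH t ! j, (side j (vX t, vZ t), vU t, take j (vH t)), fst t)) (m, b, s) =
    (case b of (c, u, g) \<Rightarrow> pmf (ks u g (SOME s. side j s = c)) m) *
    (case b of (c, u, g) \<Rightarrow> \<lambda>s. if side j (fst s, snd (snd s)) = c then pmf (chan j) (s, u, g) else 0) s"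
  proof (cases "side j (x, z) = c")
    case False
    have "mass P1 (\<lambda>t. (vH t ! j, (side j (vX t, vZ t), vU t, take j (vH t)), fst t)) (m, b, s) = prob P1 {}"
      unfolding mass_eq by (rule prob_cong) (use False in \<open>auto simp: bb s v_defs\<close>)
    thus ?thesis using False by (simp add: bb s)
  next
    case True
    have "mass P1 (\<lambda>t. (vH t ! j, (side j (vX t, vZ t), vU t, take j (vH t)), fst t)) (m, b, s) = pmf (chan (Suc j)) (s, u, g @ [m])"
      unfolding chan_take[of "Suc j" "2 * K", symmetric, OF Suc_leI[OF j]] mass_eq
    proof (rule prob_cong)
      fix t assume "t \<in> set_pmf P1"
      hence "length (vH t) = 2 * K" using set_chan by (auto simp: words_def)
      hence "take (Suc j) (vH t) = take j (vH t) @ [vH t ! j]" using j by (simp add: take_Suc_conv_app_nth)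
      thus "t \<in> {t. (vH t ! j, (side j (vX t, vZ t), vU t, take j (vH t)), fst t) = (m, b, s)} \<longleftrightarrow>
        t \<in> {t. (case t of (s, u, h) \<Rightarrow> (s, u, take (Suc j) h)) = (s, u, g @ [m])}"
        using True by (cases t) (auto simp: bb s v_defs)
    qed
    also have "\<dots> = pmf (chan j) (s, u, g) * pmf (ks u g (x, z)) m"
      unfolding s pmf_chan pmf_run_snoc[OF g] by simp
    also have "ks u g (x, z) = ks u g (SOME s. side j s = c)"
    proof (rule ks_side)
      show "side (length g) (x, z) = side (length g) (SOME s. side j s = c)"
        unfolding g using someI[of "\<lambda>s. side j s = c", OF True] True by simp
    qed
    finally show ?thesis using True by (simp add: bb s)
  qed
qed simp

lemma markov_U: "markov P1 vU vY (\<lambda>t. (vX t, vZ t))"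
proof (rule markovI_factor[where \<phi> = "\<lambda>u y. pmf (ku y) u" and \<psi> = "\<lambda>y (x, z). pmf (source pxy pzx) (x, y, z)"])
  fix u and y :: 'y and c :: "'x \<times> 'z"
  obtain x z where c: "c = (x, z)" by (cases c)
  have "mass P1 (\<lambda>t. (vU t, vY t, vX t, vZ t)) (u, y, c) = pmf (chan 0) ((x, y, z), u, [])"
    unfolding chan_take[of 0 "2 * K", symmetric, simplified] mass_eq c
    by (rule prob_cong) (auto simp: v_defs)
  thus "mass P1 (\<lambda>t. (vU t, vY t, vX t, vZ t)) (u, y, c) = pmf (ku y) u * (case c of (x, z) \<Rightarrow> pmf (source pxy pzx) (x, y, z))"
    by (simp add: pmf_chan c)
qed simp

end

section \<open>Auxiliary variables from message histories, and their rates\<close>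

lemma take_eq_take: "i \<le> j \<Longrightarrow> take j h = take j h' \<Longrightarrow> take i h = take i h'"
  by (metis min.absorb1 take_take)

text \<open>The encoded prefixes are nested, so a nonempty initial part of the list is determined by
  its last entry.\<close>

lemma take_encode:
  assumes "k \<le> K" "mono d"
  shows "take k (map (\<lambda>i. list_encode (take (d i) h)) [0..<K]) = take k (map (\<lambda>i. list_encode (take (d i) h')) [0..<K])
    \<longleftrightarrow> k = 0 \<or> take (d (k - 1)) h = take (d (k - 1)) h'"
proof -
  have "take k (map (\<lambda>i. list_encode (take (d i) h)) [0..<K]) = map (\<lambda>i. list_encode (take (d i) h)) [0..<k]" for h
    using assms by (simp add: take_map)
  hence "take k (map (\<lambda>i. list_encode (take (d i) h)) [0..<K]) = take k (map (\<lambda>i. list_encode (take (d i) h')) [0..<K])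
    \<longleftrightarrow> (\<forall>i<k. take (d i) h = take (d i) h')"
    by (auto simp: list_encode_eq)
  moreover have "(\<forall>i<k. take (d i) h = take (d i) h') \<longleftrightarrow> k = 0 \<or> take (d (k - 1)) h = take (d (k - 1)) h'"
  proof (cases k)
    case (Suc k')
    have "take (d i) h = take (d i) h'" if "i < k" "take (d k') h = take (d k') h'" for i
      by (rule take_eq_take[OF monoD[OF assms(2)] that(2)]) (use that Suc in simp)
    thus ?thesis using Suc by auto
  qed simp
  ultimately show ?thesis by blast
qed

context strategy
begin

text \<open>Each auxiliary variable records the whole message history up to its round, so that \<open>W\<^sub>K\<close> alone
  determines all messages.\<close>

definition Vf :: "nat list \<Rightarrow> nat list" where "Vf h = map (\<lambda>k. list_encode (take (2 * k + 1) h)) [0..<K]"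
definition Wf :: "nat list \<Rightarrow> nat list" where "Wf h = map (\<lambda>k. list_encode (take (2 * k + 2) h)) [0..<K]"

lemma length_Vf [simp]: "length (Vf h) = K" and length_Wf [simp]: "length (Wf h) = K"
  by (simp_all add: Vf_def Wf_def)

lemma nth_Vf: "k < K \<Longrightarrow> Vf h ! k = list_encode (take (2 * k + 1) h)" and nth_Wf: "k < K \<Longrightarrow> Wf h ! k = list_encode (take (2 * k + 2) h)"
  by (simp_all add: Vf_def Wf_def)

text \<open>For \<open>k = 0\<close> the truncated subtraction gives \<open>0\<close>, and both
  sides hold trivially.\<close>

lemma take_Vf: "k \<le> K \<Longrightarrow> take k (Vf h) = take k (Vf h') \<longleftrightarrow> take (2 * k - 1) h = take (2 * k - 1) h'"
  unfolding Vf_def by (cases k; subst take_encode) (auto simp: mono_def)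

lemma take_Wf: "k \<le> K \<Longrightarrow> take k (Wf h) = take k (Wf h') \<longleftrightarrow> take (2 * k) h = take (2 * k) h'"
  unfolding Wf_def by (cases k; subst take_encode) (auto simp: mono_def)

lemma take_VW: "k \<le> K \<Longrightarrow> take k (Vf h) = take k (Vf h') \<and> take k (Wf h) = take k (Wf h') \<longleftrightarrow> take (2 * k) h = take (2 * k) h'"
  using take_eq_take[of "2 * k - 1" "2 * k" h h'] by (auto simp: take_Vf take_Wf)

lemma take_SVW: "k < K \<Longrightarrow> take (Suc k) (Vf h) = take (Suc k) (Vf h') \<and> take k (Wf h) = take k (Wf h') \<longleftrightarrow> take (Suc (2 * k)) h = take (Suc (2 * k)) h'"
  using take_eq_take[of "2 * k" "Suc (2 * k)" h h'] by (auto simp: take_Vf take_Wf)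

definition rep :: "('x \<times> 'y \<times> 'z) \<times> nat \<times> nat list \<Rightarrow> ('x, 'y, 'z) aux_outcome" where
  "rep t = (vX t, vY t, vZ t, vU t, Vf (vH t), Wf (vH t))"

lemma rep_sel [simp]: "oX (rep t) = vX t" "oY (rep t) = vY t" "oZ (rep t) = vZ t" "oU (rep t) = vU t"
  "oV (rep t) = Vf (vH t)" "oW (rep t) = Wf (vH t)"
  by (simp_all add: rep_def oX_def oY_def oZ_def oU_def oV_def oW_def)

abbreviation "P2 \<equiv> map_pmf rep P1"

lemma cmi_rep: "cmi P2 A B C = cmi P1 (\<lambda>t. A (rep t)) (\<lambda>t. B (rep t)) (\<lambda>t. C (rep t))"
  by (simp add: cmi_def map_pmf_comp)

lemma markov_rep: "markov P2 A B C = markov P1 (\<lambda>t. A (rep t)) (\<lambda>t. B (rep t)) (\<lambda>t. C (rep t))"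
  by (simp add: markov_def map_pmf_comp)

lemma length_vH: "t \<in> set_pmf P1 \<Longrightarrow> length (vH t) = 2 * K"
  using set_chan by (auto simp: words_def)

lemma take_Suc_vH: "t \<in> set_pmf P1 \<Longrightarrow> j < 2 * K \<Longrightarrow> take (Suc j) (vH t) = take j (vH t) @ [vH t ! j]"
  using length_vH by (simp add: take_Suc_conv_app_nth)

lemma markov_V:
  assumes k: "k < K"
  shows "markov P2 (\<lambda>\<omega>. oV \<omega> ! k) (\<lambda>\<omega>. (oZ \<omega>, oU \<omega>, take k (oV \<omega>), take k (oW \<omega>))) (\<lambda>\<omega>. (oX \<omega>, oY \<omega>))"
  unfolding markov_rep rep_sel
proof (rule markov_cong[OF markov_step[of "2 * k"]])
  show "2 * k < 2 * K" using k by simp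
  fix t t' assume t: "t \<in> set_pmf P1" "t' \<in> set_pmf P1"
  show B: "(side (2 * k) (vX t, vZ t), vU t, take (2 * k) (vH t)) = (side (2 * k) (vX t', vZ t'), vU t', take (2 * k) (vH t')) \<longleftrightarrow>
      (vZ t, vU t, take k (Vf (vH t)), take k (Wf (vH t))) = (vZ t', vU t', take k (Vf (vH t')), take k (Wf (vH t')))"
    using take_VW[of k "vH t" "vH t'"] k by (auto simp: side_def)
  assume e: "(side (2 * k) (vX t, vZ t), vU t, take (2 * k) (vH t)) = (side (2 * k) (vX t', vZ t'), vU t', take (2 * k) (vH t'))"
  show "vH t ! (2 * k) = vH t' ! (2 * k) \<longleftrightarrow> Vf (vH t) ! k = Vf (vH t') ! k"
    using k e take_Suc_vH[OF t(1), of "2 * k"] take_Suc_vH[OF t(2), of "2 * k"] by (simp add: nth_Vf list_encode_eq)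
  show "fst t = fst t' \<longleftrightarrow> (vX t, vY t) = (vX t', vY t')"
    using e by (auto simp: side_def vX_def vY_def vZ_def prod_eq_iff)
qed

lemma markov_W:
  assumes k: "k < K"
  shows "markov P2 (\<lambda>\<omega>. oW \<omega> ! k) (\<lambda>\<omega>. (oX \<omega>, oU \<omega>, take (Suc k) (oV \<omega>), take k (oW \<omega>))) (\<lambda>\<omega>. (oZ \<omega>, oY \<omega>))"
  unfolding markov_rep rep_sel
proof (rule markov_cong[OF markov_step[of "Suc (2 * k)"]])
  show "Suc (2 * k) < 2 * K" using k by simp
  fix t t' assume t: "t \<in> set_pmf P1" "t' \<in> set_pmf P1"
  show B: "(side (Suc (2 * k)) (vX t, vZ t), vU t, take (Suc (2 * k)) (vH t)) = (side (Suc (2 * k)) (vX t', vZ t'), vU t', take (Suc (2 * k)) (vH t')) \<longleftrightarrow>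
      (vX t, vU t, take (Suc k) (Vf (vH t)), take k (Wf (vH t))) = (vX t', vU t', take (Suc k) (Vf (vH t')), take k (Wf (vH t')))"
    using take_SVW[of k "vH t" "vH t'"] k by (auto simp: side_def)
  assume e: "(side (Suc (2 * k)) (vX t, vZ t), vU t, take (Suc (2 * k)) (vH t)) = (side (Suc (2 * k)) (vX t', vZ t'), vU t', take (Suc (2 * k)) (vH t'))"
  show "vH t ! (Suc (2 * k)) = vH t' ! (Suc (2 * k)) \<longleftrightarrow> Wf (vH t) ! k = Wf (vH t') ! k"
    using k e take_Suc_vH[OF t(1), of "Suc (2 * k)"] take_Suc_vH[OF t(2), of "Suc (2 * k)"] by (simp add: nth_Wf list_encode_eq)
  show "fst t = fst t' \<longleftrightarrow> (vZ t, vY t) = (vZ t', vY t')"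
    using e by (auto simp: side_def vX_def vY_def vZ_def prod_eq_iff)
qed

text \<open>The term of V_k is at most the drop of H(Z | X, U, messages) over the whole stage,
  because the message of User X that follows can only lower this entropy further. The sum
  telescopes, and the starting value H(Z|X,U) is replaced by the larger H(Z|X), which does not
  involve the strategy.\<close>

lemma rate_V:
  "(\<Sum>k=1..K. cmi P2 oZ (\<lambda>\<omega>. oV \<omega> ! (k - 1)) (\<lambda>\<omega>. (oX \<omega>, oU \<omega>, take (k - 1) (oV \<omega>), take (k - 1) (oW \<omega>))))
    \<le> cent (source pxy pzx) (\<lambda>s. snd (snd s)) fst - (\<Sum>u<N. \<Sum>h\<in>words M (2 * K). HZX (qv (2 * K) u h))"
proof -
  define e where "e j = cent P1 vZ (\<lambda>t. (vX t, vU t, take j (vH t)))" for j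
  have "cmi P2 oZ (\<lambda>\<omega>. oV \<omega> ! k) (\<lambda>\<omega>. (oX \<omega>, oU \<omega>, take k (oV \<omega>), take k (oW \<omega>))) \<le> e (2 * k) - e (2 * Suc k)"
    if k: "k < K" for k
  proof -
    have lv: "(vX t, vU t, take k (Vf (vH t)), take k (Wf (vH t))) = (vX t', vU t', take k (Vf (vH t')), take k (Wf (vH t')))
      \<longleftrightarrow> (vX t, vU t, take (2 * k) (vH t)) = (vX t', vU t', take (2 * k) (vH t'))" for t t'
      using take_VW[of k "vH t" "vH t'"] k by auto
    have "cent P1 vZ (\<lambda>t. (vX t, vU t, take k (Vf (vH t)), take k (Wf (vH t)))) = e (2 * k)"
      unfolding e_def by (rule cent_cong) (simp_all only: lv)
    moreover have "e (2 * Suc k) \<le> cent P1 vZ (\<lambda>t. (Vf (vH t) ! k, vX t, vU t, take k (Vf (vH t)), take k (Wf (vH t))))"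
      unfolding e_def
    proof (rule cent_mono)
      fix t t' assume e: "(vX t, vU t, take (2 * Suc k) (vH t)) = (vX t', vU t', take (2 * Suc k) (vH t'))"
      have "take j (vH t) = take j (vH t')" if "j \<le> 2 * Suc k" for j
        by (rule take_eq_take[OF that]) (use e in simp)
      from this[of "2 * k"] this[of "Suc (2 * k)"]
      show "(Vf (vH t) ! k, vX t, vU t, take k (Vf (vH t)), take k (Wf (vH t))) = (Vf (vH t') ! k, vX t', vU t', take k (Vf (vH t')), take k (Wf (vH t')))"
        using e take_VW[of k "vH t" "vH t'"] k by (auto simp: nth_Vf)
    qed simp
    ultimately show ?thesis unfolding cmi_rep rep_sel by (simp add: cmi_cent)
  qed
  hence "(\<Sum>k<K. cmi P2 oZ (\<lambda>\<omega>. oV \<omega> ! k) (\<lambda>\<omega>. (oX \<omega>, oU \<omega>, take k (oV \<omega>), take k (oW \<omega>)))) \<le> (\<Sum>k<K. e (2 * k) - e (2 * Suc k))"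
    by (intro sum_mono) auto
  also have "\<dots> = e 0 - e (2 * K)" using sum_lessThan_telescope'[of "\<lambda>k. e (2 * k)" K] by simp
  also have "e 0 \<le> cent P1 vZ vX" unfolding e_def by (rule cent_mono) auto
  also have "cent P1 vZ vX = cent (map_pmf fst P1) (\<lambda>s. snd (snd s)) fst"
    unfolding cent_map vX_def vZ_def ..
  finally show ?thesis by (simp add: sum.atLeast1_atMost_eq source_P1 e_def cent_Z_leaf)
qed

text \<open>Telescoping as in \<open>rate_V\<close>, except that V_k joins the conditioning before
  W_k is charged, which again only lowers the entropy. The starting value H(X|Z,U) is kept:
  replacing it by H(X|Z) would charge User X for what the helper has already told User Z.\<close>

lemma rate_W:
  "(\<Sum>k=1..K. cmi P2 oX (\<lambda>\<omega>. oW \<omega> ! (k - 1)) (\<lambda>\<omega>. (oZ \<omega>, oU \<omega>, take k (oV \<omega>), take (k - 1) (oW \<omega>))))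
    \<le> (\<Sum>u<N. HXZ (Lm (\<pi> u))) - (\<Sum>u<N. \<Sum>h\<in>words M (2 * K). HXZ (qv (2 * K) u h))"
proof -
  define e where "e j = cent P1 vX (\<lambda>t. (vZ t, vU t, take j (vH t)))" for j
  have "cmi P2 oX (\<lambda>\<omega>. oW \<omega> ! k) (\<lambda>\<omega>. (oZ \<omega>, oU \<omega>, take (Suc k) (oV \<omega>), take k (oW \<omega>))) \<le> e (2 * k) - e (2 * Suc k)"
    if k: "k < K" for k
  proof -
    have "cent P1 vX (\<lambda>t. (vZ t, vU t, take (Suc k) (Vf (vH t)), take k (Wf (vH t)))) \<le> e (2 * k)"
      unfolding e_def
    proof (rule cent_mono)
      fix t t' assume "(vZ t, vU t, take (Suc k) (Vf (vH t)), take k (Wf (vH t))) = (vZ t', vU t', take (Suc k) (Vf (vH t')), take k (Wf (vH t')))"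
      thus "(vZ t, vU t, take (2 * k) (vH t)) = (vZ t', vU t', take (2 * k) (vH t'))"
        using take_Wf[of k "vH t" "vH t'"] k by simp
    qed simp
    moreover have "e (2 * Suc k) \<le> cent P1 vX (\<lambda>t. (Wf (vH t) ! k, vZ t, vU t, take (Suc k) (Vf (vH t)), take k (Wf (vH t))))"
      unfolding e_def
    proof (rule cent_mono)
      fix t t' assume e: "(vZ t, vU t, take (2 * Suc k) (vH t)) = (vZ t', vU t', take (2 * Suc k) (vH t'))"
      have "take j (vH t) = take j (vH t')" if "j \<le> 2 * Suc k" for j
        by (rule take_eq_take[OF that]) (use e in simp)
      from this[of "2 * k + 2"] this[of "Suc (2 * k)"]
      show "(Wf (vH t) ! k, vZ t, vU t, take (Suc k) (Vf (vH t)), take k (Wf (vH t))) = (Wf (vH t') ! k, vZ t', vU t', take (Suc k) (Vf (vH t')), take k (Wf (vH t')))"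
        using e take_SVW[of k "vH t" "vH t'"] k by (auto simp: nth_Wf)
    qed simp
    ultimately show ?thesis unfolding cmi_rep rep_sel by (simp add: cmi_cent)
  qed
  hence "(\<Sum>k<K. cmi P2 oX (\<lambda>\<omega>. oW \<omega> ! k) (\<lambda>\<omega>. (oZ \<omega>, oU \<omega>, take (Suc k) (oV \<omega>), take k (oW \<omega>)))) \<le> (\<Sum>k<K. e (2 * k) - e (2 * Suc k))"
    by (intro sum_mono) auto
  also have "\<dots> = e 0 - e (2 * K)" using sum_lessThan_telescope'[of "\<lambda>k. e (2 * k)" K] by simp
  finally show ?thesis unfolding e_def cent_X_leaf cent_X_root by (simp add: sum.atLeast1_atMost_eq)
qed

text \<open>I(U;Y|Z) is enlarged to I(U;X,Y|Z), at no cost since U is drawn from Y; the pair is what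
  the chain rule in \<open>rate_helper\<close> can handle.\<close>

lemma rate_U:
  "cmi P2 oU oY oZ \<le> cent (source pxy pzx) (\<lambda>s. (fst s, fst (snd s))) (\<lambda>s. snd (snd s)) - (\<Sum>u<N. HY (\<pi> u))"
proof -
  have "cmi P1 vU vY vZ \<le> cmi P1 vU (\<lambda>t. (vX t, vY t)) vZ"
  proof -
    have "cent P1 vU (\<lambda>t. ((vX t, vY t), vZ t)) \<le> cent P1 vU (\<lambda>t. (vY t, vZ t))"
      by (rule cent_mono) auto
    thus ?thesis by (simp add: cmi_cent)
  qed
  also have "\<dots> = cent P1 (\<lambda>t. (vX t, vY t)) vZ - cent P1 (\<lambda>t. (vX t, vY t)) (\<lambda>t. (vU t, vZ t))"
    by (simp add: cmi_cent')
  also have "cent P1 (\<lambda>t. (vX t, vY t)) (\<lambda>t. (vU t, vZ t)) = cent P1 (\<lambda>t. (vX t, vY t)) (\<lambda>t. (vZ t, vU t))"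
    by (rule cent_cong) auto
  also have "cent P1 (\<lambda>t. (vX t, vY t)) vZ = cent (map_pmf fst P1) (\<lambda>s. (fst s, fst (snd s))) (\<lambda>s. snd (snd s))"
    unfolding cent_map vX_def vY_def vZ_def ..
  finally show ?thesis unfolding cmi_rep rep_sel cent_XY_U source_P1 .
qed

lemma list_decode_last_Wf: "t \<in> set_pmf P1 \<Longrightarrow> list_decode (last (Wf (vH t))) = vH t"
  using K length_vH[of t] by (simp add: last_conv_nth Wf_def)

lemma list_decode_last_Vf: "list_decode (last (Vf h)) = take (2 * K - 1) h"
proof -
  have "Suc (2 * (K - 1)) = 2 * K - 1" using K by simp
  thus ?thesis using K by (simp add: last_conv_nth Vf_def)
qed

text \<open>The last message is not available to the decoder at User X, who sent it. He guesses the
  value that is best given his own letter.\<close>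

lemma ex_best_guess:
  obtains zg where "expec P1 (\<lambda>t. dz (vZ t) (zg (vU t) (take (2 * K - 1) (vH t)) (vX t)))
    \<le> (\<Sum>u<N. \<Sum>h\<in>words M (2 * K). \<Sum>s\<in>UNIV. qv (2 * K) u h $ s * dz (snd s) (zh u h (fst s)))"
proof -
  define J where "J = 2 * K - 1"
  have J: "Suc J = 2 * K" "odd J" using K by (auto simp: J_def)
  define c where "c u g x w = (\<Sum>z\<in>UNIV. qv J u g $ (x, z) * dz z (zh u (g @ [w]) x))" for u g x w
  define b where "b u g x = arg_min_on (c u g x) {..<M}" for u g x
  have b: "c u g x (b u g x) \<le> c u g x w" if "w < M" for u g x w
    unfolding b_def by (rule arg_min_least) (use that in auto)
  have UNIV_prod: "(\<Sum>s\<in>UNIV. G s) = (\<Sum>x\<in>UNIV. \<Sum>z\<in>UNIV. G (x, z))" for G :: "'x \<times> 'z \<Rightarrow> real"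
    by (simp add: sum.cartesian_product)
  have "expec P1 (\<lambda>t. dz (vZ t) (zh (vU t) (take J (vH t) @ [b (vU t) (take J (vH t)) (vX t)]) (vX t)))
    = (\<Sum>u<N. \<Sum>g\<in>words M J. \<Sum>s\<in>UNIV. qv J u g $ s * dz (snd s) (zh u (g @ [b u g (fst s)]) (fst s)))"
    by (subst expec_XZUH[where F = "\<lambda>s u g. dz (snd s) (zh u (g @ [b u g (fst s)]) (fst s))" and j = J, symmetric])
      (use J in auto)
  also have "\<dots> \<le> (\<Sum>u<N. \<Sum>g\<in>words M J. \<Sum>w<M. \<Sum>s\<in>UNIV. qv (2 * K) u (g @ [w]) $ s * dz (snd s) (zh u (g @ [w]) (fst s)))"
  proof (intro sum_mono)
    fix u g assume g: "g \<in> words M J"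
    hence l: "length g = J" by (simp add: words_def)
    \<comment> \<open>The last message sits at an odd position, so its kernel depends on
      \<open>x\<close> alone and comes out of the sum over \<open>z\<close>;
      \<open>undefined\<close> fills the place of the other letter.\<close>
    have q: "qv (2 * K) u (g @ [w]) $ (x, z) = qv J u g $ (x, z) * pmf (ks u g (x, undefined)) w" for x z w
    proof -
      have "ks u g (x, z) = ks u g (x, undefined)" by (rule ks_side) (simp add: l J side_def)
      thus ?thesis unfolding J(1)[symmetric] qv_def vec_lambda_beta pmf_run_snoc[OF l] by simp
    qed
    have "(\<Sum>s\<in>UNIV. qv J u g $ s * dz (snd s) (zh u (g @ [b u g (fst s)]) (fst s))) = (\<Sum>x\<in>UNIV. c u g x (b u g x))"
      by (simp add: UNIV_prod c_def)
    also have "\<dots> = (\<Sum>x\<in>UNIV. (\<Sum>w<M. pmf (ks u g (x, undefined)) w) * c u g x (b u g x))"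
      using ks_sub by (simp add: sum_pmf_eq_1)
    \<comment> \<open>For a fixed history and letter \<open>x\<close> the last message is drawn
      independently of Z, so its average distortion is at least that of the best choice.\<close>
    also have "\<dots> \<le> (\<Sum>x\<in>UNIV. \<Sum>w<M. pmf (ks u g (x, undefined)) w * c u g x w)"
      unfolding sum_distrib_right by (intro sum_mono mult_left_mono b) auto
    also have "\<dots> = (\<Sum>w<M. \<Sum>x\<in>UNIV. pmf (ks u g (x, undefined)) w * c u g x w)" by (rule sum.swap)
    also have "\<dots> = (\<Sum>w<M. \<Sum>s\<in>UNIV. qv (2 * K) u (g @ [w]) $ s * dz (snd s) (zh u (g @ [w]) (fst s)))"
      unfolding UNIV_prod c_def fst_conv snd_conv q sum_distrib_left by (simp add: mult_ac)
    finally show "(\<Sum>s\<in>UNIV. qv J u g $ s * dz (snd s) (zh u (g @ [b u g (fst s)]) (fst s)))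
      \<le> (\<Sum>w<M. \<Sum>s\<in>UNIV. qv (2 * K) u (g @ [w]) $ s * dz (snd s) (zh u (g @ [w]) (fst s)))" .
  qed
  finally show ?thesis
    unfolding J_def[symmetric]
    by (intro that[of "\<lambda>u g x. zh u (g @ [b u g x]) x"]) (simp only: sum_words_snoc J(1)[symmetric] diff_Suc_1)
qed

theorem strategy_region:
  assumes "Ry \<ge> cent (source pxy pzx) (\<lambda>s. (fst s, fst (snd s))) (\<lambda>s. snd (snd s)) - (\<Sum>u<N. HY (\<pi> u))"
    and "Rx \<ge> (\<Sum>u<N. HXZ (Lm (\<pi> u))) - (\<Sum>u<N. \<Sum>h\<in>words M (2 * K). HXZ (qv (2 * K) u h))"
    and "Rz \<ge> cent (source pxy pzx) (\<lambda>s. snd (snd s)) fst - (\<Sum>u<N. \<Sum>h\<in>words M (2 * K). HZX (qv (2 * K) u h))"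
    and "Dx \<ge> (\<Sum>u<N. \<Sum>h\<in>words M (2 * K). \<Sum>s\<in>UNIV. qv (2 * K) u h $ s * dx (fst s) (xh u h (snd s)))"
    and "Dz \<ge> (\<Sum>u<N. \<Sum>h\<in>words M (2 * K). \<Sum>s\<in>UNIV. qv (2 * K) u h $ s * dz (snd s) (zh u h (fst s)))"
  shows "(Rx, Ry, Rz) \<in> region_RK pxy pzx dx dz K Dx Dz"
proof -
  obtain zg where zg: "expec P1 (\<lambda>t. dz (vZ t) (zg (vU t) (take (2 * K - 1) (vH t)) (vX t)))
    \<le> (\<Sum>u<N. \<Sum>h\<in>words M (2 * K). \<Sum>s\<in>UNIV. qv (2 * K) u h $ s * dz (snd s) (zh u h (fst s)))"
    by (rule ex_best_guess)
  show ?thesis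
    unfolding region_RK_def mem_Collect_eq prod.case
  proof (rule exI[of _ P2], rule exI[of _ "\<lambda>u w z. xh u (list_decode (last w)) z"],
      rule exI[of _ "\<lambda>u v x. zg u (list_decode (last v)) x"], intro conjI ballI)
    show "finite (set_pmf P2)" by simp
    have "map_pmf (\<lambda>\<omega>. (oX \<omega>, oY \<omega>, oZ \<omega>)) P2 = map_pmf fst P1"
      by (simp add: map_pmf_comp vX_def vY_def vZ_def)
    thus "map_pmf (\<lambda>\<omega>. (oX \<omega>, oY \<omega>, oZ \<omega>)) P2 = source pxy pzx" by (simp add: source_P1)
    show "markov P2 oU oY (\<lambda>\<omega>. (oX \<omega>, oZ \<omega>))" unfolding markov_rep rep_sel by (rule markov_U)
    show "length (oV \<omega>) = K" "length (oW \<omega>) = K" if "\<omega> \<in> set_pmf P2" for \<omega> using that by auto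
    fix k assume "k \<in> {1..K}"
    hence k: "k - 1 < K" "Suc (k - 1) = k" by auto
    show "markov P2 (\<lambda>\<omega>. oV \<omega> ! (k - 1)) (\<lambda>\<omega>. (oZ \<omega>, oU \<omega>, take (k - 1) (oV \<omega>), take (k - 1) (oW \<omega>))) (\<lambda>\<omega>. (oX \<omega>, oY \<omega>))"
      by (rule markov_V[OF k(1)])
    show "markov P2 (\<lambda>\<omega>. oW \<omega> ! (k - 1)) (\<lambda>\<omega>. (oX \<omega>, oU \<omega>, take k (oV \<omega>), take (k - 1) (oW \<omega>))) (\<lambda>\<omega>. (oZ \<omega>, oY \<omega>))"
      using markov_W[OF k(1)] unfolding k(2) .
  next
    have "expec P2 (\<lambda>\<omega>. dx (oX \<omega>) (xh (oU \<omega>) (list_decode (last (oW \<omega>))) (oZ \<omega>))) =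
      expec P1 (\<lambda>t. dx (fst (vX t, vZ t)) (xh (vU t) (take (2 * K) (vH t)) (snd (vX t, vZ t))))"
      unfolding integral_map_pmf rep_sel by (rule expec_cong) (simp add: list_decode_last_Wf take_vH_full)
    also have "\<dots> = (\<Sum>u<N. \<Sum>h\<in>words M (2 * K). \<Sum>s\<in>UNIV. qv (2 * K) u h $ s * dx (fst s) (xh u h (snd s)))"
      by (rule expec_XZUH[where F = "\<lambda>s u h. dx (fst s) (xh u h (snd s))"]) simp
    also have "\<dots> \<le> Dx" by fact
    finally show "expec P2 (\<lambda>\<omega>. dx (oX \<omega>) (xh (oU \<omega>) (list_decode (last (oW \<omega>))) (oZ \<omega>))) \<le> Dx" .
    show "expec P2 (\<lambda>\<omega>. dz (oZ \<omega>) (zg (oU \<omega>) (list_decode (last (oV \<omega>))) (oX \<omega>))) \<le> Dz"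
      unfolding integral_map_pmf rep_sel list_decode_last_Vf using zg assms(5) by (rule order_trans)
    show "cmi P2 oU oY oZ \<le> Ry" using rate_U assms(1) by (rule order_trans)
    show "(\<Sum>k=1..K. cmi P2 oZ (\<lambda>\<omega>. oV \<omega> ! (k - 1)) (\<lambda>\<omega>. (oX \<omega>, oU \<omega>, take (k - 1) (oV \<omega>), take (k - 1) (oW \<omega>)))) \<le> Rz"
      using rate_V assms(3) by (rule order_trans)
    show "(\<Sum>k=1..K. cmi P2 oX (\<lambda>\<omega>. oW \<omega> ! (k - 1)) (\<lambda>\<omega>. (oZ \<omega>, oU \<omega>, take k (oV \<omega>), take (k - 1) (oW \<omega>)))) \<le> Rx"
      using rate_W assms(2) by (rule order_trans)
  qed
qed

end

section \<open>From points of the cone to the single-letter region\<close>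

context rd_problem
begin

lemma leafF_0: "leafF xh zh 0 = 0"
  using scale_HZX[of 0 0] scale_HXZ[of 0 0] by (simp add: leafF_def zero_prod_def)

lemma Leaf_iff: "(q, r) \<in> Leaf \<longleftrightarrow> (\<forall>s. q $ s \<ge> 0) \<and> (\<exists>xh zh. r = leafF xh zh q)"
  unfolding Leaf_def by auto

lemma Tr_strategy:
  assumes "(q, r) \<in> Tr"
  shows "\<exists>M \<kappa> xh zh. M > 0 \<and> (\<forall>h s. set_pmf (\<kappa> h s) \<subseteq> {..<M}) \<and>
    (\<forall>h s s'. side (length h) s = side (length h) s' \<longrightarrow> \<kappa> h s = \<kappa> h s') \<and>
    r = (\<Sum>h\<in>words M (2 * K). leafF (xh h) (zh h) (\<chi> s. q $ s * pmf (run \<kappa> (2 * K) s) h))"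
proof -
  obtain C where C: "admissible C Leaf" using admissible_Leaf by blast
  obtain M \<kappa> lf where t: "M > 0" "\<forall>h s. set_pmf (\<kappa> h s) \<subseteq> {..<M}"
    "\<forall>h s s'. side (length h) s = side (length h) s' \<longrightarrow> \<kappa> h s = \<kappa> h s'"
    "\<forall>h\<in>words M (2 * K). ((\<chi> s. q $ s * pmf (run \<kappa> (2 * K) s) h), lf h) \<in> Leaf" "r = (\<Sum>h\<in>words M (2 * K). lf h)"
    using treeE[OF C assms[unfolded Tr_def]] by (elim exE conjE) (rule that)
  have "\<forall>h\<in>words M (2 * K). \<exists>d. lf h = leafF (fst d) (snd d) (\<chi> s. q $ s * pmf (run \<kappa> (2 * K) s) h)"
  proof
    fix h assume "h \<in> words M (2 * K)"
    with t(4) have "((\<chi> s. q $ s * pmf (run \<kappa> (2 * K) s) h), lf h) \<in> Leaf" by (rule bspec)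
    then obtain a b where "lf h = leafF a b (\<chi> s. q $ s * pmf (run \<kappa> (2 * K) s) h)"
      unfolding Leaf_iff by blast
    thus "\<exists>d. lf h = leafF (fst d) (snd d) (\<chi> s. q $ s * pmf (run \<kappa> (2 * K) s) h)"
      by (intro exI[of _ "(a, b)"]) simp
  qed
  from bchoice[OF this] obtain d where
    d: "\<forall>h\<in>words M (2 * K). lf h = leafF (fst (d h)) (snd (d h)) (\<chi> s. q $ s * pmf (run \<kappa> (2 * K) s) h)" ..
  have "r = (\<Sum>h\<in>words M (2 * K). leafF (fst (d h)) (snd (d h)) (\<chi> s. q $ s * pmf (run \<kappa> (2 * K) s) h))"
    unfolding t(5) by (rule sum.cong[OF refl]) (rule d[rule_format])
  with t(1-3) show ?thesis
    by (intro exI[of _ M] exI[of _ \<kappa>] exI[of _ "\<lambda>h. fst (d h)"] exI[of _ "\<lambda>h. snd (d h)"] conjI)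
qed

text \<open>The weights of the helper's splitting become \<open>ku\<close>, the tree below each
  piece becomes \<open>ks u\<close>, and its leaves provide the decoders, so the point unfolds into
  a strategy.\<close>

theorem Rtop_region:
  assumes K: "K > 0" and mem: "((\<chi> y. pY y), (a, b, hz, hx, \<delta>x, \<delta>z)) \<in> Rtop"
    and "Ry \<ge> cent (source pxy pzx) (\<lambda>s. (fst s, fst (snd s))) (\<lambda>s. snd (snd s)) - a"
    and "Rx \<ge> b - hx" and "Rz \<ge> cent (source pxy pzx) (\<lambda>s. snd (snd s)) fst - hz"
    and "Dx \<ge> \<delta>x" and "Dz \<ge> \<delta>z"
  shows "(Rx, Ry, Rz) \<in> region_RK pxy pzx dx dz K Dx Dz"
proof -
  obtain N qs rs g where sp: "\<forall>m<(N::nat). (qs m, rs m) \<in> Top" "\<forall>m<N. \<forall>s. g m s \<ge> (0::real)"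
    "\<forall>m<N. \<forall>s. qs m $ s = (\<chi> y. pY y) $ s * g m s"
    "\<forall>s. (\<Sum>m<N. g m s) = 1" "(a, b, hz, hx, \<delta>x, \<delta>z) = (\<Sum>m<N. rs m)"
    by (rule refineE[OF mem[unfolded Rtop_def]])
  have "\<exists>ku. \<forall>y. set_pmf (ku y) \<subseteq> {..<N} \<and> (\<forall>u<N. pmf (ku y) u = g u y)"
  proof (rule choice, rule allI)
    fix y
    show "\<exists>p. set_pmf p \<subseteq> {..<N} \<and> (\<forall>u<N. pmf p u = g u y)"
      using ex_pmf_of_weights[of "{..<N}" "\<lambda>u. g u y"] sp(2,4) by auto
  qed
  then obtain ku where ku: "\<And>y. set_pmf (ku y) \<subseteq> {..<N}" "\<And>y u. u < N \<Longrightarrow> pmf (ku y) u = g u y" by blast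
  define p where "p u = (\<chi> y. pY y * pmf (ku y) u)" for u
  have qs: "qs u = p u" if "u < N" for u
    using sp(3) ku(2) that by (simp add: p_def vec_eq_iff)
  define strat where "strat u t \<longleftrightarrow> (case t of (M, \<kappa>, xh, zh) \<Rightarrow> M > 0 \<and> (\<forall>h s. set_pmf (\<kappa> h s) \<subseteq> {..<M}) \<and>
    (\<forall>h s s'. side (length h) s = side (length h) s' \<longrightarrow> \<kappa> h s = \<kappa> h s') \<and>
    rs u = (HY (p u), HXZ (Lm (p u)), \<Sum>h\<in>words M (2 * K). leafF (xh h) (zh h) (\<chi> s. Lm (p u) $ s * pmf (run \<kappa> (2 * K) s) h)))" for u t
  have "\<exists>t. u < N \<longrightarrow> strat u t" for u
  proof (cases "u < N")
    case True
    hence "(p u, rs u) \<in> Top" using sp(1) qs by metis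
    then obtain r where r: "rs u = (HY (p u), HXZ (Lm (p u)), r)" "(Lm (p u), r) \<in> Tr" by (auto simp: Top_def)
    obtain M \<kappa> xh zh where k: "M > 0" "\<forall>h s. set_pmf (\<kappa> h s) \<subseteq> {..<M}"
      "\<forall>h s s'. side (length h) s = side (length h) s' \<longrightarrow> \<kappa> h s = \<kappa> h s'"
      "r = (\<Sum>h\<in>words M (2 * K). leafF (xh h) (zh h) (\<chi> s. Lm (p u) $ s * pmf (run \<kappa> (2 * K) s) h))"
      using Tr_strategy[OF r(2)] by (elim exE conjE) (rule that)
    have "strat u (M, \<kappa>, xh, zh)"
      unfolding strat_def prod.case r(1) by (intro conjI k(1-3)) (simp only: k(4))
    thus ?thesis by blast
  qed simp
  then obtain t where t: "\<And>u. u < N \<Longrightarrow> strat u (t u)" by metis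
  define Mu where "Mu u = fst (t u)" for u
  define ks where "ks u = (if u < N then fst (snd (t u)) else (\<lambda>_ _. return_pmf 0))" for u
  define xh where "xh u = fst (snd (snd (t u)))" for u
  define zh where "zh u = snd (snd (snd (t u)))" for u
  \<comment> \<open>One alphabet for the trees of all pieces. Words beyond a piece's own alphabet
    carry no mass there, and the leaf payoff of the zero law is zero.\<close>
  define M where "M = Suc (\<Sum>u<N. Mu u)"
  have tu: "\<forall>h s. set_pmf (ks u h s) \<subseteq> {..<Mu u}" "\<forall>h s s'. side (length h) s = side (length h) s' \<longrightarrow> ks u h s = ks u h s'"
    "rs u = (HY (p u), HXZ (Lm (p u)), \<Sum>h\<in>words (Mu u) (2 * K). leafF (xh u h) (zh u h) (\<chi> s. Lm (p u) $ s * pmf (run (ks u) (2 * K) s) h))"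
    if u: "u < N" for u
  proof -
    have "strat u (Mu u, ks u, xh u, zh u)" using t[OF u] u by (simp add: Mu_def ks_def xh_def zh_def)
    thus "\<forall>h s. set_pmf (ks u h s) \<subseteq> {..<Mu u}" "\<forall>h s s'. side (length h) s = side (length h) s' \<longrightarrow> ks u h s = ks u h s'"
      "rs u = (HY (p u), HXZ (Lm (p u)), \<Sum>h\<in>words (Mu u) (2 * K). leafF (xh u h) (zh u h) (\<chi> s. Lm (p u) $ s * pmf (run (ks u) (2 * K) s) h))"
      unfolding strat_def prod.case by - (elim conjE, assumption)+
  qed
  have Mu: "Mu u \<le> M" if "u < N" for u
    unfolding M_def by (rule le_SucI, rule member_le_sum) (use that in auto)
  interpret S: strategy pxy pzx dx dz K ku ks N M
  proof
    show "set_pmf (ku y) \<subseteq> {..<N}" for y by (rule ku(1))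
    show "set_pmf (ks u h s) \<subseteq> {..<M}" for u h s
    proof (cases "u < N")
      case True
      have "set_pmf (ks u h s) \<subseteq> {..<Mu u}" using tu(1)[OF True] by blast
      also have "\<dots> \<subseteq> {..<M}" using Mu[OF True] by auto
      finally show ?thesis .
    qed (simp add: ks_def M_def)
    show "ks u h s = ks u h s'" if "side (length h) s = side (length h) s'" for u h s s'
    proof (cases "u < N")
      case True
      show ?thesis using tu(2)[OF True] that by blast
    qed (simp add: ks_def)
    show "M > 0" by (simp add: M_def)
  qed (rule K)
  have p: "p = S.\<pi>" by (simp add: p_def S.\<pi>_def fun_eq_iff)
  have rs: "rs u = (HY (S.\<pi> u), HXZ (Lm (S.\<pi> u)), \<Sum>h\<in>words M (2 * K). leafF (xh u h) (zh u h) (S.qv (2 * K) u h))"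
    if u: "u < N" for u
  proof -
    have "(\<Sum>h\<in>words (Mu u) (2 * K). leafF (xh u h) (zh u h) (S.qv (2 * K) u h)) =
      (\<Sum>h\<in>words M (2 * K). leafF (xh u h) (zh u h) (S.qv (2 * K) u h))"
    proof (rule sum.mono_neutral_left)
      show "words (Mu u) (2 * K) \<subseteq> words M (2 * K)" by (rule words_mono[OF Mu[OF u]])
      show "\<forall>h\<in>words M (2 * K) - words (Mu u) (2 * K). leafF (xh u h) (zh u h) (S.qv (2 * K) u h) = 0"
      proof
        fix h assume h: "h \<in> words M (2 * K) - words (Mu u) (2 * K)"
        have "set_pmf (run (ks u) (2 * K) s) \<subseteq> words (Mu u) (2 * K)" for s
          by (rule set_run) (use tu(1)[OF u] in blast)
        hence "pmf (run (ks u) (2 * K) s) h = 0" for s using h unfolding set_pmf_iff[symmetric] pmf_eq_0_set_pmf by blast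
        hence "S.qv (2 * K) u h = 0" by (simp add: S.qv_def vec_eq_iff)
        thus "leafF (xh u h) (zh u h) (S.qv (2 * K) u h) = 0" by (simp add: leafF_0)
      qed
    qed simp
    thus ?thesis using tu(3)[OF u] unfolding p S.qv_def by simp
  qed
  have r: "(a, b, hz, hx, \<delta>x, \<delta>z) = (\<Sum>u<N. (HY (S.\<pi> u), HXZ (Lm (S.\<pi> u)), \<Sum>h\<in>words M (2 * K). leafF (xh u h) (zh u h) (S.qv (2 * K) u h)))"
    unfolding sp(5) by (rule sum.cong) (auto simp: rs)
  have "a = (\<Sum>u<N. HY (S.\<pi> u))" using arg_cong[OF r, of fst] by (simp add: fst_sum)
  moreover have "b = (\<Sum>u<N. HXZ (Lm (S.\<pi> u)))" using arg_cong[OF r, of "\<lambda>t. fst (snd t)"] by (simp add: fst_sum snd_sum)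
  moreover have "hz = (\<Sum>u<N. \<Sum>h\<in>words M (2 * K). HZX (S.qv (2 * K) u h))"
    using arg_cong[OF r, of "\<lambda>t. fst (snd (snd t))"] by (simp add: fst_sum snd_sum leafF_def)
  moreover have "hx = (\<Sum>u<N. \<Sum>h\<in>words M (2 * K). HXZ (S.qv (2 * K) u h))"
    using arg_cong[OF r, of "\<lambda>t. fst (snd (snd (snd t)))"] by (simp add: fst_sum snd_sum leafF_def)
  moreover have "\<delta>x = (\<Sum>u<N. \<Sum>h\<in>words M (2 * K). \<Sum>s\<in>UNIV. S.qv (2 * K) u h $ s * dx (fst s) (xh u h (snd s)))"
    using arg_cong[OF r, of "\<lambda>t. fst (snd (snd (snd (snd t))))"] by (simp add: fst_sum snd_sum leafF_def)
  moreover have "\<delta>z = (\<Sum>u<N. \<Sum>h\<in>words M (2 * K). \<Sum>s\<in>UNIV. S.qv (2 * K) u h $ s * dz (snd s) (zh u h (fst s)))"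
    using arg_cong[OF r, of "\<lambda>t. snd (snd (snd (snd (snd t))))"] by (simp add: fst_sum snd_sum leafF_def)
  ultimately show ?thesis using assms(3-7) by (intro S.strategy_region) simp_all
qed

end

section \<open>Converse\<close>

lemma ex_factor:
  assumes "\<And>\<omega> \<omega>'. \<omega> \<in> S \<Longrightarrow> \<omega>' \<in> S \<Longrightarrow> V \<omega> = V \<omega>' \<Longrightarrow> W \<omega> = W \<omega>'"
  shows "\<exists>f. \<forall>\<omega>\<in>S. W \<omega> = f (V \<omega>)"
proof (rule exI, rule ballI)
  fix \<omega> assume "\<omega> \<in> S"
  hence "(SOME \<omega>'. \<omega>' \<in> S \<and> V \<omega>' = V \<omega>) \<in> S \<and> V (SOME \<omega>'. \<omega>' \<in> S \<and> V \<omega>' = V \<omega>) = V \<omega>"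
    by (intro someI[of "\<lambda>\<omega>'. \<omega>' \<in> S \<and> V \<omega>' = V \<omega>" \<omega>]) simp
  thus "W \<omega> = (\<lambda>v. W (SOME \<omega>'. \<omega>' \<in> S \<and> V \<omega>' = v)) (V \<omega>)"
    using assms[OF \<open>\<omega> \<in> S\<close>] by simp
qed

lemma mass_if:
  assumes "\<And>\<omega>. \<omega> \<in> set_pmf P \<Longrightarrow> W \<omega> = w \<longleftrightarrow> Q \<and> V \<omega> = v"
  shows "mass P W w = (if Q then mass P V v else 0)"
proof (cases Q)
  case True
  thus ?thesis unfolding mass_eq if_P[OF True] by (intro prob_cong) (simp add: assms)
next
  case False
  have "prob P {\<omega>. W \<omega> = w} = prob P {}" by (rule prob_cong) (simp add: assms False)
  thus ?thesis using False unfolding mass_eq by simp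
qed

text \<open>If the mass of \<open>b\<close> vanishes, both sides are zero by the convention for
  division.\<close>

lemma markov_factor:
  assumes "markov P A B C"
  shows "mass P (\<lambda>\<omega>. (A \<omega>, B \<omega>, C \<omega>)) (a, b, c) =
    mass P (\<lambda>\<omega>. (A \<omega>, B \<omega>)) (a, b) / mass P B b * mass P (\<lambda>\<omega>. (B \<omega>, C \<omega>)) (b, c)"
proof (cases "mass P B b = 0")
  case True
  have "mass P (\<lambda>\<omega>. (A \<omega>, B \<omega>, C \<omega>)) (a, b, c) \<le> mass P B b"
    unfolding mass_eq by (rule prob_mono_supp) auto
  thus ?thesis using True pmf_nonneg[of "map_pmf (\<lambda>\<omega>. (A \<omega>, B \<omega>, C \<omega>)) P" "(a, b, c)"] by simp
next
  case False
  thus ?thesis using assms unfolding markov_def by (simp add: field_simps)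
qed

lemma markov_sym:
  assumes "markov P A B C"
  shows "markov P C B A"
proof (rule markovI_supp)
  fix \<omega> \<omega>'
  have "mass P (\<lambda>\<omega>. (A \<omega>, B \<omega>, C \<omega>)) (A \<omega>', B \<omega>, C \<omega>) * mass P B (B \<omega>) =
    mass P (\<lambda>\<omega>. (A \<omega>, B \<omega>)) (A \<omega>', B \<omega>) * mass P (\<lambda>\<omega>. (B \<omega>, C \<omega>)) (B \<omega>, C \<omega>)"
    using assms unfolding markov_def by blast
  thus "prob P {v. C v = C \<omega> \<and> B v = B \<omega> \<and> A v = A \<omega>'} * prob P {v. B v = B \<omega>} =
    prob P {v. C v = C \<omega> \<and> B v = B \<omega>} * prob P {v. B v = B \<omega> \<and> A v = A \<omega>'}"
    by (simp add: mass_eq conj_ac mult.commute)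
qed

text \<open>\<open>A'\<close> may depend on \<open>B\<close> as well as on \<open>A\<close>: summing
  the factorised mass over the values of \<open>A\<close> that yield \<open>a'\<close> keeps it
  factorised.\<close>

lemma markov_left:
  assumes fin: "finite (set_pmf P)" and m: "markov P A B C"
    and d: "\<And>\<omega> \<omega>'. \<omega> \<in> set_pmf P \<Longrightarrow> \<omega>' \<in> set_pmf P \<Longrightarrow> (B \<omega>, A \<omega>) = (B \<omega>', A \<omega>') \<Longrightarrow> A' \<omega> = A' \<omega>'"
  shows "markov P A' B C"
proof -
  obtain f where f: "\<forall>\<omega>\<in>set_pmf P. A' \<omega> = f (B \<omega>, A \<omega>)"
    using ex_factor[of "set_pmf P" "\<lambda>\<omega>. (B \<omega>, A \<omega>)" A'] d by blast
  let ?SA = "A ` set_pmf P"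
  let ?\<phi> = "\<lambda>a b. mass P (\<lambda>\<omega>. (A \<omega>, B \<omega>)) (a, b) / mass P B b"
  let ?\<psi> = "\<lambda>b c. mass P (\<lambda>\<omega>. (B \<omega>, C \<omega>)) (b, c)"
  show ?thesis
  proof (rule markovI_factor[OF fin, where \<phi> = "\<lambda>a' b. \<Sum>a\<in>?SA. if f (b, a) = a' then ?\<phi> a b else 0" and \<psi> = ?\<psi>])
    fix a' b c
    have "mass P (\<lambda>\<omega>. (A' \<omega>, B \<omega>, C \<omega>)) (a', b, c) = (\<Sum>a\<in>?SA. mass P (\<lambda>\<omega>. (A \<omega>, A' \<omega>, B \<omega>, C \<omega>)) (a, a', b, c))"
      by (rule mass_sum_snd[symmetric]) (use fin in auto)
    also have "\<dots> = (\<Sum>a\<in>?SA. if f (b, a) = a' then mass P (\<lambda>\<omega>. (A \<omega>, B \<omega>, C \<omega>)) (a, b, c) else 0)"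
      by (intro sum.cong refl mass_if) (use f in auto)
    also have "\<dots> = (\<Sum>a\<in>?SA. if f (b, a) = a' then ?\<phi> a b else 0) * ?\<psi> b c"
      unfolding sum_distrib_right markov_factor[OF m] by (intro sum.cong) auto
    finally show "mass P (\<lambda>\<omega>. (A' \<omega>, B \<omega>, C \<omega>)) (a', b, c) = (\<Sum>a\<in>?SA. if f (b, a) = a' then ?\<phi> a b else 0) * ?\<psi> b c" .
  qed
qed

lemma markov_right:
  assumes "finite (set_pmf P)" "markov P A B C"
    and "\<And>\<omega> \<omega>'. \<omega> \<in> set_pmf P \<Longrightarrow> \<omega>' \<in> set_pmf P \<Longrightarrow> (B \<omega>, C \<omega>) = (B \<omega>', C \<omega>') \<Longrightarrow> C' \<omega> = C' \<omega>'"
  shows "markov P A B C'"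
  by (rule markov_sym[OF markov_left[OF assms(1) markov_sym[OF assms(2)] assms(3)]])

text \<open>A quantity that one end computes from its own value and the condition may join the
  condition. This is how the messages of an interactive code are absorbed one by one.\<close>

lemma markov_extend:
  fixes B :: "'o \<Rightarrow> 'b" and M :: "'o \<Rightarrow> 'm"
  assumes fin: "finite (set_pmf P)" and m: "markov P A B C"
    and d: "\<And>\<omega> \<omega>'. \<omega> \<in> set_pmf P \<Longrightarrow> \<omega>' \<in> set_pmf P \<Longrightarrow> (B \<omega>, C \<omega>) = (B \<omega>', C \<omega>') \<Longrightarrow> M \<omega> = M \<omega>'"
  shows "markov P A (\<lambda>\<omega>. (B \<omega>, M \<omega>)) C"
proof -
  obtain f where f: "\<forall>\<omega>\<in>set_pmf P. M \<omega> = f (B \<omega>, C \<omega>)"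
    using ex_factor[of "set_pmf P" "\<lambda>\<omega>. (B \<omega>, C \<omega>)" M] d by blast
  show ?thesis
  proof (rule markovI_factor[OF fin, where \<phi> = "\<lambda>a b. mass P (\<lambda>\<omega>. (A \<omega>, B \<omega>)) (a, fst b) / mass P B (fst b)" and
      \<psi> = "\<lambda>b c. if f (fst b, c) = snd b then mass P (\<lambda>\<omega>. (B \<omega>, C \<omega>)) (fst b, c) else 0"])
    fix a and bm :: "'b \<times> 'm" and c
    obtain b k where bm: "bm = (b, k)" by (cases bm)
    have "mass P (\<lambda>\<omega>. (A \<omega>, (B \<omega>, M \<omega>), C \<omega>)) (a, (b, k), c) = (if f (b, c) = k then mass P (\<lambda>\<omega>. (A \<omega>, B \<omega>, C \<omega>)) (a, b, c) else 0)"
      by (rule mass_if) (use f in auto)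
    thus "mass P (\<lambda>\<omega>. (A \<omega>, (B \<omega>, M \<omega>), C \<omega>)) (a, bm, c) = mass P (\<lambda>\<omega>. (A \<omega>, B \<omega>)) (a, fst bm) / mass P B (fst bm) *
      (if f (fst bm, c) = snd bm then mass P (\<lambda>\<omega>. (B \<omega>, C \<omega>)) (fst bm, c) else 0)"
      unfolding markov_factor[OF m] bm by simp
  qed
qed

text \<open>Given \<open>B\<close>, the variable \<open>A\<close> is independent of
  \<open>C\<close>, so an estimate using \<open>C\<close> only randomises among estimates based on
  \<open>B\<close>, and the best of these is no worse.\<close>

lemma best_estimate:
  fixes d :: "'a \<Rightarrow> 'e::finite \<Rightarrow> real"
  assumes fin: "finite (set_pmf P)" and m: "markov P A B C"
  obtains xh where "expec P (\<lambda>\<omega>. d (A \<omega>) (xh (B \<omega>))) \<le> expec P (\<lambda>\<omega>. d (A \<omega>) (G (B \<omega>) (C \<omega>)))"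
proof -
  let ?SA = "A ` set_pmf P" and ?SB = "B ` set_pmf P" and ?SC = "C ` set_pmf P"
  let ?\<phi> = "\<lambda>a b. mass P (\<lambda>\<omega>. (A \<omega>, B \<omega>)) (a, b) / mass P B b"
  let ?\<psi> = "\<lambda>b c. mass P (\<lambda>\<omega>. (B \<omega>, C \<omega>)) (b, c)"
  have E: "expec P (\<lambda>\<omega>. F (A \<omega>) (B \<omega>) (C \<omega>)) = (\<Sum>b\<in>?SB. \<Sum>c\<in>?SC. ?\<psi> b c * (\<Sum>a\<in>?SA. ?\<phi> a b * F a b c))" for F
  proof -
    have "expec P (\<lambda>\<omega>. F (A \<omega>) (B \<omega>) (C \<omega>)) = expec (map_pmf (\<lambda>\<omega>. (A \<omega>, B \<omega>, C \<omega>)) P) (\<lambda>(a, b, c). F a b c)" by simp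
    also have "\<dots> = (\<Sum>t\<in>?SA \<times> ?SB \<times> ?SC. mass P (\<lambda>\<omega>. (A \<omega>, B \<omega>, C \<omega>)) t * (case t of (a, b, c) \<Rightarrow> F a b c))"
      by (rule expec_sum) (use fin in auto)
    also have "\<dots> = (\<Sum>a\<in>?SA. \<Sum>b\<in>?SB. \<Sum>c\<in>?SC. ?\<psi> b c * (?\<phi> a b * F a b c))"
      unfolding sum.cartesian_product by (rule sum.cong[OF refl]) (auto simp: markov_factor[OF m])
    also have "\<dots> = (\<Sum>b\<in>?SB. \<Sum>a\<in>?SA. \<Sum>c\<in>?SC. ?\<psi> b c * (?\<phi> a b * F a b c))" by (rule sum.swap)
    also have "\<dots> = (\<Sum>b\<in>?SB. \<Sum>c\<in>?SC. \<Sum>a\<in>?SA. ?\<psi> b c * (?\<phi> a b * F a b c))" by (intro sum.cong refl sum.swap)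
    finally show ?thesis by (simp only: sum_distrib_left)
  qed
  define xh where "xh b = arg_min_on (\<lambda>e. \<Sum>a\<in>?SA. ?\<phi> a b * d a e) UNIV" for b
  have xh: "(\<Sum>a\<in>?SA. ?\<phi> a b * d a (xh b)) \<le> (\<Sum>a\<in>?SA. ?\<phi> a b * d a e)" for b e
    unfolding xh_def by (rule arg_min_least) auto
  have "expec P (\<lambda>\<omega>. d (A \<omega>) (xh (B \<omega>))) \<le> expec P (\<lambda>\<omega>. d (A \<omega>) (G (B \<omega>) (C \<omega>)))"
    unfolding E[of "\<lambda>a b c. d a (xh b)"] E[of "\<lambda>a b c. d a (G b c)"]
    by (intro sum_mono mult_left_mono xh) simp
  thus ?thesis by (rule that)
qed

text \<open>The chain rule along any family that grows by one variable per step; it serves both for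
  revealing a list from the front and from the back.\<close>

lemma cent_chain:
  assumes "\<And>i \<omega> \<omega>'. i < n \<Longrightarrow> \<omega> \<in> set_pmf P \<Longrightarrow> \<omega>' \<in> set_pmf P \<Longrightarrow>
      D (Suc i) \<omega> = D (Suc i) \<omega>' \<longleftrightarrow> A i \<omega> = A i \<omega>' \<and> D i \<omega> = D i \<omega>'"
    and "\<And>\<omega> \<omega>'. \<omega> \<in> set_pmf P \<Longrightarrow> \<omega>' \<in> set_pmf P \<Longrightarrow> D 0 \<omega> = D 0 \<omega>'"
  shows "cent P (D n) C = (\<Sum>i<n. cent P (A i) (\<lambda>\<omega>. (D i \<omega>, C \<omega>)))"
  using assms(1)
proof (induction n)
  case 0
  show ?case by (simp, rule cent_zero) (use assms(2) in blast)
next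
  case (Suc n)
  have "ent P (\<lambda>\<omega>. (D (Suc n) \<omega>, C \<omega>)) = ent P (\<lambda>\<omega>. (A n \<omega>, D n \<omega>, C \<omega>))"
    by (rule ent_cong) (use Suc.prems[of n] in auto)
  hence "cent P (D (Suc n)) C = cent P (A n) (\<lambda>\<omega>. (D n \<omega>, C \<omega>)) + cent P (D n) C"
    by (simp add: cent_def)
  moreover have "cent P (D n) C = (\<Sum>i<n. cent P (A i) (\<lambda>\<omega>. (D i \<omega>, C \<omega>)))"
    by (rule Suc.IH) (use Suc.prems in auto)
  ultimately show ?case by simp
qed

lemma cent_chain_take:
  assumes l: "\<And>\<omega>. \<omega> \<in> set_pmf P \<Longrightarrow> length (L \<omega>) = n"
  shows "cent P L C = (\<Sum>i<n. cent P (\<lambda>\<omega>. L \<omega> ! i) (\<lambda>\<omega>. (take i (L \<omega>), C \<omega>)))"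
proof -
  have "cent P L C = cent P (\<lambda>\<omega>. take n (L \<omega>)) C" by (rule cent_cong) (auto simp: l)
  also have "\<dots> = (\<Sum>i<n. cent P (\<lambda>\<omega>. L \<omega> ! i) (\<lambda>\<omega>. (take i (L \<omega>), C \<omega>)))"
    by (rule cent_chain) (auto simp: l take_Suc_conv_app_nth)
  finally show ?thesis .
qed

lemma cent_chain_drop:
  assumes l: "\<And>\<omega>. \<omega> \<in> set_pmf P \<Longrightarrow> length (L \<omega>) = n"
  shows "cent P L C = (\<Sum>i<n. cent P (\<lambda>\<omega>. L \<omega> ! i) (\<lambda>\<omega>. (drop (Suc i) (L \<omega>), C \<omega>)))"
proof -
  have "cent P L C = cent P (\<lambda>\<omega>. drop (n - n) (L \<omega>)) C" by simp
  also have "\<dots> = (\<Sum>i<n. cent P (\<lambda>\<omega>. L \<omega> ! (n - Suc i)) (\<lambda>\<omega>. (drop (n - i) (L \<omega>), C \<omega>)))"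
  proof (rule cent_chain[where D = "\<lambda>i \<omega>. drop (n - i) (L \<omega>)"])
    fix i \<omega> \<omega>' assume i: "i < n" and w: "\<omega> \<in> set_pmf P" "\<omega>' \<in> set_pmf P"
    have "drop (n - Suc i) (L v) = L v ! (n - Suc i) # drop (n - i) (L v)" if "v \<in> set_pmf P" for v
      using Cons_nth_drop_Suc[of "n - Suc i" "L v"] i l[OF that] by (simp add: Suc_diff_Suc)
    thus "drop (n - Suc i) (L \<omega>) = drop (n - Suc i) (L \<omega>') \<longleftrightarrow>
      L \<omega> ! (n - Suc i) = L \<omega>' ! (n - Suc i) \<and> drop (n - i) (L \<omega>) = drop (n - i) (L \<omega>')" using w by simp
  qed (simp add: l)
  also have "\<dots> = (\<Sum>i<n. cent P (\<lambda>\<omega>. L \<omega> ! (n - Suc i)) (\<lambda>\<omega>. (drop (Suc (n - Suc i)) (L \<omega>), C \<omega>)))"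
    by (intro sum.cong refl) (simp add: Suc_diff_Suc)
  also have "\<dots> = (\<Sum>i<n. cent P (\<lambda>\<omega>. L \<omega> ! i) (\<lambda>\<omega>. (drop (Suc i) (L \<omega>), C \<omega>)))"
    by (rule sum.nat_diff_reindex[of "\<lambda>i. cent P (\<lambda>\<omega>. L \<omega> ! i) (\<lambda>\<omega>. (drop (Suc i) (L \<omega>), C \<omega>))"])
  finally show ?thesis .
qed

section \<open>Memoryless blocks and transcripts\<close>

lemma replicate_pmf_Suc: "replicate_pmf (Suc n) P = bind_pmf P (\<lambda>x. map_pmf ((#) x) (replicate_pmf n P))"
  by (simp add: map_pmf_def)

lemma pmf_replicate: "length xs = n \<Longrightarrow> pmf (replicate_pmf n P) xs = (\<Prod>i<n. pmf P (xs ! i))"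
proof (induction xs arbitrary: n)
  case (Cons x xs)
  then obtain m where n: "n = Suc m" "length xs = m" by auto
  have "pmf (replicate_pmf n P) (x # xs) = pmf P x * pmf (replicate_pmf m P) xs"
    unfolding n(1) replicate_pmf_Suc by (rule pmf_bind_Cons)
  also have "\<dots> = (\<Prod>i<n. pmf P ((x # xs) ! i))"
    unfolding Cons.IH[OF n(2)] n(1) prod.lessThan_Suc_shift by simp
  finally show ?case .
qed simp

lemma length_replicate_pmf: "xs \<in> set_pmf (replicate_pmf n P) \<Longrightarrow> length xs = n"
  by (simp add: set_replicate_pmf)

lemma ent_replicate:
  assumes fin: "finite (set_pmf P)"
  shows "ent (replicate_pmf n P) (map f) = real n * ent P f"
proof -
  have "ent (replicate_pmf n P) (map f) = expec (replicate_pmf n P) (\<lambda>xs. \<Sum>x\<leftarrow>xs. - log 2 (mass P f (f x)))"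
    unfolding ent_def
  proof (rule expec_cong)
    fix xs assume xs: "xs \<in> set_pmf (replicate_pmf n P)"
    have l: "length xs = n" by (rule length_replicate_pmf[OF xs])
    have pos: "mass P f (f (xs ! i)) > 0" if "i < n" for i
      by (rule mass_pos) (use xs that l in \<open>auto simp: set_replicate_pmf lists_eq_set dest: nth_mem\<close>)
    have "mass (replicate_pmf n P) (map f) (map f xs) = (\<Prod>i<n. mass P f (f (xs ! i)))"
      unfolding map_replicate_pmf using pmf_replicate[of "map f xs" n] l by simp
    hence "- log 2 (mass (replicate_pmf n P) (map f) (map f xs)) = (\<Sum>i<n. - log 2 (mass P f (f (xs ! i))))"
      using ln_prod[of "{..<n}" "\<lambda>i. mass P f (f (xs ! i))"] pos
      by (simp add: log_def sum_negf sum_divide_distrib less_imp_neq[symmetric])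
    also have "\<dots> = (\<Sum>x\<leftarrow>xs. - log 2 (mass P f (f x)))"
      using l by (simp add: sum_list_sum_nth atLeast0LessThan)
    finally show "- log 2 (mass (replicate_pmf n P) (map f) (map f xs)) = (\<Sum>x\<leftarrow>xs. - log 2 (mass P f (f x)))" .
  qed
  also have "\<dots> = real n * ent P f" unfolding ent_def by (rule expec_sum_list[OF fin])
  finally show ?thesis .
qed

text \<open>A fresh copy of one letter leaves the law of the block unchanged. It exhibits coordinate
  \<open>i\<close> as independent of the remaining letters that enter U_i.\<close>

lemma resample_pmf:
  "i < n \<Longrightarrow> bind_pmf (replicate_pmf n P) (\<lambda>xs. map_pmf (\<lambda>x. xs[i := x]) P) = replicate_pmf n P"
proof (induction n arbitrary: i)
  case (Suc n)
  have upd: "list_update (x # xs) 0 = (\<lambda>y. y # xs)" "list_update (x # xs) (Suc j) = (\<lambda>y. x # xs[j := y])" for x :: 'a and xs j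
    by auto
  show ?case
  proof (cases i)
    case 0
    have "bind_pmf (replicate_pmf (Suc n) P) (\<lambda>xs. map_pmf (\<lambda>x. xs[i := x]) P) =
      bind_pmf P (\<lambda>_. bind_pmf (replicate_pmf n P) (\<lambda>xs. map_pmf (\<lambda>x. x # xs) P))"
      by (simp add: 0 upd bind_assoc_pmf bind_return_pmf)
    also have "\<dots> = bind_pmf (replicate_pmf n P) (\<lambda>xs. bind_pmf P (\<lambda>x. return_pmf (x # xs)))"
      by (simp add: map_pmf_def)
    also have "\<dots> = bind_pmf P (\<lambda>x. bind_pmf (replicate_pmf n P) (\<lambda>xs. return_pmf (x # xs)))"
      by (rule bind_commute_pmf)
    finally show ?thesis by simp
  next
    case (Suc j)
    have "bind_pmf (replicate_pmf (Suc n) P) (\<lambda>xs. map_pmf (\<lambda>x. xs[i := x]) P) =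
      bind_pmf P (\<lambda>a. map_pmf ((#) a) (bind_pmf (replicate_pmf n P) (\<lambda>xs. map_pmf (\<lambda>x. xs[j := x]) P)))"
      by (simp add: Suc upd bind_assoc_pmf bind_return_pmf map_bind_pmf map_pmf_comp)
    also have "\<dots> = replicate_pmf (Suc n) P"
      using Suc.IH[of j] Suc.prems Suc by (simp add: map_pmf_def)
    finally show ?thesis .
  qed
qed simp

text \<open>In a transcript \<open>evens\<close> are the messages of User Z and \<open>odds\<close>
  those of User X.\<close>

fun evens :: "'a list \<Rightarrow> 'a list" and odds :: "'a list \<Rightarrow> 'a list" where
  "evens [] = []"
| "evens (a # h) = a # odds h"
| "odds [] = []"
| "odds (a # h) = evens h"

lemma evens_odds_snoc: "evens (h @ [a]) = (if even (length h) then evens h @ [a] else evens h)"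
  "odds (h @ [a]) = (if odd (length h) then odds h @ [a] else odds h)"
  by (induction h and h rule: evens_odds.induct) auto

lemma length_evens_odds: "length (evens h) = Suc (length h) div 2" "length (odds h) = length h div 2"
  by (induction h and h rule: evens_odds.induct) auto

section \<open>A code as a random experiment on the source block\<close>

locale code = rd_problem pxy pzx dx dz K
  for pxy :: "('x::finite \<times> 'y::finite) pmf" and pzx :: "'x \<Rightarrow> 'z::finite pmf"
    and dx :: "'x \<Rightarrow> 'xh::finite \<Rightarrow> real" and dz :: "'z \<Rightarrow> 'zh::finite \<Rightarrow> real" and K +
  fixes n :: nat and fy :: "'y list \<Rightarrow> nat" and fz :: "nat \<Rightarrow> 'z list \<Rightarrow> nat \<Rightarrow> nat list \<Rightarrow> nat"
    and fx :: "nat \<Rightarrow> 'x list \<Rightarrow> nat \<Rightarrow> nat list \<Rightarrow> nat" and My :: nat and Mx Mz :: "nat \<Rightarrow> nat"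
  assumes n: "n > 0" and fy: "fy ys \<in> {1..My}" and fz: "k \<in> {1..K} \<Longrightarrow> fz k zs t h \<in> {1..Mz k}"
    and fx: "k \<in> {1..K} \<Longrightarrow> fx k xs t h \<in> {1..Mx k}"
begin

abbreviation "S \<equiv> source pxy pzx"
abbreviation "Q \<equiv> replicate_pmf n S"

definition Xs :: "('x \<times> 'y \<times> 'z) list \<Rightarrow> 'x list" where "Xs \<omega> = map fst \<omega>"
definition Ys :: "('x \<times> 'y \<times> 'z) list \<Rightarrow> 'y list" where "Ys \<omega> = map (fst \<circ> snd) \<omega>"
definition Zs :: "('x \<times> 'y \<times> 'z) list \<Rightarrow> 'z list" where "Zs \<omega> = map (snd \<circ> snd) \<omega>"
definition T0 :: "('x \<times> 'y \<times> 'z) list \<Rightarrow> nat" where "T0 \<omega> = fy (Ys \<omega>)"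
definition X :: "nat \<Rightarrow> ('x \<times> 'y \<times> 'z) list \<Rightarrow> 'x" where "X i \<omega> = Xs \<omega> ! i"
definition Y :: "nat \<Rightarrow> ('x \<times> 'y \<times> 'z) list \<Rightarrow> 'y" where "Y i \<omega> = Ys \<omega> ! i"
definition Z :: "nat \<Rightarrow> ('x \<times> 'y \<times> 'z) list \<Rightarrow> 'z" where "Z i \<omega> = Zs \<omega> ! i"
definition U :: "nat \<Rightarrow> ('x \<times> 'y \<times> 'z) list \<Rightarrow> nat \<times> 'x list \<times> 'z list" where
  "U i \<omega> = (T0 \<omega>, take i (Xs \<omega>), drop (Suc i) (Zs \<omega>))"

text \<open>Parity of the transcript tells who speaks, and the speaker is handed only the other
  user's messages. \<open>trans\<close> thus rewrites the two lists of \<open>msgs\<close> as one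
  list.\<close>

definition msg :: "nat \<Rightarrow> 'x list \<Rightarrow> 'z list \<Rightarrow> nat list \<Rightarrow> nat" where
  "msg t xs zs h = (if even (length h) then fz (Suc (length h div 2)) zs t (odds h) else fx (Suc (length h div 2)) xs t (evens h))"

primrec trans :: "nat \<Rightarrow> 'x list \<Rightarrow> 'z list \<Rightarrow> nat \<Rightarrow> nat list" where
  "trans t xs zs 0 = []"
| "trans t xs zs (Suc j) = trans t xs zs j @ [msg t xs zs (trans t xs zs j)]"

definition H :: "nat \<Rightarrow> ('x \<times> 'y \<times> 'z) list \<Rightarrow> nat list" where "H j \<omega> = trans (T0 \<omega>) (Xs \<omega>) (Zs \<omega>) j"

lemma finite_Q [simp]: "finite (set_pmf Q)" by simp

lemma length_Xs [simp]: "length (Xs \<omega>) = length \<omega>" and length_Ys [simp]: "length (Ys \<omega>) = length \<omega>"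
  and length_Zs [simp]: "length (Zs \<omega>) = length \<omega>"
  by (simp_all add: Xs_def Ys_def Zs_def)

lemma length_trans [simp]: "length (trans t xs zs j) = j"
  by (induction j) simp_all

lemma length_H [simp]: "length (H j \<omega>) = j" by (simp add: H_def)

lemma H_Suc: "H (Suc j) \<omega> = H j \<omega> @ [msg (T0 \<omega>) (Xs \<omega>) (Zs \<omega>) (H j \<omega>)]"
  by (simp add: H_def)

lemma msgs_trans: "msgs fz fx xs zs t k = (evens (trans t xs zs (2 * k)), odds (trans t xs zs (2 * k)))"
proof (induction k)
  case (Suc k)
  have e: "2 * Suc k = Suc (Suc (2 * k))" by simp
  show ?case unfolding e by (simp add: Suc Let_def msg_def evens_odds_snoc del: append_assoc)
qed simp

text \<open>Given the helper's message and \<open>zs\<close>, User Z's messages are recomputed one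
  after the other from User X's. Hence User X's rate alone bounds the conditional entropy of the
  whole transcript in \<open>rate_X\<close>.\<close>

lemma odds_trans_det: "odds (trans t xs zs j) = odds (trans t xs' zs j) \<Longrightarrow> trans t xs zs j = trans t xs' zs j"
proof (induction j)
  case (Suc j)
  have "odds (trans t xs zs j) = odds (trans t xs' zs j)"
    using Suc.prems by (cases "odd j") (auto simp: evens_odds_snoc)
  thus ?case using Suc by (cases "odd j") (auto simp: evens_odds_snoc msg_def)
qed simp

lemma evens_trans_det: "evens (trans t xs zs j) = evens (trans t xs zs' j) \<Longrightarrow> trans t xs zs j = trans t xs zs' j"
proof (induction j)
  case (Suc j)
  have "evens (trans t xs zs j) = evens (trans t xs zs' j)"
    using Suc.prems by (cases "odd j") (auto simp: evens_odds_snoc)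
  thus ?case using Suc by (cases "odd j") (auto simp: evens_odds_snoc msg_def)
qed simp

lemma nth_odds_trans: "k < j div 2 \<Longrightarrow> \<exists>l. odds (trans t xs zs j) ! k = fx (Suc k) xs t l"
proof (induction j)
  case (Suc j)
  show ?case
  proof (cases "k < j div 2")
    case True
    thus ?thesis using Suc.IH by (auto simp: evens_odds_snoc nth_append length_evens_odds)
  next
    case False
    hence "odd j" "k = j div 2" using Suc.prems by presburger+
    thus ?thesis by (auto simp: evens_odds_snoc nth_append length_evens_odds msg_def)
  qed
qed simp

lemma nth_evens_trans: "k < Suc j div 2 \<Longrightarrow> \<exists>l. evens (trans t xs zs j) ! k = fz (Suc k) zs t l"
proof (induction j)
  case (Suc j)
  show ?case
  proof (cases "k < Suc j div 2")
    case True
    thus ?thesis using Suc.IH by (auto simp: evens_odds_snoc nth_append length_evens_odds)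
  next
    case False
    hence "even j" "k = j div 2" "k = Suc j div 2" using Suc.prems by presburger+
    thus ?thesis by (auto simp: evens_odds_snoc nth_append length_evens_odds msg_def)
  qed
qed simp

definition B :: nat where "B = Suc ((\<Sum>k=1..K. Mx k) + (\<Sum>k=1..K. Mz k))"

lemma msg_less: "length h < 2 * K \<Longrightarrow> msg t xs zs h < B"
proof -
  assume h: "length h < 2 * K"
  let ?k = "Suc (length h div 2)"
  have k: "?k \<in> {1..K}" using h by auto
  have "Mx ?k \<le> (\<Sum>k=1..K. Mx k)" "Mz ?k \<le> (\<Sum>k=1..K. Mz k)"
    by (rule member_le_sum; use k in simp)+
  moreover have "fz ?k zs t (odds h) \<le> Mz ?k" "fx ?k xs t (evens h) \<le> Mx ?k"
    using fz[OF k] fx[OF k] by (meson atLeastAtMost_iff)+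
  ultimately show ?thesis unfolding msg_def B_def by auto
qed

lemma H_words: "j \<le> 2 * K \<Longrightarrow> H j \<omega> \<in> words B j"
proof (induction j)
  case (Suc j)
  thus ?case using msg_less[of "H j \<omega>" "T0 \<omega>" "Xs \<omega>" "Zs \<omega>"] by (auto simp: H_Suc words_def)
qed (simp add: H_def)

text \<open>The probability that the block of X is \<open>xs\<close> and the helper sends
  \<open>t\<close>.\<close>

definition w :: "'x list \<Rightarrow> nat \<Rightarrow> real" where
  "w xs t = (\<Sum>ys\<in>{ys. length ys = n}. if fy ys = t then \<Prod>j<n. pmf pxy (xs ! j, ys ! j) else 0)"

lemma length_Q: "\<omega> \<in> set_pmf Q \<Longrightarrow> length \<omega> = n"
  by (rule length_replicate_pmf)

text \<open>The factors p(z|x) do not involve Y, so summing over the blocks that the helper maps to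
  \<open>t\<close> leaves them intact. The Markov chains between the users' blocks are read off from
  this product.\<close>

lemma mass_XZT:
  assumes l: "length xs = n" "length zs = n"
  shows "mass Q (\<lambda>\<omega>. (Xs \<omega>, Zs \<omega>, T0 \<omega>)) (xs, zs, t) = w xs t * (\<Prod>j<n. pmf (pzx (xs ! j)) (zs ! j))"
proof -
  let ?L = "{ys :: 'y list. length ys = n}"
  have fL: "finite ?L" using finite_lists_length_eq[of "UNIV :: 'y set" n] by simp
  have "mass Q (\<lambda>\<omega>. (Xs \<omega>, Zs \<omega>, T0 \<omega>)) (xs, zs, t) = (\<Sum>ys\<in>?L. mass Q (\<lambda>\<omega>. (Ys \<omega>, Xs \<omega>, Zs \<omega>, T0 \<omega>)) (ys, xs, zs, t))"
    by (rule mass_sum_snd[symmetric]) (use fL length_Q in auto)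
  also have "\<dots> = (\<Sum>ys\<in>?L. (if fy ys = t then \<Prod>j<n. pmf pxy (xs ! j, ys ! j) else 0) * (\<Prod>j<n. pmf (pzx (xs ! j)) (zs ! j)))"
  proof (rule sum.cong[OF refl])
    fix ys assume "ys \<in> ?L"
    hence ly: "length ys = n" by simp
    have "mass Q (\<lambda>\<omega>. (Ys \<omega>, Xs \<omega>, Zs \<omega>, T0 \<omega>)) (ys, xs, zs, t) = (if fy ys = t then mass Q (\<lambda>\<omega>. (Xs \<omega>, Ys \<omega>, Zs \<omega>)) (xs, ys, zs) else 0)"
      by (rule mass_if) (auto simp: T0_def)
    moreover have "mass Q (\<lambda>\<omega>. (Xs \<omega>, Ys \<omega>, Zs \<omega>)) (xs, ys, zs) = prob Q {zip xs (zip ys zs)}"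
      unfolding mass_eq
    proof (rule prob_cong)
      fix \<omega> assume "\<omega> \<in> set_pmf Q"
      hence "length \<omega> = n" by (rule length_Q)
      thus "\<omega> \<in> {\<omega>. (Xs \<omega>, Ys \<omega>, Zs \<omega>) = (xs, ys, zs)} \<longleftrightarrow> \<omega> \<in> {zip xs (zip ys zs)}"
        using l ly by (auto simp: Xs_def Ys_def Zs_def list_eq_iff_nth_eq prod_eq_iff)
    qed
    moreover have "prob Q {zip xs (zip ys zs)} = (\<Prod>j<n. pmf S (zip xs (zip ys zs) ! j))"
      unfolding measure_pmf_single by (rule pmf_replicate) (simp add: l ly)
    moreover have "\<dots> = (\<Prod>j<n. pmf pxy (xs ! j, ys ! j)) * (\<Prod>j<n. pmf (pzx (xs ! j)) (zs ! j))"
      unfolding prod.distrib[symmetric] by (rule prod.cong) (simp_all add: l ly pmf_source)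
    ultimately show "mass Q (\<lambda>\<omega>. (Ys \<omega>, Xs \<omega>, Zs \<omega>, T0 \<omega>)) (ys, xs, zs, t) =
      (if fy ys = t then \<Prod>j<n. pmf pxy (xs ! j, ys ! j) else 0) * (\<Prod>j<n. pmf (pzx (xs ! j)) (zs ! j))" by simp
  qed
  finally show ?thesis by (simp only: w_def sum_distrib_right)
qed

lemma markov_ZXT: "markov Q Zs Xs T0"
proof (rule markovI_factor[where \<phi> = "\<lambda>zs xs. \<Prod>j<n. pmf (pzx (xs ! j)) (zs ! j)" and \<psi> = w])
  fix zs xs t assume "zs \<in> Zs ` set_pmf Q" "xs \<in> Xs ` set_pmf Q"
  hence l: "length xs = n" "length zs = n" using length_Q by auto
  have "mass Q (\<lambda>\<omega>. (Zs \<omega>, Xs \<omega>, T0 \<omega>)) (zs, xs, t) = mass Q (\<lambda>\<omega>. (Xs \<omega>, Zs \<omega>, T0 \<omega>)) (xs, zs, t)"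
    unfolding mass_eq by (rule prob_cong) auto
  thus "mass Q (\<lambda>\<omega>. (Zs \<omega>, Xs \<omega>, T0 \<omega>)) (zs, xs, t) = (\<Prod>j<n. pmf (pzx (xs ! j)) (zs ! j)) * w xs t"
    by (simp add: mass_XZT[OF l])
qed simp

lemma prod_split: "i \<le> n \<Longrightarrow> (\<Prod>j<n. (F :: nat \<Rightarrow> real) j) = (\<Prod>j<i. F j) * (\<Prod>j\<in>{i..<n}. F j)"
proof -
  assume "i \<le> n"
  hence "{..<n} = {..<i} \<union> {i..<n}" by auto
  thus ?thesis by (metis (no_types) finite_atLeastLessThan finite_lessThan ivl_disj_int_one(2) prod.union_disjoint)
qed

text \<open>Given \<open>X\<^sub>1, \<dots>, X\<^sub>i\<close> the letters \<open>Z\<^sub>1, \<dots>, Z\<^sub>i\<close> are independent of everything else, so that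
  conditioning on \<open>X\<^sub>1, \<dots>, X\<^sub>i\<^sub>-\<^sub>1\<close> and \<open>Z\<^sub>i\<^sub>+\<^sub>1, \<dots>, Z\<^sub>n\<close> together with one of \<open>X\<^sub>i\<close>, \<open>Z\<^sub>i\<close> separates the two users.\<close>

lemma markov_base_Z:
  assumes i: "i < n"
  shows "markov Q Xs (\<lambda>\<omega>. (Z i \<omega>, U i \<omega>)) Zs"
\<comment> \<open>Factors of index below \<open>i\<close> see the letters of X only through
  \<open>a\<close>, which is part of the condition, and go to the side of \<open>zs\<close>. The
  others see the letters of Z only through \<open>z # c\<close> and go to the side of
  \<open>xs\<close>.\<close>
proof (rule markovI_factor[where
    \<phi> = "\<lambda>xs (z, t, a, c). if take i xs = a then w xs t * (\<Prod>j\<in>{i..<n}. pmf (pzx (xs ! j)) ((z # c) ! (j - i))) else 0" and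
    \<psi> = "\<lambda>(z, t, a, c) zs. if zs ! i = z \<and> drop (Suc i) zs = c then \<Prod>j<i. pmf (pzx (a ! j)) (zs ! j) else 0"])
  fix xs and b :: "'z \<times> nat \<times> 'x list \<times> 'z list" and zs
  assume "zs \<in> Zs ` set_pmf Q" "xs \<in> Xs ` set_pmf Q"
  hence l: "length xs = n" "length zs = n" using length_Q by auto
  obtain z t a c where b: "b = (z, t, a, c)" by (cases b)
  let ?c = "take i xs = a \<and> zs ! i = z \<and> drop (Suc i) zs = c"
  have "mass Q (\<lambda>\<omega>. (Xs \<omega>, (Z i \<omega>, U i \<omega>), Zs \<omega>)) (xs, b, zs) = (if ?c then mass Q (\<lambda>\<omega>. (Xs \<omega>, Zs \<omega>, T0 \<omega>)) (xs, zs, t) else 0)"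
    by (rule mass_if) (auto simp: b Z_def U_def)
  also have "\<dots> = (if take i xs = a then w xs t * (\<Prod>j\<in>{i..<n}. pmf (pzx (xs ! j)) ((z # c) ! (j - i))) else 0) *
      (if zs ! i = z \<and> drop (Suc i) zs = c then \<Prod>j<i. pmf (pzx (a ! j)) (zs ! j) else 0)"
  proof (cases ?c)
    case True
    hence zc: "z # c = drop i zs" using Cons_nth_drop_Suc[of i zs] i l by simp
    have "(\<Prod>j<i. pmf (pzx (a ! j)) (zs ! j)) = (\<Prod>j<i. pmf (pzx (xs ! j)) (zs ! j))"
      by (rule prod.cong) (use True in auto)
    moreover have "(\<Prod>j\<in>{i..<n}. pmf (pzx (xs ! j)) ((z # c) ! (j - i))) = (\<Prod>j\<in>{i..<n}. pmf (pzx (xs ! j)) (zs ! j))"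
      unfolding zc by (rule prod.cong) (use l i in auto)
    ultimately show ?thesis using True i by (simp add: mass_XZT[OF l] prod_split[of i])
  qed auto
  finally show "mass Q (\<lambda>\<omega>. (Xs \<omega>, (Z i \<omega>, U i \<omega>), Zs \<omega>)) (xs, b, zs) =
    (case b of (z, t, a, c) \<Rightarrow> if take i xs = a then w xs t * (\<Prod>j\<in>{i..<n}. pmf (pzx (xs ! j)) ((z # c) ! (j - i))) else 0) *
    (case b of (z, t, a, c) \<Rightarrow> \<lambda>zs. if zs ! i = z \<and> drop (Suc i) zs = c then \<Prod>j<i. pmf (pzx (a ! j)) (zs ! j) else 0) zs"
    by (simp only: b prod.case)
qed simp

text \<open>The product is now cut after index \<open>i\<close>: with X_i in the condition, the
  factor of index \<open>i\<close> passes to the side of \<open>zs\<close>.\<close>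

lemma markov_base_X:
  assumes i: "i < n"
  shows "markov Q Xs (\<lambda>\<omega>. (X i \<omega>, U i \<omega>)) Zs"
proof (rule markovI_factor[where
    \<phi> = "\<lambda>xs (x, t, a, c). if take i xs = a \<and> xs ! i = x then w xs t * (\<Prod>j\<in>{Suc i..<n}. pmf (pzx (xs ! j)) (c ! (j - Suc i))) else 0" and
    \<psi> = "\<lambda>(x, t, a, c) zs. if drop (Suc i) zs = c then \<Prod>j<Suc i. pmf (pzx ((a @ [x]) ! j)) (zs ! j) else 0"])
  fix xs and b :: "'x \<times> nat \<times> 'x list \<times> 'z list" and zs
  assume "zs \<in> Zs ` set_pmf Q" "xs \<in> Xs ` set_pmf Q"
  hence l: "length xs = n" "length zs = n" using length_Q by auto
  obtain x t a c where b: "b = (x, t, a, c)" by (cases b)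
  let ?c = "take i xs = a \<and> xs ! i = x \<and> drop (Suc i) zs = c"
  have "mass Q (\<lambda>\<omega>. (Xs \<omega>, (X i \<omega>, U i \<omega>), Zs \<omega>)) (xs, b, zs) = (if ?c then mass Q (\<lambda>\<omega>. (Xs \<omega>, Zs \<omega>, T0 \<omega>)) (xs, zs, t) else 0)"
    by (rule mass_if) (auto simp: b X_def U_def)
  also have "\<dots> = (if take i xs = a \<and> xs ! i = x then w xs t * (\<Prod>j\<in>{Suc i..<n}. pmf (pzx (xs ! j)) (c ! (j - Suc i))) else 0) *
      (if drop (Suc i) zs = c then \<Prod>j<Suc i. pmf (pzx ((a @ [x]) ! j)) (zs ! j) else 0)"
  proof (cases ?c)
    case True
    hence ax: "a @ [x] = take (Suc i) xs" using i l by (simp add: take_Suc_conv_app_nth)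
    have "(\<Prod>j<Suc i. pmf (pzx ((a @ [x]) ! j)) (zs ! j)) = (\<Prod>j<Suc i. pmf (pzx (xs ! j)) (zs ! j))"
      unfolding ax by (rule prod.cong) auto
    moreover have "(\<Prod>j\<in>{Suc i..<n}. pmf (pzx (xs ! j)) (c ! (j - Suc i))) = (\<Prod>j\<in>{Suc i..<n}. pmf (pzx (xs ! j)) (zs ! j))"
      by (rule prod.cong) (use l i True in auto)
    ultimately show ?thesis using True i by (simp add: mass_XZT[OF l] prod_split[of "Suc i"] del: prod.lessThan_Suc)
  qed auto
  finally show "mass Q (\<lambda>\<omega>. (Xs \<omega>, (X i \<omega>, U i \<omega>), Zs \<omega>)) (xs, b, zs) =
    (case b of (x, t, a, c) \<Rightarrow> if take i xs = a \<and> xs ! i = x then w xs t * (\<Prod>j\<in>{Suc i..<n}. pmf (pzx (xs ! j)) (c ! (j - Suc i))) else 0) *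
    (case b of (x, t, a, c) \<Rightarrow> \<lambda>zs. if drop (Suc i) zs = c then \<Prod>j<Suc i. pmf (pzx ((a @ [x]) ! j)) (zs ! j) else 0) zs"
    by (simp only: b prod.case)
qed simp

text \<open>Each message is a function of the current condition and of the speaker's block, so
  \<open>markov_extend\<close>, applied from the speaker's end, lets it join the condition.\<close>

lemma markov_trans:
  assumes base: "markov Q Xs (\<lambda>\<omega>. (V \<omega>, U i \<omega>)) Zs"
  shows "markov Q Xs (\<lambda>\<omega>. (V \<omega>, U i \<omega>, H j \<omega>)) Zs"
proof (induction j)
  case 0
  show ?case by (rule markov_cong[OF base]) (auto simp: H_def)
next
  case (Suc j)
  let ?B = "\<lambda>\<omega>. (V \<omega>, U i \<omega>, H j \<omega>)" and ?m = "\<lambda>\<omega>. msg (T0 \<omega>) (Xs \<omega>) (Zs \<omega>) (H j \<omega>)"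
  have "markov Q Xs (\<lambda>\<omega>. (?B \<omega>, ?m \<omega>)) Zs"
  proof (cases "even j")
    case True
    show ?thesis by (rule markov_extend[OF finite_Q Suc]) (auto simp: msg_def U_def True)
  next
    case False
    have "markov Q Zs (\<lambda>\<omega>. (?B \<omega>, ?m \<omega>)) Xs"
      by (rule markov_extend[OF finite_Q markov_sym[OF Suc]]) (auto simp: msg_def U_def False)
    thus ?thesis by (rule markov_sym)
  qed
  thus ?case by (rule markov_cong) (auto simp: H_Suc)
qed

end

lemma cent_replicate:
  assumes "finite (set_pmf P)"
  shows "cent (replicate_pmf n P) (map f) (map g) = real n * cent P f g"
proof -
  have "ent (replicate_pmf n P) (\<lambda>xs. (map f xs, map g xs)) = ent (replicate_pmf n P) (map (\<lambda>x. (f x, g x)))"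
    by (rule ent_cong) (auto simp: list_eq_iff_nth_eq)
  thus ?thesis by (simp add: cent_def ent_replicate[OF assms] right_diff_distrib)
qed

lemma cent_list_le:
  assumes fin: "finite (set_pmf P)" and l: "\<And>\<omega>. \<omega> \<in> set_pmf P \<Longrightarrow> length (L \<omega>) = K"
    and L: "\<And>\<omega> k. \<omega> \<in> set_pmf P \<Longrightarrow> k < K \<Longrightarrow> L \<omega> ! k \<in> {1..M (Suc k)}"
  shows "cent P L C \<le> (\<Sum>k=1..K. log 2 (real (M k)))"
proof -
  have "cent P L C = (\<Sum>k<K. cent P (\<lambda>\<omega>. L \<omega> ! k) (\<lambda>\<omega>. (take k (L \<omega>), C \<omega>)))" by (rule cent_chain_take[OF l])
  also have "\<dots> \<le> (\<Sum>k<K. log 2 (real (M (Suc k))))"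
  proof (rule sum_mono)
    fix k assume "k \<in> {..<K}"
    hence k: "k < K" by simp
    have "ent P (\<lambda>\<omega>. L \<omega> ! k) \<le> log 2 (real (M (Suc k)))"
      by (rule ent_le_log_card[OF fin, of "{1..M (Suc k)}"]) (use L k in auto)
    thus "cent P (\<lambda>\<omega>. L \<omega> ! k) (\<lambda>\<omega>. (take k (L \<omega>), C \<omega>)) \<le> log 2 (real (M (Suc k)))"
      using cent_le_ent[OF fin] by (rule order_trans[rotated])
  qed
  finally show ?thesis by (simp add: sum.atLeast1_atMost_eq)
qed

text \<open>Read the left-hand side as \<open>I(A; M | C) \<le> H(M | C)\<close>.\<close>

lemma cent_diff_le:
  assumes "finite (set_pmf P)"
  shows "cent P A C - cent P A (\<lambda>\<omega>. (M \<omega>, C \<omega>)) \<le> cent P M C"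
  using cmi_cent[OF assms, of A M C] cmi_cent'[OF assms, of A M C] cent_nonneg[OF assms, of M "\<lambda>\<omega>. (A \<omega>, C \<omega>)"] by simp

section \<open>Single-letter laws and the three rate bounds\<close>

context code
begin

text \<open>U_i as a function of the letter \<open>y\<close> put at coordinate \<open>i\<close>. The
  other two components skip this coordinate, so only the helper's message reacts.\<close>

definition U_with :: "nat \<Rightarrow> ('x \<times> 'y \<times> 'z) list \<Rightarrow> 'y \<Rightarrow> nat \<times> 'x list \<times> 'z list" where
  "U_with i \<omega> y = (fy (list_update (Ys \<omega>) i y), take i (Xs \<omega>), drop (Suc i) (Zs \<omega>))"

lemma resample:
  assumes "i < n" "length \<omega> = n"
  shows "X i (list_update \<omega> i s) = fst s" "Y i (list_update \<omega> i s) = fst (snd s)" "Z i (list_update \<omega> i s) = snd (snd s)"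
    "U i (list_update \<omega> i s) = U_with i \<omega> (fst (snd s))"
  using assms by (simp_all add: X_def Y_def Z_def U_def U_with_def T0_def Xs_def Ys_def Zs_def map_update)

lemma map_Q:
  assumes i: "i < n"
  shows "map_pmf (\<lambda>\<omega>. (X i \<omega>, Y i \<omega>, Z i \<omega>, U i \<omega>)) Q =
    bind_pmf Q (\<lambda>\<omega>. map_pmf (\<lambda>s. (fst s, fst (snd s), snd (snd s), U_with i \<omega> (fst (snd s)))) S)"
proof -
  have "map_pmf (\<lambda>\<omega>. (X i \<omega>, Y i \<omega>, Z i \<omega>, U i \<omega>)) Q =
    map_pmf (\<lambda>\<omega>. (X i \<omega>, Y i \<omega>, Z i \<omega>, U i \<omega>)) (bind_pmf Q (\<lambda>\<omega>. map_pmf (\<lambda>s. list_update \<omega> i s) S))"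
    unfolding resample_pmf[OF i] ..
  also have "\<dots> = bind_pmf Q (\<lambda>\<omega>. map_pmf (\<lambda>s. (fst s, fst (snd s), snd (snd s), U_with i \<omega> (fst (snd s)))) S)"
    unfolding map_bind_pmf map_pmf_comp
    by (intro bind_pmf_cong refl map_pmf_cong) (simp add: resample[OF i length_Q])
  finally show ?thesis .
qed

lemma map_XYZ:
  assumes i: "i < n"
  shows "map_pmf (\<lambda>\<omega>. (X i \<omega>, Y i \<omega>, Z i \<omega>)) Q = S"
proof -
  have "map_pmf (\<lambda>\<omega>. (X i \<omega>, Y i \<omega>, Z i \<omega>)) Q = map_pmf (\<lambda>(x, y, z, u). (x, y, z)) (map_pmf (\<lambda>\<omega>. (X i \<omega>, Y i \<omega>, Z i \<omega>, U i \<omega>)) Q)"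
    by (simp add: map_pmf_comp)
  also have "\<dots> = S" unfolding map_Q[OF i] by (simp add: map_bind_pmf map_pmf_comp)
  finally show ?thesis .
qed

lemma mass_XYZ:
  assumes i: "i < n"
  shows "mass Q (\<lambda>\<omega>. (Y i \<omega>, X i \<omega>, Z i \<omega>)) (y, x, z) = pmf S (x, y, z)"
proof -
  have "mass Q (\<lambda>\<omega>. (Y i \<omega>, X i \<omega>, Z i \<omega>)) (y, x, z) = mass Q (\<lambda>\<omega>. (X i \<omega>, Y i \<omega>, Z i \<omega>)) (x, y, z)"
    unfolding mass_eq by (rule prob_cong) auto
  thus ?thesis by (simp add: map_XYZ[OF i])
qed

lemma mass_Y:
  assumes i: "i < n"
  shows "mass Q (Y i) y = pY y"
proof -
  have "mass Q (Y i) y = (\<Sum>s\<in>UNIV. mass Q (\<lambda>\<omega>. ((X i \<omega>, Z i \<omega>), Y i \<omega>)) (s, y))"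
    by (rule mass_sum_snd[symmetric]) auto
  also have "\<dots> = (\<Sum>s\<in>UNIV. mass Q (\<lambda>\<omega>. (Y i \<omega>, X i \<omega>, Z i \<omega>)) (y, fst s, snd s))"
    unfolding mass_eq by (intro sum.cong refl prob_cong) auto
  finally show ?thesis unfolding mass_XYZ[OF i] pY_eq .
qed

text \<open>When coordinate \<open>i\<close> is drawn afresh, U_i is a function of the new letter
  \<open>y\<close> and of the independent old block.\<close>

lemma markov_UYXZ:
  assumes i: "i < n"
  shows "markov Q (U i) (Y i) (\<lambda>\<omega>. (X i \<omega>, Z i \<omega>))"
proof (rule markovI_factor[where \<phi> = "\<lambda>u y. prob Q {\<omega>. U_with i \<omega> y = u}" and \<psi> = "\<lambda>y s. pmf S (fst s, y, snd s)"])
  fix u y and s :: "'x \<times> 'z"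
  have "mass Q (\<lambda>\<omega>. (U i \<omega>, Y i \<omega>, X i \<omega>, Z i \<omega>)) (u, y, s) = mass Q (\<lambda>\<omega>. (X i \<omega>, Y i \<omega>, Z i \<omega>, U i \<omega>)) (fst s, y, snd s, u)"
    unfolding mass_eq by (rule prob_cong) auto
  also have "\<dots> = expec Q (\<lambda>\<omega>. mass S (\<lambda>s. (fst s, fst (snd s), snd (snd s), U_with i \<omega> (fst (snd s)))) (fst s, y, snd s, u))"
    unfolding map_Q[OF i] by (rule pmf_bind)
  also have "\<dots> = expec Q (\<lambda>\<omega>. indicator {\<omega>. U_with i \<omega> y = u} \<omega> * pmf S (fst s, y, snd s))"
  proof (rule expec_cong)
    fix \<omega>
    have "mass S (\<lambda>s. (fst s, fst (snd s), snd (snd s), U_with i \<omega> (fst (snd s)))) (fst s, y, snd s, u) =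
      (if U_with i \<omega> y = u then mass S (\<lambda>s. s) (fst s, y, snd s) else 0)"
      by (rule mass_if) auto
    thus "mass S (\<lambda>s. (fst s, fst (snd s), snd (snd s), U_with i \<omega> (fst (snd s)))) (fst s, y, snd s, u) =
      indicator {\<omega>. U_with i \<omega> y = u} \<omega> * pmf S (fst s, y, snd s)" by simp
  qed
  also have "\<dots> = prob Q {\<omega>. U_with i \<omega> y = u} * pmf S (fst s, y, snd s)" by simp
  finally show "mass Q (\<lambda>\<omega>. (U i \<omega>, Y i \<omega>, X i \<omega>, Z i \<omega>)) (u, y, s) = prob Q {\<omega>. U_with i \<omega> y = u} * pmf S (fst s, y, snd s)" .
qed simp

definition piU :: "nat \<Rightarrow> nat \<times> 'x list \<times> 'z list \<Rightarrow> real^'y" where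
  "piU i u = (\<chi> y. mass Q (\<lambda>\<omega>. (Y i \<omega>, U i \<omega>)) (y, u))"

lemma piU_nonneg: "piU i u $ y \<ge> 0" by (simp add: piU_def)

lemma mass_ZXYU:
  assumes i: "i < n"
  shows "mass Q (\<lambda>\<omega>. (Z i \<omega>, (X i \<omega>, Y i \<omega>), U i \<omega>)) (z, (x, y), u) = piU i u $ y * Wy y (x, z)"
proof -
  have "mass Q (\<lambda>\<omega>. (Z i \<omega>, (X i \<omega>, Y i \<omega>), U i \<omega>)) (z, (x, y), u) = mass Q (\<lambda>\<omega>. (U i \<omega>, Y i \<omega>, X i \<omega>, Z i \<omega>)) (u, y, x, z)"
    unfolding mass_eq by (rule prob_cong) auto
  also have "\<dots> = mass Q (\<lambda>\<omega>. (U i \<omega>, Y i \<omega>)) (u, y) / pY y * pmf S (x, y, z)"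
    unfolding markov_factor[OF markov_UYXZ[OF i]] mass_XYZ[OF i] mass_Y[OF i] ..
  also have "mass Q (\<lambda>\<omega>. (U i \<omega>, Y i \<omega>)) (u, y) = mass Q (\<lambda>\<omega>. (Y i \<omega>, U i \<omega>)) (y, u)"
    unfolding mass_eq by (rule prob_cong) auto
  finally show ?thesis by (simp add: piU_def Wy_def)
qed

lemma Lm_piU:
  assumes i: "i < n"
  shows "Lm (piU i u) $ (x, z) = mass Q (\<lambda>\<omega>. (X i \<omega>, Z i \<omega>, U i \<omega>)) (x, z, u)"
proof -
  have "Lm (piU i u) $ (x, z) = (\<Sum>y\<in>UNIV. mass Q (\<lambda>\<omega>. (Z i \<omega>, (X i \<omega>, Y i \<omega>), U i \<omega>)) (z, (x, y), u))"
    by (simp add: Lm_def mass_ZXYU[OF i])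
  also have "\<dots> = (\<Sum>y\<in>UNIV. mass Q (\<lambda>\<omega>. (Y i \<omega>, X i \<omega>, Z i \<omega>, U i \<omega>)) (y, x, z, u))"
    unfolding mass_eq by (intro sum.cong refl prob_cong) auto
  also have "\<dots> = mass Q (\<lambda>\<omega>. (X i \<omega>, Z i \<omega>, U i \<omega>)) (x, z, u)" by (rule mass_sum_snd) auto
  finally show ?thesis .
qed

text \<open>The entropy of the pairs (X, Y) is expanded instead of that of Y: the earlier pairs
  contain the earlier letters of X, so the conditioning in each term of the chain rule determines
  U_i and may be weakened to (Z_i, U_i).\<close>

lemma rate_helper:
  "real n * cent S (\<lambda>s. (fst s, fst (snd s))) (\<lambda>s. snd (snd s)) - (\<Sum>i<n. cent Q (\<lambda>\<omega>. (X i \<omega>, Y i \<omega>)) (\<lambda>\<omega>. (Z i \<omega>, U i \<omega>)))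
    \<le> log 2 (real My)"
proof -
  define L :: "('x \<times> 'y \<times> 'z) list \<Rightarrow> ('x \<times> 'y) list" where "L = map (\<lambda>s. (fst s, fst (snd s)))"
  have Zm: "Zs = map (\<lambda>s. snd (snd s))" by (simp add: Zs_def fun_eq_iff)
  have "cent Q L Zs = real n * cent S (\<lambda>s. (fst s, fst (snd s))) (\<lambda>s. snd (snd s))"
    unfolding Zm L_def by (rule cent_replicate) simp
  moreover have "cent Q L (\<lambda>\<omega>. (T0 \<omega>, Zs \<omega>)) \<le> (\<Sum>i<n. cent Q (\<lambda>\<omega>. (X i \<omega>, Y i \<omega>)) (\<lambda>\<omega>. (Z i \<omega>, U i \<omega>)))"
  proof -
    have "cent Q L (\<lambda>\<omega>. (T0 \<omega>, Zs \<omega>)) = (\<Sum>i<n. cent Q (\<lambda>\<omega>. L \<omega> ! i) (\<lambda>\<omega>. (take i (L \<omega>), T0 \<omega>, Zs \<omega>)))"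
      by (rule cent_chain_take) (auto simp: L_def dest: length_Q)
    also have "\<dots> \<le> (\<Sum>i<n. cent Q (\<lambda>\<omega>. (X i \<omega>, Y i \<omega>)) (\<lambda>\<omega>. (Z i \<omega>, U i \<omega>)))"
    proof (rule sum_mono)
      fix i assume "i \<in> {..<n}"
      hence i: "i < n" by simp
      have "cent Q (\<lambda>\<omega>. L \<omega> ! i) (\<lambda>\<omega>. (take i (L \<omega>), T0 \<omega>, Zs \<omega>)) = cent Q (\<lambda>\<omega>. (X i \<omega>, Y i \<omega>)) (\<lambda>\<omega>. (take i (L \<omega>), T0 \<omega>, Zs \<omega>))"
      proof (rule cent_cong)
        have "L v ! i = (X i v, Y i v)" if "v \<in> set_pmf Q" for v
          using i length_Q[OF that] by (simp add: L_def X_def Y_def Xs_def Ys_def)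
        thus "L \<omega> ! i = L \<omega>' ! i \<longleftrightarrow> (X i \<omega>, Y i \<omega>) = (X i \<omega>', Y i \<omega>')"
          if "\<omega> \<in> set_pmf Q" "\<omega>' \<in> set_pmf Q" for \<omega> \<omega>' using that by simp
      qed simp
      also have "\<dots> \<le> cent Q (\<lambda>\<omega>. (X i \<omega>, Y i \<omega>)) (\<lambda>\<omega>. (Z i \<omega>, U i \<omega>))"
      proof (rule cent_mono)
        fix \<omega> \<omega>' assume e: "(take i (L \<omega>), T0 \<omega>, Zs \<omega>) = (take i (L \<omega>'), T0 \<omega>', Zs \<omega>')"
        have "take i (Xs v) = map fst (take i (L v))" for v by (simp add: Xs_def L_def take_map)
        thus "(Z i \<omega>, U i \<omega>) = (Z i \<omega>', U i \<omega>')" using e by (simp add: Z_def U_def)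
      qed simp
      finally show "cent Q (\<lambda>\<omega>. L \<omega> ! i) (\<lambda>\<omega>. (take i (L \<omega>), T0 \<omega>, Zs \<omega>)) \<le> cent Q (\<lambda>\<omega>. (X i \<omega>, Y i \<omega>)) (\<lambda>\<omega>. (Z i \<omega>, U i \<omega>))" .
    qed
    finally show ?thesis .
  qed
  moreover have "cent Q L Zs - cent Q L (\<lambda>\<omega>. (T0 \<omega>, Zs \<omega>)) \<le> cent Q T0 Zs" by (rule cent_diff_le) simp
  moreover have "cent Q T0 Zs \<le> ent Q T0" by (rule cent_le_ent) simp
  moreover have "ent Q T0 \<le> log 2 (real My)"
    by (rule ent_le_log_card[of _ "{1..My}"]) (use fy in \<open>auto simp: T0_def\<close>)
  ultimately show ?thesis by linarith
qed

text \<open>The first sum has to match H(X^n|Z^n,T) exactly; it does, because given (Z_i, U_i) the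
  earlier letters of Z are irrelevant for X_i. For the second sum weakening the conditions is
  enough. The difference is the information the transcript gives about X^n, which is at most the
  entropy of User X's messages.\<close>

lemma rate_X:
  "(\<Sum>i<n. cent Q (X i) (\<lambda>\<omega>. (Z i \<omega>, U i \<omega>))) - (\<Sum>i<n. cent Q (X i) (\<lambda>\<omega>. (Z i \<omega>, U i \<omega>, H (2 * K) \<omega>)))
    \<le> (\<Sum>k=1..K. log 2 (real (Mx k)))"
proof -
  let ?F = "\<lambda>\<omega>. (Zs \<omega>, T0 \<omega>)"
  have "cent Q Xs ?F = (\<Sum>i<n. cent Q (X i) (\<lambda>\<omega>. (take i (Xs \<omega>), ?F \<omega>)))"
    unfolding X_def by (rule cent_chain_take) (auto dest: length_Q)
  also have "\<dots> = (\<Sum>i<n. cent Q (X i) (\<lambda>\<omega>. (Z i \<omega>, U i \<omega>)))"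
  proof (rule sum.cong[OF refl])
    fix i assume "i \<in> {..<n}"
    hence i: "i < n" by simp
    have "cent Q (X i) (\<lambda>\<omega>. (take i (Xs \<omega>), ?F \<omega>)) = cent Q (X i) (\<lambda>\<omega>. ((Z i \<omega>, U i \<omega>), Zs \<omega>))"
      by (rule cent_cong) (auto simp: Z_def U_def)
    also have "\<dots> = cent Q (X i) (\<lambda>\<omega>. (Z i \<omega>, U i \<omega>))"
      by (rule cent_markov[OF finite_Q markov_left[OF finite_Q markov_base_Z[OF i]]]) (auto simp: X_def)
    finally show "cent Q (X i) (\<lambda>\<omega>. (take i (Xs \<omega>), ?F \<omega>)) = cent Q (X i) (\<lambda>\<omega>. (Z i \<omega>, U i \<omega>))" .
  qed
  finally have 1: "cent Q Xs ?F = (\<Sum>i<n. cent Q (X i) (\<lambda>\<omega>. (Z i \<omega>, U i \<omega>)))" .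
  have "cent Q Xs (\<lambda>\<omega>. (H (2 * K) \<omega>, ?F \<omega>)) = (\<Sum>i<n. cent Q (X i) (\<lambda>\<omega>. (take i (Xs \<omega>), H (2 * K) \<omega>, ?F \<omega>)))"
    unfolding X_def by (rule cent_chain_take) (auto dest: length_Q)
  also have "\<dots> \<le> (\<Sum>i<n. cent Q (X i) (\<lambda>\<omega>. (Z i \<omega>, U i \<omega>, H (2 * K) \<omega>)))"
    by (rule sum_mono, rule cent_mono) (auto simp: Z_def U_def)
  finally have 2: "cent Q Xs (\<lambda>\<omega>. (H (2 * K) \<omega>, ?F \<omega>)) \<le> (\<Sum>i<n. cent Q (X i) (\<lambda>\<omega>. (Z i \<omega>, U i \<omega>, H (2 * K) \<omega>)))" .
  have 3: "cent Q Xs ?F - cent Q Xs (\<lambda>\<omega>. (H (2 * K) \<omega>, ?F \<omega>)) \<le> cent Q (H (2 * K)) ?F"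
    by (rule cent_diff_le) simp
  have "ent Q (\<lambda>\<omega>. (H (2 * K) \<omega>, ?F \<omega>)) \<le> ent Q (\<lambda>\<omega>. (odds (H (2 * K) \<omega>), ?F \<omega>))"
    by (rule ent_le[OF finite_Q]) (auto simp: H_def dest: odds_trans_det)
  hence "cent Q (H (2 * K)) ?F \<le> cent Q (\<lambda>\<omega>. odds (H (2 * K) \<omega>)) ?F" by (simp add: cent_def)
  also have "\<dots> \<le> (\<Sum>k=1..K. log 2 (real (Mx k)))"
  proof (rule cent_list_le)
    fix \<omega> k assume k: "k < K"
    then obtain l where "odds (H (2 * K) \<omega>) ! k = fx (Suc k) (Xs \<omega>) (T0 \<omega>) l"
      using nth_odds_trans[of k "2 * K" "T0 \<omega>" "Xs \<omega>" "Zs \<omega>"] unfolding H_def by auto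
    moreover have "Suc k \<in> {1..K}" using k by simp
    ultimately show "odds (H (2 * K) \<omega>) ! k \<in> {1..Mx (Suc k)}" using fx by presburger
  qed (simp_all add: length_evens_odds)
  finally show ?thesis using 1 2 3 by linarith
qed

text \<open>The chain rule runs from the last letter backwards, since U_i holds the later letters of
  Z. The starting value H(Z^n|X^n,T) is n H(Z|X), because T is a function of Y^n, which is tied to
  Z^n through X^n only.\<close>

lemma rate_Z:
  "real n * cent S (\<lambda>s. snd (snd s)) fst - (\<Sum>i<n. cent Q (Z i) (\<lambda>\<omega>. (X i \<omega>, U i \<omega>, H (2 * K) \<omega>)))
    \<le> (\<Sum>k=1..K. log 2 (real (Mz k)))"
proof -
  let ?F = "\<lambda>\<omega>. (Xs \<omega>, T0 \<omega>)"
  have Zm: "Zs = map (\<lambda>s. snd (snd s))" "Xs = map fst" by (simp_all add: Zs_def Xs_def fun_eq_iff)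
  have "cent Q Zs ?F = cent Q Zs Xs" by (rule cent_markov[OF finite_Q markov_ZXT])
  also have "\<dots> = real n * cent S (\<lambda>s. snd (snd s)) fst" unfolding Zm by (rule cent_replicate) simp
  finally have 1: "cent Q Zs ?F = real n * cent S (\<lambda>s. snd (snd s)) fst" .
  have "cent Q Zs (\<lambda>\<omega>. (H (2 * K) \<omega>, ?F \<omega>)) = (\<Sum>i<n. cent Q (Z i) (\<lambda>\<omega>. (drop (Suc i) (Zs \<omega>), H (2 * K) \<omega>, ?F \<omega>)))"
    unfolding Z_def by (rule cent_chain_drop) (auto dest: length_Q)
  also have "\<dots> \<le> (\<Sum>i<n. cent Q (Z i) (\<lambda>\<omega>. (X i \<omega>, U i \<omega>, H (2 * K) \<omega>)))"
    by (rule sum_mono, rule cent_mono) (auto simp: X_def U_def)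
  finally have 2: "cent Q Zs (\<lambda>\<omega>. (H (2 * K) \<omega>, ?F \<omega>)) \<le> (\<Sum>i<n. cent Q (Z i) (\<lambda>\<omega>. (X i \<omega>, U i \<omega>, H (2 * K) \<omega>)))" .
  have 3: "cent Q Zs ?F - cent Q Zs (\<lambda>\<omega>. (H (2 * K) \<omega>, ?F \<omega>)) \<le> cent Q (H (2 * K)) ?F"
    by (rule cent_diff_le) simp
  have "ent Q (\<lambda>\<omega>. (H (2 * K) \<omega>, ?F \<omega>)) \<le> ent Q (\<lambda>\<omega>. (evens (H (2 * K) \<omega>), ?F \<omega>))"
    by (rule ent_le[OF finite_Q]) (auto simp: H_def dest: evens_trans_det)
  hence "cent Q (H (2 * K)) ?F \<le> cent Q (\<lambda>\<omega>. evens (H (2 * K) \<omega>)) ?F" by (simp add: cent_def)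
  also have "\<dots> \<le> (\<Sum>k=1..K. log 2 (real (Mz k)))"
  proof (rule cent_list_le)
    fix \<omega> k assume k: "k < K"
    then obtain l where "evens (H (2 * K) \<omega>) ! k = fz (Suc k) (Zs \<omega>) (T0 \<omega>) l"
      using nth_evens_trans[of k "2 * K" "T0 \<omega>" "Xs \<omega>" "Zs \<omega>"] unfolding H_def by auto
    moreover have "Suc k \<in> {1..K}" using k by simp
    ultimately show "evens (H (2 * K) \<omega>) ! k \<in> {1..Mz (Suc k)}" using fz by presburger
  qed (simp_all add: length_evens_odds)
  finally show ?thesis using 1 2 3 by linarith
qed

end

section \<open>The transcript as a splitting tree\<close>

context code
begin

text \<open>The unnormalised law of (X_i, Z_i) on the event that U_i is \<open>u\<close> and the
  transcript starts with \<open>h\<close>: the law at node \<open>h\<close> of the tree.\<close>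

definition qh :: "nat \<Rightarrow> nat \<times> 'x list \<times> 'z list \<Rightarrow> nat list \<Rightarrow> real^('x \<times> 'z)" where
  "qh i u h = (\<chi> s. mass Q (\<lambda>\<omega>. ((X i \<omega>, Z i \<omega>), U i \<omega>, H (length h) \<omega>)) (s, u, h))"

lemma qh_nonneg: "qh i u h $ s \<ge> 0" by (simp add: qh_def)

lemma qh_Nil:
  assumes i: "i < n"
  shows "qh i u [] = Lm (piU i u)"
proof -
  have "qh i u [] $ (x, z) = Lm (piU i u) $ (x, z)" for x z
    unfolding qh_def Lm_piU[OF i] vec_lambda_beta mass_eq by (rule prob_cong) (auto simp: H_def)
  thus ?thesis by (simp add: vec_eq_iff)
qed

lemma qh_sum:
  assumes h: "length h < 2 * K"
  shows "qh i u h = (\<Sum>m<B. qh i u (h @ [m]))"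
proof -
  let ?m = "\<lambda>\<omega>. msg (T0 \<omega>) (Xs \<omega>) (Zs \<omega>) (H (length h) \<omega>)"
  have "qh i u h $ s = (\<Sum>m<B. qh i u (h @ [m]) $ s)" for s
  proof -
    have "qh i u h $ s = (\<Sum>m<B. mass Q (\<lambda>\<omega>. (?m \<omega>, (X i \<omega>, Z i \<omega>), U i \<omega>, H (length h) \<omega>)) (m, s, u, h))"
      unfolding qh_def vec_lambda_beta by (rule mass_sum_snd[symmetric]) (use msg_less h in auto)
    also have "\<dots> = (\<Sum>m<B. qh i u (h @ [m]) $ s)"
      unfolding qh_def vec_lambda_beta mass_eq by (intro sum.cong refl prob_cong) (auto simp: H_Suc)
    finally show ?thesis .
  qed
  thus ?thesis by (simp add: vec_eq_iff)
qed

text \<open>Given the speaker's letter, U_i and the transcript so far, the speaker's block is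
  independent of the other user's letter. The conditional probability of the next message therefore
  depends on the speaker's letter only.\<close>

lemma qh_split:
  assumes i: "i < n"
  shows "\<exists>g. (\<forall>s. g s \<ge> 0) \<and> (\<forall>s s'. side (length h) s = side (length h) s' \<longrightarrow> g s = g s') \<and>
    (\<forall>s. qh i u (h @ [m]) $ s = qh i u h $ s * g s)"
proof -
  let ?m = "\<lambda>\<omega>. msg (T0 \<omega>) (Xs \<omega>) (Zs \<omega>) (H (length h) \<omega>)"
  show ?thesis
  proof (cases "even (length h)")
    case True
    let ?B = "\<lambda>\<omega>. (Z i \<omega>, U i \<omega>, H (length h) \<omega>)"
    have "markov Q (X i) ?B Zs"
      by (rule markov_left[OF finite_Q markov_trans[OF markov_base_Z[OF i]]]) (auto simp: X_def)
    hence M: "markov Q (X i) ?B ?m"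
      by (rule markov_right[OF finite_Q]) (auto simp: msg_def U_def True)
    define g where "g s = mass Q (\<lambda>\<omega>. (?B \<omega>, ?m \<omega>)) ((snd s, u, h), m) / mass Q ?B (snd s, u, h)" for s :: "'x \<times> 'z"
    have "qh i u (h @ [m]) $ s = qh i u h $ s * g s" for s
    proof -
      have "qh i u (h @ [m]) $ s = mass Q (\<lambda>\<omega>. (X i \<omega>, ?B \<omega>, ?m \<omega>)) (fst s, (snd s, u, h), m)"
        unfolding qh_def vec_lambda_beta mass_eq by (rule prob_cong) (auto simp: H_Suc)
      moreover have "qh i u h $ s = mass Q (\<lambda>\<omega>. (X i \<omega>, ?B \<omega>)) (fst s, (snd s, u, h))"
        unfolding qh_def vec_lambda_beta mass_eq by (rule prob_cong) auto
      ultimately show ?thesis unfolding markov_factor[OF M] g_def by simp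
    qed
    moreover have "g s \<ge> 0" for s by (simp add: g_def)
    moreover have "g s = g s'" if "side (length h) s = side (length h) s'" for s s'
    proof -
      have "snd s = snd s'" using that True by (simp add: side_def case_prod_unfold)
      thus ?thesis by (simp add: g_def)
    qed
    ultimately show ?thesis by blast
  next
    case False
    let ?B = "\<lambda>\<omega>. (X i \<omega>, U i \<omega>, H (length h) \<omega>)"
    have "markov Q (Z i) ?B Xs"
      by (rule markov_left[OF finite_Q markov_sym[OF markov_trans[OF markov_base_X[OF i]]]]) (auto simp: Z_def)
    hence M: "markov Q (Z i) ?B ?m"
      by (rule markov_right[OF finite_Q]) (auto simp: msg_def U_def False)
    define g where "g s = mass Q (\<lambda>\<omega>. (?B \<omega>, ?m \<omega>)) ((fst s, u, h), m) / mass Q ?B (fst s, u, h)" for s :: "'x \<times> 'z"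
    have "qh i u (h @ [m]) $ s = qh i u h $ s * g s" for s
    proof -
      have "qh i u (h @ [m]) $ s = mass Q (\<lambda>\<omega>. (Z i \<omega>, ?B \<omega>, ?m \<omega>)) (snd s, (fst s, u, h), m)"
        unfolding qh_def vec_lambda_beta mass_eq by (rule prob_cong) (auto simp: H_Suc)
      moreover have "qh i u h $ s = mass Q (\<lambda>\<omega>. (Z i \<omega>, ?B \<omega>)) (snd s, (fst s, u, h))"
        unfolding qh_def vec_lambda_beta mass_eq by (rule prob_cong) auto
      ultimately show ?thesis unfolding markov_factor[OF M] g_def by simp
    qed
    moreover have "g s \<ge> 0" for s by (simp add: g_def)
    moreover have "g s = g s'" if "side (length h) s = side (length h) s'" for s s'
    proof -
      have "fst s = fst s'" using that False by (simp add: side_def case_prod_unfold)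
      thus ?thesis by (simp add: g_def)
    qed
    ultimately show ?thesis by blast
  qed
qed

lemma qh_tree:
  assumes i: "i < n"
  shows "(Lm (piU i u), \<Sum>h\<in>words B (2 * K). leafF (xh h) (zh h) (qh i u h)) \<in> Tr"
proof -
  obtain C where C: "admissible C Leaf" using admissible_Leaf by blast
  have "(qh i u [], \<Sum>h\<in>words B (2 * K). leafF (xh h) (zh h) (qh i u h)) \<in> tree side Leaf (2 * K)"
  proof (rule treeI[OF C])
    show "B > 0" by (simp add: B_def)
    show "qh i u h = (\<Sum>m<B. qh i u (h @ [m]))" if "length h < 2 * K" for h by (rule qh_sum[OF that])
    show "\<exists>g. (\<forall>s. g s \<ge> 0) \<and> (\<forall>s s'. side (length h) s = side (length h) s' \<longrightarrow> g s = g s') \<and>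
      (\<forall>s. qh i u (h @ [m]) $ s = qh i u h $ s * g s)" for h m by (rule qh_split[OF i])
    show "(qh i u h, leafF (xh h) (zh h) (qh i u h)) \<in> Leaf" for h
      unfolding Leaf_iff using qh_nonneg by blast
  qed
  thus ?thesis unfolding Tr_def qh_Nil[OF i] .
qed

definition UU :: "nat \<Rightarrow> (nat \<times> 'x list \<times> 'z list) set" where "UU i = U i ` set_pmf Q"

lemma finite_UU [simp]: "finite (UU i)" by (simp add: UU_def)

lemma cent_XY_U:
  assumes i: "i < n"
  shows "cent Q (\<lambda>\<omega>. (X i \<omega>, Y i \<omega>)) (\<lambda>\<omega>. (Z i \<omega>, U i \<omega>)) = (\<Sum>u\<in>UU i. HY (piU i u))"
proof -
  have m: "mass Q (\<lambda>\<omega>. (Z i \<omega>, (X i \<omega>, Y i \<omega>), U i \<omega>)) (z, xy, u) = piU i u $ snd xy * Wy (snd xy) (fst xy, z)" for z xy u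
    using mass_ZXYU[OF i, of z "fst xy" "snd xy" u] by simp
  have "cent Q (\<lambda>\<omega>. (X i \<omega>, Y i \<omega>)) (\<lambda>\<omega>. (Z i \<omega>, U i \<omega>)) = (\<Sum>u\<in>UU i.
     condH (\<lambda>z xy. mass Q (\<lambda>\<omega>. (Z i \<omega>, (X i \<omega>, Y i \<omega>), U i \<omega>)) (z, xy, u)))"
    by (rule cent_condH) (simp_all add: UU_def)
  thus ?thesis unfolding HY_def m by (simp add: case_prod_unfold)
qed

lemma cent_X_U:
  assumes i: "i < n"
  shows "cent Q (X i) (\<lambda>\<omega>. (Z i \<omega>, U i \<omega>)) = (\<Sum>u\<in>UU i. HXZ (Lm (piU i u)))"
proof -
  have m: "mass Q (\<lambda>\<omega>. (Z i \<omega>, X i \<omega>, U i \<omega>)) (z, x, u) = Lm (piU i u) $ (x, z)" for z x u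
    unfolding Lm_piU[OF i] mass_eq by (rule prob_cong) auto
  have "cent Q (X i) (\<lambda>\<omega>. (Z i \<omega>, U i \<omega>)) = (\<Sum>u\<in>UU i. condH (\<lambda>z x. mass Q (\<lambda>\<omega>. (Z i \<omega>, X i \<omega>, U i \<omega>)) (z, x, u)))"
    by (rule cent_condH) (simp_all add: UU_def)
  thus ?thesis unfolding HXZ_def m .
qed

lemma cent_X_UH:
  shows "cent Q (X i) (\<lambda>\<omega>. (Z i \<omega>, U i \<omega>, H (2 * K) \<omega>)) = (\<Sum>u\<in>UU i. \<Sum>h\<in>words B (2 * K). HXZ (qh i u h))"
proof -
  have m: "mass Q (\<lambda>\<omega>. (Z i \<omega>, X i \<omega>, U i \<omega>, H (2 * K) \<omega>)) (z, x, u, h) = qh i u h $ (x, z)" if "h \<in> words B (2 * K)" for z x u h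
    unfolding qh_def vec_lambda_beta mass_eq by (rule prob_cong) (use that in \<open>auto simp: words_def\<close>)
  have "cent Q (X i) (\<lambda>\<omega>. (Z i \<omega>, U i \<omega>, H (2 * K) \<omega>)) = (\<Sum>c\<in>UU i \<times> words B (2 * K).
    condH (\<lambda>z x. mass Q (\<lambda>\<omega>. (Z i \<omega>, X i \<omega>, U i \<omega>, H (2 * K) \<omega>)) (z, x, c)))"
    by (rule cent_condH) (use H_words[OF order_refl] in \<open>auto simp: UU_def\<close>)
  also have "\<dots> = (\<Sum>u\<in>UU i. \<Sum>h\<in>words B (2 * K). HXZ (qh i u h))"
    unfolding sum.cartesian_product by (rule sum.cong) (auto simp: m HXZ_def)
  finally show ?thesis .
qed

lemma cent_Z_UH:
  shows "cent Q (Z i) (\<lambda>\<omega>. (X i \<omega>, U i \<omega>, H (2 * K) \<omega>)) = (\<Sum>u\<in>UU i. \<Sum>h\<in>words B (2 * K). HZX (qh i u h))"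
proof -
  have m: "mass Q (\<lambda>\<omega>. (X i \<omega>, Z i \<omega>, U i \<omega>, H (2 * K) \<omega>)) (x, z, u, h) = qh i u h $ (x, z)" if "h \<in> words B (2 * K)" for z x u h
    unfolding qh_def vec_lambda_beta mass_eq by (rule prob_cong) (use that in \<open>auto simp: words_def\<close>)
  have "cent Q (Z i) (\<lambda>\<omega>. (X i \<omega>, U i \<omega>, H (2 * K) \<omega>)) = (\<Sum>c\<in>UU i \<times> words B (2 * K).
    condH (\<lambda>x z. mass Q (\<lambda>\<omega>. (X i \<omega>, Z i \<omega>, U i \<omega>, H (2 * K) \<omega>)) (x, z, c)))"
    by (rule cent_condH) (use H_words[OF order_refl] in \<open>auto simp: UU_def\<close>)
  also have "\<dots> = (\<Sum>u\<in>UU i. \<Sum>h\<in>words B (2 * K). HZX (qh i u h))"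
    unfolding sum.cartesian_product by (rule sum.cong) (auto simp: m HZX_def)
  finally show ?thesis .
qed

lemma expec_XZUH:
  "expec Q (\<lambda>\<omega>. F (X i \<omega>, Z i \<omega>) (U i \<omega>) (H (2 * K) \<omega>)) = (\<Sum>u\<in>UU i. \<Sum>h\<in>words B (2 * K). \<Sum>s\<in>UNIV. qh i u h $ s * F s u h)"
proof -
  let ?V = "\<lambda>\<omega>. ((X i \<omega>, Z i \<omega>), U i \<omega>, H (2 * K) \<omega>)"
  have "expec Q (\<lambda>\<omega>. F (X i \<omega>, Z i \<omega>) (U i \<omega>) (H (2 * K) \<omega>)) = expec (map_pmf ?V Q) (\<lambda>(s, u, h). F s u h)" by simp
  also have "\<dots> = (\<Sum>t\<in>UNIV \<times> UU i \<times> words B (2 * K). mass Q ?V t * (case t of (s, u, h) \<Rightarrow> F s u h))"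
    by (rule expec_sum) (use H_words[OF order_refl] in \<open>auto simp: UU_def\<close>)
  also have "\<dots> = (\<Sum>s\<in>UNIV. \<Sum>u\<in>UU i. \<Sum>h\<in>words B (2 * K). qh i u h $ s * F s u h)"
    unfolding sum.cartesian_product by (rule sum.cong) (auto simp: qh_def words_def)
  also have "\<dots> = (\<Sum>u\<in>UU i. \<Sum>s\<in>UNIV. \<Sum>h\<in>words B (2 * K). qh i u h $ s * F s u h)" by (rule sum.swap)
  also have "\<dots> = (\<Sum>u\<in>UU i. \<Sum>h\<in>words B (2 * K). \<Sum>s\<in>UNIV. qh i u h $ s * F s u h)" by (intro sum.cong refl sum.swap)
  finally show ?thesis .
qed

lemma sum_piU:
  assumes i: "i < n"
  shows "(\<Sum>u\<in>UU i. piU i u $ y) = pY y"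
proof -
  have "(\<Sum>u\<in>UU i. piU i u $ y) = mass Q (Y i) y"
    unfolding piU_def vec_lambda_beta by (rule mass_sum_fst) (simp_all add: UU_def)
  thus ?thesis by (simp add: mass_Y[OF i])
qed

text \<open>Block decoders give way to single-letter ones: given the decoder's own letter, U_i and
  the transcript, the letter to be estimated is independent of the decoder's block, so
  \<open>best_estimate\<close> applies.\<close>

theorem code_point:
  assumes Dx: "expec Q (\<lambda>\<omega>. (\<Sum>i<n. dx (X i \<omega>) (gz (Zs \<omega>) (T0 \<omega>) (odds (H (2 * K) \<omega>)) i)) / real n) \<le> Dx"
    and Dz: "expec Q (\<lambda>\<omega>. (\<Sum>i<n. dz (Z i \<omega>) (gx (Xs \<omega>) (T0 \<omega>) (evens (H (2 * K) \<omega>)) i)) / real n) \<le> Dz"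
  obtains a b hz hx \<delta>x \<delta>z where "((\<chi> y. pY y), (a, b, hz, hx, \<delta>x, \<delta>z)) \<in> Rtop"
    "cent S (\<lambda>s. (fst s, fst (snd s))) (\<lambda>s. snd (snd s)) - a \<le> log 2 (real My) / real n"
    "b - hx \<le> (\<Sum>k=1..K. log 2 (real (Mx k))) / real n"
    "cent S (\<lambda>s. snd (snd s)) fst - hz \<le> (\<Sum>k=1..K. log 2 (real (Mz k))) / real n"
    "\<delta>x \<le> Dx" "\<delta>z \<le> Dz"
proof -
  let ?J = "2 * K"
  have "\<forall>i. \<exists>xe. i < n \<longrightarrow> expec Q (\<lambda>\<omega>. dx (X i \<omega>) (xe (Z i \<omega>, U i \<omega>, H ?J \<omega>)))
    \<le> expec Q (\<lambda>\<omega>. dx (X i \<omega>) (gz (Zs \<omega>) (T0 \<omega>) (odds (H ?J \<omega>)) i))"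
  proof
    fix i
    show "\<exists>xe. i < n \<longrightarrow> expec Q (\<lambda>\<omega>. dx (X i \<omega>) (xe (Z i \<omega>, U i \<omega>, H ?J \<omega>)))
      \<le> expec Q (\<lambda>\<omega>. dx (X i \<omega>) (gz (Zs \<omega>) (T0 \<omega>) (odds (H ?J \<omega>)) i))"
    proof (cases "i < n")
      case True
      have M: "markov Q (X i) (\<lambda>\<omega>. (Z i \<omega>, U i \<omega>, H ?J \<omega>)) Zs"
        by (rule markov_left[OF finite_Q markov_trans[OF markov_base_Z[OF True]]]) (auto simp: X_def)
      obtain xe where "expec Q (\<lambda>\<omega>. dx (X i \<omega>) (xe (Z i \<omega>, U i \<omega>, H ?J \<omega>))) \<le>
        expec Q (\<lambda>\<omega>. dx (X i \<omega>) ((\<lambda>(z, (t, _), h) zs. gz zs t (odds h) i) (Z i \<omega>, U i \<omega>, H ?J \<omega>) (Zs \<omega>)))"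
        by (rule best_estimate[OF finite_Q M])
      thus ?thesis by (intro exI[of _ xe]) (simp add: U_def)
    qed simp
  qed
  from choice[OF this] obtain xe where xe: "\<forall>i. i < n \<longrightarrow> expec Q (\<lambda>\<omega>. dx (X i \<omega>) (xe i (Z i \<omega>, U i \<omega>, H ?J \<omega>)))
    \<le> expec Q (\<lambda>\<omega>. dx (X i \<omega>) (gz (Zs \<omega>) (T0 \<omega>) (odds (H ?J \<omega>)) i))" ..
  have "\<forall>i. \<exists>ze. i < n \<longrightarrow> expec Q (\<lambda>\<omega>. dz (Z i \<omega>) (ze (X i \<omega>, U i \<omega>, H ?J \<omega>)))
    \<le> expec Q (\<lambda>\<omega>. dz (Z i \<omega>) (gx (Xs \<omega>) (T0 \<omega>) (evens (H ?J \<omega>)) i))"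
  proof
    fix i
    show "\<exists>ze. i < n \<longrightarrow> expec Q (\<lambda>\<omega>. dz (Z i \<omega>) (ze (X i \<omega>, U i \<omega>, H ?J \<omega>)))
      \<le> expec Q (\<lambda>\<omega>. dz (Z i \<omega>) (gx (Xs \<omega>) (T0 \<omega>) (evens (H ?J \<omega>)) i))"
    proof (cases "i < n")
      case True
      have M: "markov Q (Z i) (\<lambda>\<omega>. (X i \<omega>, U i \<omega>, H ?J \<omega>)) Xs"
        by (rule markov_left[OF finite_Q markov_sym[OF markov_trans[OF markov_base_X[OF True]]]]) (auto simp: Z_def)
      obtain ze where "expec Q (\<lambda>\<omega>. dz (Z i \<omega>) (ze (X i \<omega>, U i \<omega>, H ?J \<omega>))) \<le>
        expec Q (\<lambda>\<omega>. dz (Z i \<omega>) ((\<lambda>(z, (t, _), h) xs. gx xs t (evens h) i) (X i \<omega>, U i \<omega>, H ?J \<omega>) (Xs \<omega>)))"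
        by (rule best_estimate[OF finite_Q M])
      thus ?thesis by (intro exI[of _ ze]) (simp add: U_def)
    qed simp
  qed
  from choice[OF this] obtain ze where ze: "\<forall>i. i < n \<longrightarrow> expec Q (\<lambda>\<omega>. dz (Z i \<omega>) (ze i (X i \<omega>, U i \<omega>, H ?J \<omega>)))
    \<le> expec Q (\<lambda>\<omega>. dz (Z i \<omega>) (gx (Xs \<omega>) (T0 \<omega>) (evens (H ?J \<omega>)) i))" ..
  define r where "r i u = (HY (piU i u), HXZ (Lm (piU i u)),
    \<Sum>h\<in>words B ?J. leafF (\<lambda>z. xe i (z, u, h)) (\<lambda>x. ze i (x, u, h)) (qh i u h))" for i u
  obtain C where C: "admissible C Top" using admissible_Top by blast
  have top: "(piU i u, r i u) \<in> Top" if "i < n" for i u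
    using qh_tree[OF that] by (simp add: Top_def r_def piU_nonneg)
  let ?I = "Sigma {..<n} UU"
  \<comment> \<open>For every coordinate the pieces add up to the same law of Y. Each coordinate can
    thus be given weight \<open>1 / n\<close>, and averaging over coordinates is itself a
    splitting.\<close>
  have "((\<chi> y. pY y), \<Sum>t\<in>?I. (1 / real n) *\<^sub>R r (fst t) (snd t)) \<in> refineN (Suc (card ?I)) id Top"
  proof (rule refineN_I[where qs = "\<lambda>t. (1 / real n) *\<^sub>R piU (fst t) (snd t)" and
        g = "\<lambda>t y. piU (fst t) (snd t) $ y / (real n * pY y)"])
    show "(0, 0) \<in> Top" by (rule admissibleD(2)[OF C])
    fix t assume t: "t \<in> ?I"
    hence i: "fst t < n" by auto
    show "((1 / real n) *\<^sub>R piU (fst t) (snd t), (1 / real n) *\<^sub>R r (fst t) (snd t)) \<in> Top"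
      by (rule admissibleD(5)[OF C top[OF i]]) simp
    show "0 \<le> piU (fst t) (snd t) $ y / (real n * pY y)" for y
      by (simp add: piU_nonneg pY_def)
    show "((1 / real n) *\<^sub>R piU (fst t) (snd t)) $ y = (\<chi> y. pY y) $ y * (piU (fst t) (snd t) $ y / (real n * pY y))" for y
    \<comment> \<open>Where \<open>pY y = 0\<close> the kernel is zero by the convention for
      division, which is right because each piece is dominated by \<open>pY\<close>.\<close>
    proof (cases "pY y = 0")
      case True
      have "piU (fst t) (snd t) $ y \<le> mass Q (Y (fst t)) y"
        unfolding piU_def vec_lambda_beta mass_eq by (rule prob_mono_supp) auto
      hence "piU (fst t) (snd t) $ y = 0" using True piU_nonneg[of "fst t" "snd t" y] by (simp add: mass_Y[OF i])
      thus ?thesis by simp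
    qed simp
  next
    show "(\<chi> y. pY y) = (\<Sum>t\<in>?I. (1 / real n) *\<^sub>R piU (fst t) (snd t))"
    proof -
      have "(\<Sum>t\<in>?I. (1 / real n) *\<^sub>R piU (fst t) (snd t)) $ y = (\<Sum>i<n. \<Sum>u\<in>UU i. (1 / real n) * piU i u $ y)" for y
        by (simp add: sum.Sigma case_prod_unfold)
      also have "\<dots> y = (\<Sum>i<n. (1 / real n) * pY y)" for y
        by (intro sum.cong refl) (simp add: sum_distrib_left[symmetric] sum_divide_distrib[symmetric] sum_piU)
      finally show ?thesis using n by (simp add: vec_eq_iff)
    qed
  qed auto
  hence mem: "((\<chi> y. pY y), \<Sum>t\<in>?I. (1 / real n) *\<^sub>R r (fst t) (snd t)) \<in> Rtop"
    unfolding Rtop_def refine_def by blast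
  define a where "a = (\<Sum>i<n. cent Q (\<lambda>\<omega>. (X i \<omega>, Y i \<omega>)) (\<lambda>\<omega>. (Z i \<omega>, U i \<omega>))) / real n"
  define b where "b = (\<Sum>i<n. cent Q (X i) (\<lambda>\<omega>. (Z i \<omega>, U i \<omega>))) / real n"
  define hz where "hz = (\<Sum>i<n. cent Q (Z i) (\<lambda>\<omega>. (X i \<omega>, U i \<omega>, H ?J \<omega>))) / real n"
  define hx where "hx = (\<Sum>i<n. cent Q (X i) (\<lambda>\<omega>. (Z i \<omega>, U i \<omega>, H ?J \<omega>))) / real n"
  define \<delta>x where "\<delta>x = (\<Sum>i<n. expec Q (\<lambda>\<omega>. dx (X i \<omega>) (xe i (Z i \<omega>, U i \<omega>, H ?J \<omega>)))) / real n"
  define \<delta>z where "\<delta>z = (\<Sum>i<n. expec Q (\<lambda>\<omega>. dz (Z i \<omega>) (ze i (X i \<omega>, U i \<omega>, H ?J \<omega>)))) / real n"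
  have ex: "expec Q (\<lambda>\<omega>. dx (X i \<omega>) (xe i (Z i \<omega>, U i \<omega>, H ?J \<omega>))) =
    (\<Sum>u\<in>UU i. \<Sum>h\<in>words B ?J. \<Sum>s\<in>UNIV. qh i u h $ s * dx (fst s) (xe i (snd s, u, h)))" for i
    using expec_XZUH[of "\<lambda>s u h. dx (fst s) (xe i (snd s, u, h))" i] by simp
  have ez: "expec Q (\<lambda>\<omega>. dz (Z i \<omega>) (ze i (X i \<omega>, U i \<omega>, H ?J \<omega>))) =
    (\<Sum>u\<in>UU i. \<Sum>h\<in>words B ?J. \<Sum>s\<in>UNIV. qh i u h $ s * dz (snd s) (ze i (fst s, u, h)))" for i
    using expec_XZUH[of "\<lambda>s u h. dz (snd s) (ze i (fst s, u, h))" i] by simp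
  have "(\<Sum>t\<in>?I. (1 / real n) *\<^sub>R r (fst t) (snd t)) = (\<Sum>i<n. (1 / real n) *\<^sub>R (\<Sum>u\<in>UU i. r i u))"
    by (simp add: sum.Sigma case_prod_unfold scaleR_sum_right)
  also have "\<dots> = (\<Sum>i<n. (1 / real n) *\<^sub>R (cent Q (\<lambda>\<omega>. (X i \<omega>, Y i \<omega>)) (\<lambda>\<omega>. (Z i \<omega>, U i \<omega>)),
      cent Q (X i) (\<lambda>\<omega>. (Z i \<omega>, U i \<omega>)), cent Q (Z i) (\<lambda>\<omega>. (X i \<omega>, U i \<omega>, H ?J \<omega>)),
      cent Q (X i) (\<lambda>\<omega>. (Z i \<omega>, U i \<omega>, H ?J \<omega>)), expec Q (\<lambda>\<omega>. dx (X i \<omega>) (xe i (Z i \<omega>, U i \<omega>, H ?J \<omega>))),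
      expec Q (\<lambda>\<omega>. dz (Z i \<omega>) (ze i (X i \<omega>, U i \<omega>, H ?J \<omega>)))))"
    by (intro sum.cong refl arg_cong[of _ _ "scaleR (1 / real n)"])
      (simp add: r_def leafF_def prod_eq_iff fst_sum snd_sum cent_XY_U cent_X_U cent_X_UH cent_Z_UH ex ez)
  also have "\<dots> = (a, b, hz, hx, \<delta>x, \<delta>z)"
    by (simp add: prod_eq_iff fst_sum snd_sum a_def b_def hz_def hx_def \<delta>x_def \<delta>z_def sum_divide_distrib)
  finally have r: "(\<Sum>t\<in>?I. (1 / real n) *\<^sub>R r (fst t) (snd t)) = (a, b, hz, hx, \<delta>x, \<delta>z)" .
  have dv: "A - B / real n \<le> C / real n" if "real n * A - B \<le> C" for A B C
  proof -
    have "A - B / real n = (real n * A - B) / real n" using n by (simp add: diff_divide_distrib)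
    thus ?thesis using divide_right_mono[OF that, of "real n"] by simp
  qed
  show ?thesis
  proof (rule that)
    show "((\<chi> y. pY y), (a, b, hz, hx, \<delta>x, \<delta>z)) \<in> Rtop" using mem unfolding r .
    show "cent S (\<lambda>s. (fst s, fst (snd s))) (\<lambda>s. snd (snd s)) - a \<le> log 2 (real My) / real n"
      unfolding a_def by (rule dv[OF rate_helper])
    show "b - hx \<le> (\<Sum>k=1..K. log 2 (real (Mx k))) / real n"
      unfolding b_def hx_def diff_divide_distrib[symmetric] by (rule divide_right_mono[OF rate_X]) simp
    show "cent S (\<lambda>s. snd (snd s)) fst - hz \<le> (\<Sum>k=1..K. log 2 (real (Mz k))) / real n"
      unfolding hz_def by (rule dv[OF rate_Z])
    have "\<delta>x \<le> (\<Sum>i<n. expec Q (\<lambda>\<omega>. dx (X i \<omega>) (gz (Zs \<omega>) (T0 \<omega>) (odds (H ?J \<omega>)) i))) / real n"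
      unfolding \<delta>x_def by (intro divide_right_mono sum_mono xe[rule_format]) auto
    thus "\<delta>x \<le> Dx" using Dx by simp
    have "\<delta>z \<le> (\<Sum>i<n. expec Q (\<lambda>\<omega>. dz (Z i \<omega>) (gx (Xs \<omega>) (T0 \<omega>) (evens (H ?J \<omega>)) i))) / real n"
      unfolding \<delta>z_def by (intro divide_right_mono sum_mono ze[rule_format]) auto
    thus "\<delta>z \<le> Dz" using Dz by simp
  qed
qed

end

section \<open>Passage to the limit\<close>

lemma LIMSEQ_le_slack:
  assumes X: "X \<longlonglongrightarrow> L" and r: "strict_mono r" and le: "\<And>m. X m \<le> c + 2 * inverse (real (Suc (r m)))"
  shows "L \<le> (c::real)"
proof -
  have "(\<lambda>m. inverse (real (Suc (r m)))) \<longlonglongrightarrow> 0"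
    using LIMSEQ_subseq_LIMSEQ[OF LIMSEQ_inverse_real_of_nat r] by (simp add: o_def)
  hence "(\<lambda>m. c + 2 * inverse (real (Suc (r m)))) \<longlonglongrightarrow> c + 2 * 0" by (intro tendsto_intros)
  thus ?thesis using LIMSEQ_le[OF X] le by simp
qed

context rd_problem
begin

lemma is_code_point:
  assumes n: "n > 0" and c: "is_code pxy pzx dx dz K n My Mx Mz Dx Dz"
  shows "\<exists>a b hz hx \<delta>x \<delta>z. ((\<chi> y. pY y), (a, b, hz, hx, \<delta>x, \<delta>z)) \<in> Rtop \<and>
    cent (source pxy pzx) (\<lambda>s. (fst s, fst (snd s))) (\<lambda>s. snd (snd s)) - a \<le> log 2 (real My) / real n \<and>
    b - hx \<le> (\<Sum>k=1..K. log 2 (real (Mx k))) / real n \<and>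
    cent (source pxy pzx) (\<lambda>s. snd (snd s)) fst - hz \<le> (\<Sum>k=1..K. log 2 (real (Mz k))) / real n \<and>
    \<delta>x \<le> Dx \<and> \<delta>z \<le> Dz"
proof -
  obtain fy fz fx gx gz where f: "\<forall>ys. fy ys \<in> {1..My}" "\<forall>k\<in>{1..K}. \<forall>zs ty txs. fz k zs ty txs \<in> {1..Mz k}"
      "\<forall>k\<in>{1..K}. \<forall>xs ty tzs. fx k xs ty tzs \<in> {1..Mx k}"
    and dx: "expec (replicate_pmf n (source pxy pzx))
         (\<lambda>s. let xs = map fst s; ys = map (fst \<circ> snd) s; zs = map (snd \<circ> snd) s;
                  ty = fy ys; tx = snd (msgs fz fx xs zs ty K)
              in (\<Sum>i<n. dx (xs ! i) (gz zs ty tx i)) / real n) \<le> Dx"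
    and dz: "expec (replicate_pmf n (source pxy pzx))
         (\<lambda>s. let xs = map fst s; ys = map (fst \<circ> snd) s; zs = map (snd \<circ> snd) s;
                  ty = fy ys; tz = fst (msgs fz fx xs zs ty K)
              in (\<Sum>i<n. dz (zs ! i) (gx xs ty tz i)) / real n) \<le> Dz"
    using c unfolding is_code_def by (elim exE conjE) (rule that)
  interpret code pxy pzx dx dz K n fy fz fx My Mx Mz
    by standard (use n f in auto)
  show ?thesis
  proof (rule code_point)
    show "expec Q (\<lambda>\<omega>. (\<Sum>i<n. dx (X i \<omega>) (gz (Zs \<omega>) (T0 \<omega>) (odds (H (2 * K) \<omega>)) i)) / real n) \<le> Dx"
      using dx unfolding Let_def msgs_trans snd_conv X_def Xs_def Zs_def T0_def Ys_def H_def .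
    show "expec Q (\<lambda>\<omega>. (\<Sum>i<n. dz (Z i \<omega>) (gx (Xs \<omega>) (T0 \<omega>) (evens (H (2 * K) \<omega>)) i)) / real n) \<le> Dz"
      using dz unfolding Let_def msgs_trans fst_conv Z_def Xs_def Zs_def T0_def Ys_def H_def .
  qed (intro exI conjI, assumption+)
qed

text \<open>One \<open>e\<close> is spent on the distance to an achievable triple, the other on the
  slack in \<open>achievable\<close>.\<close>

lemma region_op_point:
  assumes R: "(Rx, Ry, Rz) \<in> region_op pxy pzx dx dz K Dx Dz" and e: "e > 0"
  shows "\<exists>p. ((\<chi> y. pY y), p) \<in> Rtop \<and>
    cent (source pxy pzx) (\<lambda>s. (fst s, fst (snd s))) (\<lambda>s. snd (snd s)) - fst p \<le> Ry + 2 * e \<and>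
    fst (snd p) - fst (snd (snd (snd p))) \<le> Rx + 2 * e \<and>
    cent (source pxy pzx) (\<lambda>s. snd (snd s)) fst - fst (snd (snd p)) \<le> Rz + 2 * e \<and>
    fst (snd (snd (snd (snd p)))) \<le> Dx + 2 * e \<and> snd (snd (snd (snd (snd p)))) \<le> Dz + 2 * e"
proof -
  obtain R' where R': "achievable pxy pzx dx dz K Dx Dz R'" "dist R' (Rx, Ry, Rz) < e"
    using R e unfolding region_op_def closure_approachable by blast
  obtain Rx' Ry' Rz' where r: "R' = (Rx', Ry', Rz')" by (cases R')
  have d: "dist Rx' Rx < e" "dist Ry' Ry < e" "dist Rz' Rz < e"
    using R'(2) dist_fst_le[of R' "(Rx, Ry, Rz)"] dist_snd_le[of R' "(Rx, Ry, Rz)"]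
      dist_fst_le[of "snd R'" "(Ry, Rz)"] dist_snd_le[of "snd R'" "(Ry, Rz)"] by (simp_all add: r)
  obtain N where N: "\<forall>n\<ge>N. \<exists>My Mx Mz. is_code pxy pzx dx dz K n My Mx Mz (Dx + e) (Dz + e) \<and>
         log 2 (real My) / real n \<le> Ry' + e \<and>
         (\<Sum>k=1..K. log 2 (real (Mx k))) / real n \<le> Rx' + e \<and>
         (\<Sum>k=1..K. log 2 (real (Mz k))) / real n \<le> Rz' + e"
    using R'(1) e unfolding achievable_def r prod.case by blast
  \<comment> \<open>\<open>Suc N\<close> guarantees a positive block length.\<close>
  obtain My Mx Mz where c: "is_code pxy pzx dx dz K (Suc N) My Mx Mz (Dx + e) (Dz + e)"
     "log 2 (real My) / real (Suc N) \<le> Ry' + e" "(\<Sum>k=1..K. log 2 (real (Mx k))) / real (Suc N) \<le> Rx' + e"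
     "(\<Sum>k=1..K. log 2 (real (Mz k))) / real (Suc N) \<le> Rz' + e"
    using N[rule_format, OF le_SucI[OF order_refl]] by (elim exE conjE) (rule that)
  obtain a b hz hx \<delta>x \<delta>z where p: "((\<chi> y. pY y), (a, b, hz, hx, \<delta>x, \<delta>z)) \<in> Rtop"
    "cent (source pxy pzx) (\<lambda>s. (fst s, fst (snd s))) (\<lambda>s. snd (snd s)) - a \<le> log 2 (real My) / real (Suc N)"
    "b - hx \<le> (\<Sum>k=1..K. log 2 (real (Mx k))) / real (Suc N)"
    "cent (source pxy pzx) (\<lambda>s. snd (snd s)) fst - hz \<le> (\<Sum>k=1..K. log 2 (real (Mz k))) / real (Suc N)"
    "\<delta>x \<le> Dx + e" "\<delta>z \<le> Dz + e"
    using is_code_point[OF zero_less_Suc c(1)] by (elim exE conjE) (rule that)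
  show ?thesis
    by (rule exI[of _ "(a, b, hz, hx, \<delta>x, \<delta>z)"], unfold fst_conv snd_conv, intro conjI p(1))
      (use p c(2-4) d e in \<open>unfold dist_real_def, linarith+\<close>)
qed

text \<open>Along the sequence the law of Y stays the same, so admissibility bounds the payoffs. A
  subsequence converges, its limit stays in the closed cone \<open>Rtop\<close>, and the slacks
  vanish.\<close>

theorem region_op_subset:
  assumes K: "K > 0" and R: "(Rx, Ry, Rz) \<in> region_op pxy pzx dx dz K Dx Dz"
  shows "(Rx, Ry, Rz) \<in> region_RK pxy pzx dx dz K Dx Dz"
proof -
  let ?h1 = "cent (source pxy pzx) (\<lambda>s. (fst s, fst (snd s))) (\<lambda>s. snd (snd s))"
  let ?h2 = "cent (source pxy pzx) (\<lambda>s. snd (snd s)) fst"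
  let ?e = "\<lambda>m. inverse (real (Suc m))"
  have "\<forall>m. \<exists>p. ((\<chi> y. pY y), p) \<in> Rtop \<and> ?h1 - fst p \<le> Ry + 2 * ?e m \<and>
    fst (snd p) - fst (snd (snd (snd p))) \<le> Rx + 2 * ?e m \<and> ?h2 - fst (snd (snd p)) \<le> Rz + 2 * ?e m \<and>
    fst (snd (snd (snd (snd p)))) \<le> Dx + 2 * ?e m \<and> snd (snd (snd (snd (snd p)))) \<le> Dz + 2 * ?e m"
    by (rule allI, rule region_op_point[OF R]) simp
  from choice[OF this] obtain p where p: "\<forall>m. ((\<chi> y. pY y), p m) \<in> Rtop \<and> ?h1 - fst (p m) \<le> Ry + 2 * ?e m \<and>
    fst (snd (p m)) - fst (snd (snd (snd (p m)))) \<le> Rx + 2 * ?e m \<and> ?h2 - fst (snd (snd (p m))) \<le> Rz + 2 * ?e m \<and>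
    fst (snd (snd (snd (snd (p m))))) \<le> Dx + 2 * ?e m \<and> snd (snd (snd (snd (snd (p m))))) \<le> Dz + 2 * ?e m" ..
  obtain C where "admissible C Top" using admissible_Top by blast
  hence C: "admissible C Rtop" unfolding Rtop_def by (rule admissible_refine)
  have "bounded (range p)"
    unfolding bounded_iff using admissibleD(4)[OF C] p by blast
  then obtain l r where r: "strict_mono r" and l: "(p \<circ> r) \<longlonglongrightarrow> l"
    using bounded_imp_convergent_subsequence by blast
  have l': "(\<lambda>m. p (r m)) \<longlonglongrightarrow> l" using l by (simp add: o_def)
  have "((\<chi> y. pY y), l) \<in> Rtop"
    by (rule closed_sequentially[OF admissibleD(1)[OF C], where f = "\<lambda>m. ((\<chi> y. pY y), p (r m))"])
      (use p l' in \<open>auto intro!: tendsto_intros\<close>)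
  moreover have "?h1 - fst l \<le> Ry"
    by (rule LIMSEQ_le_slack[OF _ r, of "\<lambda>m. ?h1 - fst (p (r m))"]) (use p l' in \<open>auto intro!: tendsto_intros\<close>)
  moreover have "fst (snd l) - fst (snd (snd (snd l))) \<le> Rx"
    by (rule LIMSEQ_le_slack[OF _ r, of "\<lambda>m. fst (snd (p (r m))) - fst (snd (snd (snd (p (r m)))))"])
      (use p l' in \<open>auto intro!: tendsto_intros\<close>)
  moreover have "?h2 - fst (snd (snd l)) \<le> Rz"
    by (rule LIMSEQ_le_slack[OF _ r, of "\<lambda>m. ?h2 - fst (snd (snd (p (r m))))"]) (use p l' in \<open>auto intro!: tendsto_intros\<close>)
  moreover have "fst (snd (snd (snd (snd l)))) \<le> Dx"
    by (rule LIMSEQ_le_slack[OF _ r, of "\<lambda>m. fst (snd (snd (snd (snd (p (r m))))))"]) (use p l' in \<open>auto intro!: tendsto_intros\<close>)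
  moreover have "snd (snd (snd (snd (snd l)))) \<le> Dz"
    by (rule LIMSEQ_le_slack[OF _ r, of "\<lambda>m. snd (snd (snd (snd (snd (p (r m))))))"]) (use p l' in \<open>auto intro!: tendsto_intros\<close>)
  ultimately show ?thesis
    using Rtop_region[OF K, of "fst l" "fst (snd l)" "fst (snd (snd l))" "fst (snd (snd (snd l)))"
        "fst (snd (snd (snd (snd l))))" "snd (snd (snd (snd (snd l))))" Ry Rx Rz Dx Dz] by simp
qed

end

theorem theorem4:
  fixes pxy :: "('x::finite \<times> 'y::finite) pmf"
    and pzx :: "'x \<Rightarrow> ('z::finite) pmf"
    and dx :: "'x \<Rightarrow> ('xh::finite) \<Rightarrow> real"
    and dz :: "'z \<Rightarrow> ('zh::finite) \<Rightarrow> real"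
    and K :: nat and Dx Dz :: real
  assumes "K \<ge> 1"
    and "\<forall>x xh. dx x xh \<ge> 0"
    and "\<forall>z zh. dz z zh \<ge> 0"
  shows "region_op pxy pzx dx dz K Dx Dz = region_RK pxy pzx dx dz K Dx Dz"
proof
  show "region_op pxy pzx dx dz K Dx Dz \<subseteq> region_RK pxy pzx dx dz K Dx Dz"
    using rd_problem.region_op_subset[of K _ _ _ pxy pzx dx dz Dx Dz] assms(1) by auto
  show "region_RK pxy pzx dx dz K Dx Dz \<subseteq> region_op pxy pzx dx dz K Dx Dz"
  proof
    fix R assume "R \<in> region_RK pxy pzx dx dz K Dx Dz"
    hence "achievable pxy pzx dx dz K Dx Dz R" using RK_achievable assms by blast
    thus "R \<in> region_op pxy pzx dx dz K Dx Dz" unfolding region_op_def using closure_subset by blast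
  qed
qed

end
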